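(* Let $\ell>0$, $r>0$, $n\ge1$ an integer and $1\le p<\infty$. Let $\mathbf{V}=\mathrm{diag}(v_i(\cdot))_{1\le i\le n}$ and $\mathbf{K}=\mathrm{diag}(k_i(\cdot))_{1\le i\le n}$ with real-valued $v_i,k_i\in L^\infty(0,\ell)$, and suppose there is $\nu>0$ with $v_i(x)\ge\nu$ for all $i$ and a.e. $x\in(0,\ell)$. Let $\eta:[-r,0]\to\mathbb{R}^{n\times n}$ be of bounded variation and continuous from the left, such that $L(\varphi):=\int_{-r}^0d\eta(\theta)\varphi(\theta)$ defines a positive operator. Consider the hyperbolic system $(\Sigma_{\mathsf{Hyp}})$ $$\partial_tz(t,x)+\mathbf{V}(x)\partial_xz(t,x)=\mathbf{K}(x)z(t,x),\quad t\ge0,\ x\in(0,\ell),$$ $$z(t,0)=\int_{-r}^0d\eta(\theta)\,z(t+\theta,\ell),\quad t\ge0,$$ $$z(0,x)=f(x),\ x\in(0,\ell),\qquad z(\theta,\ell)=\varphi(\theta),\ \theta\in[-r,0],$$ on $X_p=L^p(0,\ell;\mathbb{R}^n)$, $Y_p=L^p(-r,0;\mathbb{R}^n)$. Then $(\Sigma_{\mathsf{Hyp}})$ is well-posed, and it is uniformly exponentially stable if and only if $r(\Xi L(\varepsilon_0))<1$, where $$\Xi=\mathrm{diag}\big(e^{\xi_i(\ell)}\big)_{i=1,\dots,n},\qquad \xi_i(x)=\int_0^x\frac{k_i(s)}{v_i(s)}\,ds,\qquad L(\varepsilon_0)=\int_{-r}^0d\eta(\theta)\in\mathbb{R}^{n\times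 n},$$ and $r(\cdot)$ denotes the spectral radius.
   Context: Integrals against $d\eta$ are Riemann–Stieltjes; $L$ acts on $W^{1,p}(-r,0;\mathbb{R}^n)$ with values in $\mathbb{R}^n$, and positivity is with respect to the componentwise (pointwise) order. The system is rewritten with $A_mf=-\mathbf{V}\partial_xf+\mathbf{K}f$, $D(A_m)=W^{1,p}(0,\ell;\mathbb{R}^n)$, $Gf=f(0)$, $Pf=f(\ell)$, as $\partial_tz=A_mz$, $Gz(t)=L(\tilde z_t)$, $\tilde z(t)=Pz(t)$, $z(0)=f$, $\tilde z_0=\varphi$, where $\tilde z_t(\theta)=\tilde z(t+\theta)$. It is governed by the operator $\mathfrak{A}=\mathrm{diag}(A_m,\partial_\theta)$ on $X_p\times Y_p$ with domain $\{(f,\varphi)\in W^{1,p}(0,\ell;\mathbb{R}^n)\times W^{1,p}(-r,0;\mathbb{R}^n):\ f(0)=L(\varphi),\ \varphi(0)=f(\ell)\}$. Well-posed means: $\mathfrak{A}$ generates a positive $C_0$-semigroup $\mathfrak{T}$ on $X_p\times Y_p$, so that for every $(f,\varphi)\in X_p\times Y_p$ there is a unique mild solution $z\in\mathcal{C}(\mathbb{R}_+,X_p)$ (the first component of $\mathfrak{T}(t)(f,\varphi)$), positive for positive data. Uniformly exponentially stable means: there are $M,\alpha>0$ with $\|\mathfrak{T}(t)(f,\varphi)\|\le Me^{-\alpha t}\|(f,\varphi)\|$ for all $t\ge0$ and $(f,\varphi)\in X_p\times Y_p$. *)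

theory Defs
  imports "HOL-Analysis.Analysis" "HOL-Library.Function_Algebras"
begin

text \<open>
  Elements of \<open>L\<^sup>p(a,b)\<close> are handled through representatives: functions on the whole real
  line of which only the restriction to \<open>(a,b)\<close> matters. \<open>Lp_norm\<close> is therefore a seminorm, and
  ``\<open>f = g\<close> in \<open>L\<^sup>p(a,b)\<close>'' reads \<open>Lp_norm p a b (f - g) = 0\<close>, i.e. equality almost everywhere.
\<close>

instantiation "fun" :: (type, real_vector) real_vector
begin

definition scaleR_fun :: "real \<Rightarrow> ('a \<Rightarrow> 'b) \<Rightarrow> 'a \<Rightarrow> 'b" where
  "scaleR_fun c f = (\<lambda>x. c *\<^sub>R f x)"

instance
  by standard (simp_all add: scaleR_fun_def fun_eq_iff scaleR_add_right scaleR_add_left)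

end


section \<open>Lebesgue and Sobolev spaces on an interval\<close>

definition Lp :: "real \<Rightarrow> real \<Rightarrow> real \<Rightarrow> (real \<Rightarrow> real^'n) set" where
  "Lp p a b = {f. f \<in> borel_measurable (lebesgue_on {a<..<b}) \<and>
                  integrable (lebesgue_on {a<..<b}) (\<lambda>x. norm (f x) powr p)}"

definition Lp_norm :: "real \<Rightarrow> real \<Rightarrow> real \<Rightarrow> (real \<Rightarrow> real^'n) \<Rightarrow> real" where
  "Lp_norm p a b f = (\<integral>x. norm (f x) powr p \<partial>(lebesgue_on {a<..<b})) powr (1 / p)"

definition Linf :: "real \<Rightarrow> real \<Rightarrow> (real \<Rightarrow> real) set" where
  "Linf a b = {f. f \<in> borel_measurable (lebesgue_on {a<..<b}) \<and>
                  (\<exists>C. AE x in lebesgue_on {a<..<b}. \<bar>f x\<bar> \<le> C)}"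

definition ae_nonneg :: "real \<Rightarrow> real \<Rightarrow> (real \<Rightarrow> real^'n) \<Rightarrow> bool" where
  "ae_nonneg a b f \<longleftrightarrow> (AE x in lebesgue_on {a<..<b}. 0 \<le> f x)"

text \<open>\<open>test_function a b \<psi> \<psi>'\<close>: \<open>\<psi> \<in> C\<^sup>1\<^sub>c(a,b)\<close> with derivative \<open>\<psi>'\<close>.\<close>

definition test_function :: "real \<Rightarrow> real \<Rightarrow> (real \<Rightarrow> real) \<Rightarrow> (real \<Rightarrow> real) \<Rightarrow> bool" where
  "test_function a b \<psi> \<psi>' \<longleftrightarrow>
     (\<forall>x. (\<psi> has_real_derivative \<psi>' x) (at x)) \<and> continuous_on UNIV \<psi>' \<and>
     (\<exists>S. compact S \<and> S \<subseteq> {a<..<b} \<and> (\<forall>x. x \<notin> S \<longrightarrow> \<psi> x = 0))"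

definition has_weak_deriv :: "real \<Rightarrow> real \<Rightarrow> (real \<Rightarrow> real^'n) \<Rightarrow> (real \<Rightarrow> real^'n) \<Rightarrow> bool" where
  "has_weak_deriv a b f g \<longleftrightarrow>
     (\<forall>\<psi> \<psi>'. test_function a b \<psi> \<psi>' \<longrightarrow>
        (\<integral>x. \<psi>' x *\<^sub>R f x \<partial>(lebesgue_on {a<..<b})) =
        - (\<integral>x. \<psi> x *\<^sub>R g x \<partial>(lebesgue_on {a<..<b})))"

definition W1p :: "real \<Rightarrow> real \<Rightarrow> real \<Rightarrow> (real \<Rightarrow> real^'n) set" where
  "W1p p a b = {f \<in> Lp p a b. \<exists>g \<in> Lp p a b. has_weak_deriv a b f g}"

text \<open>Unique up to null sets for \<open>f \<in> W1p p a b\<close>.\<close>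

definition weak_deriv :: "real \<Rightarrow> real \<Rightarrow> real \<Rightarrow> (real \<Rightarrow> real^'n) \<Rightarrow> real \<Rightarrow> real^'n" where
  "weak_deriv p a b f = (SOME g. g \<in> Lp p a b \<and> has_weak_deriv a b f g)"

text \<open>
  The representative of \<open>f \<in> W\<^sup>1\<^sup>,\<^sup>p(a,b)\<close> that is continuous on the closed interval; its values on
  \<open>[a,b]\<close> are uniquely determined. Point evaluations and Riemann--Stieltjes integrals of Sobolev
  functions refer to it.
\<close>

definition cont_rep :: "real \<Rightarrow> real \<Rightarrow> (real \<Rightarrow> real^'n) \<Rightarrow> real \<Rightarrow> real^'n" where
  "cont_rep a b f =
     (SOME h. continuous_on {a..b} h \<and> (AE x in lebesgue_on {a<..<b}. f x = h x))"


section \<open>Riemann--Stieltjes integrals against matrix-valued functions\<close>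

definition bounded_variation_on :: "real \<Rightarrow> real \<Rightarrow> (real \<Rightarrow> real^'n^'n) \<Rightarrow> bool" where
  "bounded_variation_on a b \<eta> \<longleftrightarrow>
     (\<exists>B. \<forall>d. d division_of {a..b} \<longrightarrow> (\<Sum>J\<in>d. norm (\<eta> (Sup J) - \<eta> (Inf J))) \<le> B)"

text \<open>A constant gauge: the sums converge as the mesh tends to zero, for arbitrary tags.\<close>

definition has_RS_integral ::
  "real \<Rightarrow> real \<Rightarrow> (real \<Rightarrow> real^'n^'n) \<Rightarrow> (real \<Rightarrow> real^'n) \<Rightarrow> real^'n \<Rightarrow> bool" where
  "has_RS_integral a b \<eta> \<phi> I \<longleftrightarrow>
     (\<forall>e>0. \<exists>\<delta>>0. \<forall>d. d tagged_division_of {a..b} \<and> (\<lambda>x. ball x \<delta>) fine d \<longrightarrow>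
        norm ((\<Sum>(x, J)\<in>d. (\<eta> (Sup J) - \<eta> (Inf J)) *v \<phi> x) - I) < e)"

definition RS_integral ::
  "real \<Rightarrow> real \<Rightarrow> (real \<Rightarrow> real^'n^'n) \<Rightarrow> (real \<Rightarrow> real^'n) \<Rightarrow> real^'n" where
  "RS_integral a b \<eta> \<phi> = (THE I. has_RS_integral a b \<eta> \<phi> I)"


section \<open>Strongly continuous semigroups on a seminormed space\<close>

text \<open>
  \<open>E\<close> is the underlying subspace, \<open>N\<close> a seminorm on it; the operators act on the
  quotient of \<open>E\<close> by the kernel of \<open>N\<close>, so all identities hold modulo that kernel.
\<close>

definition C0_semigroup ::
  "'a::real_vector set \<Rightarrow> ('a \<Rightarrow> real) \<Rightarrow> (real \<Rightarrow> 'a \<Rightarrow> 'a) \<Rightarrow> bool" where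
  "C0_semigroup E N T \<longleftrightarrow>
     (\<forall>t\<ge>0. \<forall>u\<in>E. T t u \<in> E) \<and>
     (\<forall>t\<ge>0. \<forall>u\<in>E. \<forall>w\<in>E. N (T t (u + w) - (T t u + T t w)) = 0) \<and>
     (\<forall>t\<ge>0. \<forall>c. \<forall>u\<in>E. N (T t (c *\<^sub>R u) - c *\<^sub>R T t u) = 0) \<and>
     (\<forall>t\<ge>0. \<exists>C. \<forall>u\<in>E. N (T t u) \<le> C * N u) \<and>
     (\<forall>u\<in>E. N (T 0 u - u) = 0) \<and>
     (\<forall>s\<ge>0. \<forall>t\<ge>0. \<forall>u\<in>E. N (T (s + t) u - T s (T t u)) = 0) \<and>
     (\<forall>u\<in>E. ((\<lambda>t. N (T t u - u)) \<longlongrightarrow> 0) (at_right 0))"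

text \<open>The generator of \<open>T\<close> is the operator \<open>A\<close> with domain \<open>D\<close>, as an equality of graphs.\<close>

definition is_generator ::
  "'a::real_vector set \<Rightarrow> ('a \<Rightarrow> real) \<Rightarrow> (real \<Rightarrow> 'a \<Rightarrow> 'a) \<Rightarrow> 'a set \<Rightarrow> ('a \<Rightarrow> 'a) \<Rightarrow> bool" where
  "is_generator E N T D A \<longleftrightarrow>
     (\<forall>u\<in>E. \<forall>w\<in>E.
        ((\<lambda>h. N ((1 / h) *\<^sub>R (T h u - u) - w)) \<longlongrightarrow> 0) (at_right 0) \<longleftrightarrow>
        u \<in> D \<and> N (A u - w) = 0)"

definition uniformly_exp_stable ::
  "'a set \<Rightarrow> ('a \<Rightarrow> real) \<Rightarrow> (real \<Rightarrow> 'a \<Rightarrow> 'a) \<Rightarrow> bool" where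
  "uniformly_exp_stable E N T \<longleftrightarrow>
     (\<exists>M>0. \<exists>\<alpha>>0. \<forall>t\<ge>0. \<forall>u\<in>E. N (T t u) \<le> M * exp (- \<alpha> * t) * N u)"


section \<open>Matrices\<close>

definition diag :: "'a::zero^'n \<Rightarrow> 'a^'n^'n" where
  "diag d = (\<chi> i j. if i = j then d $ i else 0)"

definition spectral_radius :: "real^'n^'n \<Rightarrow> real" where
  "spectral_radius A =
     Sup {cmod \<mu> | \<mu>. \<exists>x :: complex^'n. x \<noteq> 0 \<and> map_matrix complex_of_real A *v x = \<mu> *s x}"


section \<open>The hyperbolic system\<close>

type_synonym 'n state = "(real \<Rightarrow> real^'n) \<times> (real \<Rightarrow> real^'n)"

definition XY :: "real \<Rightarrow> real \<Rightarrow> real \<Rightarrow> 'n::finite state set" where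
  "XY p l r = Lp p 0 l \<times> Lp p (-r) 0"

definition XY_norm :: "real \<Rightarrow> real \<Rightarrow> real \<Rightarrow> 'n::finite state \<Rightarrow> real" where
  "XY_norm p l r = (\<lambda>(f, \<phi>). Lp_norm p 0 l f + Lp_norm p (-r) 0 \<phi>)"

definition XY_nonneg :: "real \<Rightarrow> real \<Rightarrow> 'n::finite state \<Rightarrow> bool" where
  "XY_nonneg l r = (\<lambda>(f, \<phi>). ae_nonneg 0 l f \<and> ae_nonneg (-r) 0 \<phi>)"

definition delay_op :: "real \<Rightarrow> (real \<Rightarrow> real^'n^'n) \<Rightarrow> (real \<Rightarrow> real^'n) \<Rightarrow> real^'n" where
  "delay_op r \<eta> \<phi> = RS_integral (-r) 0 \<eta> (cont_rep (-r) 0 \<phi>)"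

definition positive_delay_op :: "real \<Rightarrow> real \<Rightarrow> (real \<Rightarrow> real^'n^'n) \<Rightarrow> bool" where
  "positive_delay_op p r \<eta> \<longleftrightarrow>
     (\<forall>\<phi> \<in> W1p p (-r) 0. ae_nonneg (-r) 0 \<phi> \<longrightarrow> 0 \<le> delay_op r \<eta> \<phi>)"

text \<open>\<open>L(\<epsilon>\<^sub>0) = \<integral> d\<eta>(\<theta>)\<close>, the matrix of \<open>c \<mapsto> L(\<epsilon>\<^sub>0 c)\<close> with \<open>\<epsilon>\<^sub>0(\<theta>) = 1\<close>.\<close>

definition L_eps0 :: "real \<Rightarrow> (real \<Rightarrow> real^'n^'n) \<Rightarrow> real^'n^'n" where
  "L_eps0 r \<eta> = matrix (\<lambda>c. RS_integral (-r) 0 \<eta> (\<lambda>\<theta>. c))"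

definition xi :: "(real \<Rightarrow> real^'n) \<Rightarrow> (real \<Rightarrow> real^'n) \<Rightarrow> 'n \<Rightarrow> real \<Rightarrow> real" where
  "xi v k i x = (\<integral>s. k s $ i / v s $ i \<partial>(lebesgue_on {0<..<x}))"

definition Xi :: "real \<Rightarrow> (real \<Rightarrow> real^'n) \<Rightarrow> (real \<Rightarrow> real^'n) \<Rightarrow> real^'n^'n" where
  "Xi l v k = diag (\<chi> i. exp (xi v k i l))"

definition A_max ::
  "real \<Rightarrow> real \<Rightarrow> (real \<Rightarrow> real^'n) \<Rightarrow> (real \<Rightarrow> real^'n) \<Rightarrow> (real \<Rightarrow> real^'n) \<Rightarrow> real \<Rightarrow> real^'n" where
  "A_max p l v k f = (\<lambda>x. - (diag (v x) *v weak_deriv p 0 l f x) + diag (k x) *v f x)"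

definition sys_domain :: "real \<Rightarrow> real \<Rightarrow> real \<Rightarrow> (real \<Rightarrow> real^'n^'n) \<Rightarrow> 'n::finite state set" where
  "sys_domain p l r \<eta> =
     {(f, \<phi>). f \<in> W1p p 0 l \<and> \<phi> \<in> W1p p (-r) 0 \<and>
        cont_rep 0 l f 0 = delay_op r \<eta> \<phi> \<and> cont_rep (-r) 0 \<phi> 0 = cont_rep 0 l f l}"

definition sys_op ::
  "real \<Rightarrow> real \<Rightarrow> real \<Rightarrow> (real \<Rightarrow> real^'n) \<Rightarrow> (real \<Rightarrow> real^'n) \<Rightarrow> 'n::finite state \<Rightarrow> 'n state" where
  "sys_op p l r v k = (\<lambda>(f, \<phi>). (A_max p l v k f, weak_deriv p (-r) 0 \<phi>))"

definition sys_semigroup ::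
  "real \<Rightarrow> real \<Rightarrow> real \<Rightarrow> (real \<Rightarrow> real^'n) \<Rightarrow> (real \<Rightarrow> real^'n) \<Rightarrow> (real \<Rightarrow> real^'n^'n) \<Rightarrow>
   (real \<Rightarrow> 'n::finite state \<Rightarrow> 'n state) \<Rightarrow> bool" where
  "sys_semigroup p l r v k \<eta> T \<longleftrightarrow>
     C0_semigroup (XY p l r) (XY_norm p l r) T \<and>
     is_generator (XY p l r) (XY_norm p l r) T (sys_domain p l r \<eta>) (sys_op p l r v k)"

definition positive_semigroup ::
  "real \<Rightarrow> real \<Rightarrow> real \<Rightarrow> (real \<Rightarrow> 'n::finite state \<Rightarrow> 'n state) \<Rightarrow> bool" where
  "positive_semigroup p l r T \<longleftrightarrow>
     (\<forall>t\<ge>0. \<forall>u \<in> XY p l r. XY_nonneg l r u \<longrightarrow> XY_nonneg l r (T t u))"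

definition mild_solution ::
  "real \<Rightarrow> real \<Rightarrow> real \<Rightarrow> (real \<Rightarrow> real^'n) \<Rightarrow> (real \<Rightarrow> real^'n) \<Rightarrow> (real \<Rightarrow> real^'n^'n) \<Rightarrow>
   'n::finite state \<Rightarrow> (real \<Rightarrow> real \<Rightarrow> real^'n) \<Rightarrow> bool" where
  "mild_solution p l r v k \<eta> u z \<longleftrightarrow>
     (\<exists>T. sys_semigroup p l r v k \<eta> T \<and>
        (\<forall>t\<ge>0. z t \<in> Lp p 0 l \<and> Lp_norm p 0 l (z t - fst (T t u)) = 0))"

definition well_posed ::
  "real \<Rightarrow> real \<Rightarrow> real \<Rightarrow> (real \<Rightarrow> real^'n::finite) \<Rightarrow> (real \<Rightarrow> real^'n) \<Rightarrow> (real \<Rightarrow> real^'n^'n) \<Rightarrow> bool" where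
  "well_posed p l r v k \<eta> \<longleftrightarrow>
     (\<exists>T. sys_semigroup p l r v k \<eta> T \<and> positive_semigroup p l r T) \<and>
     (\<forall>u \<in> XY p l r.
        (\<exists>z. mild_solution p l r v k \<eta> u z) \<and>
        (\<forall>z z'. mild_solution p l r v k \<eta> u z \<and> mild_solution p l r v k \<eta> u z' \<longrightarrow>
           (\<forall>t\<ge>0. Lp_norm p 0 l (z t - z' t) = 0)) \<and>
        (\<forall>z. mild_solution p l r v k \<eta> u z \<longrightarrow>
           (\<forall>t\<ge>0. ((\<lambda>s. Lp_norm p 0 l (z s - z t)) \<longlongrightarrow> 0) (at t within {0..})) \<and>
           (XY_nonneg l r u \<longrightarrow> (\<forall>t\<ge>0. ae_nonneg 0 l (z t)))))"

end

theory Submission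
  imports Defs "HOL-Real_Asymp.Real_Asymp"
begin
text \<open>
  Integrated along its characteristics, the system only remembers the outflow values. With
  \<open>\<tau>\<^sub>i(x) = \<integral>\<^sub>0\<^sup>x 1 / v\<^sub>i\<close> the state is \<open>f\<^sub>i(x) = exp (\<xi>\<^sub>i(x) - \<xi>\<^sub>i(l)) b\<^sub>i(- \<tau>\<^sub>i(x))\<close> and
  \<open>\<phi>\<^sub>i(\<theta>) = b\<^sub>i(\<theta> - \<tau>\<^sub>i(l))\<close>, where the history \<open>b\<close> lives on the intervals \<open>(- \<tau>\<^sub>i(l) - r, 0)\<close>, and the boundary condition
  becomes the delay equation \<open>b\<^sub>i(t) = \<Sum>\<^sub>j \<integral> b\<^sub>j(t - \<sigma>) d\<nu>\<^sub>i\<^sub>j(\<sigma>)\<close>. Positivity of \<open>L\<close> makes the entries of \<open>\<eta>\<close> monotone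
  (lemma \<open>positive_delay_op_mono\<close>), so the \<open>\<nu>\<^sub>i\<^sub>j\<close> are positive measures. They are supported away from \<open>0\<close>, because
  crossing the domain takes time, and the matrix of their masses is \<open>\<Xi> L(\<epsilon>\<^sub>0)\<close> (lemma \<open>coupling_matrix\<close>).

  The delay equation is solved by steps (\<open>sol_exists\<close>). Translation along solutions is a positive semigroup, and an
  energy estimate with exponential weights bounds it (\<open>energy_estimate\<close>). Its generator is the derivative on histories
  whose value at zero satisfies the equation (\<open>generator_if\<close>, \<open>generator_only_if\<close>), which the change of variables turns into the
  system operator on its domain (\<open>in_domain_iff\<close>). A semigroup is determined by its generator, so every semigroup of the
  system is this one.

  If the spectral radius is below one, a positive matrix and its transpose contract suitable positive vectors \<open>w\<close> and \<open>q\<close>.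
  Jensen's inequality with these weights interpolates between the two contractions and gives exponential decay for
  every \<open>p\<close> (\<open>state_decay\<close>). Otherwise the moduli of an eigenvector form \<open>w \<ge> 0\<close>, \<open>w \<noteq> 0\<close>, with \<open>w \<le> \<Xi> L(\<epsilon>\<^sub>0) w\<close>, and by
  comparison the solution with constant history \<open>w\<close> never drops below \<open>w\<close> (\<open>sol_nondecaying\<close>).
\<close>

abbreviation Borel where "Borel == borel_measurable borel"
abbreviation L1_on where "L1_on == set_integrable lborel"
abbreviation seq_limit ("((_)/ ----> (_))" [60, 60] 60) where "X ----> L == X \<longlonglongrightarrow> L"
abbreviation bool_iff (infixr "<=>" 25) where "P <=> Q == P = (Q :: bool)"
abbreviation filter_limit (infixr "--->" 55) where "f ---> L == tendsto f L"

lemmas integral_cong_all = Bochner_Integration.integral_cong and AE_neq = AE_lborel_singleton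

section \<open>Semigroups on complete seminormed spaces\<close>

lemma nonpos_if_right_Dini_nonpos:
 fixes ph :: "real => real"
 assumes "0 <= t" and cont: "continuous_on {0..t} ph" and "ph 0 = 0"
  and dini: "!!s ep. 0 <= s ==> s < t ==> 0 < ep ==>
   eventually (%h. ph (s + h) <= ph s + ep * h) (at_right 0)"
 shows "ph t <= 0"
proof -
 have "ph t <= ep * t" if "0 < ep" for ep
 proof (rule ccontr)
  assume neg: "~ ph t <= ep * t"
  define S where "S = {s : {0..t}. ph s - ep * s : {..0}}"
  have "closed ({0..t} \<inter> (%s. ph s - ep * s) -` {..0})"
   by (intro continuous_closed_preimage continuous_intros cont)
  then have "closed S" by (simp add: S_def vimage_def Int_def)
  moreover have S0: "0 : S" using assms by (auto simp: S_def)
  moreover have bdd: "bdd_above S" by (rule bdd_aboveI[of _ t]) (auto simp: S_def)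
  ultimately have cS: "Sup S : S" by (intro closed_contains_Sup) auto
  define c where "c = Sup S"
  have c: "0 <= c" "c <= t" "ph c <= ep * c" using cS by (auto simp: S_def c_def)
  with neg have "c < t" by (cases "c = t") auto
  have "eventually (%h. ph (c + h) <= ph c + ep * h) (at_right 0)"
   using dini c \<open>c < t\<close> that by auto
  moreover have "eventually (%h. h : {0<..<t - c}) (at_right 0)"
   using \<open>c < t\<close> by (intro eventually_at_right_real) auto
  ultimately have "eventually (%h. ph (c + h) <= ph c + ep * h & h : {0<..<t - c}) (at_right 0)"
   by (rule eventually_conj)
  then obtain h where h: "ph (c + h) <= ph c + ep * h" "0 < h" "h < t - c"
   using eventually_happens' trivial_limit_at_right_real by fastforce
  then have "c + h : S" using c by (auto simp: S_def algebra_simps)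
  then have "c + h <= c" unfolding c_def by (rule cSup_upper[OF _ bdd])
  with h show False by simp
 qed
 then have "ph t <= ep" if "0 < ep" for ep
 proof (cases "t = 0")
  case False
  then show ?thesis using \<open>!!ep. 0 < ep ==> ph t <= ep * t\<close>[of "ep / t"] that assms(1) by simp
 qed (use assms that in simp)
 then show ?thesis by (meson dense_ge)
qed

locale seminormed_space =
 fixes E :: "'a::real_vector set" and N :: "'a => real"
 assumes subspace: "subspace E"
  and N_nonneg: "u : E ==> 0 <= N u"
  and N_add: "u : E ==> w : E ==> N (u + w) <= N u + N w"
  and N_scaleR: "u : E ==> N (c *\<^sub>R u) = abs(c) * N u"
begin
lemma E_add: "u : E ==> w : E ==> u + w : E"
 and E_diff: "u : E ==> w : E ==> u - w : E"
 and E_scaleR: "u : E ==> c *\<^sub>R u : E"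
 and E_0: "0 : E"
 using subspace by (auto intro: subspace_add subspace_diff subspace_scale subspace_0)

lemma N_0: "N 0 = 0"
 using N_scaleR[OF E_0, of 0] by simp

lemma N_minus_commute: "u : E ==> w : E ==> N (u - w) = N (w - u)"
 using N_scaleR[of "u - w" "-1"] E_diff by simp

lemma N_triangle: "x : E ==> y : E ==> z : E ==> N (x - z) <= N (x - y) + N (y - z)"
 using N_add[of "x - y" "y - z"] E_diff by simp

lemma N_triangle': "x : E ==> y : E ==> N x <= N y + N (x - y)"
 using N_add[of y "x - y"] E_diff by simp

lemma N_cong_diff:
 assumes "x : E" "y : E" "x' : E" "y' : E" "N (x - x') = 0" "N (y - y') = 0"
 shows "N (x - y) = N (x' - y')"
proof -
 have "N (x - y) <= N (x - x') + N (x' - y') + N (y' - y)"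
  using N_triangle[of x x' y] N_triangle[of x' y' y] assms by simp
 moreover have "N (x' - y') <= N (x' - x) + N (x - y) + N (y - y')"
  using N_triangle[of x' x y'] N_triangle[of x y y'] assms by simp
 ultimately show ?thesis using assms N_minus_commute by simp
qed

lemma N_cong: "x : E ==> y : E ==> N (x - y) = 0 ==> N x = N y"
 using N_cong_diff[of x 0 y 0] E_0 N_0 by simp

text \<open>One of \<open>x + u\<close>, \<open>x - u\<close> is at least as large as \<open>u\<close>.\<close>

lemma seminorm_max:
 fixes q :: "'a => real"
 assumes q_add: "!!u w. u : E ==> w : E ==> q (u + w) <= q u + q w"
  and q_scaleR: "!!u c. u : E ==> q (c *\<^sub>R u) = abs(c) * q u"
  and "x : E" "u : E"
 shows "q u <= q (x + u) | q u <= q (x - u)"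
proof -
 have "2 * q u = q (2 *\<^sub>R u)" using q_scaleR[of u 2] assms by simp
 also have "2 *\<^sub>R u = (x + u) + (-1) *\<^sub>R (x - u)" by (simp add: scaleR_2)
 also have "q ... <= q (x + u) + q ((-1) *\<^sub>R (x - u))"
  using assms by (intro q_add E_add E_scaleR E_diff) auto
 also have "q ((-1) *\<^sub>R (x - u)) = q (x - u)"
  using q_scaleR[of "x - u" "-1"] assms E_diff by simp
 finally show ?thesis by linarith
qed
end

locale complete_seminormed_space = seminormed_space +
 assumes complete: "!!u. (!!n. u n : E) ==> (!!n. N (u n) <= (1/3) ^ n) ==>
  \<exists>w\<in>E. (%n. N (w - (\<Sum>k<n. u k))) ----> 0"
begin
text \<open>
  The uniform boundedness principle, by the gliding hump: signs are chosen so that the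
  \<open>k\<close>-th summand, of size \<open>3\<^sup>-\<^sup>k\<close>, makes the \<open>k\<close>-th seminorm large, while all later
  summands together are too small to undo this.
\<close>

lemma uniform_boundedness:
 fixes q :: "nat => 'a => real"
 assumes q_add: "!!n u w. u : E ==> w : E ==> q n (u + w) <= q n u + q n w"
  and q_scaleR: "!!n u c. u : E ==> q n (c *\<^sub>R u) = abs(c) * q n u"
  and q_nonneg: "!!n u. u : E ==> 0 <= q n u"
  and q_bdd: "!!n. EX C. \<forall>u\<in>E. q n u <= C * N u"
  and ptw: "!!u. u : E ==> EX B. ALL n. q n u <= B"
 shows "EX C. ALL n. \<forall>u\<in>E. q n u <= C * N u"
proof (rule ccontr)
 assume contra: "\<nexists>C. ALL n. \<forall>u\<in>E. q n u <= C * N u"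
 define c where "c n = Sup (q n ` {u : E. N u <= 1})" for n
 have bdd: "bdd_above (q n ` {u : E. N u <= 1})" for n
 proof -
  obtain C where C: "\<forall>u\<in>E. q n u <= C * N u" using q_bdd by blast
  have "q n u <= abs(C)" if "u : E" "N u <= 1" for u
  proof -
   have "q n u <= C * N u" using C that by blast
   also have "... <= abs(C) * N u" using N_nonneg[OF that(1)] by (simp add: mult_right_mono)
   also have "... <= abs(C) * 1" using that by (intro mult_left_mono) auto
   finally show ?thesis by simp
  qed
  then show ?thesis by (intro bdd_aboveI2[where M="abs(C)"]) auto
 qed
 have ne: "q n ` {u : E. N u <= 1} ~= {}" for n using E_0 N_0 by auto
 have c_bound: "q n u <= c n * N u" if u: "u : E" for n u
 proof (cases "N u = 0")
  case True
  obtain C where C: "\<forall>u\<in>E. q n u <= C * N u" using q_bdd by blast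
  then show ?thesis using True u by fastforce
 next
  case False
  then have pos: "N u > 0" using N_nonneg[OF u] by simp
  have "q n ((1 / N u) *\<^sub>R u) <= c n" unfolding c_def
   by (rule cSup_upper[OF _ bdd]) (use u pos E_scaleR N_scaleR[OF u] in auto)
  then show ?thesis using q_scaleR[OF u] pos by (simp add: field_simps)
 qed
 have "EX n. c n > C" for C
 proof (rule ccontr)
  assume "\<nexists>n. C < c n"
  then have "q n u <= C * N u" if "u : E" for n u
   using c_bound[OF that, of n] mult_right_mono[OF _ N_nonneg[OF that], of "c n" C]
   by (force simp: not_less)
  with contra show False by blast
 qed
 then have "\<forall>k::nat. EX n. c n > 4 ^ k" by blast
 then obtain m where m: "!!k::nat. c (m k) > 4 ^ k" by metis
 have "\<exists>u\<in>E. N u <= 1 & q (m k) u >= 3/4 * c (m k)" for k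
 proof -
  have "0 < c (m k)" using m[of k] by (meson less_trans zero_less_power zero_less_numeral)
  then have "3/4 * c (m k) < c (m k)" by simp
  then obtain y where "y : q (m k) ` {u : E. N u <= 1}" "3/4 * c (m k) < y"
   using less_cSupD[OF ne, of "3/4 * c (m k)" "m k"] unfolding c_def by blast
  then show ?thesis by force
 qed
 then obtain e where e: "!!k. e k : E" "!!k. N (e k) <= 1" "!!k. q (m k) (e k) >= 3/4 * c (m k)" by metis
 define d where "d k = (1/3::real) ^ k *\<^sub>R e k" for k
 have d: "d k : E" "N (d k) <= (1/3) ^ k" "q (m k) (d k) >= 3/4 * c (m k) * (1/3) ^ k" for k
  using e[of k] E_scaleR N_scaleR[OF e(1)] q_scaleR[OF e(1)]
  by (auto simp: d_def mult_left_le power_abs field_simps)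
 define sg where "sg k x = (if q (m k) (x + d k) >= q (m k) (d k) then d k else - d k)" for k x
 define x where "x = rec_nat 0 (%k x. x + sg k x)"
 have x_simps: "x 0 = 0" "!!k. x (Suc k) = x k + sg k (x k)" by (simp_all add: x_def)
 have sgE: "sg k y : E" for k y
  using d(1)[of k] E_scaleR[OF d(1)[of k], of "-1"] by (simp add: sg_def)
 have sgN: "N (sg k y) <= (1/3) ^ k" for k y
  using d(2)[of k] N_scaleR[OF d(1)[of k], of "-1"] by (simp add: sg_def)
 have xE: "x k : E" for k by (induction k) (auto simp: x_simps E_0 intro: E_add sgE)
 have x_sum: "x n = (\<Sum>k<n. sg k (x k))" for n by (induction n) (simp_all add: x_simps)
 have big: "q (m k) (x (Suc k)) >= q (m k) (d k)" for k
  using seminorm_max[of "q (m k)", OF q_add q_scaleR xE d(1), of k k]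
  by (auto simp: x_simps sg_def)
 obtain w where w: "w : E" "(%n. N (w - x n)) ----> 0"
  using complete[of "%k. sg k (x k)", OF sgE sgN] unfolding x_sum[symmetric] by blast
 have incr: "N (x (Suc k + j) - x (Suc k)) <= 1/2 * (1/3) ^ k - 1/2 * (1/3) ^ (k + j)" for k j
 proof (induction j)
  case (Suc j)
  have "N (x (Suc k + Suc j) - x (Suc k)) <= N (x (Suc k + Suc j) - x (Suc k + j)) + N (x (Suc k + j) - x (Suc k))"
   by (rule N_triangle) (auto intro: xE)
  also have "x (Suc k + Suc j) - x (Suc k + j) = sg (Suc k + j) (x (Suc k + j))" using x_simps(2)[of "Suc k + j"] by simp
  also have "N ... <= (1/3) ^ (Suc k + j)" by (rule sgN)
  finally show ?case using Suc by (simp add: power_add)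
 qed (simp add: N_0)
 have tail: "N (w - x (Suc k)) <= 1/2 * (1/3) ^ k" for k
 proof (rule field_le_epsilon)
  fix ep :: real assume "0 < ep"
  then obtain n0 where n0: "!!n. n >= n0 ==> abs(N (w - x n)) < ep"
   using w(2) by (auto simp: LIMSEQ_def)
  have "N (w - x (Suc k)) <= N (w - x (Suc k + n0)) + N (x (Suc k + n0) - x (Suc k))"
   by (rule N_triangle) (auto intro: xE w)
  also have "... <= ep + (1/2 * (1/3) ^ k)"
  proof (intro add_mono)
   show "N (w - x (Suc k + n0)) <= ep" using n0[of "Suc k + n0"] by simp
   have "0 <= (1/2) * (1/3::real) ^ (k + n0)" by simp
   then show "N (x (Suc k + n0) - x (Suc k)) <= 1/2 * (1/3) ^ k" using incr[of k n0] by linarith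
  qed
  finally show "N (w - x (Suc k)) <= 1/2 * (1/3) ^ k + ep" by simp
 qed
 have low: "q (m k) w >= 1/4 * (4/3) ^ k" for k
 proof -
  have "q (m k) (x (Suc k)) <= q (m k) w + q (m k) (x (Suc k) - w)"
   using q_add[of w "x (Suc k) - w"] w xE E_diff by simp
  also have "q (m k) (x (Suc k) - w) <= c (m k) * N (x (Suc k) - w)"
   using c_bound w xE E_diff by simp
  also have "... <= c (m k) * (1/2 * (1/3) ^ k)"
   using tail[of k] N_minus_commute[OF w(1) xE] m[of k]
   by (intro mult_left_mono) (auto intro: order_trans[of 0 "4 ^ k"] less_imp_le)
  finally have "3/4 * c (m k) * (1/3) ^ k <= q (m k) w + c (m k) * (1/2 * (1/3) ^ k)"
   using big[of k] d(3)[of k] by linarith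
  then have "1/4 * (c (m k) * (1/3) ^ k) <= q (m k) w" by simp
  moreover have "4 ^ k * (1/3) ^ k <= c (m k) * (1/3) ^ k"
   using m[of k] by (intro mult_right_mono) auto
  moreover have "4 ^ k * (1/3) ^ k = (4/3::real) ^ k" by (simp add: power_mult_distrib[symmetric])
  ultimately show ?thesis by linarith
 qed
 obtain B where B: "!!n. q n w <= B" using ptw[OF w(1)] by blast
 obtain k where "(4/3::real) ^ k > 4 * B" using real_arch_pow[of "4/3" "4*B"] by auto
 with low[of k] B[of "m k"] show False by linarith
qed
end

locale C0_semigroup_space = complete_seminormed_space +
 fixes T :: "real => 'a::real_vector => 'a"
 assumes C0: "C0_semigroup E N T"
begin
lemma T_in: "0 <= t ==> u : E ==> T t u : E"
 and T_add: "0 <= t ==> u : E ==> w : E ==> N (T t (u + w) - (T t u + T t w)) = 0"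
 and T_scaleR: "0 <= t ==> u : E ==> N (T t (c *\<^sub>R u) - c *\<^sub>R T t u) = 0"
 and T_bounded: "0 <= t ==> EX C. \<forall>u\<in>E. N (T t u) <= C * N u"
 and T_0: "u : E ==> N (T 0 u - u) = 0"
 and T_semigroup: "0 <= s ==> 0 <= t ==> u : E ==> N (T (s + t) u - T s (T t u)) = 0"
 and T_strong: "u : E ==> ((%t. N (T t u - u)) ---> 0) (at_right 0)"
 using C0 unfolding C0_semigroup_def by blast+

lemma T_diff:
 assumes "0 <= t" "u : E" "w : E"
 shows "N (T t (u - w) - (T t u - T t w)) = 0"
proof -
 have m: "(-1) *\<^sub>R w : E" using assms E_scaleR by blast
 have "N (T t (u + (-1) *\<^sub>R w) - (T t u + T t ((-1) *\<^sub>R w))) = 0" using T_add[OF assms(1,2) m] .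
 moreover have "N (T t u + T t ((-1) *\<^sub>R w) - (T t u + (-1) *\<^sub>R T t w)) = 0"
  using T_scaleR[OF assms(1,3), of "-1"] by simp
 ultimately show ?thesis
  using N_triangle[of "T t (u + (-1) *\<^sub>R w)" "T t u + T t ((-1) *\<^sub>R w)" "T t u + (-1) *\<^sub>R T t w"]
   N_nonneg[of "T t (u - w) - (T t u - T t w)"] assms m
  by (simp add: E_add E_diff E_scaleR T_in)
qed

lemma T_diff_le:
 assumes "0 <= t" "u : E" "w : E" "\<forall>u\<in>E. N (T t u) <= C * N u"
 shows "N (T t u - T t w) <= C * N (u - w)"
proof -
 have "N (T t u - T t w) = N (T t (u - w))"
  using N_cong[OF _ _ T_diff[OF assms(1-3)]] assms by (simp add: E_diff T_in)
 then show ?thesis using assms E_diff by simp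
qed

lemma T_bounded_near_0: "\<exists>dl>0. EX C. \<forall>t\<in>{0..dl}. \<forall>u\<in>E. N (T t u) <= C * N u"
proof (rule ccontr)
 assume contra: "~ ?thesis"
 have "\<exists>t\<in>{0..1 / real (Suc n)}. ~ (\<forall>u\<in>E. N (T t u) <= real n * N u)" for n
  using contra by (metis of_nat_0_less_iff zero_less_Suc zero_less_divide_1_iff)
 then obtain t where t: "!!n. t n : {0..1 / real (Suc n)}"
  "!!n. ~ (\<forall>u\<in>E. N (T (t n) u) <= real n * N u)" by metis
 have t0: "0 <= t n" for n using t(1)[of n] by simp
 have "EX C. ALL n. \<forall>u\<in>E. N (T (t n) u) <= C * N u"
 proof (rule uniform_boundedness)
  fix n and u assume u: "u : E"
  show "0 <= N (T (t n) u)" using N_nonneg T_in t0 u by blast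
  show "N (T (t n) (c *\<^sub>R u)) = abs(c) * N (T (t n) u)" for c
   using N_cong[OF _ _ T_scaleR[OF t0 u]] N_scaleR T_in t0 u E_scaleR by metis
  show "N (T (t n) (u + w)) <= N (T (t n) u) + N (T (t n) w)" if "w : E" for w
   using N_cong[OF _ _ T_add[OF t0 u that]] N_add T_in t0 u E_add that by metis
 next
  fix n show "EX C. \<forall>u\<in>E. N (T (t n) u) <= C * N u" using T_bounded t0 by blast
 next
  fix u assume u: "u : E"
  have "(%n. N (T (t n) u - u)) ----> 0"
  proof (rule LIMSEQ_I)
   fix ep :: real assume "0 < ep"
   then have "eventually (%s. abs(N (T s u - u)) < ep) (at_right 0)"
   using tendstoD[OF T_strong[OF u]] by (auto simp: dist_real_def)
   then obtain b where b: "b > 0" "!!s. 0 < s ==> s < b ==> abs(N (T s u - u)) < ep"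
   unfolding eventually_at_right_field by blast
   obtain n0 :: nat where n0: "1 / real (Suc n0) < b" using b(1) nat_approx_posE by blast
   have "norm (N (T (t n) u - u) - 0) < ep" if "n >= n0" for n
   proof (cases "t n = 0")
   case True then show ?thesis using T_0[OF u] \<open>0 < ep\<close> by simp
   next
   case False
   have "t n <= 1 / real (Suc n)" using t(1)[of n] by simp
   also have "... <= 1 / real (Suc n0)" using that by (simp add: frac_le)
   finally show ?thesis using False t0[of n] n0 b(2)[of "t n"] by simp
   qed
   then show "EX no. \<forall>n\<ge>no. norm (N (T (t n) u - u) - 0) < ep" by blast
  qed
  then have "Bseq (%n. N (T (t n) u - u))" by (rule convergent_imp_Bseq[OF convergentI])
  then obtain B where B: "!!n. norm (N (T (t n) u - u)) <= B" by (auto simp: Bseq_def)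
  have "N (T (t n) u) <= N u + B" for n
   using N_triangle'[of "T (t n) u" u] B[of n] T_in[OF t0 u] u by simp
  then show "EX B. ALL n. N (T (t n) u) <= B" by blast
 qed
 then obtain C where C: "!!n u. u : E ==> N (T (t n) u) <= C * N u" by blast
 obtain n where "real n >= C" using real_arch_simple by blast
 then have "N (T (t n) u) <= real n * N u" if "u : E" for u
  using C[OF that, of n] N_nonneg[OF that] mult_right_mono[of C "real n" "N u"] by simp
 with t(2)[of n] show False by blast
qed

lemma T_locally_bounded: "\<exists>C\<ge>0. \<forall>s\<in>{0..t}. \<forall>u\<in>E. N (T s u) <= C * N u"
proof -
 obtain dl C where dl: "dl > 0" "!!s u. s : {0..dl} ==> u : E ==> N (T s u) <= C * N u"
  using T_bounded_near_0 by blast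
 have "\<exists>C\<ge>0. \<forall>s\<in>{0..real n * dl}. \<forall>u\<in>E. N (T s u) <= C * N u" for n
 proof (induction n)
  case 0
  have "N (T 0 u) <= 1 * N u" if "u : E" for u
   using N_cong[OF _ _ T_0[OF that]] T_in that by simp
  then show ?case by (intro exI[of _ 1]) auto
 next
  case (Suc n)
  then obtain B where B: "0 <= B" "!!s u. s : {0..real n * dl} ==> u : E ==> N (T s u) <= B * N u" by blast
  have "N (T s u) <= max B (B * abs(C)) * N u" if s: "s : {0..real (Suc n) * dl}" and u: "u : E" for s u
  proof (cases "s <= real n * dl")
   case True
   then have "N (T s u) <= B * N u" using B(2) s u by auto
   also have "... <= max B (B * abs(C)) * N u" using N_nonneg[OF u] by (intro mult_right_mono) auto
   finally show ?thesis .
  next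
   case False
   define a where "a = real n * dl"
   have a: "0 <= a" "a < s" "s - a <= dl" using False s dl(1) by (auto simp: a_def algebra_simps)
   have "N (T (a + (s - a)) u) = N (T a (T (s - a) u))"
   using a u by (intro N_cong T_semigroup T_in) auto
   also have "... <= B * N (T (s - a) u)" using a u by (intro B T_in) (auto simp: a_def)
   also have "... <= B * (abs(C) * N u)"
   proof (intro mult_left_mono B)
   have "N (T (s - a) u) <= C * N u" using a u by (intro dl) auto
   also have "... <= abs(C) * N u" using N_nonneg[OF u] by (intro mult_right_mono) auto
   finally show "N (T (s - a) u) <= abs(C) * N u" .
   qed
   also have "... <= max B (B * abs(C)) * N u"
   using N_nonneg[OF u] by (simp add: mult.assoc[symmetric] mult_right_mono)
   finally show ?thesis by simp
  qed
  moreover have "0 <= max B (B * abs(C))" using B(1) by simp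
  ultimately show ?case by blast
 qed
 moreover obtain n where "t <= real n * dl" using dl(1) by (metis mult.commute reals_Archimedean3 less_imp_le mult.commute)
 ultimately show ?thesis by (meson atLeastAtMost_iff order_trans)
qed
end

text \<open>
  For a solution \<open>S s u\<close> of one semigroup with \<open>u\<close> in the domain, \<open>s \<mapsto> T (t - s) (S s u)\<close> is
  continuous with vanishing right derivative, hence constant; at the ends it is \<open>T t u\<close> and
  \<open>S t u\<close>. Continuity needs the local boundedness of \<^emph>\<open>both\<close> semigroups.
\<close>

lemma (in complete_seminormed_space) generator_determines_semigroup_on_domain:
 assumes T: "C0_semigroup E N T" and S: "C0_semigroup E N S"
  and gT: "is_generator E N T D A" and gS: "is_generator E N S D A"
  and u: "u : D" "u : E" "A u : E" and t: "0 <= t"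
 shows "N (T t u - S t u) = 0"
proof -
 interpret T: C0_semigroup_space E N T by unfold_locales (rule T)
 interpret S: C0_semigroup_space E N S by unfold_locales (rule S)
 obtain C1 where C1: "0 <= C1" "!!s u. s : {0..t} ==> u : E ==> N (T s u) <= C1 * N u"
  using T.T_locally_bounded[of t] by blast
 obtain C2 where C2: "0 <= C2" "!!s u. s : {0..t} ==> u : E ==> N (S s u) <= C2 * N u"
  using S.T_locally_bounded[of t] by blast
 have orbit: "((%h. N ((1 / h) *\<^sub>R (S h (S s u) - S s u) - S s (A u))) ---> 0) (at_right 0)"
  if s: "0 <= s" for s
 proof -
  obtain C where C: "\<forall>u\<in>E. N (S s u) <= C * N u" using S.T_bounded s by blast
  have lim: "((%h. C * N ((1 / h) *\<^sub>R (S h u - u) - A u)) ---> C * 0) (at_right 0)"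
   using gS u unfolding is_generator_def by (intro tendsto_intros) (simp add: N_0)
  show ?thesis
  proof (rule Lim_null_comparison[OF _ lim[simplified]])
   show "\<forall>\<^sub>F h in at_right 0. norm (N ((1 / h) *\<^sub>R (S h (S s u) - S s u) - S s (A u)))
   <= C * N ((1 / h) *\<^sub>R (S h u - u) - A u)"
   proof (rule eventually_at_right_less[THEN eventually_mono])
   fix h :: real assume h: "0 < h"
   define x where "x = (1/h) *\<^sub>R (S h u - u)"
   have Sh: "S h u : E" using S.T_in h u by simp
   have xE: "x : E" using u h Sh by (auto simp: x_def intro: E_scaleR E_diff)
   have comm: "N (S h (S s u) - S s (S h u)) = 0"
   proof -
   have "N (S (h + s) u - S h (S s u)) = 0" "N (S (s + h) u - S s (S h u)) = 0"
   using S.T_semigroup s h u by auto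
   then have "N (S (h + s) u - S (h + s) u) = N (S h (S s u) - S s (S h u))"
   using s h u by (intro N_cong_diff) (auto simp: add.commute intro!: S.T_in)
   then show ?thesis by (simp add: N_0)
   qed
   have "N (S s (S h u) - S s u - S s (S h u - u)) = 0"
   using S.T_diff[OF s Sh u(2)] N_minus_commute[of "S s (S h u - u)" "S s (S h u) - S s u"] s u Sh
   by (auto intro!: S.T_in E_diff)
   then have e1: "N ((S h (S s u) - S s u) - S s (S h u - u)) = 0"
   using comm N_cong_diff[of "S h (S s u) - S s u" "S s (S h u - u)" "S s (S h u) - S s u" "S s (S h u - u)"]
   s h u Sh by (simp add: S.T_in E_diff N_0)
   have e2: "N ((1/h) *\<^sub>R (S h (S s u) - S s u) - (1/h) *\<^sub>R S s (S h u - u)) = 0"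
   using e1 N_scaleR[of "(S h (S s u) - S s u) - S s (S h u - u)" "1/h"] s h u Sh
   by (simp add: scaleR_diff_right S.T_in E_diff)
   have e3: "N ((1/h) *\<^sub>R S s (S h u - u) - S s x) = 0"
   using S.T_scaleR[OF s E_diff[OF Sh u(2)], of "1/h"] N_minus_commute[of "S s x" "(1/h) *\<^sub>R S s (S h u - u)"]
   s u Sh xE by (auto simp: x_def intro!: S.T_in E_diff E_scaleR)
   have "N ((1/h) *\<^sub>R (S h (S s u) - S s u) - S s x) <= 0"
   using N_triangle[of "(1/h) *\<^sub>R (S h (S s u) - S s u)" "(1/h) *\<^sub>R S s (S h u - u)" "S s x"] e2 e3 s h u Sh xE
   by (simp add: S.T_in E_diff E_scaleR)
   then have e4: "N ((1/h) *\<^sub>R (S h (S s u) - S s u) - S s x) = 0"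
   using N_nonneg s h u Sh xE by (simp add: S.T_in E_diff E_scaleR order_antisym)
   have "N ((1/h) *\<^sub>R (S h (S s u) - S s u) - S s (A u)) = N (S s x - S s (A u))"
   using e4 s h u Sh xE by (intro N_cong_diff) (auto simp: N_0 intro!: S.T_in E_diff E_scaleR)
   also have "... <= C * N (x - A u)" by (rule S.T_diff_le[OF s xE u(3) C])
   finally have "N ((1/h) *\<^sub>R (S h (S s u) - S s u) - S s (A u)) <= C * N (x - A u)" .
   moreover have "0 <= N ((1/h) *\<^sub>R (S h (S s u) - S s u) - S s (A u))"
   using s h u Sh by (intro N_nonneg) (auto intro!: S.T_in E_diff E_scaleR)
   ultimately show "norm (N ((1 / h) *\<^sub>R (S h (S s u) - S s u) - S s (A u))) <= C * N ((1 / h) *\<^sub>R (S h u - u) - A u)"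
   by (simp add: x_def)
   qed
  qed
 qed
 define g where "g s = T (t - s) (S s u)" for s
 have gE: "g s : E" if "0 <= s" "s <= t" for s
  using that u by (auto simp: g_def intro!: T.T_in S.T_in)
 have step: "N (g (s + h) - g s) <= C1 * N (S h (S s u) - T h (S s u))"
  if "0 <= s" "0 <= h" "s + h <= t" for s h
 proof -
  have SE: "S s u : E" using S.T_in that u by simp
  have "N (g (s + h) - T (t - (s + h)) (S h (S s u))) <= C1 * N (S (s + h) u - S h (S s u))"
   unfolding g_def using that u SE C1 by (intro T.T_diff_le) (auto intro!: S.T_in)
  also have "N (S (s + h) u - S h (S s u)) = 0"
   using S.T_semigroup[of h s u] that u by (simp add: add.commute)
  finally have 1: "N (g (s + h) - T (t - (s + h)) (S h (S s u))) <= 0" by simp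
  have 2: "N (g s - T (t - (s + h)) (T h (S s u))) = 0"
   using T.T_semigroup[of "t - (s + h)" h "S s u"] that SE by (simp add: g_def)
  have TE: "T (t - (s + h)) (S h (S s u)) : E" "T (t - (s + h)) (T h (S s u)) : E"
   using that SE by (auto intro!: T.T_in S.T_in)
  have "N (g (s + h) - T (t - (s + h)) (S h (S s u))) = 0"
   using 1 N_nonneg[OF E_diff[OF gE TE(1), of "s + h"]] that by simp
  with 2 have "N (g (s + h) - g s) = N (T (t - (s + h)) (S h (S s u)) - T (t - (s + h)) (T h (S s u)))"
   using that TE gE by (intro N_cong_diff) auto
  also have "... <= C1 * N (S h (S s u) - T h (S s u))"
   using that SE C1 by (intro T.T_diff_le) (auto intro!: T.T_in S.T_in)
  finally show ?thesis .
 qed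
 have dini0: "((%h. C1 * N ((1/h) *\<^sub>R (S h (S s u) - T h (S s u)))) ---> 0) (at_right 0)" if s: "0 <= s" for s
 proof -
  define w where "w = S s u"
  define a where "a = S s (A u)"
  have wE: "w : E" "a : E" using S.T_in s u by (auto simp: w_def a_def)
  have lS: "((%h. N ((1 / h) *\<^sub>R (S h w - w) - a)) ---> 0) (at_right 0)"
   using orbit[OF s] by (simp add: w_def a_def)
  then have "w : D & N (A w - a) = 0" using gS wE unfolding is_generator_def by blast
  then have lT: "((%h. N ((1 / h) *\<^sub>R (T h w - w) - a)) ---> 0) (at_right 0)"
   using gT wE unfolding is_generator_def by blast
  have lim: "((%h. C1 * (N ((1 / h) *\<^sub>R (S h w - w) - a) + N ((1 / h) *\<^sub>R (T h w - w) - a))) ---> C1 * (0 + 0)) (at_right 0)"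
   by (intro tendsto_intros lS lT)
  show ?thesis
  proof (rule Lim_null_comparison[OF _ lim[simplified]])
   show "\<forall>\<^sub>F h in at_right 0. norm (C1 * N ((1/h) *\<^sub>R (S h (S s u) - T h (S s u))))
   <= C1 * (N ((1 / h) *\<^sub>R (S h w - w) - a) + N ((1 / h) *\<^sub>R (T h w - w) - a))"
   proof (rule eventually_at_right_less[THEN eventually_mono])
   fix h :: real assume h: "0 < h"
   have E1: "S h w : E" "T h w : E" using h wE by (auto intro: S.T_in T.T_in)
   define x where "x = (1 / h) *\<^sub>R (S h w - w)"
   define y where "y = (1 / h) *\<^sub>R (T h w - w)"
   have xy: "x : E" "y : E" using E1 wE by (auto simp: x_def y_def intro!: E_scaleR E_diff)
   have "(1/h) *\<^sub>R (S h w - T h w) = x - y" by (simp add: x_def y_def algebra_simps)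
   moreover have "N (x - y) <= N (x - a) + N (y - a)"
   using N_triangle[of x a y] N_minus_commute[of a y] xy wE by simp
   moreover have "0 <= N (x - y)" using xy by (intro N_nonneg E_diff)
   ultimately show "norm (C1 * N ((1/h) *\<^sub>R (S h (S s u) - T h (S s u)))) <= C1 * (N (x - a) + N (y - a))"
   using C1(1) by (simp add: w_def[symmetric] abs_mult mult_left_mono)
   qed
  qed
 qed
 define ph where "ph s = N (g s - g 0)" for s
 have ph_diff: "abs(ph s' - ph s) <= N (g s' - g s)" if "0 <= s" "s <= t" "0 <= s'" "s' <= t" for s s'
  using N_triangle[of "g s'" "g s" "g 0"] N_triangle[of "g s" "g s'" "g 0"] N_minus_commute[of "g s'" "g s"]
   gE[of s] gE[of s'] gE[of 0] that t by (simp add: ph_def)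
 have nbh: "((%h. N (S h u - u)) ---> 0) (at_right 0)" using S.T_strong u by simp
 have left: "N (g (s + h) - g s) <= C1 * (C2 * N (S h u - u)) + C1 * (N (S s u - w) + (C1 * N (S s u - w) + N (T h w - w)))"
  if "0 <= s" "0 <= h" "s + h <= t" "w : E" for s h w
 proof -
  define x where "x = S s u"
  have xE: "x : E" "S h x : E" "T h x : E" "T h w : E" "S h u : E" using that u by (auto simp: x_def intro!: S.T_in T.T_in)
  have "N (S h x - S s (S h u)) = 0"
  proof -
   have "N (S (h + s) u - S (s + h) u) = N (S h x - S s (S h u))"
   unfolding x_def using that u by (intro N_cong_diff S.T_semigroup S.T_in) auto
   then show ?thesis by (simp add: add.commute N_0)
  qed
  then have "N (S h x - x) = N (S s (S h u) - S s u)"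
   using that u xE by (intro N_cong_diff) (auto simp: x_def N_0 intro!: S.T_in)
  also have "... <= C2 * N (S h u - u)" using that u xE C2 by (intro S.T_diff_le) auto
  finally have 1: "N (S h x - x) <= C2 * N (S h u - u)" .
  have "N (T h x - T h w) <= C1 * N (x - w)" using that xE C1 by (intro T.T_diff_le) auto
  then have 2: "N (x - T h x) <= N (x - w) + (C1 * N (x - w) + N (T h w - w))"
   using N_triangle[of x w "T h x"] N_triangle[of w "T h w" "T h x"] that xE
   N_minus_commute[of w "T h w"] N_minus_commute[of "T h w" "T h x"] by simp
  have "N (S h x - T h x) <= C2 * N (S h u - u) + (N (x - w) + (C1 * N (x - w) + N (T h w - w)))"
   using N_triangle[of "S h x" x "T h x"] xE 1 2 by simp
  then have "C1 * N (S h x - T h x) <= C1 * (C2 * N (S h u - u) + (N (x - w) + (C1 * N (x - w) + N (T h w - w))))"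
   by (rule mult_left_mono[OF _ C1(1)])
  then show ?thesis using step[of s h] that by (simp add: x_def algebra_simps)
 qed
 have "continuous_on {0..t} ph"
 proof (rule continuous_on_subset[of "{0..t}"])
  show "continuous_on {0..t} ph"
   unfolding continuous_on_iff
  proof (intro ballI allI impI)
   fix s ep :: real assume s: "s : {0..t}" and ep: "0 < ep"
   define w where "w = S s u"
   have wE: "w : E" using S.T_in s u by (auto simp: w_def)
   have "((%h. C1 * (C2 * N (S h u - u)) + C1 * (C2 * N (S h u - u) + (C1 * (C2 * N (S h u - u)) + N (T h w - w)))) --->
   C1 * (C2 * 0) + C1 * (C2 * 0 + (C1 * (C2 * 0) + 0))) (at_right 0)"
   by (intro tendsto_intros nbh T.T_strong wE)
   then have "eventually (%h. abs(C1 * (C2 * N (S h u - u)) + C1 * (C2 * N (S h u - u) + (C1 * (C2 * N (S h u - u)) + N (T h w - w)))) < ep) (at_right 0)"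
   using ep by (auto dest!: tendstoD[where e=ep] simp: dist_real_def)
   then obtain d where d: "d > 0" "!!h. 0 < h ==> h < d ==>
   abs(C1 * (C2 * N (S h u - u)) + C1 * (C2 * N (S h u - u) + (C1 * (C2 * N (S h u - u)) + N (T h w - w)))) < ep"
   unfolding eventually_at_right_field by blast
   have bnd: "abs(ph s' - ph s) < ep" if s': "s' : {0..t}" "abs(s' - s) < d" for s'
   proof -
   consider "s' = s" | "s < s'" | "s' < s" by linarith
   then show ?thesis
   proof cases
   case 1 then show ?thesis using ep by simp
   next
   case 2
   define h where "h = s' - s"
   have "0 <= N (S h u - u)" using u S.T_in 2 by (intro N_nonneg E_diff) (auto simp: h_def)
   then have nn: "0 <= C2 * N (S h u - u)" "0 <= C1 * (C2 * N (S h u - u))" using C1 C2 by auto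
   have "abs(ph s' - ph s) <= N (g s' - g s)" using ph_diff s s' by auto
   also have "... <= C1 * (C2 * N (S h u - u)) + C1 * (N (S s u - w) + (C1 * N (S s u - w) + N (T h w - w)))"
   using left[of s h w] s s' 2 wE by (simp add: h_def)
   also have "... = C1 * (C2 * N (S h u - u)) + C1 * (0 + (C1 * 0 + N (T h w - w)))" by (simp add: w_def N_0)
   also have "... <= C1 * (C2 * N (S h u - u)) + C1 * (C2 * N (S h u - u) + (C1 * (C2 * N (S h u - u)) + N (T h w - w)))"
   using nn C1 by (intro add_left_mono mult_left_mono add_mono) auto
   also have "... < ep" using d(2)[of h] 2 s' by (auto simp: h_def)
   finally show ?thesis .
   next
   case 3
   define h where "h = s - s'"
   have hE: "S h u : E" using u S.T_in 3 by (auto simp: h_def)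
   have "N (S s u - S s' u) = N (S s' (S h u) - S s' u)"
   using S.T_semigroup[of s' h u] 3 s s' u hE by (intro N_cong_diff) (auto simp: h_def N_0 intro!: S.T_in)
   also have "... <= C2 * N (S h u - u)" using s' u hE C2 by (intro S.T_diff_le) auto
   finally have le: "N (S s' u - w) <= C2 * N (S h u - u)"
   using N_minus_commute[of "S s' u" w] wE S.T_in[of s' u] s' u by (simp add: w_def)
   have "abs(ph s' - ph s) = abs(ph s - ph s')" by simp
   also have "... <= N (g s - g s')" using ph_diff s s' by auto
   also have "... <= C1 * (C2 * N (S h u - u)) + C1 * (N (S s' u - w) + (C1 * N (S s' u - w) + N (T h w - w)))"
   using left[of s' h w] s s' 3 wE by (simp add: h_def)
   also have "... <= C1 * (C2 * N (S h u - u)) + C1 * (C2 * N (S h u - u) + (C1 * (C2 * N (S h u - u)) + N (T h w - w)))"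
   using le C1 by (intro add_left_mono mult_left_mono add_mono) auto
   also have "... < ep" using d(2)[of h] 3 s' by (auto simp: h_def)
   finally show ?thesis .
   qed
   qed
   show "\<exists>d>0. \<forall>s'\<in>{0..t}. dist s' s < d --> dist (ph s') (ph s) < ep"
   using d(1) bnd by (intro exI[of _ d]) (auto simp: dist_real_def)
  qed
 qed auto
 then have "ph t <= 0"
 proof (rule nonpos_if_right_Dini_nonpos[OF t])
  show "ph 0 = 0" by (simp add: ph_def N_0)
  fix s ep :: real assume s: "0 <= s" "s < t" and ep: "0 < ep"
  have "eventually (%h. C1 * N ((1/h) *\<^sub>R (S h (S s u) - T h (S s u))) < ep) (at_right 0)"
   using order_tendstoD(2)[OF dini0[OF s(1)] ep] .
  moreover have "eventually (%h. h : {0<..<t - s}) (at_right 0)"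
   using s by (intro eventually_at_right_real) auto
  ultimately show "eventually (%h. ph (s + h) <= ph s + ep * h) (at_right 0)"
  proof eventually_elim
   case (elim h)
   have E1: "S h (S s u) - T h (S s u) : E" using elim s u by (auto intro!: S.T_in T.T_in E_diff)
   have "ph (s + h) - ph s <= N (g (s + h) - g s)" using ph_diff[of s "s + h"] elim s by auto
   also have "... <= C1 * N (S h (S s u) - T h (S s u))" using step[of s h] elim s by auto
   also have "... = C1 * N ((1/h) *\<^sub>R (S h (S s u) - T h (S s u))) * h"
   using N_scaleR[OF E1, of "1/h"] elim by simp
   also have "... <= ep * h" using elim by (intro mult_right_mono) auto
   finally show ?case by simp
  qed
 qed
 then have "N (g t - g 0) = 0" using N_nonneg[of "g t - g 0"] gE[of t] gE[of 0] t by (simp add: ph_def E_diff)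
 moreover have "N (g t - S t u) = 0" using T.T_0[of "S t u"] S.T_in[of t u] t u by (simp add: g_def)
 moreover have "N (g 0 - T t u) = 0"
  using T.T_diff_le[of t "S 0 u" u C1] S.T_0[OF u(2)] S.T_in[of 0 u] t u C1 N_nonneg[of "g 0 - T t u"] gE[of 0] T.T_in[of t u]
  by (simp add: g_def E_diff)
 ultimately show ?thesis
  using N_cong_diff[of "g 0" "g t" "T t u" "S t u"] N_minus_commute[of "g 0" "g t"] gE[of 0] gE[of t] t u
  by (simp add: T.T_in S.T_in)
qed

lemma (in complete_seminormed_space) generator_determines_semigroup:
 assumes T: "C0_semigroup E N T" and S: "C0_semigroup E N S"
  and gT: "is_generator E N T D A" and gS: "is_generator E N S D A"
  and dense: "!!u ep. u : E ==> 0 < ep ==> \<exists>w\<in>D \<inter> E. A w : E & N (u - w) < ep"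
  and u: "u : E" and t: "0 <= t"
 shows "N (T t u - S t u) = 0"
proof -
 interpret T: C0_semigroup_space E N T by unfold_locales (rule T)
 interpret S: C0_semigroup_space E N S by unfold_locales (rule S)
 obtain C1 where C1: "0 <= C1" "!!u. u : E ==> N (T t u) <= C1 * N u"
  using T.T_locally_bounded[of t] t by fastforce
 obtain C2 where C2: "0 <= C2" "!!u. u : E ==> N (S t u) <= C2 * N u"
  using S.T_locally_bounded[of t] t by fastforce
 have "N (T t u - S t u) <= ep" if "0 < ep" for ep
 proof -
  have "0 < ep / (C1 + C2 + 1)" using that C1 C2 by simp
  then obtain w where w: "w : D" "w : E" "A w : E" "N (u - w) < ep / (C1 + C2 + 1)"
   using dense[OF u] by blast
  have "N (T t u - T t w) <= C1 * N (u - w)" using t u w C1 by (intro T.T_diff_le) auto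
  moreover have "N (S t u - S t w) <= C2 * N (u - w)" using t u w C2 by (intro S.T_diff_le) auto
  moreover have "N (T t w - S t w) = 0"
   by (rule generator_determines_semigroup_on_domain[OF T S gT gS w(1-3) t])
  ultimately have "N (T t u - S t u) <= (C1 + C2) * N (u - w)"
   using N_triangle[of "T t u" "T t w" "S t u"] N_triangle[of "T t w" "S t w" "S t u"]
   N_minus_commute[of "S t w" "S t u"] t u w by (simp add: T.T_in S.T_in algebra_simps)
  also have "... <= (C1 + C2 + 1) * N (u - w)"
   using N_nonneg[of "u - w"] u w E_diff by (intro mult_right_mono) auto
  also have "... <= ep" using w(4) C1 C2 by (simp add: field_simps)
  finally show ?thesis .
 qed
 then have "N (T t u - S t u) <= 0" by (meson dense_ge)
 then show ?thesis using N_nonneg[of "T t u - S t u"] t u by (simp add: T.T_in S.T_in E_diff)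
qed

section \<open>Nonnegative matrices and the spectral radius\<close>

text \<open>
  Only two consequences of Perron--Frobenius theory are needed, and both have direct proofs. First,
  a nonnegative matrix without real eigenvalue \<open>\<ge> 1\<close> strictly contracts some positive vector: the
  positive matrices \<open>M + ep\<close> have positive eigenvectors by Brouwer's theorem, and
  if their eigenvalues stayed \<open>\<ge> 1\<close> as \<open>ep \<rightarrow> 0\<close>, compactness would give an eigenvalue
  \<open>\<ge> 1\<close> of \<open>M\<close>.
\<close>

lemma positive_matrix_eigenvector:
 fixes M :: "real^'n^'n"
 assumes pos: "!!i j. 0 < M $ i $ j"
 obtains x rh where "!!i. 0 < x $ i" "sum (%i. x $ i) UNIV = 1" "0 < rh" "M *v x = rh *s x"
proof -
 define S :: "(real^'n) set" where "S = {x. (ALL i. 0 <= x $ i) & (SUM i:UNIV. x $ i) = 1}"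
 define s where "s x = (SUM i:UNIV. (M *v x) $ i)" for x
 have Mx: "0 < (M *v x) $ i" if "x : S" for x i
 proof -
  have "EX j. 0 < x $ j"
  proof (rule ccontr)
   assume "\<nexists>j. 0 < x $ j"
   then have "x $ j = 0" for j using that by (auto simp: S_def not_less order_antisym)
   then show False using that by (simp add: S_def)
  qed
  then obtain j where j: "0 < x $ j" by blast
  have "0 < (SUM j:UNIV. M $ i $ j * x $ j)"
   using that j pos by (intro sum_pos2[of _ j]) (auto simp: S_def less_imp_le)
  then show ?thesis by (simp add: matrix_vector_mult_def)
 qed
 have s_pos: "0 < s x" if "x : S" for x
  unfolding s_def using Mx[OF that] by (intro sum_pos) auto
 have "compact S"
 proof -
  have "closed S"
   unfolding S_def by (intro closed_Collect_conj closed_Collect_all closed_Collect_le closed_Collect_eq continuous_intros)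
  moreover have "bounded S"
  proof (rule boundedI)
   fix x assume x: "x : S"
   have "norm x <= (SUM i:UNIV. abs(x $ i))" by (rule norm_le_l1_cart)
   also have "... = 1" using x by (simp add: S_def)
   finally show "norm x <= 1" .
  qed
  ultimately show ?thesis by (simp add: compact_eq_bounded_closed)
 qed
 moreover have "convex S"
  by (auto simp: S_def convex_def sum.distrib sum_distrib_left[symmetric])
 moreover have "S ~= {}"
 proof -
  have "(\<chi> i. 1 / real CARD('n)) : S" by (simp add: S_def)
  then show ?thesis by blast
 qed
 moreover have "continuous_on S (%x. (1 / s x) *\<^sub>R (M *v x))"
  using s_pos by (intro continuous_intros) (force simp: s_def intro!: continuous_intros matrix_vector_mult_linear_continuous_on)+
 moreover have "(%x. (1 / s x) *\<^sub>R (M *v x)) : S \<rightarrow> S"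
 proof
  fix x assume x: "x : S"
  have "(SUM i:UNIV. (1 / s x) * (M *v x) $ i) = 1"
   using s_pos[OF x] by (simp only: sum_distrib_left[symmetric] s_def[symmetric]) simp
  then show "(1 / s x) *\<^sub>R (M *v x) : S"
   using s_pos[OF x] Mx[OF x] by (simp add: S_def less_imp_le)
 qed
 ultimately obtain x where x: "x : S" "(1 / s x) *\<^sub>R (M *v x) = x" by (rule brouwer)
 have eq: "M *v x = s x *s x"
 proof -
  have "s x *\<^sub>R ((1 / s x) *\<^sub>R (M *v x)) = s x *\<^sub>R x" by (simp only: x(2))
  then show ?thesis using s_pos[OF x(1)] by (simp add: scalar_mult_eq_scaleR)
 qed
 have "0 < x $ i" for i
 proof -
  have "s x * x $ i = (M *v x) $ i" using eq by simp
  then show ?thesis using Mx[OF x(1), of i] s_pos[OF x(1)] by (metis zero_less_mult_pos)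
 qed
 then show thesis using that[of x "s x"] x(1) s_pos[OF x(1)] eq by (simp add: S_def)
qed

lemma nonneg_matrix_perturbed_eigenvectors:
 fixes M :: "real^'n^'n"
 assumes nonneg: "!!i j. 0 <= M $ i $ j"
 obtains x rh y sv where "!!k i. 0 < x k $ i" "!!k :: nat. 0 < rh k"
  "!!k i. (M *v x k) $ i <= rh k * x k $ i"
  "rh ----> sv" "y ~= 0" "M *v y = sv *s y"
proof -
 define e where "e k = 1 / real (Suc k)" for k
 define P where "P k = (\<chi> i j. M $ i $ j + e k)" for k
 have ek: "0 < e k" "e k <= 1" for k by (auto simp: e_def)
 have "EX x rh. (ALL i. 0 < x $ i) & (SUM i:UNIV. x $ i) = 1 & 0 < rh & P k *v x = rh *s x" for k
 proof -
  have "0 < P k $ i $ j" for i j using nonneg[of i j] ek[of k] by (simp add: P_def)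
  then show ?thesis using positive_matrix_eigenvector[of "P k"] by metis
 qed
 then obtain x rh where x: "!!k i. 0 < x k $ i" "!!k. (SUM i:UNIV. x k $ i) = 1"
  and rh: "!!k. 0 < rh k" "!!k. P k *v x k = rh k *s x k" by metis
 have Px: "(P k *v x k) $ i = (M *v x k) $ i + e k" for k i
  using x(2)[of k] by (simp add: P_def matrix_vector_mult_def algebra_simps sum.distrib sum_distrib_left[symmetric])
 have x01: "0 <= x k $ i" "x k $ i <= 1" for k i
 proof -
  show "0 <= x k $ i" using x(1) less_imp_le by blast
  have "x k $ i <= (SUM i:UNIV. x k $ i)" using x(1) by (intro member_le_sum) (auto intro: less_imp_le)
  then show "x k $ i <= 1" using x(2) by simp
 qed
 define B where "B = (SUM i:UNIV. (SUM j:UNIV. M $ i $ j)) + real CARD('n)"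
 have rhB: "rh k <= B" for k
 proof -
  have "rh k = (SUM i:UNIV. rh k * x k $ i)" using x(2)[of k] by (simp add: sum_distrib_left[symmetric])
  also have "... = (SUM i:UNIV. (P k *v x k) $ i)" using rh(2)[of k] by simp
  also have "... = (SUM i:UNIV. (SUM j:UNIV. M $ i $ j * x k $ j) + e k)" unfolding Px by (simp add: matrix_vector_mult_def)
  also have "... <= (SUM i:UNIV. (SUM j:UNIV. M $ i $ j) + 1)"
   using nonneg x01 ek by (intro sum_mono add_mono) (auto simp: mult_left_le)
  finally show ?thesis by (simp add: B_def sum.distrib)
 qed
 have "compact (cball 0 (real CARD('n)) \<times> {0..B} :: ((real^'n) \<times> real) set)"
  by (intro compact_Times compact_cball compact_Icc)
 moreover have "ALL k. (x k, rh k) : cball 0 (real CARD('n)) \<times> {0..B}"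
 proof
  fix k
  have "norm (x k) <= (SUM i:UNIV. abs(x k $ i))" by (rule norm_le_l1_cart)
  also have "... <= (\<Sum>i\<in>(UNIV::'n set). 1)" using x01 by (intro sum_mono) auto
  finally show "(x k, rh k) : cball 0 (real CARD('n)) \<times> {0..B}" using rh(1) rhB less_imp_le by auto
 qed
 ultimately obtain l r where r: "strict_mono (r :: nat => nat)" "((%k. (x k, rh k)) \<circ> r) ----> l"
  unfolding compact_def by meson
 obtain y sv where yl: "l = (y, sv)" by force
 have lx: "(%k. x (r k)) ----> y" and lr: "(%k. rh (r k)) ----> sv"
  using tendsto_fst[OF r(2)] tendsto_snd[OF r(2)] by (simp_all add: yl o_def)
 have "e ----> 0" unfolding e_def using LIMSEQ_inverse_real_of_nat by (simp add: field_simps)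
 then have le: "(%k. e (r k)) ----> 0" using LIMSEQ_subseq_LIMSEQ[OF _ r(1), of e 0] by (simp add: o_def)
 have "(M *v y) $ i = sv * y $ i" for i
 proof (rule LIMSEQ_unique)
  show "(%k. rh (r k) * x (r k) $ i) ----> sv * y $ i" by (intro tendsto_intros lr lx)
  have "(%k. (SUM j:UNIV. M $ i $ j * x (r k) $ j) + e (r k)) ----> (SUM j:UNIV. M $ i $ j * y $ j) + 0"
   by (intro tendsto_intros lx le)
  moreover have "(SUM j:UNIV. M $ i $ j * x (r k) $ j) + e (r k) = rh (r k) * x (r k) $ i" for k
   using Px[of "r k" i] unfolding rh(2)[of "r k"] by (simp add: matrix_vector_mult_def)
  ultimately show "(%k. rh (r k) * x (r k) $ i) ----> (M *v y) $ i" by (simp add: matrix_vector_mult_def)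
 qed
 then have eq: "M *v y = sv *s y" by (simp add: vec_eq_iff)
 have "(%k. SUM i:UNIV. x (r k) $ i) ----> (SUM i:UNIV. y $ i)" by (intro tendsto_intros lx)
 then have "(SUM i:UNIV. y $ i) = 1" by (simp add: x(2) LIMSEQ_const_iff)
 then have "y ~= 0" by auto
 moreover have "(M *v x k) $ i <= rh k * x k $ i" for k i
  using Px[of k i] rh(2)[of k] ek[of k] by simp
 ultimately show thesis
  using that[of "%k. x (r k)" "%k. rh (r k)" sv y] x(1) rh(1) lr eq by blast
qed

lemma nonneg_matrix_contracts_positive_vector:
 fixes M :: "real^'n^'n"
 assumes nonneg: "!!i j. 0 <= M $ i $ j"
  and eig: "!!rh x. x ~= 0 ==> M *v x = rh *s x ==> rh < 1"
 obtains w rh where "!!i. 0 < w $ i" "0 < rh" "rh < 1" "!!i. (M *v w) $ i <= rh * w $ i"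
proof -
 show thesis
 proof (rule nonneg_matrix_perturbed_eigenvectors[OF nonneg])
  fix x rh y sv assume x: "!!k i. 0 < x k $ i" "!!k :: nat. 0 < rh k"
   "!!k i. (M *v x k) $ i <= rh k * x k $ i" and lim: "rh ----> sv" and y: "y ~= 0" "M *v y = sv *s y"
  have "eventually (%k. rh k < 1) sequentially" using order_tendstoD(2)[OF lim eig[OF y]] .
  then obtain k where "rh k < 1" by (auto simp: eventually_sequentially)
  with x show thesis by (intro that[of "x k" "rh k"])
 qed
qed

lemma transpose_real_eigenvalue:
 fixes M :: "real^'n^'n"
 assumes "x ~= 0" "transpose M *v x = rh *s x"
 obtains y where "y ~= 0" "M *v y = rh *s y"
proof -
 have mat: "(mat rh *v z) $ i = rh * z $ i" for z :: "real^'n" and i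
 proof -
  have "(mat rh *v z) $ i = (SUM j:UNIV. if i = j then rh * z $ j else 0)"
   unfolding matrix_vector_mult_def mat_def vec_lambda_beta by (rule sum.cong) auto
  then show ?thesis by simp
 qed
 have shift: "(A - mat rh) *v z = A *v z - rh *s z" for A :: "real^'n^'n" and z
  by (simp add: matrix_vector_mult_diff_rdistrib vec_eq_iff mat)
 have "(transpose M - mat rh) *v x = 0" using assms(2) shift by simp
 then have "~ invertible (transpose M - mat rh)"
  using assms(1) matrix_left_invertible_ker[of "transpose M - mat rh"] invertible_left_inverse by metis
 moreover have "transpose (M - mat rh) = transpose M - mat rh"
  by (auto simp: vec_eq_iff transpose_def mat_def)
 ultimately have "~ invertible (M - mat rh)"
  by (metis det_transpose invertible_det_nz)
 then have "EX y. y ~= 0 & (M - mat rh) *v y = 0"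
  using matrix_left_invertible_ker[of "M - mat rh"] invertible_left_inverse by metis
 then show thesis using that shift by auto
qed

definition eigvals :: "real^'n^'n => real set" where
 "eigvals A = {cmod \<mu> | \<mu>. \<exists>x :: complex^'n. x ~= 0 & map_matrix complex_of_real A *v x = \<mu> *s x}"

lemma spectral_radius_eigvals: "spectral_radius A = Sup (eigvals A)"
 by (simp add: spectral_radius_def eigvals_def)
lemma norm_complex_vec_scale: "norm (c *s x) = cmod c * norm (x :: complex^'n)"
 by (simp add: norm_vec_def L2_set_def norm_mult power_mult_distrib sum_distrib_left[symmetric] real_sqrt_mult)
lemma eigvals_normalized:
 assumes "map_matrix complex_of_real A *v x = \<mu> *s x" "x ~= (0 :: complex^'n)"
 obtains y where "norm y = 1" "map_matrix complex_of_real A *v y = \<mu> *s y"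
proof -
 define y where "y = complex_of_real (1 / norm x) *s x"
 have "norm y = 1" using assms(2) by (simp add: y_def norm_complex_vec_scale norm_divide)
 moreover have "map_matrix complex_of_real A *v y = \<mu> *s y"
  using assms(1) by (simp add: y_def vector_scalar_commute vector_smult_assoc mult.commute)
 ultimately show thesis by (rule that)
qed

text \<open>Compactness of the set of normalized eigenvectors makes the supremum in the spectral radius a maximum.\<close>

lemma compact_eigvals: "compact (eigvals (A :: real^'n^'n))"
proof -
 define L where "L = (%x :: complex^'n. map_matrix complex_of_real A *v x)"
 have lin: "bounded_linear L"
  unfolding L_def
  by (rule linear_conv_bounded_linear[THEN iffD1])
   (auto intro!: linearI simp: matrix_vector_right_distrib vec_eq_iff matrix_vector_mult_def scaleR_conv_of_real sum_distrib_left algebra_simps)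
 obtain B where B: "!!x. norm (L x) <= norm x * B" using bounded_linear.bounded[OF lin] by blast
 define S where "S = {(\<mu>, x). norm x = 1 & L x = \<mu> *s x}"
 have "closed S"
 proof -
  have "S = {z. norm (snd z) = 1} \<inter> {z. L (snd z) = fst z *s snd z}" by (auto simp: S_def)
  moreover have "continuous_on UNIV (%z :: complex \<times> (complex^'n). L (snd z))"
   by (intro bounded_linear.continuous_on[OF lin] continuous_intros)
  moreover have "continuous_on UNIV (%z :: complex \<times> (complex^'n). fst z *s snd z)"
   unfolding vector_scalar_mult_def by (intro continuous_intros)
  ultimately show ?thesis by (auto intro!: closed_Int closed_Collect_eq continuous_intros)
 qed
 moreover have "S \<subseteq> cball 0 B \<times> cball 0 1"
 proof
  fix z assume "z : S"
  then obtain \<mu> x where z: "z = (\<mu>, x)" "norm x = 1" "L x = \<mu> *s x" by (auto simp: S_def)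
  have "cmod \<mu> = norm (L x)" using z by (simp add: norm_complex_vec_scale)
  also have "... <= B" using B[of x] z by simp
  finally show "z : cball 0 B \<times> cball 0 1" using z by simp
 qed
 then have "bounded S" using bounded_subset[OF bounded_Times[OF bounded_cball bounded_cball]] by blast
 ultimately have "compact S" by (simp add: compact_eq_bounded_closed)
 then have "compact ((%z. cmod (fst z)) ` S)" by (intro compact_continuous_image continuous_intros)
 moreover have "(%z. cmod (fst z)) ` S = eigvals A"
 proof (intro equalityI subsetI)
  fix a assume "a : (%z. cmod (fst z)) ` S"
  then obtain \<mu> x where "a = cmod \<mu>" "norm x = 1" "L x = \<mu> *s x" by (auto simp: S_def)
  moreover from this have "x ~= 0" by auto
  ultimately show "a : eigvals A" by (auto simp: eigvals_def L_def)
 next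
  fix a assume "a : eigvals A"
  then obtain \<mu> x where x: "a = cmod \<mu>" "x ~= 0" "map_matrix complex_of_real A *v x = \<mu> *s x"
   by (auto simp: eigvals_def)
  obtain y where "norm y = 1" "map_matrix complex_of_real A *v y = \<mu> *s y"
   by (rule eigvals_normalized[OF x(3,2)])
  then have "(\<mu>, y) : S" by (simp add: S_def L_def)
  then show "a : (%z. cmod (fst z)) ` S" using x(1) by force
 qed
 ultimately show ?thesis by simp
qed

lemma real_eigenvalue_in_eigvals:
 assumes "x ~= (0 :: real^'n)" "A *v x = rh *s x"
 shows "abs(rh) : eigvals A"
proof -
 define z where "z = (\<chi> i. complex_of_real (x $ i))"
 have "(map_matrix complex_of_real A *v z) $ i = (complex_of_real rh *s z) $ i" for i
 proof -
  have "(map_matrix complex_of_real A *v z) $ i = complex_of_real ((A *v x) $ i)"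
   by (simp add: z_def matrix_vector_mult_def map_matrix_def)
  then show ?thesis using assms(2) by (simp add: z_def)
 qed
 then have "map_matrix complex_of_real A *v z = complex_of_real rh *s z" by (simp add: vec_eq_iff)
 moreover have "z ~= 0" using assms(1) by (auto simp: z_def vec_eq_iff)
 ultimately show ?thesis unfolding eigvals_def by (intro CollectI exI[of _ "complex_of_real rh"]) auto
qed

lemma spectral_radius_less_one_real_eigenvalue:
 assumes "spectral_radius A < 1" "x ~= (0 :: real^'n)" "A *v x = rh *s x"
 shows "rh < 1"
proof -
 have "abs(rh) <= spectral_radius A"
  unfolding spectral_radius_eigvals
  by (intro cSup_upper real_eigenvalue_in_eigvals[OF assms(2,3)] bounded_imp_bdd_above compact_imp_bounded compact_eigvals)
 then show ?thesis using assms(1) by linarith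
qed

lemma spectral_radius_less_one_contracts:
 fixes M :: "real^'n^'n"
 assumes nonneg: "!!i j. 0 <= M $ i $ j" and "spectral_radius M < 1"
 obtains w q rh where "!!i. 0 < w $ i" "!!i. 0 < q $ i" "0 < rh" "rh < 1"
  "!!i. (SUM j:UNIV. M $ i $ j * w $ j) <= rh * w $ i" "!!j. (SUM i:UNIV. q $ i * M $ i $ j) <= rh * q $ j"
proof -
 obtain w rh1 where w: "!!i. 0 < w $ i" "0 < rh1" "rh1 < 1" "!!i. (M *v w) $ i <= rh1 * w $ i"
  by (rule nonneg_matrix_contracts_positive_vector[OF nonneg spectral_radius_less_one_real_eigenvalue[OF assms(2)]]) auto
 have tnn: "0 <= transpose M $ i $ j" for i j using nonneg by (simp add: transpose_def)
 have teig: "rh < 1" if "x ~= 0" "transpose M *v x = rh *s x" for rh x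
  by (rule transpose_real_eigenvalue[OF that]) (rule spectral_radius_less_one_real_eigenvalue[OF assms(2)])
 obtain q rh2 where q: "!!i. 0 < q $ i" "0 < rh2" "rh2 < 1" "!!i. (transpose M *v q) $ i <= rh2 * q $ i"
  by (rule nonneg_matrix_contracts_positive_vector[OF tnn teig]) auto
 show thesis
 proof (rule that[of w q "max rh1 rh2"])
  show "(SUM j:UNIV. M $ i $ j * w $ j) <= max rh1 rh2 * w $ i" for i
   using w(4)[of i] mult_right_mono[of rh1 "max rh1 rh2" "w $ i"] less_imp_le[OF w(1), of i]
   by (simp add: matrix_vector_mult_def)
  show "(SUM i:UNIV. q $ i * M $ i $ j) <= max rh1 rh2 * q $ j" for j
   using q(4)[of j] mult_right_mono[of rh2 "max rh1 rh2" "q $ j"] less_imp_le[OF q(1), of j]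
   by (simp add: matrix_vector_mult_def transpose_def mult.commute)
 qed (use w q in auto)
qed

text \<open>Conversely, the componentwise modulus of an eigenvector to an eigenvalue of modulus \<open>\<ge> 1\<close> does not decrease.\<close>

lemma spectral_radius_ge_one_noncontracting:
 fixes M :: "real^'n^'n"
 assumes nonneg: "!!i j. 0 <= M $ i $ j" and "~ spectral_radius M < 1"
 obtains w where "!!i. 0 <= w $ i" "w ~= 0" "!!i. w $ i <= (SUM j:UNIV. M $ i $ j * w $ j)"
proof -
 have "eigvals M ~= {}"
 proof (rule nonneg_matrix_perturbed_eigenvectors[OF nonneg])
  fix y sv assume "y ~= 0" "M *v y = sv *s y"
  then show "eigvals M ~= {}" using real_eigenvalue_in_eigvals by blast
 qed
 then have "spectral_radius M : eigvals M"
  unfolding spectral_radius_eigvals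
  by (intro closed_contains_Sup compact_imp_closed compact_eigvals bounded_imp_bdd_above compact_imp_bounded)
 then obtain \<mu> x where x: "cmod \<mu> = spectral_radius M" "x ~= 0" "map_matrix complex_of_real M *v x = \<mu> *s x"
  by (auto simp: eigvals_def)
 define w where "w = (\<chi> i. cmod (x $ i))"
 have "w $ i <= (SUM j:UNIV. M $ i $ j * w $ j)" for i
 proof -
  have "w $ i <= cmod \<mu> * w $ i" using assms(2) x(1) by (simp add: w_def mult_le_cancel_right1)
  also have "... = cmod ((map_matrix complex_of_real M *v x) $ i)" using x(3) by (simp add: w_def norm_mult)
  also have "... <= (SUM j:UNIV. cmod (complex_of_real (M $ i $ j) * x $ j))"
   by (simp add: matrix_vector_mult_def map_matrix_def sum_norm_le)
  also have "... = (SUM j:UNIV. M $ i $ j * w $ j)" using nonneg by (simp add: norm_mult w_def)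
  finally show ?thesis .
 qed
 moreover have "w ~= 0" using x(2) by (auto simp: w_def vec_eq_iff)
 ultimately show thesis using that[of w] by (simp add: w_def)
qed

section \<open>Inequalities for \<open>p\<close>-th powers\<close>

lemma powr_above_tangent:
 fixes x A p :: real
 assumes "1 <= p" "0 <= x" "0 < A"
 shows "A powr p + p * A powr (p - 1) * (x - A) <= x powr p"
proof (cases "x = 0")
 case True
 have "A powr p = A powr (p - 1) * A" using assms by (simp add: powr_mult_base mult.commute)
 then have "A powr p + p * A powr (p - 1) * (x - A) = (1 - p) * A powr p" using True by (simp add: algebra_simps)
 also have "... <= 0" using assms by (intro mult_nonpos_nonneg) auto
 finally show ?thesis using True by simp
next
 case False
 have "x powr p - A powr p >= (p * A powr (p - 1)) * (x - A)"
 proof (rule convex_on_imp_above_tangent[OF powr_convex[OF assms(1)]])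
  show "((%x. x powr p) has_field_derivative p * A powr (p - 1)) (at A within {0<..})"
   using assms by (auto intro!: derivative_eq_intros)
 qed (use assms False in \<open>auto simp: interior_open\<close>)
 then show ?thesis by simp
qed

lemma le_one_plus_powr:
 fixes x p :: real
 assumes "1 <= p" "0 <= x"
 shows "x <= 1 + x powr p"
proof (cases "x <= 1")
 case True
 then show ?thesis using powr_ge_zero[of x p] by linarith
next
 case False
 then have "x powr 1 <= x powr p" using assms by (intro powr_mono) auto
 then show ?thesis using False by simp
qed

text \<open>Jensen's inequality for \<open>t \<mapsto> t\<^sup>p\<close>, for finite sums and for finite measures.\<close>

lemma weighted_sum_powr_le:
 fixes te y :: "'i => real"
 assumes p: "1 <= p" and te: "!!i. i : I ==> 0 <= te i" and y: "!!i. i : I ==> 0 <= y i"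
 shows "(\<Sum>i\<in>I. te i * y i) powr p <= (\<Sum>i\<in>I. te i) powr (p - 1) * (\<Sum>i\<in>I. te i * y i powr p)"
proof (cases "(\<Sum>i\<in>I. te i * y i) = 0")
 case True
 then show ?thesis using te y by (auto intro!: mult_nonneg_nonneg sum_nonneg)
next
 case False
 define S where "S = (\<Sum>i\<in>I. te i * y i)"
 define m where "m = (\<Sum>i\<in>I. te i)"
 have S: "0 < S" using False te y by (auto simp: S_def order_less_le intro!: sum_nonneg)
 have m: "0 < m"
 proof (rule ccontr)
  assume "~ 0 < m"
  then have m0: "m = 0" using te sum_nonneg[of I te] by (simp add: m_def order_antisym)
  have "finite I" using False sum.infinite by fastforce
  then have "te i = 0" if "i : I" for i using m0 te that by (simp add: m_def sum_nonneg_eq_0_iff)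
  then show False using S by (simp add: S_def)
 qed
 define A where "A = S / m"
 have A: "0 < A" using S m by (simp add: A_def)
 have "(\<Sum>i\<in>I. te i * (A powr p + p * A powr (p - 1) * (y i - A))) <= (\<Sum>i\<in>I. te i * y i powr p)"
  using te y p A by (intro sum_mono mult_left_mono powr_above_tangent)
 also have "(\<Sum>i\<in>I. te i * (A powr p + p * A powr (p - 1) * (y i - A)))
   = m * A powr p + p * A powr (p - 1) * (S - m * A)"
  by (simp add: S_def m_def algebra_simps sum.distrib sum_subtractf sum_distrib_left sum_distrib_right)
 also have "... = m * A powr p" using m by (simp add: A_def)
 finally have "m powr (p - 1) * (m * A powr p) <= m powr (p - 1) * (\<Sum>i\<in>I. te i * y i powr p)"
  by (intro mult_left_mono) auto
 also have "m powr (p - 1) * (m * A powr p) = m powr p * A powr p"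
  using m by (simp add: powr_diff)
 also have "... = S powr p" using m S by (simp add: A_def powr_mult[symmetric])
 finally show ?thesis by (simp add: S_def m_def)
qed

lemma weighted_two_powr_le:
 fixes a b x y :: real
 assumes p: "1 <= p" and "0 <= a" "0 <= b" "0 <= x" "0 <= y"
 shows "(a * x + b * y) powr p <= (a + b) powr (p - 1) * (a * x powr p + b * y powr p)"
proof -
 have s: "sum f {True, False} = f True + f False" for f :: "bool => real" by simp
 have "(\<Sum>i\<in>{True, False}. (if i then a else b) * (if i then x else y)) powr p
   <= (\<Sum>i\<in>{True, False}. if i then a else b) powr (p - 1) * (\<Sum>i\<in>{True, False}. (if i then a else b) * (if i then x else y) powr p)"
  by (rule weighted_sum_powr_le[OF p]) (use assms in \<open>auto split: if_splits\<close>)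
 then show ?thesis unfolding s if_True if_False .
qed

lemma powr_add_le:
 fixes a b :: real
 assumes "1 <= p" "0 <= a" "0 <= b"
 shows "(a + b) powr p <= 2 powr (p - 1) * (a powr p + b powr p)"
proof -
 have "(1 * a + 1 * b) powr p <= (1 + 1) powr (p - 1) * (1 * a powr p + 1 * b powr p)"
  using assms by (intro weighted_two_powr_le) auto
 then show ?thesis by simp
qed

lemma abs_powr_add_le:
 fixes a b :: real
 assumes "1 <= p"
 shows "abs(a + b) powr p <= 2 powr (p - 1) * (abs(a) powr p + abs(b) powr p)"
proof -
 have "abs(a + b) powr p <= (abs(a) + abs(b)) powr p" using assms by (intro powr_mono2) auto
 also have "... <= 2 powr (p - 1) * (abs(a) powr p + abs(b) powr p)" using assms by (intro powr_add_le) auto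
 finally show ?thesis .
qed

lemma (in finite_measure) integrable_if_powr_integrable:
 fixes g :: "'a => real"
 assumes p: "1 <= p" and [measurable]: "g : borel_measurable M"
  and fin: "(\<integral>\<^sup>+x. ennreal (abs(g x) powr p) \<partial>M) < infinity"
 shows "integrable M (%x. abs(g x) powr p)" "integrable M g"
proof -
 show 1: "integrable M (%x. abs(g x) powr p)" using fin by (intro integrableI_bounded) auto
 show "integrable M g"
 proof (rule Bochner_Integration.integrable_bound[OF Bochner_Integration.integrable_add[OF integrable_const[of 1] 1]])
  have "abs(g x) <= 1 + abs(g x) powr p" for x by (rule le_one_plus_powr[OF p]) simp
  then show "AE x in M. norm (g x) <= norm (1 + abs(g x) powr p)" by simp
 qed measurable
qed

lemma (in finite_measure) Jensen_powr:
 fixes g :: "'a => real"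
 assumes p: "1 <= p" and [measurable]: "g : borel_measurable M"
 shows "ennreal (abs(\<integral>x. g x \<partial>M) powr p) <=
  ennreal (measure M (space M) powr (p - 1)) * (\<integral>\<^sup>+x. ennreal (abs(g x) powr p) \<partial>M)"
proof -
 define m where "m = measure M (space M)"
 define S where "S = (\<integral>x. abs(g x) \<partial>M)"
 have S0: "0 <= S" by (simp add: S_def)
 consider "(\<integral>x. g x \<partial>M) = 0" | "(\<integral>x. g x \<partial>M) ~= 0" "(\<integral>\<^sup>+x. ennreal (abs(g x) powr p) \<partial>M) = infinity"
  | "(\<integral>x. g x \<partial>M) ~= 0" "(\<integral>\<^sup>+x. ennreal (abs(g x) powr p) \<partial>M) < infinity"
  using top.not_eq_extremum[of "\<integral>\<^sup>+x. ennreal (abs(g x) powr p) \<partial>M"] by (auto simp: infinity_ennreal_def)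
 then show ?thesis
 proof cases
  case 1
  then show ?thesis by simp
 next
  case 2
  have "m ~= 0"
  proof
   assume "m = 0"
   then have "emeasure M (space M) = 0" by (simp add: m_def emeasure_eq_measure)
   then have "AE x in M. g x = 0" by (intro AE_I[where N="space M"]) auto
   then have "(\<integral>x. g x \<partial>M) = (\<integral>x. 0 \<partial>M)" by (intro integral_cong_AE) auto
   with 2 show False by simp
  qed
  then have "0 < m powr (p - 1)" by simp
  then have "ennreal (m powr (p - 1)) * (\<integral>\<^sup>+x. ennreal (abs(g x) powr p) \<partial>M) = infinity"
   using 2 by (simp add: ennreal_mult_top)
  then show ?thesis by (simp add: m_def)
 next
  case 3
  note int = integrable_if_powr_integrable[OF p _ 3(2), simplified]
  have S_ge: "abs(\<integral>x. g x \<partial>M) <= S" using integral_norm_bound[of M g] by (simp add: S_def)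
  then have S: "0 < S" using 3(1) by linarith
  have m: "0 < m"
  proof (rule ccontr)
   assume "~ 0 < m"
   then have "measure M (space M) = 0" using measure_nonneg[of M "space M"] unfolding m_def by linarith
   then have "emeasure M (space M) = 0" by (simp add: emeasure_eq_measure)
   then have "AE x in M. g x = 0" by (intro AE_I[where N="space M"]) auto
   then have "(\<integral>x. g x \<partial>M) = (\<integral>x. 0 \<partial>M)" by (intro integral_cong_AE) auto
   with 3 show False by simp
  qed
  define A where "A = S / m"
  have A: "0 < A" using S m by (simp add: A_def)
  have "(\<integral>x. A powr p + p * A powr (p - 1) * (abs(g x) - A) \<partial>M) <= (\<integral>x. abs(g x) powr p \<partial>M)"
   using int p A by (intro integral_mono powr_above_tangent) auto
  also have "(\<integral>x. A powr p + p * A powr (p - 1) * (abs(g x) - A) \<partial>M) = m * A powr p + p * A powr (p - 1) * (S - m * A)"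
   using int by (simp add: S_def m_def)
  also have "... = m * A powr p" using m by (simp add: A_def)
  finally have "m powr (p - 1) * (m * A powr p) <= m powr (p - 1) * (\<integral>x. abs(g x) powr p \<partial>M)"
   by (intro mult_left_mono) auto
  also have "m powr (p - 1) * (m * A powr p) = m powr p * A powr p"
   using m by (simp add: powr_diff)
  also have "... = S powr p" using m S by (simp add: A_def powr_mult[symmetric])
  finally have le: "S powr p <= m powr (p - 1) * (\<integral>x. abs(g x) powr p \<partial>M)" .
  have "abs(\<integral>x. g x \<partial>M) powr p <= S powr p" using S_ge p by (intro powr_mono2) auto
  also note le
  finally have "ennreal (abs(\<integral>x. g x \<partial>M) powr p) <= ennreal (m powr (p - 1) * (\<integral>x. abs(g x) powr p \<partial>M))"
   by (rule ennreal_leI)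
  also have "... = ennreal (m powr (p - 1)) * (\<integral>\<^sup>+x. ennreal (abs(g x) powr p) \<partial>M)"
   using int by (simp add: nn_integral_eq_integral ennreal_mult)
  finally show ?thesis by (simp add: m_def)
 qed
qed

section \<open>The space \<open>L\<^sup>p\<close>\<close>

definition Lnorm :: "real => 'b measure => ('b => 'c::{banach, second_countable_topology}) => real" where
 "Lnorm p M f = (\<integral>x. norm (f x) powr p \<partial>M) powr (1 / p)"

definition Lspace :: "real => 'b measure => ('b => 'c::{banach, second_countable_topology}) set" where
 "Lspace p M = {f : borel_measurable M. integrable M (%x. norm (f x) powr p)}"

lemma Lp_eq_Lspace: "Lp p a b = Lspace p (lebesgue_on {a<..<b})"
 unfolding Lp_def Lspace_def by (rule refl)

lemma Lp_norm_eq_Lnorm: "Lp_norm p a b f = Lnorm p (lebesgue_on {a<..<b}) f"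
 unfolding Lp_norm_def Lnorm_def by (rule refl)

lemma Lnorm_nonneg: "0 <= Lnorm p M f"
 by (simp add: Lnorm_def)
lemma Lnorm_powr:
 assumes "1 <= p"
 shows "Lnorm p M f powr p = (\<integral>x. norm (f x) powr p \<partial>M)"
proof -
 have 1: "1 / p * p = 1" using assms by simp
 have 0: "0 <= (\<integral>x. norm (f x) powr p \<partial>M)" by (intro integral_nonneg_AE AE_I2 powr_ge_zero)
 show ?thesis unfolding Lnorm_def powr_powr 1 using 0 by (rule powr_one)
qed

lemma Lnorm_le_iff:
 assumes "1 <= p" "0 <= c"
 shows "Lnorm p M f <= c <=> (\<integral>x. norm (f x) powr p \<partial>M) <= c powr p"
proof
 assume "Lnorm p M f <= c"
 then have "Lnorm p M f powr p <= c powr p"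
  using assms Lnorm_nonneg[of p M f] by (intro powr_mono2) auto
 then show "(\<integral>x. norm (f x) powr p \<partial>M) <= c powr p" using Lnorm_powr[OF assms(1), of M f] by simp
next
 assume le: "(\<integral>x. norm (f x) powr p \<partial>M) <= c powr p"
 show "Lnorm p M f <= c"
 proof (rule ccontr)
  assume "~ Lnorm p M f <= c"
  then have "c powr p < Lnorm p M f powr p" using assms by (intro powr_less_mono2) auto
  then show False using le Lnorm_powr[OF assms(1), of M f] by simp
 qed
qed

lemma Lnorm_scaleR:
 assumes "1 <= p"
 shows "Lnorm p M (%x. c *\<^sub>R f x) = abs(c) * Lnorm p M f"
proof -
 have 1: "p * (1 / p) = 1" using assms by simp
 have 2: "abs(c) powr 1 = abs(c)" by simp
 have "(\<integral>x. norm (c *\<^sub>R f x) powr p \<partial>M) = abs(c) powr p * (\<integral>x. norm (f x) powr p \<partial>M)"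
  by (simp add: powr_mult)
 then show ?thesis unfolding Lnorm_def by (simp only: powr_mult powr_powr 1 2)
qed

lemma Lspace_scaleR: "f : Lspace p M ==> (%x. c *\<^sub>R f x) : Lspace p M"
 by (auto simp: Lspace_def powr_mult intro!: borel_measurable_scaleR)

text \<open>Minkowski's inequality, from convexity of \<open>t \<mapsto> t\<^sup>p\<close> with weights proportional to the two norms.\<close>

lemma Minkowski:
 assumes p: "1 <= p" and f: "f : Lspace p M" and g: "g : Lspace p M"
 shows "(%x. f x + g x) : Lspace p M" "Lnorm p M (%x. f x + g x) <= Lnorm p M f + Lnorm p M g"
proof -
 have [measurable]: "f : borel_measurable M" "g : borel_measurable M" using f g by (auto simp: Lspace_def)
 have fi: "integrable M (%x. norm (f x) powr p)" and gi: "integrable M (%x. norm (g x) powr p)"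
  using f g by (auto simp: Lspace_def)
 have conv: "norm (f x + g x) powr p <= (a + b) powr (p - 1) * (a powr (1 - p) * norm (f x) powr p + b powr (1 - p) * norm (g x) powr p)"
  if ab: "0 < a" "0 < b" for a b x
 proof -
  have "norm (f x + g x) powr p <= (norm (f x) + norm (g x)) powr p"
   using p norm_triangle_ineq by (intro powr_mono2) auto
  also have "... = (a * (norm (f x) / a) + b * (norm (g x) / b)) powr p" using ab by simp
  also have "... <= (a + b) powr (p - 1) * (a * (norm (f x) / a) powr p + b * (norm (g x) / b) powr p)"
   using p ab by (intro weighted_two_powr_le) auto
  also have "a * (norm (f x) / a) powr p = a powr (1 - p) * norm (f x) powr p"
   using ab by (simp add: powr_divide powr_diff)
  also have "b * (norm (g x) / b) powr p = b powr (1 - p) * norm (g x) powr p"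
   using ab by (simp add: powr_divide powr_diff)
  finally show ?thesis .
 qed
 have int: "integrable M (%x. norm (f x + g x) powr p)"
  by (rule Bochner_Integration.integrable_bound[of M "%x. 2 powr (p - 1) * (norm (f x) powr p + norm (g x) powr p)"])
   (use fi gi conv[of 1 1] in auto)
 then show "(%x. f x + g x) : Lspace p M" by (simp add: Lspace_def)
 define A where "A = Lnorm p M f"
 define B where "B = Lnorm p M g"
 have "Lnorm p M (%x. f x + g x) <= A + B + ep" if "0 < ep" for ep
 proof -
  define a where "a = A + ep / 2"
  define b where "b = B + ep / 2"
  have ab: "0 < a" "0 < b" "A <= a" "B <= b" "0 <= A" "0 <= B"
   using that Lnorm_nonneg[of p M f] Lnorm_nonneg[of p M g] by (auto simp: a_def b_def A_def B_def)
  have *: "a powr (1 - p) * A powr p <= a" if "0 < a" "0 <= A" "A <= a" for a A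
  proof -
   have "a powr (1 - p) * A powr p <= a powr (1 - p) * a powr p"
   using p that by (intro mult_left_mono powr_mono2) auto
   then show ?thesis using that by (simp add: powr_add[symmetric])
  qed
  have "(\<integral>x. norm (f x + g x) powr p \<partial>M) <=
   (\<integral>x. (a + b) powr (p - 1) * (a powr (1 - p) * norm (f x) powr p + b powr (1 - p) * norm (g x) powr p) \<partial>M)"
   using conv ab int fi gi by (intro integral_mono) auto
  also have "... = (a + b) powr (p - 1) * (a powr (1 - p) * A powr p + b powr (1 - p) * B powr p)"
   using fi gi p by (simp add: A_def B_def Lnorm_powr)
  also have "... <= (a + b) powr (p - 1) * (a + b)"
   using ab by (intro mult_left_mono add_mono *) auto
  also have "... = (a + b) powr p" using ab by (simp add: powr_mult_base mult.commute)
  finally have "Lnorm p M (%x. f x + g x) <= a + b" using ab p by (subst Lnorm_le_iff) auto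
  then show ?thesis by (simp add: a_def b_def)
 qed
 then show "Lnorm p M (%x. f x + g x) <= Lnorm p M f + Lnorm p M g"
  unfolding A_def B_def by (rule field_le_epsilon)
qed

lemma Lspace_diff: "1 <= p ==> f : Lspace p M ==> g : Lspace p M ==> (%x. f x - g x) : Lspace p M"
 using Minkowski(1)[of p f M "%x. (-1) *\<^sub>R g x"] Lspace_scaleR[of g p M "-1"] by simp

lemma Lspace_zero: "(%x. 0) : Lspace p M" and Lnorm_zero: "Lnorm p M (%x. 0) = 0"
 by (auto simp: Lspace_def Lnorm_def)
lemma Minkowski_sum:
 assumes p: "1 <= p" and f: "!!i. i : I ==> f i : Lspace p M"
 shows "(%x. \<Sum>i\<in>I. f i x) : Lspace p M & Lnorm p M (%x. \<Sum>i\<in>I. f i x) <= (\<Sum>i\<in>I. Lnorm p M (f i))"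
proof (cases "finite I")
 case True
 then show ?thesis using f
 proof (induction I)
  case (insert i I)
  then show ?case using Minkowski[OF p, of "f i" M "%x. \<Sum>i\<in>I. f i x"] by auto
 qed (simp add: Lspace_zero Lnorm_zero)
qed (simp add: Lspace_zero Lnorm_zero)

text \<open>
  Completeness (Riesz--Fischer) for rapidly convergent series: monotone convergence makes the series
  absolutely convergent almost everywhere, Fatou's lemma bounds its tails.
\<close>

lemma Lspace_complete:
 fixes u :: "nat => 'b => 'c::{banach, second_countable_topology}"
 assumes p: "1 <= p" and u: "!!n. u n : Lspace p M" and le: "!!n. Lnorm p M (u n) <= (1/3) ^ n"
 shows "\<exists>w\<in>Lspace p M. (%n. Lnorm p M (%x. w x - (\<Sum>k<n. u k x))) ----> 0"
proof -
 have [measurable]: "u n : borel_measurable M" for n using u by (auto simp: Lspace_def)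
 have geo: "(\<Sum>k\<in>{m..<n}. (1/3::real) ^ k) <= 3/2 * (1/3) ^ m" for m n
 proof (cases "m <= n")
  case True
  have "(\<Sum>k\<in>{m..<n}. (1/3::real) ^ k) = 3/2 * ((1/3) ^ m - (1/3) ^ n)"
   using True by (induction n rule: dec_induct) (simp_all add: right_diff_distrib)
  also have "... <= 3/2 * ((1/3) ^ m - 0)" by (intro mult_left_mono diff_left_mono) auto
  finally show ?thesis by simp
 qed simp
 define G where "G n x = (\<Sum>k<n. norm (u k x))" for n x
 have nu: "(%x. norm (u n x)) : Lspace p M" "Lnorm p M (%x. norm (u n x)) = Lnorm p M (u n)" for n
  using u[of n] by (auto simp: Lspace_def Lnorm_def)
 have G: "G n : Lspace p M" "Lnorm p M (G n) <= 3/2" for n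
 proof -
  have "(%x. \<Sum>k<n. norm (u k x)) : Lspace p M & Lnorm p M (%x. \<Sum>k<n. norm (u k x)) <= (\<Sum>k<n. Lnorm p M (%x. norm (u k x)))"
   by (rule Minkowski_sum[OF p nu(1)])
  moreover have "(\<Sum>k<n. Lnorm p M (%x. norm (u k x))) <= (\<Sum>k\<in>{0..<n}. (1/3) ^ k)"
   using le by (simp add: nu(2) lessThan_atLeast0 sum_mono)
  ultimately show "G n : Lspace p M" "Lnorm p M (G n) <= 3/2" using geo[of 0 n] by (auto simp: G_def[abs_def])
 qed
 have G0: "0 <= G n x" for n x by (simp add: G_def sum_nonneg)
 have Gint: "(\<integral>\<^sup>+x. ennreal (G n x powr p) \<partial>M) <= ennreal ((3/2) powr p)" for n
 proof -
  have "integrable M (%x. G n x powr p)" using G(1)[of n] G0 by (simp add: Lspace_def)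
  then have "(\<integral>\<^sup>+x. ennreal (G n x powr p) \<partial>M) = ennreal (\<integral>x. G n x powr p \<partial>M)"
   by (intro nn_integral_eq_integral) auto
  also have "... <= ennreal ((3/2) powr p)"
   using iffD1[OF Lnorm_le_iff[OF p] G(2)[of n]] G0 by (intro ennreal_leI) simp
  finally show ?thesis .
 qed
 have "AE x in M. summable (%k. norm (u k x))"
 proof -
  have [measurable]: "G n : borel_measurable M" for n unfolding G_def by measurable
  have "incseq (%n x. ennreal (G n x powr p))"
   using p by (intro incseq_SucI le_funI ennreal_leI powr_mono2) (auto simp: G_def sum_nonneg)
  then have "(\<integral>\<^sup>+x. (SUP n. ennreal (G n x powr p)) \<partial>M) = (SUP n. \<integral>\<^sup>+x. ennreal (G n x powr p) \<partial>M)"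
   by (intro nn_integral_monotone_convergence_SUP) auto
  also have "... <= ennreal ((3/2) powr p)" using Gint by (intro SUP_least) auto
  finally have "(\<integral>\<^sup>+x. (SUP n. ennreal (G n x powr p)) \<partial>M) ~= infinity" by (auto simp: top_unique)
  then have "AE x in M. (SUP n. ennreal (G n x powr p)) ~= infinity" by (intro nn_integral_PInf_AE) auto
  then show ?thesis
  proof (rule AE_mp, intro AE_I2 impI)
   fix x assume fin: "(SUP n. ennreal (G n x powr p)) ~= infinity"
   then obtain c where c: "0 <= c" "(SUP n. ennreal (G n x powr p)) = ennreal c"
   by (metis ennreal_cases infinity_ennreal_def)
   show "summable (%k. norm (u k x))"
   proof (rule summableI_nonneg_bounded)
   fix n
   have "ennreal (G n x powr p) <= ennreal c" unfolding c(2)[symmetric] by (rule SUP_upper) simp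
   then have "G n x powr p <= c" using c by simp
   moreover have "G n x <= 1 + G n x powr p" by (rule le_one_plus_powr[OF p G0])
   ultimately show "(\<Sum>k<n. norm (u k x)) <= 1 + c" by (simp add: G_def)
   qed simp
  qed
 qed
 then have conv: "AE x in M. (%n. \<Sum>k<n. u k x) ----> (\<Sum>k. u k x)"
  by (rule AE_mp) (auto intro!: AE_I2 summable_LIMSEQ summable_norm_cancel)
 define w where "w x = (\<Sum>k. u k x)" for x
 have [measurable]: "w : borel_measurable M" unfolding w_def by measurable
 have tail: "(%x. w x - (\<Sum>k<n. u k x)) : Lspace p M & Lnorm p M (%x. w x - (\<Sum>k<n. u k x)) <= 3/2 * (1/3) ^ n" for n
 proof -
  define c where "c = 3/2 * (1/3::real) ^ n"
  have c0: "0 <= c" by (simp add: c_def)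
  have part: "(\<integral>\<^sup>+x. ennreal (norm (\<Sum>k\<in>{n..<n+K}. u k x) powr p) \<partial>M) <= ennreal (c powr p)" for K
  proof -
   have 1: "(%x. \<Sum>k\<in>{n..<n+K}. u k x) : Lspace p M & Lnorm p M (%x. \<Sum>k\<in>{n..<n+K}. u k x) <= (\<Sum>k\<in>{n..<n+K}. Lnorm p M (u k))"
   by (rule Minkowski_sum[OF p u])
   have "(\<Sum>k\<in>{n..<n+K}. Lnorm p M (u k)) <= (\<Sum>k\<in>{n..<n+K}. (1/3) ^ k)" using le by (intro sum_mono)
   also have "... <= c" unfolding c_def by (rule geo)
   finally have "Lnorm p M (%x. \<Sum>k\<in>{n..<n+K}. u k x) <= c" using 1 by linarith
   then have "(\<integral>x. norm (\<Sum>k\<in>{n..<n+K}. u k x) powr p \<partial>M) <= c powr p" using p c0 by (simp add: Lnorm_le_iff)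
   moreover have "integrable M (%x. norm (\<Sum>k\<in>{n..<n+K}. u k x) powr p)" using 1 by (simp add: Lspace_def)
   ultimately show ?thesis by (subst nn_integral_eq_integral) (auto intro: ennreal_leI)
  qed
  have "(\<integral>\<^sup>+x. ennreal (norm (w x - (\<Sum>k<n. u k x)) powr p) \<partial>M)
   = (\<integral>\<^sup>+x. liminf (%K. ennreal (norm (\<Sum>k\<in>{n..<n+K}. u k x) powr p)) \<partial>M)"
  proof (rule nn_integral_cong_AE, rule AE_mp[OF conv], intro AE_I2 impI)
   fix x assume lim: "(%n. \<Sum>k<n. u k x) ----> (\<Sum>k. u k x)"
   have eq: "(\<Sum>k\<in>{n..<n+K}. u k x) = (\<Sum>k<n+K. u k x) - (\<Sum>k<n. u k x)" for K
   by (simp add: lessThan_atLeast0 sum_diff_nat_ivl)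
   have "(%K. \<Sum>k<n+K. u k x) ----> w x"
   using LIMSEQ_ignore_initial_segment[OF lim, of n] by (simp add: w_def add.commute)
   then have "(%K. norm ((\<Sum>k<n+K. u k x) - (\<Sum>k<n. u k x)) powr p) ----> norm (w x - (\<Sum>k<n. u k x)) powr p"
   using p by (intro tendsto_powr2 tendsto_intros) auto
   then have "(%K. ennreal (norm (\<Sum>k\<in>{n..<n+K}. u k x) powr p)) ----> ennreal (norm (w x - (\<Sum>k<n. u k x)) powr p)"
   unfolding eq by (intro tendsto_ennrealI)
   from lim_imp_Liminf[OF _ this]
   show "ennreal (norm (w x - (\<Sum>k<n. u k x)) powr p) = liminf (%K. ennreal (norm (\<Sum>k\<in>{n..<n+K}. u k x) powr p))" by simp
  qed
  also have "... <= liminf (%K. \<integral>\<^sup>+x. ennreal (norm (\<Sum>k\<in>{n..<n+K}. u k x) powr p) \<partial>M)"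
   by (rule nn_integral_liminf) measurable
  also have "... <= liminf (%K::nat. ennreal (c powr p))" using part by (intro Liminf_mono) auto
  also have "... = ennreal (c powr p)" by (simp add: Liminf_const)
  finally have fin: "(\<integral>\<^sup>+x. ennreal (norm (w x - (\<Sum>k<n. u k x)) powr p) \<partial>M) <= ennreal (c powr p)" .
  then have int: "integrable M (%x. norm (w x - (\<Sum>k<n. u k x)) powr p)"
   by (intro integrableI_bounded) (auto simp: le_less_trans[OF _ ennreal_less_top])
  then have "ennreal (\<integral>x. norm (w x - (\<Sum>k<n. u k x)) powr p \<partial>M) <= ennreal (c powr p)"
   using fin by (subst (asm) nn_integral_eq_integral) auto
  then have "(\<integral>x. norm (w x - (\<Sum>k<n. u k x)) powr p \<partial>M) <= c powr p" by (subst (asm) ennreal_le_iff) auto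
  then have "Lnorm p M (%x. w x - (\<Sum>k<n. u k x)) <= c" by (simp only: Lnorm_le_iff[OF p c0])
  moreover have "(%x. w x - (\<Sum>k<n. u k x)) : Lspace p M" using int by (simp add: Lspace_def)
  ultimately show ?thesis by (simp add: c_def)
 qed
 have "w : Lspace p M" using tail[of 0] by simp
 moreover have "(%n. Lnorm p M (%x. w x - (\<Sum>k<n. u k x))) ----> 0"
 proof (rule Lim_null_comparison)
  have "(%n. 3/2 * (1/3::real) ^ n) ----> 3/2 * 0" by (intro tendsto_intros LIMSEQ_realpow_zero) auto
  then show "(%n. 3/2 * (1/3::real) ^ n) ----> 0" by simp
  show "\<forall>\<^sub>F n in sequentially. norm (Lnorm p M (%x. w x - (\<Sum>k<n. u k x))) <= 3/2 * (1/3) ^ n"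
   using tail by (intro always_eventually allI) (simp only: real_norm_def abs_of_nonneg[OF Lnorm_nonneg])
 qed
 ultimately show ?thesis by blast
qed

section \<open>Continuity of translation and integral means\<close>

lemma nn_integral_shift:
 fixes f :: "real => ennreal"
 assumes "f : Borel"
 shows "(\<integral>\<^sup>+x. f (x + h) \<partial>lborel) = (\<integral>\<^sup>+x. f x \<partial>lborel)"
 using nn_integral_real_affine[OF assms, of 1 h] by (simp add: add.commute)

lemma integral_shift:
 fixes f :: "real => real"
 shows "(\<integral>x. f (x + h) \<partial>lborel) = (\<integral>x. f x \<partial>lborel)"
 using lborel_integral_real_affine[of 1 f h] by (simp add: add.commute)

lemma integrable_shift:
 fixes f :: "real => real"
 assumes "integrable lborel f"
 shows "integrable lborel (%x. f (x + h))"
 using lborel_integrable_real_affine[OF assms, of 1 h] by (simp add: add.commute)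

lemma AE_shift:
 assumes "AE x in lborel. P (x::real)"
 shows "AE x in lborel. P (x + h)"
proof -
 obtain N where N: "N : null_sets lborel" "{x. ~ P x} \<subseteq> N"
  using assms by (auto elim!: AE_E simp: null_sets_def)
 have "AE x in lborel. x ~: N" by (rule AE_not_in[OF N(1)])
 then have "AE x in lborel. h + 1 * x ~: N"
  using N(1) by (intro AE_borel_affine) (auto simp: null_sets_def)
 then show ?thesis by eventually_elim (use N(2) in \<open>auto simp: add.commute\<close>)
qed

text \<open>
  For the indicator of an open set \<open>U\<close>, lower semicontinuity makes \<open>(1\<^sub>U(x) - 1\<^sub>U(x + h))\<^sup>+\<close>
  tend to \<open>0\<close> pointwise; since both indicators have the same integral, the integral of the absolute value
  of their difference is twice that of the positive part.
\<close>

lemma translation_continuous_open: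
 assumes U: "open (U :: real set)" "emeasure lborel U < infinity" and h: "h ----> 0"
 shows "(%n. \<integral>x. abs(indicator U (x + h n) - indicator U x) \<partial>lborel) ----> (0::real)"
proof -
 have [measurable]: "U : sets borel" using U by simp
 have int: "integrable lborel (indicator U :: real => real)" using U by simp
 note ints = integrable_shift[OF int]
 have "(%n. \<integral>x. max 0 (indicator U x - indicator U (x + h n)) \<partial>lborel) ----> integral\<^sup>L lborel (%x::real. 0::real)"
 proof (rule integral_dominated_convergence[where w="indicator U"])
  show "AE x in lborel. (%n. max 0 (indicator U x - indicator U (x + h n))) ----> (0::real)"
  proof (rule AE_I2)
   fix x :: real
   have "eventually (%n. max 0 (indicator U x - indicator U (x + h n)) = (0::real)) sequentially"
   proof (cases "x : U")
   case True
   have "(%n. x + h n) ----> x + 0" by (intro tendsto_intros h)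
   then have "eventually (%n. x + h n : U) sequentially"
   using U(1) True by (auto dest: topological_tendstoD)
   then show ?thesis by eventually_elim (use True in auto)
   qed (auto split: split_indicator)
   then show "(%n. max 0 (indicator U x - indicator U (x + h n))) ----> (0::real)"
   by (rule tendsto_eventually)
  qed
  show "AE x in lborel. norm (max 0 (indicator U x - indicator U (x + h n)) :: real) <= indicator U x" for n
   by (intro AE_I2) (auto split: split_indicator)
 qed (use int in auto)
 from tendsto_mult[OF tendsto_const[of 2] this]
 have lim: "(%n. 2 * (\<integral>x. max 0 (indicator U x - indicator U (x + h n)) \<partial>lborel)) ----> 2 * (0::real)"
  by simp
 have "(\<integral>x. abs(indicator U (x + h n) - indicator U x) \<partial>lborel) = 2 * (\<integral>x. max 0 (indicator U x - indicator U (x + h n)) \<partial>lborel :: real)" for n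
 proof -
  have eq: "abs(indicator U (x + h n) - indicator U x) = 2 * max 0 (indicator U x - indicator U (x + h n)) + (indicator U (x + h n) - indicator U x :: real)" for x
   by (auto split: split_indicator)
  have "integrable lborel (%x. max 0 (indicator U x - indicator U (x + h n)) :: real)"
   using int ints[of "h n"] by (intro integrable_max) auto
  then show ?thesis
   unfolding eq using int ints[of "h n"] integral_shift[of "indicator U" "h n"] by simp
 qed
 with lim show ?thesis by simp
qed

lemma translation_continuous_L1:
 fixes f :: "real => real"
 assumes "integrable lborel f" and h: "h ----> 0"
 shows "(%n. \<integral>x. abs(f (x + h n) - f x) \<partial>lborel) ----> 0"
 using assms(1)
proof (induction rule: integrable_induct)
 case (base A c)
 have [measurable]: "A : sets borel" using base by simp
 have close: "(%n. \<integral>x. abs(indicator A (x + h n) - indicator A x) \<partial>lborel) ----> (0::real)"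
 proof (rule LIMSEQ_I)
  fix e :: real assume e: "0 < e"
  obtain U where U: "open U" "A \<subseteq> U" "emeasure lborel (U - A) < e/4"
   using outer_regular_lborel[of A "e/4"] e by auto
  have [measurable]: "U : sets borel" using U by simp
  have "emeasure lborel U <= emeasure lborel A + emeasure lborel (U - A)"
   using U(2) by (subst plus_emeasure) (auto simp: Un_absorb1)
  then have fin: "emeasure lborel U < infinity" using base(2) U(3) by (auto simp: less_top[symmetric] top_unique add_top)
  have intA: "integrable lborel (indicator A :: real => real)" and intU: "integrable lborel (indicator U :: real => real)"
   using base fin by auto
  have intD: "integrable lborel (%x. indicator U x - indicator A x :: real)" using intA intU by simp
  have D: "(\<integral>x. indicator U x - indicator A x \<partial>lborel) < e/4"
  proof -
   have "(\<integral>x. indicator U x - indicator A x \<partial>lborel) = (\<integral>x. indicator (U - A) x \<partial>lborel)"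
   using U(2) by (intro integral_cong_all) (auto split: split_indicator)
   also have "... = measure lborel (U - A)" by simp
   also have "... < e/4"
   proof -
   have "emeasure lborel (U - A) ~= top" using U(3) by auto
   then have "emeasure lborel (U - A) = ennreal (measure lborel (U - A))" by (rule emeasure_eq_ennreal_measure)
   then show ?thesis using U(3) by (simp add: ennreal_less_iff)
   qed
   finally show ?thesis .
  qed
  obtain n0 where n0: "!!n. n >= n0 ==> norm ((\<integral>x. abs(indicator U (x + h n) - indicator U x) \<partial>lborel) - (0::real)) < e/2"
   using LIMSEQ_D[OF translation_continuous_open[OF U(1) fin h], of "e/2"] e by auto
  have "norm ((\<integral>x. abs(indicator A (x + h n) - indicator A x) \<partial>lborel) - (0::real)) < e" if n: "n >= n0" for n
  proof -
   have "(\<integral>x. abs(indicator A (x + h n) - indicator A x) \<partial>lborel) <=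
   (\<integral>x. abs(indicator U (x + h n) - indicator U x) + (indicator U (x + h n) - indicator A (x + h n)) + (indicator U x - indicator A x) \<partial>lborel :: real)"
   using intA intU intD integrable_shift[OF intA] integrable_shift[OF intU] U(2)
   by (intro integral_mono) (auto split: split_indicator)
   also have "... = (\<integral>x. abs(indicator U (x + h n) - indicator U x) \<partial>lborel) + 2 * (\<integral>x. indicator U x - indicator A x \<partial>lborel)"
   using intA intU intD integrable_shift[OF intA, of "h n"] integrable_shift[OF intU, of "h n"]
   integral_shift[of "indicator U" "h n"] integral_shift[of "indicator A" "h n"] by simp
   also have "... < e/2 + 2 * (e/4)" using n0[OF n] D by (intro add_strict_mono) auto
   finally show ?thesis by simp
  qed
  then show "\<exists>n0. \<forall>n\<ge>n0. norm ((\<integral>x. abs(indicator A (x + h n) - indicator A x) \<partial>lborel) - (0::real)) < e" by blast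
 qed
 have eq: "abs(indicator A (x + h n) *\<^sub>R c - indicator A x *\<^sub>R c) = abs(c) * abs(indicator A (x + h n) - indicator A x)" for x n
  by (simp add: left_diff_distrib[symmetric] abs_mult)
 have "(%n. abs(c) * (\<integral>x. abs(indicator A (x + h n) - indicator A x) \<partial>lborel)) ----> abs(c) * 0"
  by (intro tendsto_intros close)
 then show ?case unfolding eq by simp
next
 case (add f g)
 show ?case
 proof (rule Lim_null_comparison)
  show "(%n. (\<integral>x. abs(f (x + h n) - f x) \<partial>lborel) + (\<integral>x. abs(g (x + h n) - g x) \<partial>lborel)) ----> 0"
   by (rule tendsto_add[OF add(3,4), simplified])
  have "(\<integral>x. abs(f (x + h n) + g (x + h n) - (f x + g x)) \<partial>lborel) <= (\<integral>x. abs(f (x + h n) - f x) + abs(g (x + h n) - g x) \<partial>lborel)" for n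
   using add(1,2) integrable_shift[OF add(1), of "h n"] integrable_shift[OF add(2), of "h n"] by (intro integral_mono) auto
  then show "\<forall>\<^sub>F n in sequentially. norm (\<integral>x. abs(f (x + h n) + g (x + h n) - (f x + g x)) \<partial>lborel)
   <= (\<integral>x. abs(f (x + h n) - f x) \<partial>lborel) + (\<integral>x. abs(g (x + h n) - g x) \<partial>lborel)"
   using add(1,2) integrable_shift[OF add(1)] integrable_shift[OF add(2)] by (intro always_eventually allI) simp
 qed
next
 case (lim f s)
 show ?case
 proof (rule LIMSEQ_I)
  fix e :: real assume e: "0 < e"
  have "(%i. \<integral>x. abs(s i x - f x) \<partial>lborel) ----> integral\<^sup>L lborel (%x::real. 0::real)"
  proof (rule integral_dominated_convergence[where w="%x. 3 * abs(f x)"])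
   have l: "(%i. s i x) ----> f x" for x using lim(2) by simp
   have "(%i. abs(s i x - f x)) ----> abs(f x - f x)" for x by (intro tendsto_intros l)
   then show "AE x in lborel. (%i. abs(s i x - f x)) ----> 0" by simp
   have "abs(s i x - f x) <= 3 * abs(f x)" for i x
   using lim(3)[of x i] abs_triangle_ineq4[of "s i x" "f x"] by simp
   then show "AE x in lborel. norm (abs(s i x - f x)) <= 3 * abs(f x)" for i by simp
  qed (use lim in auto)
  then obtain i where "abs(\<integral>x. abs(s i x - f x) \<partial>lborel) < e/3"
   using LIMSEQ_D[of _ 0 "e/3"] e by (force simp: eventually_sequentially)
  then have i: "(\<integral>x. abs(s i x - f x) \<partial>lborel) < e/3" by simp
  obtain n0 where n0: "!!n. n >= n0 ==> norm ((\<integral>x. abs(s i (x + h n) - s i x) \<partial>lborel) - 0) < e/3"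
   using LIMSEQ_D[OF lim(5)[of i], of "e/3"] e by auto
  have "norm ((\<integral>x. abs(f (x + h n) - f x) \<partial>lborel) - 0) < e" if n: "n >= n0" for n
  proof -
   note ints = lim(1)[of i] lim(4) integrable_shift[OF lim(1)[of i], of "h n"] integrable_shift[OF lim(4), of "h n"]
   have "(\<integral>x. abs(f (x + h n) - f x) \<partial>lborel) <=
   (\<integral>x. abs(s i (x + h n) - s i x) + abs(s i (x + h n) - f (x + h n)) + abs(s i x - f x) \<partial>lborel)"
   using ints by (intro integral_mono) auto
   also have "... = (\<integral>x. abs(s i (x + h n) - s i x) \<partial>lborel) + (\<integral>x. abs(s i (x + h n) - f (x + h n)) \<partial>lborel) + (\<integral>x. abs(s i x - f x) \<partial>lborel)"
   using ints by simp
   also have "(\<integral>x. abs(s i (x + h n) - f (x + h n)) \<partial>lborel) = (\<integral>x. abs(s i x - f x) \<partial>lborel)"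
   by (rule integral_shift[of "%x. abs(s i x - f x)"])
   finally show ?thesis using n0[OF n] i by simp
  qed
  then show "\<exists>n0. \<forall>n\<ge>n0. norm ((\<integral>x. abs(f (x + h n) - f x) \<partial>lborel) - 0) < e" by blast
 qed
qed

text \<open>The \<open>p\<close>-th power of the \<open>L\<^sup>p(A)\<close> norm, as an extended real.\<close>

definition powint :: "real => real set => (real => real) => ennreal" where
 "powint p A f = (\<integral>\<^sup>+x\<in>A. ennreal (abs(f x) powr p) \<partial>lborel)"

lemma powint_mono_set: "A \<subseteq> B ==> powint p A f <= powint p B f"
 unfolding powint_def by (intro nn_integral_mono) (auto split: split_indicator)

lemma powint_cong_AE: "AE x in lborel. x : A --> f x = g x ==> powint p A f = powint p A g"
 unfolding powint_def by (intro nn_integral_cong_AE) (auto split: split_indicator)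

lemma powint_mono:
 assumes "0 <= p" "AE x in lborel. x : A --> abs(f x) <= abs(g x)"
 shows "powint p A f <= powint p A g"
 unfolding powint_def using assms(2)
 by (intro nn_integral_mono_AE) (auto split: split_indicator intro!: ennreal_leI powr_mono2 assms(1) elim: eventually_mono)
lemma powint_shift:
 assumes [measurable]: "f : Borel"
 shows "powint p {a<..<b} (%x. f (x + h)) = powint p {a + h<..<b + h} f"
proof -
 have "powint p {a<..<b} (%x. f (x + h)) = (\<integral>\<^sup>+x. (%y. ennreal (abs(f y) powr p) * indicator {a + h<..<b + h} y) (x + h) \<partial>lborel)"
  unfolding powint_def by (intro nn_integral_cong) (auto split: split_indicator)
 also have "... = (\<integral>\<^sup>+y. ennreal (abs(f y) powr p) * indicator {a + h<..<b + h} y \<partial>lborel)"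
  by (rule nn_integral_shift) measurable
 finally show ?thesis by (simp add: powint_def)
qed

lemma powint_add:
 assumes p: "1 <= p" and [measurable]: "f : Borel" "g : Borel" "A : sets borel"
 shows "powint p A (%x. f x + g x) <= ennreal (2 powr (p - 1)) * (powint p A f + powint p A g)"
proof -
 have "powint p A (%x. f x + g x) <= (\<integral>\<^sup>+x. ennreal (2 powr (p - 1)) * (ennreal (abs(f x) powr p) * indicator A x + ennreal (abs(g x) powr p) * indicator A x) \<partial>lborel)"
  unfolding powint_def
 proof (intro nn_integral_mono)
  fix x
  have "ennreal (abs(f x + g x) powr p) <= ennreal (2 powr (p - 1) * (abs(f x) powr p + abs(g x) powr p))"
   by (intro ennreal_leI abs_powr_add_le p)
  also have "... = ennreal (2 powr (p - 1)) * (ennreal (abs(f x) powr p) + ennreal (abs(g x) powr p))"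
   by (simp add: ennreal_mult)
  finally show "ennreal (abs(f x + g x) powr p) * indicator A x <= ennreal (2 powr (p - 1)) * (ennreal (abs(f x) powr p) * indicator A x + ennreal (abs(g x) powr p) * indicator A x)"
   by (auto split: split_indicator)
 qed
 also have "... = ennreal (2 powr (p - 1)) * (powint p A f + powint p A g)"
  by (simp add: nn_integral_cmult nn_integral_add powint_def)
 finally show ?thesis .
qed

lemma powint_cmult:
 assumes [measurable]: "f : Borel" "A : sets borel"
 shows "powint p A (%x. c * f x) = ennreal (abs(c) powr p) * powint p A f"
 unfolding powint_def
 by (subst nn_integral_cmult[symmetric]) (auto simp: abs_mult powr_mult ennreal_mult mult.assoc)
lemma powint_minus: "powint p A (%x. - f x) = powint p A f"
 by (simp add: powint_def)
lemma powint_diff: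
 assumes p: "1 <= p" and [measurable]: "f : Borel" "g : Borel" "A : sets borel"
 shows "powint p A (%x. f x - g x) <= ennreal (2 powr (p - 1)) * (powint p A f + powint p A g)"
 using powint_add[OF p, of f "%x. - g x" A] by (simp add: powint_minus)

lemma powint_eq_0_iff:
 assumes [measurable]: "f : Borel" "A : sets borel"
 shows "powint p A f = 0 <=> (AE x in lborel. x : A --> f x = 0)"
 unfolding powint_def by (subst nn_integral_0_iff_AE) (auto split: split_indicator simp: indicator_def intro!: AE_cong)

lemma powint_const_finite: "powint p {a<..<b} (%_. c) < infinity"
 using emeasure_bounded_finite[of "{a<..<b}"]
 by (auto simp: powint_def nn_integral_cmult_indicator ennreal_mult_less_top)

text \<open>On a bounded interval \<open>L\<^sup>p\<close> is contained in \<open>L\<^sup>1\<close>.\<close>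

lemma powint_integrable:
 assumes p: "1 <= p" and [measurable]: "f : Borel" and fin: "powint p {a<..<b} f < infinity"
 shows "L1_on {a<..<b} f" "L1_on {a<..<b} (%x. abs(f x) powr p)"
proof -
 have "(\<integral>\<^sup>+x. ennreal (norm (indicator {a<..<b} x *\<^sub>R (abs(f x)) powr p)) \<partial>lborel) < infinity"
  using fin by (simp add: powint_def indicator_mult_ennreal mult.commute)
 then show 1: "L1_on {a<..<b} (%x. abs(f x) powr p)"
  unfolding set_integrable_def by (intro integrableI_bounded) auto
 have 2: "L1_on {a<..<b} (%x. 1 :: real)"
  using emeasure_bounded_finite[of "{a<..<b}"] by (auto simp: set_integrable_def)
 show "L1_on {a<..<b} f"
  unfolding set_integrable_def
 proof (rule Bochner_Integration.integrable_bound[OF set_integral_add(1)[OF 2 1, unfolded set_integrable_def]])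
  have "abs(f x) <= 1 + abs(f x) powr p" for x by (rule le_one_plus_powr[OF p]) simp
  then show "AE x in lborel. norm (indicator {a<..<b} x *\<^sub>R f x) <= norm (indicator {a<..<b} x *\<^sub>R (1 + abs(f x) powr p))"
   by (auto split: split_indicator)
 qed measurable
qed

text \<open>The \<open>L\<^sup>1\<close> statement carries over to \<open>L\<^sup>p\<close> by truncation: for bounded \<open>g\<close>, \<open>\<bar>g\<bar>\<^sup>p\<close> is dominated by a multiple of \<open>\<bar>g\<bar>\<close>.\<close>

lemma translation_continuous_Lp:
 fixes f :: "real => real"
 assumes p: "1 <= p" and [measurable]: "f : Borel"
  and supp: "!!x. x ~: {a<..<b} ==> f x = 0" and fin: "powint p {a<..<b} f < infinity" and h: "h ----> 0"
 shows "(%n. powint p UNIV (%x. f (x + h n) - f x)) ----> 0"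
proof (rule order_tendstoI)
 fix e :: ennreal assume "0 < e"
 then obtain e' where e': "0 < e'" "e' < e" "e' < infinity" by (metis dense ennreal_add_eq_top ennreal_less_top order_less_trans min_less_iff_conj infinity_ennreal_def top.not_eq_extremum)
 define ep where "ep = enn2real e'"
 have ep: "0 < ep" "ennreal ep < e" using e' by (auto simp: ep_def enn2real_positive_iff)
 define c where "c = (2 powr (p - 1)) * (2 powr (p - 1))"
 have c: "0 < c" by (simp add: c_def)
 have int: "integrable lborel f"
 proof -
  have "(%x. indicator {a<..<b} x *\<^sub>R f x) = f" using supp by (auto split: split_indicator)
  then show ?thesis using powint_integrable(1)[OF p _ fin] by (simp add: set_integrable_def)
 qed
 have intp: "integrable lborel (%x. abs(f x) powr p)"
 proof -
  have "(%x. indicator {a<..<b} x *\<^sub>R (abs(f x) powr p)) = (%x. abs(f x) powr p)" using supp by (auto split: split_indicator)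
  then show ?thesis using powint_integrable(2)[OF p _ fin] by (simp add: set_integrable_def)
 qed
 define g where "g K x = (if abs(f x) <= real K then f x else 0)" for K x
 have [measurable]: "g K : Borel" for K unfolding g_def by measurable
 have gint: "integrable lborel (g K)" for K
  by (rule Bochner_Integration.integrable_bound[OF int]) (auto simp: g_def)
 have "(%K. \<integral>x. abs(f x - g K x) powr p \<partial>lborel) ----> integral\<^sup>L lborel (%x::real. 0::real)"
 proof (rule integral_dominated_convergence[OF _ _ intp])
  show "AE x in lborel. (%K. abs(f x - g K x) powr p) ----> 0"
  proof (rule AE_I2)
   fix x
   obtain K0 :: nat where "abs(f x) <= real K0" using real_arch_simple by blast
   then have "eventually (%K. abs(f x - g K x) powr p = 0) sequentially"
   by (intro eventually_sequentiallyI[of K0]) (auto simp: g_def)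
   then show "(%K. abs(f x - g K x) powr p) ----> 0" by (rule tendsto_eventually)
  qed
  show "AE x in lborel. norm (abs(f x - g K x) powr p) <= abs(f x) powr p" for K by (auto simp: g_def)
 qed auto
 then obtain K where K: "(\<integral>x. abs(f x - g K x) powr p \<partial>lborel) < ep / (4 * c)"
  using LIMSEQ_D[of "%K. \<integral>x. abs(f x - g K x) powr p \<partial>lborel" 0 "ep / (4 * c)"] ep c by force
 have Kint: "integrable lborel (%x. abs(f x - g K x) powr p)"
  by (rule Bochner_Integration.integrable_bound[OF intp]) (auto simp: g_def)
 have fg: "powint p UNIV (%x. f x - g K x) <= ennreal (ep / (4 * c))"
  using K Kint by (simp add: powint_def nn_integral_eq_integral ennreal_leI)
 define B where "B = (2 * real K + 1) powr (p - 1)"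
 have B: "0 < B" by (simp add: B_def)
 have "eventually (%n. (\<integral>x. abs(g K (x + h n) - g K x) \<partial>lborel) < ep / (4 * c * B)) sequentially"
  using order_tendstoD(2)[OF translation_continuous_L1[OF gint h], of "ep / (4 * c * B)" K] ep c B by auto
 then show "eventually (%n. powint p UNIV (%x. f (x + h n) - f x) < e) sequentially"
 proof eventually_elim
  case (elim n)
  note gi = gint[of K] integrable_shift[OF gint[of K], of "h n"]
  have pw: "abs(g K (x + h n) - g K x) powr p <= B * abs(g K (x + h n) - g K x)" for x
  proof -
   define d where "d = abs(g K (x + h n) - g K x)"
   have d: "0 <= d" "d <= 2 * real K + 1" by (auto simp: d_def g_def)
   have "d powr p = d powr (p - 1) * d" using d by (simp add: powr_mult_base mult.commute)
   also have "... <= B * d" using d p unfolding B_def by (intro mult_right_mono powr_mono2) auto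
   finally show ?thesis by (simp add: d_def)
  qed
  have "powint p UNIV (%x. g K (x + h n) - g K x) <= (\<integral>\<^sup>+x. ennreal (B * abs(g K (x + h n) - g K x)) \<partial>lborel)"
   unfolding powint_def using pw by (intro nn_integral_mono) (auto intro!: ennreal_leI)
  also have "... = ennreal (\<integral>x. B * abs(g K (x + h n) - g K x) \<partial>lborel)"
   using gi B by (intro nn_integral_eq_integral) auto
  also have "... <= ennreal (ep / (4 * c))"
   using elim B c by (intro ennreal_leI) (simp add: field_simps)
  finally have 1: "powint p UNIV (%x. g K (x + h n) - g K x) <= ennreal (ep / (4 * c))" .
  have "powint p UNIV (%x. f (x + h n) - g K (x + h n)) = powint p UNIV (%x. f x - g K x)"
   unfolding powint_def by (simp, rule nn_integral_shift[of "%x. ennreal (abs(f x - g K x) powr p)"]) measurable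
  then have 2: "powint p UNIV (%x. f (x + h n) - g K (x + h n)) <= ennreal (ep / (4 * c))" using fg by simp
  have c1: "1 <= 2 powr (p - 1)" using p by (simp add: ge_one_powr_ge_zero)
  have "powint p UNIV (%x. f (x + h n) - f x) = powint p UNIV (%x. (f (x + h n) - g K (x + h n)) + ((g K (x + h n) - g K x) - (f x - g K x)))"
   by (simp add: algebra_simps)
  also have "... <= ennreal (2 powr (p - 1)) * (powint p UNIV (%x. f (x + h n) - g K (x + h n)) + powint p UNIV (%x. (g K (x + h n) - g K x) - (f x - g K x)))"
   by (rule powint_add[OF p]) measurable
  also have "... <= ennreal (2 powr (p - 1)) * (ennreal (ep / (4 * c)) + ennreal (2 powr (p - 1)) * (ennreal (ep / (4 * c)) + ennreal (ep / (4 * c))))"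
  proof (intro mult_left_mono add_mono 2)
   have "powint p UNIV (%x. (g K (x + h n) - g K x) - (f x - g K x)) <= ennreal (2 powr (p - 1)) * (powint p UNIV (%x. g K (x + h n) - g K x) + powint p UNIV (%x. f x - g K x))"
   by (rule powint_diff[OF p]) measurable
   also have "... <= ennreal (2 powr (p - 1)) * (ennreal (ep / (4 * c)) + ennreal (ep / (4 * c)))"
   by (intro mult_left_mono add_mono 1 fg) auto
   finally show "powint p UNIV (%x. (g K (x + h n) - g K x) - (f x - g K x)) <= ennreal (2 powr (p - 1)) * (ennreal (ep / (4 * c)) + ennreal (ep / (4 * c)))" .
  qed auto
  also have "... = ennreal (2 powr (p - 1) * (ep / (4 * c) + 2 powr (p - 1) * (ep / (4 * c) + ep / (4 * c))))"
  proof -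
   have k: "ennreal k * (ennreal d + ennreal k * (ennreal d + ennreal d)) = ennreal (k * (d + k * (d + d)))"
   if "0 <= k" "0 <= d" for k d
   using that by (simp only: ennreal_plus[symmetric] ennreal_mult[symmetric] mult_nonneg_nonneg add_nonneg_nonneg)
   show ?thesis by (rule k) (use ep c in auto)
  qed
  also have "... <= ennreal ep"
  proof (rule ennreal_leI)
   have "2 powr (p - 1) * (ep / (4 * c)) <= c * (ep / (4 * c))"
   using c1 ep c by (intro mult_right_mono) (auto simp: c_def mult_le_cancel_left1)
   then have "2 powr (p - 1) * (ep / (4 * c) + 2 powr (p - 1) * (ep / (4 * c) + ep / (4 * c))) <= c * (ep / (4 * c)) + c * (ep / (4 * c) + ep / (4 * c))"
   by (simp add: distrib_left c_def mult.assoc)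
   also have "... <= ep" using c ep by (simp add: field_simps)
   finally show "2 powr (p - 1) * (ep / (4 * c) + 2 powr (p - 1) * (ep / (4 * c) + ep / (4 * c))) <= ep" .
  qed
  also have "... < e" by (rule ep)
  finally show ?case .
 qed
qed simp

lemma translation_continuous_Lp_at:
 fixes f :: "real => real"
 assumes "1 <= p" "f : Borel"
  and "!!x. x ~: {a<..<b} ==> f x = 0" "powint p {a<..<b} f < infinity"
 shows "((%h. powint p UNIV (%x. f (x + h) - f x)) ---> 0) (at 0 within S)"
 unfolding tendsto_at_iff_sequentially comp_def
 using translation_continuous_Lp[OF assms] by blast

text \<open>Steklov means: the average of \<open>f\<close> over \<open>(s, s + h)\<close>.\<close>

definition steklov :: "real => (real => real) => real => real" where
 "steklov h f s = (1 / h) * (\<integral>u. indicator {0<..<h} u * f (s + u) \<partial>lborel)"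

lemma steklov_tendsto_Lp:
 fixes f :: "real => real"
 assumes p: "1 <= p" and [measurable]: "f : Borel"
  and supp: "!!x. x ~: {a<..<b} ==> f x = 0" and fin: "powint p {a<..<b} f < infinity"
 shows "((%h. powint p UNIV (%s. steklov h f s - f s)) ---> 0) (at_right 0)"
proof (rule order_tendstoI)
 fix e :: ennreal assume e: "0 < e"
 obtain e' where e': "0 < e'" "e' < e" using dense[OF e] by blast
 define ph where "ph u = powint p UNIV (%s. f (s + u) - f s)" for u
 have "((%u. ph u) ---> 0) (at_right 0)"
  unfolding ph_def by (rule translation_continuous_Lp_at[OF p _ supp fin]) simp_all
 from order_tendstoD(2)[OF this e'(1)] obtain dl where dl: "0 < dl" "!!u. 0 < u ==> u < dl ==> ph u < e'"
  unfolding eventually_at_right_field by blast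
 have int: "integrable lborel f"
 proof -
  have "(%x. indicator {a<..<b} x *\<^sub>R f x) = f" using supp by (auto split: split_indicator)
  then show ?thesis using powint_integrable(1)[OF p _ fin] by (simp add: set_integrable_def)
 qed
 have "powint p UNIV (%s. steklov h f s - f s) <= e'" if h: "0 < h" "h < dl" for h
 proof -
  define M where "M = density lborel (%u::real. ennreal (1 / h * indicator {0<..<h} u))"
  have [measurable_cong, simp]: "sets M = sets borel" by (simp add: M_def)
  have mass: "emeasure M (space M) = 1"
  proof -
   have "emeasure M (space M) = (\<integral>\<^sup>+u. ennreal (1 / h) * indicator {0<..<h} u \<partial>lborel)"
   unfolding M_def by (subst emeasure_density) (auto intro!: nn_integral_cong split: split_indicator)
   also have "... = 1" using h by (subst nn_integral_cmult_indicator) (auto simp: ennreal_mult[symmetric])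
   finally show ?thesis .
  qed
  then interpret M: finite_measure M by (intro finite_measureI) simp
  have mass1: "measure M (space M) = 1" using mass by (simp add: measure_def)
  interpret pair_sigma_finite lborel M by unfold_locales
  have Mint: "(\<integral>u. g u \<partial>M) = (\<integral>u. 1 / h * indicator {0<..<h} u * g u \<partial>lborel)" if [measurable]: "g : Borel" for g :: "real => real"
   unfolding M_def using h by (subst integral_density) auto
  have "steklov h f s - f s = (\<integral>u. f (s + u) - f s \<partial>M)" for s
  proof -
   have i: "integrable lborel (%u. f (s + u))" using integrable_shift[OF int, of s] by (simp add: add.commute)
   have "integrable lborel (%u. 1 / h * indicator {0<..<h} u * f (s + u))"
   by (rule Bochner_Integration.integrable_bound[of _ "%u. 1 / h * f (s + u)"]) (use i h in \<open>auto split: split_indicator\<close>)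
   then have Mi: "integrable M (%u. f (s + u))"
   unfolding M_def using h by (subst integrable_density) auto
   have "(\<integral>u. f (s + u) - f s \<partial>M) = (\<integral>u. f (s + u) \<partial>M) - f s"
   using Mi by (simp add: mass1)
   also have "(\<integral>u. f (s + u) \<partial>M) = steklov h f s"
   by (subst Mint) (auto simp: steklov_def mult.assoc)
   finally show ?thesis by simp
  qed
  then have "powint p UNIV (%s. steklov h f s - f s) = (\<integral>\<^sup>+s. ennreal (abs(\<integral>u. f (s + u) - f s \<partial>M) powr p) \<partial>lborel)"
   by (simp add: powint_def)
  also have "... <= (\<integral>\<^sup>+s. (\<integral>\<^sup>+u. ennreal (abs(f (s + u) - f s) powr p) \<partial>M) \<partial>lborel)"
   using M.Jensen_powr[OF p, of "%u. f (_ + u) - f _"] by (intro nn_integral_mono) (auto simp: mass1)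
  also have "... = (\<integral>\<^sup>+u. ph u \<partial>M)"
   unfolding ph_def powint_def by (subst Fubini'[symmetric]) auto
  also have "... <= (\<integral>\<^sup>+u. e' \<partial>M)"
  proof (rule nn_integral_mono_AE)
   have "AE u in M. u : {0<..<h}"
   unfolding M_def by (subst AE_density) (auto split: split_indicator)
   then show "AE u in M. ph u <= e'" by eventually_elim (use dl(2) h in \<open>auto intro: less_imp_le\<close>)
  qed
  also have "... = e'" by (simp add: mass)
  finally show ?thesis .
 qed
 then have "powint p UNIV (%s. steklov h f s - f s) < e" if "0 < h" "h < dl" for h
  using that e'(2) by (meson le_less_trans)
 then show "eventually (%h. powint p UNIV (%s. steklov h f s - f s) < e) (at_right 0)"
  unfolding eventually_at_right_field using dl(1) by blast
qed simp

section \<open>Primitives of integrable functions\<close>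

definition ivl :: "real => real => (real => real) => real" where
 "ivl a b f = (\<integral>t. indicator {a..b} t * f t \<partial>lborel)"

lemma set_integrable_real: "set_integrable M A (f :: _ => real) <=> integrable M (%t. indicator A t * f t)"
 by (simp add: set_integrable_def)
lemma ivl_HK:
 assumes "L1_on {a..b} f"
 shows "ivl a b f = integral {a..b} f" "f integrable_on {a..b}"
 using set_borel_integral_eq_integral[OF assms] by (auto simp: ivl_def set_lebesgue_integral_def)

lemma set_integrable_subinterval:
 fixes f :: "real => real"
 assumes "L1_on {a..b} f" "a <= c" "d <= b"
 shows "L1_on {c..d} f"
 by (rule set_integrable_subset[OF assms(1)]) (use assms in auto)
lemma ivl_combine:
 assumes "L1_on {a..b} f" "a <= c" "c <= b"
 shows "ivl a b f = ivl a c f + ivl c b f"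
 using Henstock_Kurzweil_Integration.integral_combine[OF assms(2,3) ivl_HK(2)[OF assms(1)]]
  ivl_HK(1)[OF assms(1)] ivl_HK(1)[OF set_integrable_subinterval[OF assms(1), of a c]]
  ivl_HK(1)[OF set_integrable_subinterval[OF assms(1), of c b]] assms by simp

lemma ivl_refl: "ivl a a f = 0"
proof -
 have "(%t. indicator {a..a} t * f t) = (%t. f a * indicator {a} t)" by (auto split: split_indicator)
 then show ?thesis by (simp add: ivl_def)
qed

lemma continuous_on_ivl:
 assumes "L1_on {a..b} f"
 shows "continuous_on {a..b} (%x. ivl a x f)"
proof -
 have "continuous_on {a..b} (%x. integral {a..x} f)"
  by (rule indefinite_integral_continuous_1[OF ivl_HK(2)[OF assms]])
 then show ?thesis
  by (rule continuous_on_cong[THEN iffD1, rotated -1])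
   (auto intro!: ivl_HK(1)[symmetric] set_integrable_subinterval[OF assms])
qed

lemma continuous_on_primitive:
 assumes "L1_on {a..b} g" "!!x. x : {a..b} ==> P x = c + ivl a x g"
 shows "continuous_on {a..b} P"
proof -
 have "continuous_on {a..b} (%x. c + ivl a x g)" by (intro continuous_intros continuous_on_ivl assms(1))
 then show ?thesis by (rule continuous_on_eq) (simp add: assms(2))
qed

lemma ivl_cong_AE:
 assumes "AE t\<in>{a<..<b} in lborel. f t = g t"
  "f : Borel" "g : Borel"
 shows "ivl a b f = ivl a b g"
proof -
 have "AE t in lborel. indicator {a..b} t * f t = indicator {a..b} t * g t"
  using assms(1) AE_neq[of a] AE_neq[of b]
  by eventually_elim (auto split: split_indicator)
 then show ?thesis unfolding ivl_def using assms(2,3) by (intro integral_cong_AE) simp_all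
qed

lemma set_integrable_cong_Ioo:
 assumes "f : Borel"
 shows "L1_on {a<..<b} f <=> L1_on {a..b} (f :: real => real)"
proof -
 have "AE t in lborel. indicator {a<..<b} t * f t = indicator {a..b} t * f t"
  using AE_neq[of a] AE_neq[of b]
  by eventually_elim (auto split: split_indicator)
 then show ?thesis unfolding set_integrable_real using assms by (intro integrable_cong_AE) simp_all
qed

lemma ivl_add: "L1_on {a..b} f ==> L1_on {a..b} g ==> ivl a b (%t. f t + g t) = ivl a b f + ivl a b g"
 and ivl_diff: "L1_on {a..b} f ==> L1_on {a..b} g ==> ivl a b (%t. f t - g t) = ivl a b f - ivl a b g"
 by (auto simp: ivl_def set_integrable_real algebra_simps)
lemma ivl_cong: "(!!t. t : {a..b} ==> f t = g t) ==> ivl a b f = ivl a b g"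
 unfolding ivl_def by (intro integral_cong_all) (auto split: split_indicator)

lemma ivl_cmult: "ivl a b (%t. c * f t) = c * ivl a b f"
 by (simp add: ivl_def mult.left_commute)
lemma ivl_const: "a <= b ==> ivl a b (%t. c) = c * (b - a)"
 by (simp add: ivl_def)
lemma set_integrable_const_Icc: "L1_on {a..b :: real} (%t. c :: real)"
 by (intro borel_integrable_atLeastAtMost' continuous_intros)
lemma ivl_mono: "L1_on {a..b} f ==> L1_on {a..b} g ==> (!!t. t : {a..b} ==> f t <= g t) ==> ivl a b f <= ivl a b g"
 unfolding ivl_def set_integrable_real by (intro integral_mono) (auto split: split_indicator)

lemma ivl_abs_le: "abs(ivl a b f) <= ivl a b (%t. abs(f t))"
proof -
 have "abs(ivl a b f) <= (\<integral>t. abs(indicator {a..b} t * f t) \<partial>lborel)"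
  unfolding ivl_def using integral_norm_bound[of lborel "%t. indicator {a..b} t * f t"] by simp
 then show ?thesis by (simp add: ivl_def abs_mult)
qed

lemma ivl_shift: "ivl a b (%t. f (t + h)) = ivl (a + h) (b + h) f"
proof -
 have "ivl a b (%t. f (t + h)) = (\<integral>t. (%s. indicator {a + h..b + h} s * f s) (t + h) \<partial>lborel)"
  unfolding ivl_def by (intro integral_cong_all) (auto split: split_indicator)
 also have "... = ivl (a + h) (b + h) f" unfolding ivl_def by (rule integral_shift)
 finally show ?thesis .
qed

lemma set_integrable_shift:
 fixes f :: "real => real"
 assumes "L1_on {a + h..b + h} f"
 shows "L1_on {a..b} (%t. f (t + h))"
proof -
 have "(%t. indicator {a..b} t * f (t + h)) = (%t. (%s. indicator {a + h..b + h} s * f s) (t + h))"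
  by (auto split: split_indicator)
 then show ?thesis using integrable_shift[OF assms[unfolded set_integrable_real], of h]
  by (simp add: set_integrable_real)
qed

lemma ivl_FTC:
 assumes "a <= b" "!!x. a <= x ==> x <= b ==> (F has_real_derivative f x) (at x)" "continuous_on {a..b} f"
 shows "ivl a b f = F b - F a"
 using integral_FTC_atLeastAtMost[of a b F f] assms
 by (auto simp: ivl_def has_real_derivative_iff_has_vector_derivative[symmetric] intro: has_field_derivative_at_within)
lemma (in pair_sigma_finite) integrable_kernel_product:
 fixes H :: "'a => real" and G :: "'b => real"
 assumes H: "integrable M1 H" and G: "integrable M2 G"
  and [measurable]: "case_prod k : borel_measurable (M1 \<Otimes>\<^sub>M M2)" and k: "!!s t. abs(k s t) <= 1"
 shows "integrable (M1 \<Otimes>\<^sub>M M2) (%(s, t). k s t * (H s * G t))"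
proof (rule integrableI_bounded)
 have [measurable]: "H : borel_measurable M1" "G : borel_measurable M2" using H G by auto
 show "(%(s, t). k s t * (H s * G t)) : borel_measurable (M1 \<Otimes>\<^sub>M M2)" by measurable
 have "(\<integral>\<^sup>+x. ennreal (norm (case x of (s, t) => k s t * (H s * G t))) \<partial>(M1 \<Otimes>\<^sub>M M2))
   <= (\<integral>\<^sup>+x. ennreal (abs(H (fst x))) * ennreal (abs(G (snd x))) \<partial>(M1 \<Otimes>\<^sub>M M2))"
 proof (intro nn_integral_mono)
  fix x :: "'a \<times> 'b"
  have "abs(k (fst x) (snd x)) * (abs(H (fst x)) * abs(G (snd x))) <= 1 * (abs(H (fst x)) * abs(G (snd x)))"
   by (intro mult_right_mono k) auto
  then show "ennreal (norm (case x of (s, t) => k s t * (H s * G t))) <= ennreal (abs(H (fst x))) * ennreal (abs(G (snd x)))"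
   by (auto simp: split_beta abs_mult ennreal_mult[symmetric] intro!: ennreal_leI)
 qed
 also have "... = (\<integral>\<^sup>+s. (\<integral>\<^sup>+t. ennreal (abs(H s)) * ennreal (abs(G t)) \<partial>M2) \<partial>M1)"
  by (subst M2.nn_integral_fst[symmetric]) auto
 also have "... = (\<integral>\<^sup>+s. ennreal (abs(H s)) \<partial>M1) * (\<integral>\<^sup>+t. ennreal (abs(G t)) \<partial>M2)"
  by (simp add: nn_integral_cmult nn_integral_multc)
 also have "... < infinity"
  using H G by (auto simp: integrable_iff_bounded ennreal_mult_less_top)
 finally show "(\<integral>\<^sup>+x. ennreal (norm (case x of (s, t) => k s t * (H s * G t))) \<partial>(M1 \<Otimes>\<^sub>M M2)) < infinity" .
qed

text \<open>
  The product rule for primitives of merely integrable functions is Fubini's theorem on a triangle.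
\<close>

lemma ivl_swap:
 assumes H: "L1_on {a..b} H" and G: "L1_on {a..b} G"
 shows "ivl a b (%s. H s * ivl a s G) = ivl a b (%t. G t * ivl t b H)"
proof -
 define H' where "H' s = indicator {a..b} s * H s" for s
 define G' where "G' s = indicator {a..b} s * G s" for s
 have HG: "integrable lborel H'" "integrable lborel G'"
  using H G by (simp_all add: H'_def[abs_def] G'_def[abs_def] set_integrable_real)
 define k :: "real => real => real" where "k s t = (if t <= s then 1 else 0)" for s t
 have "integrable (lborel \<Otimes>\<^sub>M lborel) (%(s, t). k s t * (H' s * G' t))"
  by (rule lborel_pair.integrable_kernel_product[OF HG]) (auto simp: k_def split_beta)
 from lborel_pair.Fubini_integral[OF this]
 have "(\<integral>t. (\<integral>s. k s t * (H' s * G' t) \<partial>lborel) \<partial>lborel) = (\<integral>s. (\<integral>t. k s t * (H' s * G' t) \<partial>lborel) \<partial>lborel)" .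
 moreover have "(\<integral>s. k s t * (H' s * G' t) \<partial>lborel) = indicator {a..b} t * (G t * ivl t b H)" for t
 proof -
  have "(\<integral>s. k s t * (H' s * G' t) \<partial>lborel) = (\<integral>s. G' t * (indicator {t..b} s * H s) \<partial>lborel)"
   by (intro integral_cong_all) (auto simp: k_def H'_def G'_def split: split_indicator)
  then show ?thesis by (simp add: ivl_def G'_def)
 qed
 moreover have "(\<integral>t. k s t * (H' s * G' t) \<partial>lborel) = indicator {a..b} s * (H s * ivl a s G)" for s
 proof -
  have "(\<integral>t. k s t * (H' s * G' t) \<partial>lborel) = (\<integral>t. H' s * (indicator {a..s} t * G t) \<partial>lborel)"
   by (intro integral_cong_all) (auto simp: k_def H'_def G'_def split: split_indicator)
  then show ?thesis by (simp add: ivl_def H'_def)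
 qed
 ultimately show ?thesis by (simp add: ivl_def)
qed

lemma continuous_on_Icc_bounded:
 fixes Q :: "real => real"
 assumes "continuous_on {a..b} Q"
 obtains B where "!!t. t : {a..b} ==> abs(Q t) <= B"
proof -
 have "bounded (Q ` {a..b})" by (intro compact_imp_bounded compact_continuous_image assms compact_Icc)
 then obtain B where "\<forall>x\<in>Q ` {a..b}. norm x <= B" unfolding bounded_iff by blast
 then show thesis by (intro that[of B]) auto
qed

lemma set_integrable_mult_continuous:
 fixes G Q :: "real => real"
 assumes G: "L1_on {a..b} G" and Q: "continuous_on {a..b} Q"
 shows "L1_on {a..b} (%t. G t * Q t)"
proof -
 obtain B where B: "!!t. t : {a..b} ==> abs(Q t) <= B"
  using continuous_on_Icc_bounded[OF Q] by blast
 have m: "(%t. indicator {a..b} t *\<^sub>R Q t) : Borel"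
  using borel_measurable_continuous_on_indicator[OF _ Q] by simp
 have "(%t. indicator {a..b} t * (G t * Q t)) = (%t. (indicator {a..b} t * G t) * (indicator {a..b} t *\<^sub>R Q t))"
  by (auto split: split_indicator)
 moreover have "integrable lborel (%t. (indicator {a..b} t * G t) * (indicator {a..b} t *\<^sub>R Q t))"
 proof (rule Bochner_Integration.integrable_bound[of _ "%t. B * (indicator {a..b} t * G t)"])
  show "integrable lborel (%t. B * (indicator {a..b} t * G t))" using G by (simp add: set_integrable_real)
  show "(%t. indicator {a..b} t * G t * (indicator {a..b} t *\<^sub>R Q t)) : borel_measurable lborel"
   by (rule borel_measurable_times[OF borel_measurable_integrable[OF G[unfolded set_integrable_real]]]) (use m in simp)
  show "AE t in lborel. norm (indicator {a..b} t * G t * (indicator {a..b} t *\<^sub>R Q t)) <= norm (B * (indicator {a..b} t * G t))"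
  proof (rule AE_I2)
   fix t
   show "norm (indicator {a..b} t * G t * (indicator {a..b} t *\<^sub>R Q t)) <= norm (B * (indicator {a..b} t * G t))"
   proof (cases "t : {a..b}")
   case True
   have "abs(G t) * abs(Q t) <= abs(G t) * abs(B)" using B[OF True] by (intro mult_left_mono) auto
   then show ?thesis using True by (simp add: abs_mult mult.commute)
   qed simp
  qed
 qed
 ultimately show ?thesis by (simp add: set_integrable_real)
qed

lemma ivl_product_rule:
 assumes ab: "a <= b" and G: "L1_on {a..b} G" and H: "L1_on {a..b} H"
  and P: "!!x. x : {a..b} ==> P x = P a + ivl a x G" and Q: "!!x. x : {a..b} ==> Q x = Q a + ivl a x H"
 shows "L1_on {a..b} (%x. G x * Q x + P x * H x)"
  "P b * Q b - P a * Q a = ivl a b (%x. G x * Q x + P x * H x)"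
proof -
 note contP = continuous_on_primitive[OF G P] and contQ = continuous_on_primitive[OF H Q]
 note GQ = set_integrable_mult_continuous[OF G contQ]
 have HP: "L1_on {a..b} (%x. P x * H x)"
  using set_integrable_mult_continuous[OF H contP] by (simp add: mult.commute)
 show "L1_on {a..b} (%x. G x * Q x + P x * H x)" by (rule set_integral_add(1)[OF GQ HP])
 have cH: "continuous_on {a..b} (%t. ivl t b H)" and cG: "continuous_on {a..b} (%t. ivl a t G)"
 proof -
  have eq: "ivl a b H - ivl a t H = ivl t b H" if "t : {a..b}" for t using ivl_combine[OF H, of t] that by auto
  have "continuous_on {a..b} (%t. ivl a b H - ivl a t H)" by (intro continuous_intros continuous_on_ivl H)
  then show "continuous_on {a..b} (%t. ivl t b H)" by (rule continuous_on_eq) (rule eq)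
 qed (rule continuous_on_ivl[OF G])
 note i1 = set_integrable_mult_continuous[OF G cH] and i2 = set_integrable_mult_continuous[OF H cG]
 have "ivl a b (%x. P x * H x) = ivl a b (%x. P a * H x + H x * ivl a x G)"
 proof (rule ivl_cong)
  fix x assume x: "x : {a..b}"
  show "P x * H x = P a * H x + H x * ivl a x G" by (subst P[OF x]) (simp add: algebra_simps)
 qed
 also have "... = P a * ivl a b H + ivl a b (%x. H x * ivl a x G)"
  using ivl_add[OF set_integrable_mult_right[OF H, of "P a"] i2] by (simp only: ivl_cmult)
 finally have 1: "ivl a b (%x. P x * H x) = P a * ivl a b H + ivl a b (%x. H x * ivl a x G)" .
 have "ivl a b (%x. G x * Q x) = ivl a b (%x. Q b * G x - G x * ivl x b H)"
 proof (rule ivl_cong)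
  fix x assume x: "x : {a..b}"
  have eq: "Q x = Q b - ivl x b H" using Q[OF x] Q[of b] ivl_combine[OF H, of x] x ab by auto
  show "G x * Q x = Q b * G x - G x * ivl x b H" by (subst eq) (simp add: algebra_simps)
 qed
 also have "... = Q b * ivl a b G - ivl a b (%x. G x * ivl x b H)"
  using ivl_diff[OF set_integrable_mult_right[OF G, of "Q b"] i1] by (simp only: ivl_cmult)
 finally have 2: "ivl a b (%x. G x * Q x) = Q b * ivl a b G - ivl a b (%x. G x * ivl x b H)" .
 have "ivl a b (%x. G x * Q x + P x * H x) = P a * ivl a b H + Q b * ivl a b G"
  using 1 2 ivl_swap[OF H G] ivl_add[OF GQ HP] by linarith
 also have "... = P b * Q b - P a * Q a"
  using P[of b] Q[of b] ab by (simp add: algebra_simps)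
 finally show "P b * Q b - P a * Q a = ivl a b (%x. G x * Q x + P x * H x)" by simp
qed

text \<open>The chain rule is needed for the exponential only, where the power series reduces it to the product rule.\<close>

lemma ivl_exp_rule:
 assumes ab: "a <= b" and ka: "L1_on {a..b} ka"
 shows "exp (ivl a b ka) = 1 + ivl a b (%x. ka x * exp (ivl a x ka))"
proof -
 define ks where "ks x = ivl a x ka" for x
 have cont: "continuous_on {a..b} ks" unfolding ks_def by (rule continuous_on_ivl[OF ka])
 have pow: "ks x ^ Suc n = ivl a x (%y. ka y * (real (Suc n) * ks y ^ n))" if "x : {a..b}" for x n
  using that
 proof (induction n arbitrary: x)
  case 0
  then show ?case by (simp add: ks_def)
 next
  case (Suc n)
  have kax: "L1_on {a..x} ka" using Suc.prems by (intro set_integrable_subinterval[OF ka]) auto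
  have cx: "continuous_on {a..x} (%y. real (Suc n) * ks y ^ n)" 
   using Suc.prems by (intro continuous_intros continuous_on_subset[OF cont]) auto
  have "ks x * ks x ^ Suc n - ks a * ks a ^ Suc n = ivl a x (%y. ka y * ks y ^ Suc n + ks y * (ka y * (real (Suc n) * ks y ^ n)))"
  proof (rule ivl_product_rule(2))
   show "L1_on {a..x} (%y. ka y * (real (Suc n) * ks y ^ n))"
   by (rule set_integrable_mult_continuous[OF kax cx])
   show "ks y ^ Suc n = ks a ^ Suc n + ivl a y (%y. ka y * (real (Suc n) * ks y ^ n))" if "y : {a..x}" for y
   using Suc.IH[of y] that Suc.prems by (simp add: ks_def ivl_refl)
   show "ks y = ks a + ivl a y ka" for y by (simp add: ks_def ivl_refl)
  qed (use Suc.prems kax in auto)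
  moreover have "ka y * ks y ^ Suc n + ks y * (ka y * (real (Suc n) * ks y ^ n)) = ka y * (real (Suc (Suc n)) * ks y ^ Suc n)" for y
   by (simp add: algebra_simps)
  ultimately show ?case by (simp add: ks_def ivl_refl)
 qed
 obtain B where B: "!!t. t : {a..b} ==> abs(ks t) <= B"
  using continuous_on_Icc_bounded[OF cont] by blast
 define s where "s N x = (\<Sum>n<N. ks x ^ n / fact n)" for N x
 have cs: "continuous_on {a..b} (s N)" for N unfolding s_def by (intro continuous_intros cont) auto
 have part: "s (Suc N) b = 1 + ivl a b (%x. ka x * s N x)" for N
 proof (induction N)
  case 0
  then show ?case by (simp add: s_def ivl_def)
 next
  case (Suc N)
  have c: "continuous_on {a..b} (%x. ks x ^ N / fact N)" by (intro continuous_intros cont) auto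
  have "ivl a b (%x. ka x * s (Suc N) x) = ivl a b (%x. ka x * s N x + ka x * (ks x ^ N / fact N))"
   by (simp add: s_def algebra_simps)
  also have "... = ivl a b (%x. ka x * s N x) + ivl a b (%x. ka x * (ks x ^ N / fact N))"
   by (intro ivl_add set_integrable_mult_continuous ka cs c)
  also have "(%x. ka x * (ks x ^ N / fact N)) = (%x. (1 / fact (Suc N)) * (ka x * (real (Suc N) * ks x ^ N)))"
   by (simp add: field_simps del: of_nat_Suc)
  also have "ivl a b ... = (1 / fact (Suc N)) * ks b ^ Suc N"
   unfolding ivl_cmult using pow[of b N] ab by simp
  finally show ?case using Suc by (simp add: s_def)
 qed
 have lim: "(%N. s N x) ----> exp (ks x)" for x
  using exp_converges[of "ks x"] by (simp add: sums_def s_def divide_inverse mult.commute)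
 have "(%N. ivl a b (%x. ka x * s N x)) ----> ivl a b (%x. ka x * exp (ks x))"
  unfolding ivl_def
 proof (rule integral_dominated_convergence[where w="%x. exp (abs(B)) * abs(indicator {a..b} x * ka x)"])
  show "integrable lborel (%x. exp (abs(B)) * abs(indicator {a..b} x * ka x))" using ka by (simp add: set_integrable_real)
  show "(%x. indicator {a..b} x * (ka x * s N x)) : borel_measurable lborel" for N
   using set_integrable_mult_continuous[OF ka cs, of N] by (auto simp: set_integrable_real)
  have "continuous_on {a..b} (%x. exp (ks x))" by (intro continuous_intros cont)
  from set_integrable_mult_continuous[OF ka this]
  show "(%x. indicator {a..b} x * (ka x * exp (ks x))) : borel_measurable lborel" by (auto simp: set_integrable_real)
  show "AE x in lborel. (%N. indicator {a..b} x * (ka x * s N x)) ----> indicator {a..b} x * (ka x * exp (ks x))"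
   by (intro AE_I2 tendsto_intros lim)
  show "AE x in lborel. norm (indicator {a..b} x * (ka x * s N x)) <= exp (abs(B)) * abs(indicator {a..b} x * ka x)" for N
  proof (rule AE_I2)
   fix x
   show "norm (indicator {a..b} x * (ka x * s N x)) <= exp (abs(B)) * abs(indicator {a..b} x * ka x)"
   proof (cases "x : {a..b}")
   case True
   have "abs(s N x) <= (\<Sum>n<N. abs(ks x ^ n / fact n))" unfolding s_def by (rule sum_abs)
   also have "... <= (\<Sum>n<N. abs(B) ^ n / fact n)"
   using B[OF True] by (intro sum_mono) (auto simp: power_abs intro!: divide_right_mono power_mono)
   also have "... <= exp (abs(B))"
   using exp_converges[of "abs(B)"] sum_le_suminf[of "%n. abs(B) ^ n / fact n" "{..<N}"]
   by (simp add: sums_iff divide_inverse mult.commute)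
   finally have "abs(ka x) * abs(s N x) <= abs(ka x) * exp (abs(B))" by (intro mult_left_mono) auto
   then show ?thesis using True by (simp add: abs_mult mult.commute)
   qed simp
  qed
 qed
 then have "(%N. 1 + ivl a b (%x. ka x * s N x)) ----> 1 + ivl a b (%x. ka x * exp (ks x))" by (intro tendsto_intros)
 moreover have "(%N. 1 + ivl a b (%x. ka x * s N x)) ----> exp (ks b)"
  unfolding part[symmetric] by (rule LIMSEQ_Suc[OF lim])
 ultimately show ?thesis unfolding ks_def by (rule LIMSEQ_unique[symmetric])
qed

lemma AE_eq_0_if_ivl_eq_0:
 assumes int: "L1_on {a..b} f" and [measurable]: "f : Borel"
  and zero: "!!x y. a < x ==> x < y ==> y < b ==> ivl x y f = 0"
 shows "AE x\<in>{a<..<b} in lborel. f x = 0"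
proof -
 define g where "g x = indicator {a<..<b} x * f x" for x
 have gm[measurable]: "g : Borel" unfolding g_def by measurable
 have supp: "!!x. x ~: {a<..<b} ==> g x = 0" by (simp add: g_def)
 have gi: "integrable lborel g"
  using set_integrable_cong_Ioo[of f a b] int by (simp add: g_def[abs_def] set_integrable_real)
 have "powint 1 {a<..<b} g <= (\<integral>\<^sup>+x. ennreal (norm (g x)) \<partial>lborel)"
  unfolding powint_def by (intro nn_integral_mono) (auto split: split_indicator)
 also have "... < infinity" using gi by (simp add: integrable_iff_bounded)
 finally have fin: "powint 1 {a<..<b} g < infinity" .
 have lim: "((%h. powint 1 UNIV (%s. steklov h g s - g s)) ---> 0) (at_right 0)"
  by (rule steklov_tendsto_Lp[OF order_refl gm supp fin])
 have "powint 1 {a<..<b - dl} g = 0" if dl: "0 < dl" for dl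
 proof -
  have "powint 1 {a<..<b - dl} g <= powint 1 UNIV (%s. steklov h g s - g s)" if h: "0 < h" "h < dl" for h
  proof -
   have st: "steklov h g s = 0" if s: "s : {a<..<b - dl}" for s
   proof -
   have "(\<integral>u. indicator {0<..<h} u * g (s + u) \<partial>lborel) = ivl 0 h (%u. f (u + s))"
   proof -
   have "AE u in lborel. indicator {0<..<h} u * g (s + u) = indicator {0..h} u * f (u + s)"
   using AE_neq[of 0] AE_neq[of h]
   by eventually_elim (use s h in \<open>auto simp: g_def add.commute split: split_indicator\<close>)
   then show ?thesis unfolding ivl_def by (intro integral_cong_AE) simp_all
   qed
   also have "... = 0" unfolding ivl_shift using zero[of s "h + s"] s h by simp
   finally show ?thesis by (simp add: steklov_def)
   qed
   have "powint 1 {a<..<b - dl} g = powint 1 {a<..<b - dl} (%s. steklov h g s - g s)"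
   unfolding powint_def using st by (intro nn_integral_cong) (auto split: split_indicator)
   also have "... <= powint 1 UNIV (%s. steklov h g s - g s)" by (rule powint_mono_set) simp
   finally show ?thesis .
  qed
  then have "eventually (%h. powint 1 {a<..<b - dl} g <= powint 1 UNIV (%s. steklov h g s - g s)) (at_right 0)"
   unfolding eventually_at_right_field using dl by blast
  from tendsto_lowerbound[OF lim this] show ?thesis by simp
 qed
 then have "AE x\<in>{a<..<b - 1 / real (Suc n)} in lborel. g x = 0" for n
  by (subst powint_eq_0_iff[symmetric, of g _ 1]) auto
 then have "AE x in lborel. ALL n. x : {a<..<b - 1 / real (Suc n)} --> g x = 0" by (subst AE_all_countable) auto
 then show ?thesis
 proof eventually_elim
  case (elim x)
  show ?case
  proof
   assume x: "x : {a<..<b}"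
   then obtain n where "1 / real (Suc n) < b - x" using nat_approx_posE[of "b - x"] by auto
   then have "x : {a<..<b - 1 / real (Suc n)}" using x by auto
   then have "g x = 0" using elim by blast
   then show "f x = 0" using x by (simp add: g_def)
  qed
 qed
qed

section \<open>Weak derivatives and the fundamental lemma\<close>

text \<open>Trapezoidal approximations of the indicator of \<open>(x, y)\<close>.\<close>

definition trapez :: "real => real => real => real => real" where
 "trapez k x y t = max 0 (min 1 (min (k * (t - x)) (k * (y - t))))"

lemma trapez_props:
 assumes "0 <= k"
 shows "continuous_on S (trapez k x y)" "0 <= trapez k x y t" "trapez k x y t <= 1" "t ~: {x..y} ==> trapez k x y t = 0"
proof -
 show "continuous_on S (trapez k x y)" unfolding trapez_def by (intro continuous_intros)
 assume "t ~: {x..y}"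
 then have "k * (t - x) <= 0 | k * (y - t) <= 0"
  using assms mult_nonneg_nonpos[of k "t - x"] mult_nonneg_nonpos[of k "y - t"] by auto
 then show "trapez k x y t = 0" unfolding trapez_def by linarith
qed (auto simp: trapez_def)

lemma trapez_tendsto: "(%n. trapez (real n) x y t) ----> indicator {x<..<y} t"
proof (cases "t : {x<..<y}")
 case True
 obtain n1 n2 :: nat where n: "1 < real n1 * (t - x)" "1 < real n2 * (y - t)"
  using True reals_Archimedean3[of "t - x"] reals_Archimedean3[of "y - t"] by (meson diff_gt_0_iff_gt greaterThanLessThan_iff)
 have "trapez (real n) x y t = 1" if "n >= max n1 n2" for n
 proof -
  have "real n1 * (t - x) <= real n * (t - x)" "real n2 * (y - t) <= real n * (y - t)"
   using that True by (auto intro!: mult_right_mono)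
  then show ?thesis using n by (simp add: trapez_def)
 qed
 then have "eventually (%n. trapez (real n) x y t = indicator {x<..<y} t) sequentially"
  using True by (intro eventually_sequentiallyI[of "max n1 n2"]) auto
 then show ?thesis by (rule tendsto_eventually)
next
 case False
 have "trapez (real n) x y t = 0" for n
 proof -
  have "real n * (t - x) <= 0 | real n * (y - t) <= 0"
   using False mult_nonneg_nonpos[of "real n" "t - x"] mult_nonneg_nonpos[of "real n" "y - t"] by auto
  then show ?thesis unfolding trapez_def by linarith
 qed
 then show ?thesis using False by simp
qed

lemma test_function_primitive:
 assumes xy: "a < x" "x <= y" "y < b" and q: "continuous_on UNIV q" and supp: "!!t. t ~: {x..y} ==> q t = 0"
  and zero: "ivl x y q = 0"
 shows "EX ps. test_function a b ps q"
proof -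
 define ps where "ps t = integral {a..t} q" for t
 have int: "L1_on {c..d} q" for c d
  by (intro borel_integrable_atLeastAtMost' continuous_on_subset[OF q]) auto
 have out: "ps t = 0" if "t ~: {x..y}" for t
 proof (cases "t < x")
  case True
  have "integral {a..t} q = integral {a..t} (%_. 0)" using True supp by (intro integral_cong) auto
  then show ?thesis by (simp add: ps_def)
 next
  case False
  then have t: "y < t" using that by auto
  have "ivl a t q = ivl a x q + (ivl x y q + ivl y t q)"
   using ivl_combine[OF int, of a x t] ivl_combine[OF int, of x y t] xy t by simp
  moreover have "ivl a x q = 0" "ivl y t q = 0"
  proof -
   have "ivl a x q = ivl a x (%_. 0)" "ivl y t q = ivl y t (%_. 0)"
   using supp q by (intro ivl_cong_AE AE_I2; auto intro!: borel_measurable_continuous_onI)+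
   then show "ivl a x q = 0" "ivl y t q = 0" by (simp_all add: ivl_def)
  qed
  ultimately show ?thesis using zero ivl_HK(1)[OF int] by (simp add: ps_def)
 qed
 have "(ps has_real_derivative q t) (at t)" for t
 proof (cases "t < x")
  case True
  have "(ps has_real_derivative 0) (at t)"
  proof (rule DERIV_cong_ev[THEN iffD2, OF refl _ refl])
   show "\<forall>\<^sub>F s in nhds t. ps s = 0"
   using eventually_nhds_in_open[of "{..<x}" t] True by (auto elim!: eventually_mono intro!: out)
  qed simp
  then show ?thesis using supp[of t] True by simp
 next
  case False
  have "((%x. integral {a..x} q) has_real_derivative q t) (at t within {a..t + 1})"
   using False xy by (intro integral_has_real_derivative continuous_on_subset[OF q]) auto
  moreover have "at t within {a..t + 1} = at t"
   using False xy by (intro at_within_interior) auto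
  ultimately show ?thesis by (simp add: ps_def[abs_def])
 qed
 moreover have "compact {x..y}" "{x..y} \<subseteq> {a<..<b}" using xy by auto
 ultimately have "test_function a b ps q" unfolding test_function_def using q out by blast
 then show ?thesis by blast
qed

lemma test_function_weak_derivative:
 assumes ab: "a < b" and G: "L1_on {a..b} G" and F: "!!x. x : {a..b} ==> F x = c + ivl a x G"
  and test: "test_function a b ps ps'"
 shows "ivl a b (%x. ps' x * F x) = - ivl a b (%x. ps x * G x)"
proof -
 have d: "!!x. (ps has_real_derivative ps' x) (at x)" and c': "continuous_on UNIV ps'"
  using test by (auto simp: test_function_def)
 have z: "ps a = 0" "ps b = 0" using test by (auto simp: test_function_def)
 have psint: "L1_on {a..b} ps'"
  by (intro borel_integrable_atLeastAtMost' continuous_on_subset[OF c']) auto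
 have prod: "F b * ps b - F a * ps a = ivl a b (%x. G x * ps x + F x * ps' x)"
 proof (rule ivl_product_rule(2)[OF _ G psint])
  show "F x = F a + ivl a x G" if "x : {a..b}" for x using F[OF that] F[of a] ab by (simp add: ivl_refl)
  show "ps x = ps a + ivl a x ps'" if "x : {a..b}" for x
   using that d by (subst ivl_FTC[of _ _ ps]) (auto intro: continuous_on_subset[OF c'])
 qed (use ab in auto)
 have cps: "continuous_on {a..b} ps" by (intro continuous_at_imp_continuous_on ballI DERIV_isCont[OF d])
 have cF: "continuous_on {a..b} F" by (rule continuous_on_primitive[OF G F])
 have e: "(%x. F x * ps' x) = (%x. ps' x * F x)" "(%x. G x * ps x) = (%x. ps x * G x)"
  by (rule ext, rule mult.commute)+
 have "L1_on {a..b} (%x. F x * ps' x)"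
  unfolding e by (rule set_integrable_mult_continuous[OF psint cF])
 from ivl_add[OF set_integrable_mult_continuous[OF G cps] this] prod z
 have "ivl a b (%x. G x * ps x) + ivl a b (%x. F x * ps' x) = 0" by simp
 then show ?thesis unfolding e by linarith
qed

text \<open>
  The du Bois-Reymond lemma. A function annihilated by all derivatives of test functions is constant: every continuous
  function with compact support becomes such a derivative after subtracting a multiple of a fixed bump.
\<close>

lemma constant_if_annihilates_derivatives:
 assumes ab: "a < b" and h: "L1_on {a..b} h" and [measurable]: "h : Borel"
  and ann: "!!ps ps'. test_function a b ps ps' ==> ivl a b (%x. ps' x * h x) = 0"
 shows "EX c. AE x\<in>{a<..<b} in lborel. h x = c"
proof -
 define x0 where "x0 = (2 * a + b) / 3"
 define y0 where "y0 = (a + 2 * b) / 3"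
 have xy0: "a < x0" "x0 < y0" "y0 < b" using ab by (auto simp: x0_def y0_def field_simps)
 define be where "be = trapez 1 x0 y0"
 have cbe: "continuous_on S be" for S by (simp add: be_def trapez_props)
 have trint: "L1_on {c..d} (trapez (real n) x y)" for c d n x y
  by (intro borel_integrable_atLeastAtMost' trapez_props) simp
 have beint: "L1_on {c..d} be" for c d by (intro borel_integrable_atLeastAtMost' cbe)
 have ext: "ivl a b (%t. q t * g t) = ivl x y (%t. q t * g t)" if "a <= x" "y <= b" "!!t. t ~: {x..y} ==> q t = 0" for q g x y
  unfolding ivl_def using that by (intro integral_cong_all) (auto split: split_indicator)
 define m where "m = ivl a b be"
 have m: "0 < m"
 proof -
  have "m = integral {a..b} be" unfolding m_def by (rule ivl_HK(1)[OF beint])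
  moreover have "integral {a..b} be ~= 0"
  proof
   assume "integral {a..b} be = 0"
   then have "\<forall>t\<in>{a..b}. be t = 0"
   using integral_eq_0_iff[OF cbe, of a b] ab by (auto simp: be_def trapez_props)
   then have "be ((x0 + y0) / 2) = 0" using xy0 by auto
   then show False using xy0 by (auto simp: be_def trapez_def max_def min_def field_simps split: if_splits)
  qed
  moreover have "0 <= integral {a..b} be" by (intro integral_nonneg integrable_continuous_interval cbe) (auto simp: be_def trapez_props)
  ultimately show ?thesis by linarith
 qed
 define c where "c = ivl a b (%t. be t * h t) / m"
 have hc: "L1_on {a..b} (%t. h t - c)"
  by (intro set_integral_diff h set_integrable_const_Icc)
 have "AE x\<in>{a<..<b} in lborel. h x - c = 0"
 proof (rule AE_eq_0_if_ivl_eq_0[OF hc])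
  fix x y assume xy: "a < x" "x < y" "y < b"
  have step: "ivl a b (%t. trapez (real n) x y t * (h t - c)) = 0" for n
  proof -
   define \<zeta> where "\<zeta> = trapez (real n) x y"
   define \<mu> where "\<mu> = ivl a b \<zeta> / m"
   have c\<zeta>: "continuous_on S \<zeta>" for S by (simp add: \<zeta>_def trapez_props)
   have \<zeta>int: "L1_on {c..d} \<zeta>" for c d by (simp add: \<zeta>_def trint)
   define q where "q t = \<zeta> t - \<mu> * be t" for t
   have qs: "q t = 0" if "t ~: {min x x0..max y y0}" for t
   proof -
   have "t ~: {x..y}" "t ~: {x0..y0}" using that by auto
   then show ?thesis using trapez_props(4)[of "real n" t x y] trapez_props(4)[of 1 t x0 y0]
   by (simp add: q_def \<zeta>_def be_def)
   qed
   have "ivl a b q = 0"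
   proof -
   have "ivl a b q = ivl a b \<zeta> - \<mu> * m"
   unfolding q_def m_def using ivl_diff[OF \<zeta>int[of a b] set_integrable_mult_right[OF beint[of a b], of \<mu>]] by (simp only: ivl_cmult)
   then show ?thesis using m by (simp add: \<mu>_def)
   qed
   then have "ivl (min x x0) (max y y0) q = 0"
   using ext[of "min x x0" "max y y0" q "%_. 1"] qs xy xy0 by auto
   moreover have "continuous_on UNIV q" unfolding q_def by (intro continuous_intros c\<zeta> cbe)
   moreover have "a < min x x0" "min x x0 <= max y y0" "max y y0 < b" using xy xy0 by auto
   ultimately obtain ps where "test_function a b ps q"
   using test_function_primitive[of a "min x x0" "max y y0" b q] qs by blast
   then have "0 = ivl a b (%t. q t * h t)" using ann by simp
   also have "... = ivl a b (%t. h t * \<zeta> t - \<mu> * (h t * be t))" by (simp add: q_def algebra_simps)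
   also have "... = ivl a b (%t. h t * \<zeta> t) - \<mu> * ivl a b (%t. h t * be t)"
   using ivl_diff[OF set_integrable_mult_continuous[OF h c\<zeta>] set_integrable_mult_right[OF set_integrable_mult_continuous[OF h cbe], of \<mu>]]
   by (simp only: ivl_cmult)
   also have "\<mu> * ivl a b (%t. h t * be t) = c * ivl a b \<zeta>"
   by (simp add: \<mu>_def c_def mult.commute)
   also have "ivl a b (%t. h t * \<zeta> t) - c * ivl a b \<zeta> = ivl a b (%t. h t * \<zeta> t - c * \<zeta> t)"
   using ivl_diff[OF set_integrable_mult_continuous[OF h c\<zeta>] set_integrable_mult_right[OF \<zeta>int[of a b], of c]]
   by (simp only: ivl_cmult)
   finally show ?thesis by (simp add: \<zeta>_def algebra_simps)
  qed
  have "(%n. ivl a b (%t. trapez (real n) x y t * (h t - c))) ----> ivl a b (%t. indicator {x<..<y} t * (h t - c))"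
   unfolding ivl_def
  proof (rule integral_dominated_convergence[where w="%t. abs(indicator {a..b} t * (h t - c))"])
   show "integrable lborel (%t. abs(indicator {a..b} t * (h t - c)))" using hc unfolding set_integrable_real by simp
   have [measurable]: "trapez (real n) x y : Borel" for n
   by (intro borel_measurable_continuous_onI trapez_props) simp
   show "(%t. indicator {a..b} t * (trapez (real n) x y t * (h t - c))) : borel_measurable lborel" for n by measurable
   show "AE t in lborel. (%n. indicator {a..b} t * (trapez (real n) x y t * (h t - c))) ----> indicator {a..b} t * (indicator {x<..<y} t * (h t - c))"
   by (intro AE_I2 tendsto_intros trapez_tendsto)
   show "AE t in lborel. norm (indicator {a..b} t * (trapez (real n) x y t * (h t - c))) <= abs(indicator {a..b} t * (h t - c))" for n
   by (intro AE_I2) (auto simp: abs_mult trapez_props mult_left_le_one_le split: split_indicator)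
  qed measurable
  then have "0 = ivl a b (%t. indicator {x<..<y} t * (h t - c))" unfolding step by (simp add: LIMSEQ_const_iff)
  also have "... = ivl x y (%t. indicator {x<..<y} t * (h t - c))"
   using xy by (intro ext) auto
  also have "... = ivl x y (%t. h t - c)"
   by (intro ivl_cong_AE) (auto split: split_indicator)
  finally show "ivl x y (%t. h t - c) = 0" by simp
 qed measurable
 then show ?thesis by (intro exI[of _ c]) auto
qed

lemma primitive_if_weak_derivative:
 assumes ab: "a < b" and F: "L1_on {a..b} F" and G: "L1_on {a..b} G"
  and [measurable]: "F : Borel" "G : Borel"
  and weak: "!!ps ps'. test_function a b ps ps' ==> ivl a b (%x. ps' x * F x) = - ivl a b (%x. ps x * G x)"
 shows "EX c. AE x\<in>{a<..<b} in lborel. F x = c + ivl a x G"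
proof -
 define P where "P x = indicator {a..b} x *\<^sub>R ivl a x G" for x
 have Pc: "continuous_on {a..b} (%x. ivl a x G)" by (rule continuous_on_ivl[OF G])
 have Pm[measurable]: "P : Borel"
  unfolding P_def[abs_def] using borel_measurable_continuous_on_indicator[OF _ Pc] by simp
 have Pint: "L1_on {a..b} P"
  by (rule set_integrable_cong[THEN iffD1, OF refl refl _ borel_integrable_atLeastAtMost'[OF Pc]]) (auto simp: P_def)
 have "EX c. AE x\<in>{a<..<b} in lborel. F x - P x = c"
 proof (rule constant_if_annihilates_derivatives[OF ab])
  show "L1_on {a..b} (%x. F x - P x)" by (intro set_integral_diff F Pint)
  fix ps ps' assume test: "test_function a b ps ps'"
  have c': "continuous_on {a..b} ps'" using test by (auto simp: test_function_def intro: continuous_on_subset)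
  have "ivl a b (%x. ps' x * P x) = - ivl a b (%x. ps x * G x)"
   by (rule test_function_weak_derivative[OF ab G _ test, of _ 0]) (simp add: P_def)
  moreover have "ivl a b (%x. ps' x * (F x - P x)) = ivl a b (%x. F x * ps' x - P x * ps' x)" by (simp add: algebra_simps)
  moreover have "... = ivl a b (%x. ps' x * F x) - ivl a b (%x. ps' x * P x)"
   by (subst ivl_diff) (auto simp: mult.commute intro!: set_integrable_mult_continuous F Pint c')
  ultimately show "ivl a b (%x. ps' x * (F x - P x)) = 0" using weak[OF test] by simp
 qed measurable
 then obtain c where "AE x\<in>{a<..<b} in lborel. F x - P x = c" by blast
 then have "AE x\<in>{a<..<b} in lborel. F x = c + ivl a x G"
  by eventually_elim (auto simp: P_def split: split_indicator)
 then show ?thesis by blast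
qed

lemma continuous_AE_eq:
 fixes f g :: "real => 'a::real_normed_vector"
 assumes ab: "a < b" and f: "continuous_on {a..b} f" and g: "continuous_on {a..b} g"
  and eq: "AE x\<in>{a<..<b} in lborel. f x = g x" and x: "x : {a..b}"
 shows "f x = g x"
proof -
 define S where "S = {x : {a<..<b}. f x = g x}"
 have "{a..b} \<subseteq> closure S"
 proof (rule ccontr)
  assume "~ {a..b} \<subseteq> closure S"
  then have "~ {a<..<b} \<subseteq> closure S"
   using closure_mono[of "{a<..<b}" "closure S"] ab by (auto simp: closure_greaterThanLessThan)
  then have ne: "{a<..<b} - closure S ~= {}" by blast
  have "open ({a<..<b} - closure S)" by (intro open_Diff) auto
  then have nn: "~ negligible ({a<..<b} - closure S)" using open_not_negligible ne by blast
  obtain N where N: "N : null_sets lborel" "{x. ~ (x : {a<..<b} --> f x = g x)} \<subseteq> N"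
   using eq by (auto elim!: AE_E simp: null_sets_def)
  have "negligible N" using N(1) by (simp add: negligible_iff_null_sets null_sets_completionI)
  moreover have "{a<..<b} - closure S \<subseteq> N"
  proof
   fix x assume x: "x : {a<..<b} - closure S"
   then have "x ~: S" using closure_subset[of S] by blast
   then show "x : N" using x N(2) by (auto simp: S_def)
  qed
  ultimately show False using nn negligible_subset by blast
 qed
 moreover have "closure S \<subseteq> {a..b}" by (rule closure_minimal) (auto simp: S_def)
 ultimately have cl: "closure S = {a..b}" by blast
 have "f x - g x = 0"
 proof (rule continuous_constant_on_closure[of S "%x. f x - g x"])
  show "continuous_on (closure S) (%x. f x - g x)" unfolding cl by (intro continuous_intros f g)
  show "x : closure S" using x cl by simp
 qed (simp add: S_def)
 then show ?thesis by simp
qed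

section \<open>Vector-valued Lebesgue and Sobolev functions through Borel representatives\<close>

definition rep :: "real => real => (real => real^'n) => ('n => real => real) => bool" where
 "rep a b f F <=> (ALL i. F i : Borel) &
   (ALL i. AE x\<in>{a<..<b} in lborel. f x $ i = F i x)"

lemma rep_meas: "rep a b f F ==> F i : Borel"
 and rep_AE: "rep a b f F ==> AE x\<in>{a<..<b} in lborel. f x $ i = F i x"
 by (simp_all add: rep_def)
lemma AE_lebesgue_on_Ioo: "(AE x in lebesgue_on {a<..<b}. P x) <=> (AE x\<in>{a<..<b::real} in lborel. P x)"
 by (subst AE_restrict_space_iff) (simp_all add: AE_completion_iff)
lemma nn_integral_lebesgue_on_Ioo:
 "(\<integral>\<^sup>+x. f x \<partial>lebesgue_on {a<..<b::real}) = (\<integral>\<^sup>+x. f x * indicator {a<..<b} x \<partial>lborel)"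
 by (subst nn_integral_restrict_space) (simp_all add: nn_integral_completion)
lemma borel_measurable_lebesgue_on: "f : Borel ==> f : borel_measurable (lebesgue_on S)"
 by (intro measurable_restrict_space1 measurable_completion) simp
lemma borel_measurable_vec_lambda:
 fixes F :: "'n::finite => 'a => real"
 assumes "!!i. F i : borel_measurable M"
 shows "(%x. \<chi> i. F i x) : borel_measurable M"
proof -
 have "(%x. \<chi> i. F i x) = (%x. SUM i:UNIV. F i x *\<^sub>R axis i (1::real))"
  by (rule ext) (simp add: vec_eq_iff axis_def if_distrib cong: if_cong)
 moreover have "(%x. SUM i:UNIV. F i x *\<^sub>R axis i (1::real)) : borel_measurable M"
  by (intro borel_measurable_sum borel_measurable_scaleR assms borel_measurable_const)
 ultimately show ?thesis by simp
qed

lemma rep_exists: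
 assumes "f : borel_measurable (lebesgue_on {a<..<b})"
 shows "EX F. rep a b f F & (ALL i x. x ~: {a<..<b} --> F i x = 0)"
proof -
 have "(%x. indicator {a<..<b} x *\<^sub>R f x) : borel_measurable lebesgue"
  using assms by (subst (asm) borel_measurable_restrict_space_iff) auto
 then have "(%x. (indicator {a<..<b} x *\<^sub>R f x) $ i) : borel_measurable (completion lborel)" for i
  by (rule measurable_compose) (rule borel_measurable_nth)
 then have "\<exists>g\<in>borel_measurable lborel. AE x in lborel. (indicator {a<..<b} x *\<^sub>R f x) $ i = g x" for i
  by (rule completion_ex_borel_measurable_real)
 then obtain g where g: "!!i. g i : Borel" "!!i. AE x in lborel. (indicator {a<..<b} x *\<^sub>R f x) $ i = g i x"
  by (metis measurable_lborel2)
 define F where "F i x = indicator {a<..<b} x * g i x" for i x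
 have "F i : Borel" for i
 proof -
  have "F i = (%x. indicator {a<..<b} x * g i x)" by (rule ext) (simp add: F_def)
  then show ?thesis using g(1)[of i] by simp
 qed
 moreover have "AE x\<in>{a<..<b} in lborel. f x $ i = F i x" for i
  using g(2)[of i] by eventually_elim (auto simp: F_def)
 ultimately have "rep a b f F" by (simp add: rep_def)
 then show ?thesis by (intro exI[of _ F]) (simp add: F_def)
qed

lemma rep_vec_lambda: "(!!i. F i : Borel) ==> rep a b (%x. \<chi> i. F i x) F"
 by (simp add: rep_def)
lemma rep_add: "rep a b f F ==> rep a b g G ==> rep a b (f + g) (%i x. F i x + G i x)"
 and rep_diff: "rep a b f F ==> rep a b g G ==> rep a b (f - g) (%i x. F i x - G i x)"
 and rep_scaleR: "rep a b f F ==> rep a b (c *\<^sub>R f) (%i x. c * F i x)"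
proof -
 assume f: "rep a b f F"
 have "AE x\<in>{a<..<b} in lborel. (c *\<^sub>R f) x $ i = c * F i x" for i
  using rep_AE[OF f, of i] by eventually_elim (simp add: scaleR_fun_def)
 then show "rep a b (c *\<^sub>R f) (%i x. c * F i x)" using rep_meas[OF f] by (simp add: rep_def)
 assume g: "rep a b g G"
 have "AE x\<in>{a<..<b} in lborel. (f + g) x $ i = F i x + G i x" for i
  using rep_AE[OF f, of i] rep_AE[OF g, of i] by eventually_elim (simp add: plus_fun_def)
 then show "rep a b (f + g) (%i x. F i x + G i x)" using rep_meas[OF f] rep_meas[OF g] by (simp add: rep_def)
 have "AE x\<in>{a<..<b} in lborel. (f - g) x $ i = F i x - G i x" for i
  using rep_AE[OF f, of i] rep_AE[OF g, of i] by eventually_elim simp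
 then show "rep a b (f - g) (%i x. F i x - G i x)" using rep_meas[OF f] rep_meas[OF g] by (simp add: rep_def)
qed

text \<open>Comparison of the norm with the \<open>p\<close>-th power integrals of the components.\<close>

lemma rep_norm_bounds:
 fixes f :: "real => real^'n"
 assumes p: "1 <= p" and f: "rep a b f F"
 defines "N \<equiv> (\<integral>\<^sup>+x. ennreal (norm (f x) powr p) \<partial>lebesgue_on {a<..<b})"
 shows "powint p {a<..<b} (F i) <= N"
  "N <= ennreal (real CARD('n) powr (p - 1)) * (SUM i:UNIV. powint p {a<..<b} (F i))"
proof -
 have [measurable]: "F i : Borel" for i by (rule rep_meas[OF f])
 have N: "N = (\<integral>\<^sup>+x. ennreal (norm (f x) powr p) * indicator {a<..<b} x \<partial>lborel)"
  unfolding N_def by (rule nn_integral_lebesgue_on_Ioo)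
 have "AE x in lborel. ennreal (abs(F i x) powr p) * indicator {a<..<b} x <= ennreal (norm (f x) powr p) * indicator {a<..<b} x"
  using rep_AE[OF f, of i]
 proof eventually_elim
  case (elim x)
  show ?case
  proof (cases "x : {a<..<b}")
   case True
   then have "abs(F i x) powr p <= norm (f x) powr p"
   using elim p component_le_norm_cart[of "f x" i] by (intro powr_mono2) auto
   then show ?thesis using True by (simp add: ennreal_leI)
  qed simp
 qed
 then show "powint p {a<..<b} (F i) <= N" unfolding N powint_def by (rule nn_integral_mono_AE)
 have "AE x in lborel. ALL i. x : {a<..<b} --> f x $ i = F i x"
  unfolding AE_all_countable using rep_AE[OF f] by blast
 then have "AE x in lborel. ennreal (norm (f x) powr p) * indicator {a<..<b} x <=
  ennreal (real CARD('n) powr (p - 1)) * (SUM i:UNIV. ennreal (abs(F i x) powr p) * indicator {a<..<b} x)"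
 proof eventually_elim
  case (elim x)
  show ?case
  proof (cases "x : {a<..<b}")
   case True
   have "norm (f x) powr p <= (SUM i:UNIV. 1 * abs(f x $ i)) powr p"
   using p norm_le_l1_cart[of "f x"] by (intro powr_mono2) auto
   also have "... <= (\<Sum>i\<in>(UNIV::'n set). 1) powr (p - 1) * (SUM i:UNIV. 1 * abs(f x $ i) powr p)"
   by (rule weighted_sum_powr_le[OF p]) auto
   also have "... = real CARD('n) powr (p - 1) * (SUM i:UNIV. abs(F i x) powr p)" using elim True by simp
   finally have "ennreal (norm (f x) powr p) <= ennreal (real CARD('n) powr (p - 1) * (SUM i:UNIV. abs(F i x) powr p))"
   by (rule ennreal_leI)
   also have "... = ennreal (real CARD('n) powr (p - 1)) * (SUM i:UNIV. ennreal (abs(F i x) powr p))"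
   by (subst ennreal_mult) (simp_all add: sum_nonneg)
   finally show ?thesis using True by simp
  qed simp
 qed
 then have "N <= (\<integral>\<^sup>+x. ennreal (real CARD('n) powr (p - 1)) * (SUM i:UNIV. ennreal (abs(F i x) powr p) * indicator {a<..<b} x) \<partial>lborel)"
  unfolding N by (rule nn_integral_mono_AE)
 also have "... = ennreal (real CARD('n) powr (p - 1)) * (SUM i:UNIV. powint p {a<..<b} (F i))"
 proof -
  have m: "(%x. SUM i:UNIV. ennreal (abs(F i x) powr p) * indicator {a<..<b} x) : borel_measurable lborel" by measurable
  show ?thesis
   unfolding powint_def nn_integral_cmult[OF m]
   by (rule arg_cong[where f="(*) (ennreal (real CARD('n) powr (p - 1)))"], rule nn_integral_sum) measurable
 qed
 finally show "N <= ennreal (real CARD('n) powr (p - 1)) * (SUM i:UNIV. powint p {a<..<b} (F i))" .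
qed

lemma Lp_norm_nonneg: "0 <= Lp_norm p a b f"
 by (simp add: Lp_norm_def)
lemma Lp_norm_powr_ennreal:
 assumes p: "1 <= p" and f: "f : Lp p a b"
 shows "ennreal (Lp_norm p a b f powr p) = (\<integral>\<^sup>+x. ennreal (norm (f x) powr p) \<partial>lebesgue_on {a<..<b})"
proof -
 have "integrable (lebesgue_on {a<..<b}) (%x. norm (f x) powr p)" using f by (simp add: Lp_def)
 then have "(\<integral>\<^sup>+x. ennreal (norm (f x) powr p) \<partial>lebesgue_on {a<..<b}) = ennreal (\<integral>x. norm (f x) powr p \<partial>lebesgue_on {a<..<b})"
  by (intro nn_integral_eq_integral AE_I2) simp_all
 then show ?thesis by (simp only: Lp_norm_eq_Lnorm Lnorm_powr[OF p])
qed

lemma Lp_iff_rep: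
 fixes f :: "real => real^'n"
 assumes p: "1 <= p" and f: "rep a b f F" and m: "f : borel_measurable (lebesgue_on {a<..<b})"
 shows "f : Lp p a b <=> (ALL i. powint p {a<..<b} (F i) < infinity)"
proof
 assume L: "f : Lp p a b"
 show "ALL i. powint p {a<..<b} (F i) < infinity"
 proof
  fix i
  have "powint p {a<..<b} (F i) <= ennreal (Lp_norm p a b f powr p)"
   unfolding Lp_norm_powr_ennreal[OF p L] by (rule rep_norm_bounds(1)[OF p f])
  also have "... < infinity" by simp
  finally show "powint p {a<..<b} (F i) < infinity" .
 qed
next
 assume fin: "ALL i. powint p {a<..<b} (F i) < infinity"
 have "(SUM i:UNIV. powint p {a<..<b} (F i)) < infinity" using fin by (simp add: less_top[symmetric])
 then have "ennreal (real CARD('n) powr (p - 1)) * (SUM i:UNIV. powint p {a<..<b} (F i)) < infinity"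
  by (simp add: ennreal_mult_less_top)
 then have "(\<integral>\<^sup>+x. ennreal (norm (f x) powr p) \<partial>lebesgue_on {a<..<b}) < infinity"
  using rep_norm_bounds(2)[OF p f] by (rule le_less_trans[rotated])
 then have "integrable (lebesgue_on {a<..<b}) (%x. norm (f x) powr p)"
  using m by (intro integrableI_bounded) auto
 then show "f : Lp p a b" using m by (simp add: Lp_def)
qed

lemma vec_lambda_in_Lp:
 fixes F :: "'n::finite => real => real"
 assumes "1 <= p" "!!i. F i : Borel" "!!i. powint p {a<..<b} (F i) < infinity"
 shows "(%x. \<chi> i. F i x) : Lp p a b"
 using Lp_iff_rep[OF assms(1) rep_vec_lambda[of F a b, OF assms(2)] borel_measurable_lebesgue_on[OF borel_measurable_vec_lambda[OF assms(2)]]]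
  assms(3) by blast

lemma Lp_rep:
 assumes p: "1 <= p" and f: "f : Lp p a b"
 shows "EX F. rep a b f F & (ALL i x. x ~: {a<..<b} --> F i x = 0) & (ALL i. powint p {a<..<b} (F i) < infinity)"
proof -
 have m: "f : borel_measurable (lebesgue_on {a<..<b})" using f by (simp add: Lp_def)
 obtain F where F: "rep a b f F" "ALL i x. x ~: {a<..<b} --> F i x = 0" using rep_exists[OF m] by blast
 then show ?thesis using Lp_iff_rep[OF p F(1) m] f by blast
qed

lemma Lp_norm_bounds:
 fixes f :: "real => real^'n"
 assumes p: "1 <= p" and f: "f : Lp p a b" and F: "rep a b f F"
 shows "powint p {a<..<b} (F i) <= ennreal (Lp_norm p a b f powr p)"
  "ennreal (Lp_norm p a b f powr p) <= ennreal (real CARD('n) powr (p - 1)) * (SUM i:UNIV. powint p {a<..<b} (F i))"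
 unfolding Lp_norm_powr_ennreal[OF p f] by (rule rep_norm_bounds[OF p F])+

lemma Lp_integrable:
 assumes p: "1 <= p" and f: "f : Lp p a b" and F: "rep a b f F"
 shows "L1_on {a..b} (F i)"
proof -
 have "powint p {a<..<b} (F i) < infinity"
  using Lp_norm_bounds(1)[OF p f F, of i] by (rule le_less_trans) simp
 from powint_integrable(1)[OF p rep_meas[OF F] this] show ?thesis
  using set_integrable_cong_Ioo[OF rep_meas[OF F]] by blast
qed

lemma integral_test_rep:
 fixes f :: "real => real^'n"
 assumes p: "1 <= p" and f: "f : Lp p a b" and F: "rep a b f F" and ps: "continuous_on UNIV ps"
 shows "(\<integral>x. ps x *\<^sub>R f x \<partial>lebesgue_on {a<..<b}) $ i = ivl a b (%x. ps x * F i x)"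
proof -
 let ?M = "lebesgue_on {a<..<b}"
 have fm[measurable]: "f : borel_measurable ?M" using f by (simp add: Lp_def)
 have psb: "ps : Borel" by (rule borel_measurable_continuous_onI[OF ps])
 have psm[measurable]: "ps : borel_measurable ?M" by (rule borel_measurable_lebesgue_on[OF psb])
 have fi[measurable]: "(%x. f x $ i) : borel_measurable ?M" for i
  by (rule measurable_compose[OF fm borel_measurable_nth])
 have Fb: "F i : Borel" for i by (rule rep_meas[OF F])
 have Fm[measurable]: "F i : borel_measurable ?M" for i by (rule borel_measurable_lebesgue_on[OF Fb])
 have eq: "AE x in ?M. ps x * f x $ i = ps x * F i x" for i
  unfolding AE_lebesgue_on_Ioo using rep_AE[OF F, of i] by eventually_elim simp
 have Fint: "L1_on {a<..<b} (%x. ps x * F i x)" for i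
  using set_integrable_mult_continuous[OF Lp_integrable[OF p f F] continuous_on_subset[OF ps], of i]
   set_integrable_cong_Ioo[of "%x. ps x * F i x" a b] Fb psb by (simp add: mult.commute)
 have intF: "integrable ?M (%x. ps x * F i x)" for i
  using Fint[of i] Fb[of i] psb
  by (subst integrable_restrict_space) (simp_all add: integrable_completion set_integrable_real)
 have intf: "integrable ?M (%x. ps x * f x $ i)" for i
 proof -
  have "(%x. ps x * f x $ i) : borel_measurable ?M" "(%x. ps x * F i x) : borel_measurable ?M" by measurable
  from integrable_cong_AE[OF this eq] intF show ?thesis by blast
 qed
 have int: "integrable ?M (%x. ps x *\<^sub>R f x)"
 proof -
  have "integrable ?M (%x. SUM i:UNIV. (ps x * f x $ i) *\<^sub>R axis i (1::real))"
   by (intro Bochner_Integration.integrable_sum integrable_scaleR_left intf)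
  moreover have "(%x. SUM i:UNIV. (ps x * f x $ i) *\<^sub>R axis i (1::real)) = (%x. ps x *\<^sub>R f x)"
   by (rule ext) (simp add: vec_eq_iff axis_def if_distrib cong: if_cong)
  ultimately show ?thesis by simp
 qed
 have "(\<integral>x. ps x *\<^sub>R f x \<partial>?M) $ i = (\<integral>x. (ps x *\<^sub>R f x) $ i \<partial>?M)"
  by (rule integral_bounded_linear[OF bounded_linear_vec_nth int, symmetric])
 also have "... = (\<integral>x. ps x * F i x \<partial>?M)" using eq[of i] by (intro integral_cong_AE) simp_all
 also have "... = (\<integral>x. indicator {a<..<b} x * (ps x * F i x) \<partial>lborel)"
  using Fb[of i] psb by (subst integral_restrict_space) (simp_all add: integral_completion)
 also have "... = ivl a b (%x. ps x * F i x)"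
 proof -
  have "AE x in lborel. indicator {a<..<b} x * (ps x * F i x) = indicator {a..b} x * (ps x * F i x)"
   using AE_neq[of a] AE_neq[of b] by eventually_elim (auto split: split_indicator)
  then show ?thesis unfolding ivl_def using Fb[of i] psb by (intro integral_cong_AE) simp_all
 qed
 finally show ?thesis .
qed

lemma test_function_continuous:
 assumes "test_function a b ps ps'"
 shows "continuous_on UNIV ps" "continuous_on UNIV ps'"
proof -
 have "(ps has_real_derivative ps' x) (at x)" for x using assms by (simp add: test_function_def)
 then show "continuous_on UNIV ps" by (intro continuous_at_imp_continuous_on ballI DERIV_isCont)
 show "continuous_on UNIV ps'" using assms by (simp add: test_function_def)
qed

lemma has_weak_deriv_iff_primitive:
 assumes ab: "a < b" and p: "1 <= p" and f: "f : Lp p a b" and F: "rep a b f F"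
  and g: "g : Lp p a b" and G: "rep a b g G"
 shows "has_weak_deriv a b f g <=> (ALL i. EX c. AE x\<in>{a<..<b} in lborel. F i x = c + ivl a x (G i))"
proof -
 have iff: "has_weak_deriv a b f g <=> (ALL ps ps'. test_function a b ps ps' -->
   (ALL i. ivl a b (%x. ps' x * F i x) = - ivl a b (%x. ps x * G i x)))"
  unfolding has_weak_deriv_def vec_eq_iff uminus_vec_def vec_lambda_beta
  by (intro all_cong1 imp_cong refl)
   (simp add: integral_test_rep[OF p f F] integral_test_rep[OF p g G] test_function_continuous)
 note Fi = Lp_integrable[OF p f F] and Gi = Lp_integrable[OF p g G]
 show ?thesis
 proof
  assume "has_weak_deriv a b f g"
  then have "!!ps ps' i. test_function a b ps ps' ==> ivl a b (%x. ps' x * F i x) = - ivl a b (%x. ps x * G i x)"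
   using iff by blast
  then show "ALL i. EX c. AE x\<in>{a<..<b} in lborel. F i x = c + ivl a x (G i)"
   by (intro allI primitive_if_weak_derivative[OF ab Fi Gi rep_meas[OF F] rep_meas[OF G]])
 next
  assume R: "ALL i. EX c. AE x\<in>{a<..<b} in lborel. F i x = c + ivl a x (G i)"
  show "has_weak_deriv a b f g"
   unfolding iff
  proof (intro allI impI)
   fix ps ps' i assume test: "test_function a b ps ps'"
   obtain c where c: "AE x\<in>{a<..<b} in lborel. F i x = c + ivl a x (G i)" using R by blast
   define P where "P x = indicator {a..b} x *\<^sub>R (c + ivl a x (G i))" for x
   have [measurable]: "P : Borel"
   unfolding P_def using borel_measurable_continuous_on_indicator[of "{a..b}" "%x. c + ivl a x (G i)"]
   by (simp add: continuous_on_add continuous_on_ivl[OF Gi])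
   have [measurable]: "ps' : Borel" "F i : Borel"
   using test_function_continuous(2)[OF test] rep_meas[OF F] by (auto intro: borel_measurable_continuous_onI)
   have "ivl a b (%x. ps' x * F i x) = ivl a b (%x. ps' x * P x)"
   proof (rule ivl_cong_AE)
   show "AE x\<in>{a<..<b} in lborel. ps' x * F i x = ps' x * P x"
   using c by eventually_elim (simp add: P_def)
   qed measurable
   also have "... = - ivl a b (%x. ps x * G i x)"
   by (rule test_function_weak_derivative[OF ab Gi _ test, of _ c]) (simp add: P_def)
   finally show "ivl a b (%x. ps' x * F i x) = - ivl a b (%x. ps x * G i x)" .
  qed
 qed
qed

lemma primitive_unique:
 assumes ab: "a < b" and G: "L1_on {a..b} G" and G': "L1_on {a..b} G'"
  and m: "G : Borel" "G' : Borel"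
  and F: "AE x\<in>{a<..<b} in lborel. F x = c + ivl a x G"
  and F': "AE x\<in>{a<..<b} in lborel. F x = c' + ivl a x G'"
 shows "AE x\<in>{a<..<b} in lborel. G x = G' x"
proof -
 have ae: "AE x\<in>{a<..<b} in lborel. c + ivl a x G = c' + ivl a x G'"
  using F F' by eventually_elim simp
 have eq: "c + ivl a x G = c' + ivl a x G'" if "x : {a..b}" for x
  by (rule continuous_AE_eq[OF ab _ _ ae that]) (intro continuous_intros continuous_on_ivl G G')+
 have "AE x\<in>{a<..<b} in lborel. G x - G' x = 0"
 proof (rule AE_eq_0_if_ivl_eq_0)
  show "L1_on {a..b} (%x. G x - G' x)" by (rule set_integral_diff(1)[OF G G'])
  show "(%x. G x - G' x) : Borel" using m by simp
  fix x y assume xy: "a < x" "x < y" "y < b"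
  note s = set_integrable_subinterval[OF G, of x y] set_integrable_subinterval[OF G', of x y]
  have "ivl a y G = ivl a x G + ivl x y G" "ivl a y G' = ivl a x G' + ivl x y G'"
   using xy by (auto intro!: ivl_combine set_integrable_subinterval[OF G] set_integrable_subinterval[OF G'])
  then have "ivl x y G = ivl x y G'" using eq[of x] eq[of y] xy by auto
  then show "ivl x y (%x. G x - G' x) = 0" using ivl_diff[OF s] xy by simp
 qed
 then show ?thesis by eventually_elim simp
qed

lemma W1pI:
 assumes "a < b" "1 <= p" "f : Lp p a b" "rep a b f F" "g : Lp p a b" "rep a b g G"
  and "!!i. AE x\<in>{a<..<b} in lborel. F i x = c i + ivl a x (G i)"
 shows "f : W1p p a b"
 unfolding W1p_def using has_weak_deriv_iff_primitive[OF assms(1-6)] assms(3,5,7) by blast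

lemma W1pD:
 assumes ab: "a < b" and p: "1 <= p" and f: "f : W1p p a b"
 shows "f : Lp p a b" "weak_deriv p a b f : Lp p a b"
  "rep a b f F ==> rep a b (weak_deriv p a b f) G ==> EX c. AE x\<in>{a<..<b} in lborel. F i x = c + ivl a x (G i)"
proof -
 show L: "f : Lp p a b" using f by (simp add: W1p_def)
 have "EX g. g : Lp p a b & has_weak_deriv a b f g" using f by (auto simp: W1p_def)
 then have "weak_deriv p a b f : Lp p a b & has_weak_deriv a b f (weak_deriv p a b f)"
  unfolding weak_deriv_def by (rule someI_ex)
 then show w: "weak_deriv p a b f : Lp p a b"
  and "rep a b f F ==> rep a b (weak_deriv p a b f) G ==> EX c. AE x\<in>{a<..<b} in lborel. F i x = c + ivl a x (G i)"
  using has_weak_deriv_iff_primitive[OF ab p L _ _] by blast+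
qed

lemma weak_deriv_AE:
 assumes ab: "a < b" and p: "1 <= p" and f: "f : Lp p a b" and F: "rep a b f F"
  and g: "g : Lp p a b" and G: "rep a b g G"
  and prim: "!!i. AE x\<in>{a<..<b} in lborel. F i x = c i + ivl a x (G i)"
 shows "AE x\<in>{a<..<b} in lborel. weak_deriv p a b f x $ i = G i x"
proof -
 have W: "f : W1p p a b" by (rule W1pI[OF ab p f F g G prim])
 note w = W1pD(2)[OF ab p W]
 obtain H where H: "rep a b (weak_deriv p a b f) H" using Lp_rep[OF p w] by blast
 obtain d where "AE x\<in>{a<..<b} in lborel. F i x = d + ivl a x (H i)" using W1pD(3)[OF ab p W F H] by blast
 from primitive_unique[OF ab Lp_integrable[OF p w H] Lp_integrable[OF p g G] rep_meas[OF H] rep_meas[OF G] this prim]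
 have "AE x\<in>{a<..<b} in lborel. H i x = G i x" .
 with rep_AE[OF H, of i] show ?thesis by eventually_elim simp
qed

lemma cont_rep_eq:
 fixes f :: "real => real^'n"
 assumes ab: "a < b" and F: "!!i. AE x\<in>{a<..<b} in lborel. f x $ i = H i x"
  and H: "!!i. continuous_on {a..b} (H i)"
 shows "continuous_on {a..b} (cont_rep a b f)" "x : {a..b} ==> cont_rep a b f x $ i = H i x"
proof -
 define h where "h x = (\<chi> i. H i x)" for x
 have hc: "continuous_on {a..b} h" unfolding h_def by (intro continuous_on_vec_lambda H)
 have all: "AE x in lborel. ALL i. x : {a<..<b} --> f x $ i = H i x" unfolding AE_all_countable using F by blast
 then have "AE x\<in>{a<..<b} in lborel. f x = h x"
  by eventually_elim (simp add: h_def vec_eq_iff)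
 then have fh: "AE x in lebesgue_on {a<..<b}. f x = h x" unfolding AE_lebesgue_on_Ioo .
 have "EX h. continuous_on {a..b} h & (AE x in lebesgue_on {a<..<b}. f x = h x)" using hc fh by blast
 then have c: "continuous_on {a..b} (cont_rep a b f) & (AE x in lebesgue_on {a<..<b}. f x = cont_rep a b f x)"
  unfolding cont_rep_def by (rule someI_ex)
 then show "continuous_on {a..b} (cont_rep a b f)" by blast
 have "AE x\<in>{a<..<b} in lborel. cont_rep a b f x = h x"
  using conjunct2[OF c, unfolded AE_lebesgue_on_Ioo] fh[unfolded AE_lebesgue_on_Ioo] by eventually_elim simp
 from continuous_AE_eq[OF ab conjunct1[OF c] hc this, of x]
 show "x : {a..b} ==> cont_rep a b f x $ i = H i x" by (simp add: h_def)
qed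

section \<open>Riemann--Stieltjes integrals\<close>

definition has_RS :: "real => real => (real => real) => (real => real) => real => bool" where
 "has_RS a b ee ph I <=>
   (\<forall>e>0. \<exists>dl>0. ALL d. d tagged_division_of {a..b} & (%x. ball x dl) fine d -->
   abs((\<Sum>(x, J)\<in>d. (ee (Sup J) - ee (Inf J)) * ph x) - I) < e)"

lemma fine_ball_mono:
 assumes "(%x. ball x dl) fine d" "dl <= dl'"
 shows "(%x. ball x dl') fine d"
 unfolding fine_def
proof clarify
 fix x K y assume "(x, K) : d" "y : K"
 then have "y : ball x dl" using assms(1) unfolding fine_def by blast
 then show "y : ball x dl'" using assms(2) by simp
qed

lemma has_RS_diff:
 assumes "has_RS a b P ph I" "has_RS a b Q ph J"
 shows "has_RS a b (%t. P t - Q t) ph (I - J)"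
 unfolding has_RS_def
proof (intro allI impI)
 fix e :: real assume e: "0 < e"
 obtain dl1 where dl1: "0 < dl1" "!!d. d tagged_division_of {a..b} ==> (%x. ball x dl1) fine d ==>
   abs((\<Sum>(x, J)\<in>d. (P (Sup J) - P (Inf J)) * ph x) - I) < e / 2"
  using assms(1) e unfolding has_RS_def by (meson half_gt_zero)
 obtain dl2 where dl2: "0 < dl2" "!!d. d tagged_division_of {a..b} ==> (%x. ball x dl2) fine d ==>
   abs((\<Sum>(x, J)\<in>d. (Q (Sup J) - Q (Inf J)) * ph x) - J) < e / 2"
  using assms(2) e unfolding has_RS_def by (meson half_gt_zero)
 have "abs((\<Sum>(x, J)\<in>d. (P (Sup J) - Q (Sup J) - (P (Inf J) - Q (Inf J))) * ph x) - (I - J)) < e"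
  if d: "d tagged_division_of {a..b}" "(%x. ball x (min dl1 dl2)) fine d" for d
 proof -
  have f: "(%x. ball x dl1) fine d" "(%x. ball x dl2) fine d" using fine_ball_mono[OF d(2)] by simp_all
  have "(\<Sum>(x, J)\<in>d. (P (Sup J) - Q (Sup J) - (P (Inf J) - Q (Inf J))) * ph x) =
   (\<Sum>(x, J)\<in>d. (P (Sup J) - P (Inf J)) * ph x) - (\<Sum>(x, J)\<in>d. (Q (Sup J) - Q (Inf J)) * ph x)"
   by (simp add: sum_subtractf[symmetric] split_beta algebra_simps)
  then show ?thesis using dl1(2)[OF d(1) f(1)] dl2(2)[OF d(1) f(2)] by linarith
 qed
 then show "\<exists>dl>0. ALL d. d tagged_division_of {a..b} & (%x. ball x dl) fine d -->
   abs((\<Sum>(x, J)\<in>d. (P (Sup J) - Q (Sup J) - (P (Inf J) - Q (Inf J))) * ph x) - (I - J)) < e"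
  using dl1(1) dl2(1) by (intro exI[of _ "min dl1 dl2"]) auto
qed

text \<open>
  The measure of a nondecreasing function \<open>P\<close> on \<open>[a, b]\<close>, seen from \<open>ta\<close> in the reversed time
  \<open>sv = ta - te\<close>. Reversal turns left continuity of \<open>P\<close> into the right continuity that
  \<open>interval_measure\<close> expects, and delays into nonnegative numbers.
\<close>

definition clip :: "real => real => real => real" where
 "clip a b x = max a (min b x)"

definition delay_measure :: "real => real => real => (real => real) => real measure" where
 "delay_measure a b ta P = interval_measure (%sv. - P (clip a b (ta - sv)))"

locale left_monotone =
 fixes a b :: real and P :: "real => real"
 assumes ab: "a < b"
  and mono: "a <= x ==> x <= y ==> y <= b ==> P x <= P y"
  and left: "a < x ==> x <= b ==> continuous (at_left x) P"
begin
lemma clip_in: "clip a b x : {a..b}" and clip_mono: "x <= y ==> clip a b x <= clip a b y"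
 and clip_id: "x : {a..b} ==> clip a b x = x"
 using ab by (auto simp: clip_def)

lemma neg_mono: "x <= y ==> - P (clip a b (ta - x)) <= - P (clip a b (ta - y))"
 using mono[of "clip a b (ta - y)" "clip a b (ta - x)"] clip_in[of "ta - x"] clip_in[of "ta - y"] clip_mono[of "ta - y" "ta - x"] by auto

lemma neg_right_cont: "continuous (at_right x) (%sv. - P (clip a b (ta - sv)))"
proof -
 have "((%sv. P (clip a b (ta - sv))) ---> P (clip a b (ta - x))) (at_right x)"
 proof -
  consider "ta - x <= a" | "a < ta - x" "ta - x <= b" | "b < ta - x" by linarith
  then show ?thesis
  proof cases
   case 1
   have "eventually (%sv. P (clip a b (ta - sv)) = P (clip a b (ta - x))) (at_right x)"
   unfolding eventually_at_right_field using 1 ab by (intro exI[of _ "x + 1"]) (auto simp: clip_def)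
   then show ?thesis by (rule tendsto_eventually)
  next
   case 3
   have "eventually (%sv. P (clip a b (ta - sv)) = P (clip a b (ta - x))) (at_right x)"
   unfolding eventually_at_right_field using 3 ab by (intro exI[of _ "ta - b"]) (auto simp: clip_def)
   then show ?thesis by (rule tendsto_eventually)
  next
   case 2
   have "(P ---> P (ta - x)) (at_left (ta - x))" using left[OF 2] by (simp add: continuous_within)
   moreover have "filterlim (%sv. ta - sv) (at_left (ta - x)) (at_right x)"
   unfolding filterlim_at
   proof
   show "\<forall>\<^sub>F sv in at_right x. ta - sv : {..<ta - x} & ta - sv ~= ta - x"
   unfolding eventually_at_right_field by (intro exI[of _ "x + 1"]) auto
   show "filterlim (%sv. ta - sv) (nhds (ta - x)) (at_right x)" by (intro tendsto_intros)
   qed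
   ultimately have lim: "((%sv. P (ta - sv)) ---> P (ta - x)) (at_right x)" by (rule filterlim_compose)
   have "eventually (%sv. P (ta - sv) = P (clip a b (ta - sv))) (at_right x)"
   unfolding eventually_at_right_field using 2 by (intro exI[of _ "ta - a"]) (auto simp: clip_def)
   from Lim_transform_eventually[OF lim this] show ?thesis using 2 by (simp add: clip_def)
  qed
 qed
 then show ?thesis by (simp add: continuous_within tendsto_minus)
qed

lemma sets_delay_measure[simp, measurable_cong]: "sets (delay_measure a b ta P) = sets borel"
 and space_delay_measure[simp]: "space (delay_measure a b ta P) = UNIV"
 by (simp_all add: delay_measure_def)
lemma emeasure_delay_measure:
 "x <= y ==> emeasure (delay_measure a b ta P) {x<..y} = ennreal (P (clip a b (ta - x)) - P (clip a b (ta - y)))"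
 unfolding delay_measure_def
 by (subst emeasure_interval_measure_Ioc) (simp_all add: neg_mono neg_right_cont del: neg_le_iff_le)
lemma delay_measure_UNIV: "emeasure (delay_measure a b ta P) UNIV = ennreal (P b - P a)"
proof -
 define X where "X n = {ta - b - real n - 1<..ta - a + real n}" for n :: nat
 have "(\<Union>n. X n) = UNIV"
 proof -
  have "x : (\<Union>n. X n)" for x
  proof -
   obtain n :: nat where "abs(x) + abs(ta - b) + abs(ta - a) < real n" using reals_Archimedean2 by blast
   then have "ta - b - real n - 1 < x" "x <= ta - a + real n" by linarith+
   then have "x : X n" by (simp add: X_def)
   then show ?thesis by blast
  qed
  then show ?thesis by blast
 qed
 moreover have "incseq X" by (auto simp: incseq_def X_def)
 ultimately have "emeasure (delay_measure a b ta P) UNIV = (SUP n. emeasure (delay_measure a b ta P) (X n))"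
  by (subst SUP_emeasure_incseq) (auto simp: X_def)
 also have "... = (SUP n::nat. ennreal (P b - P a))"
  unfolding X_def using ab by (subst emeasure_delay_measure) (auto simp: clip_def)
 finally show ?thesis by simp
qed

lemma finite_delay_measure: "finite_measure (delay_measure a b ta P)"
 by (rule finite_measureI) (simp add: delay_measure_UNIV)
lemma measure_delay_measure:
 "x <= y ==> measure (delay_measure a b ta P) {x<..y} = P (clip a b (ta - x)) - P (clip a b (ta - y))"
 using neg_mono[of x y ta] by (simp add: measure_def emeasure_delay_measure)

lemma AE_delay_measure: "AE sv in delay_measure a b ta P. sv : {ta - b<..ta - a}"
proof -
 interpret finite_measure "delay_measure a b ta P" by (rule finite_delay_measure)
 have "emeasure (delay_measure a b ta P) (space (delay_measure a b ta P) - {ta - b<..ta - a})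
   = emeasure (delay_measure a b ta P) UNIV - emeasure (delay_measure a b ta P) {ta - b<..ta - a}"
  by (subst emeasure_compl) auto
 also have "... = 0" using ab by (simp add: emeasure_delay_measure delay_measure_UNIV clip_def)
 finally show ?thesis by (intro AE_I[of _ _ "UNIV - {ta - b<..ta - a}"]) auto
qed

text \<open>
  On a cell \<open>[u, v]\<close> of a tagged division, the term \<open>(P v - P u) ph(x)\<close> differs from the integral of \<open>ph\<close> over
  \<open>[u, v)\<close> by at most the oscillation of \<open>ph\<close> times \<open>P v - P u\<close>; both sides are increments, so the
  errors telescope.
\<close>

lemma has_RS_delay_measure:
 assumes ph: "continuous_on {a..b} ph"
 shows "has_RS a b P ph (\<integral>sv. indicator {ta - b<..ta - a} sv * ph (ta - sv) \<partial>delay_measure a b ta P)"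
 unfolding has_RS_def
proof (intro allI impI)
 fix e :: real assume e: "0 < e"
 let ?M = "delay_measure a b ta P"
 interpret finite_measure ?M by (rule finite_delay_measure)
 define ph' where "ph' sv = indicator {ta - b..ta - a} sv *\<^sub>R ph (ta - sv)" for sv
 have cont: "continuous_on {ta - b..ta - a} (%sv. ph (ta - sv))"
  by (intro continuous_on_compose2[OF ph] continuous_intros) auto
 have [measurable]: "ph' : Borel"
  unfolding ph'_def[abs_def] using borel_measurable_continuous_on_indicator[OF _ cont] by simp
 obtain B where B: "!!t. t : {a..b} ==> abs(ph t) <= B" using continuous_on_Icc_bounded[OF ph] by blast
 have Bph: "abs(ph' sv) <= abs(B)" for sv using B[of "ta - sv"] by (auto simp: ph'_def split: split_indicator)
 have int: "integrable ?M (%sv. indicator A sv * ph' sv)" if "A : sets borel" for A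
 proof (rule integrable_const_bound[of _ "abs(B)"])
  show "AE sv in ?M. norm (indicator A sv * ph' sv) <= abs(B)" using Bph by (auto split: split_indicator)
  show "(%sv. indicator A sv * ph' sv) : borel_measurable ?M" using that by measurable
 qed
 define g where "g t = (\<integral>sv. indicator {ta - t<..ta - a} sv * ph' sv \<partial>?M)" for t
 have g_diff: "g v - g u = (\<integral>sv. indicator {ta - v<..ta - u} sv * ph' sv \<partial>?M)" if "a <= u" "u <= v" for u v
 proof -
  have "g v - g u = (\<integral>sv. indicator {ta - v<..ta - a} sv * ph' sv - indicator {ta - u<..ta - a} sv * ph' sv \<partial>?M)"
   unfolding g_def by (rule Bochner_Integration.integral_diff[OF int int, symmetric]) auto
  also have "... = (\<integral>sv. indicator {ta - v<..ta - u} sv * ph' sv \<partial>?M)"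
   using that by (intro integral_cong_all) (auto split: split_indicator)
  finally show ?thesis .
 qed
 have ga: "g a = 0" by (simp add: g_def)
 have gb: "g b = (\<integral>sv. indicator {ta - b<..ta - a} sv * ph (ta - sv) \<partial>?M)"
  unfolding g_def by (intro integral_cong_all) (auto simp: ph'_def split: split_indicator)
 define K where "K = P b - P a + 1"
 have K: "0 < K" using mono[of a b] ab by (simp add: K_def)
 have eK: "0 < e / K" using e K by simp
 have "uniformly_continuous_on {a..b} ph" by (rule compact_uniformly_continuous[OF ph compact_Icc])
 then have "\<exists>dl>0. \<forall>x\<in>{a..b}. \<forall>y\<in>{a..b}. dist y x < dl --> dist (ph y) (ph x) < e / K"
  using eK unfolding uniformly_continuous_on_def by blast
 then obtain dl where dl: "0 < dl" "!!x y. x : {a..b} ==> y : {a..b} ==> dist y x < dl ==> dist (ph y) (ph x) < e / K"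
  by blast
 have "abs((\<Sum>(x, J)\<in>d. (P (Sup J) - P (Inf J)) * ph x) - g b) < e"
  if d: "d tagged_division_of {a..b}" "(%x. ball x dl) fine d" for d
 proof -
  have tele_g: "(\<Sum>(x, J)\<in>d. g (Sup J) - g (Inf J)) = g b - g a"
   and tele_P: "(\<Sum>(x, J)\<in>d. P (Sup J) - P (Inf J)) = P b - P a"
   using additive_tagged_division_1[OF less_imp_le[OF ab] d(1)] by auto
  have cell: "abs((P (Sup J) - P (Inf J)) * ph x - (g (Sup J) - g (Inf J))) <= e / K * (P (Sup J) - P (Inf J))"
   if xJ: "(x, J) : d" for x J
  proof -
   obtain u v where uv: "J = {u..v}" using tagged_division_ofD(4)[OF d(1) xJ] by auto
   have xin: "x : J" and sub: "J \<subseteq> {a..b}"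
   using tagged_division_ofD(2,3)[OF d(1) xJ] by auto
   then have uv': "u <= x" "x <= v" "a <= u" "v <= b" using uv by auto
   then have si: "Sup J = v" "Inf J = u" using uv by auto
   have ball: "J \<subseteq> ball x dl" using d(2) xJ unfolding fine_def by blast
   have m: "measure ?M {ta - v<..ta - u} = P v - P u"
   using uv' by (subst measure_delay_measure) (auto simp: clip_def)
   have i1: "integrable ?M (%sv. indicator {ta - v<..ta - u} sv * ph x)"
   by (intro integrable_mult_left integrable_real_indicator) (auto simp: emeasure_eq_measure)
   have cell_eq: "(P v - P u) * ph x - (g v - g u) = (\<integral>sv. indicator {ta - v<..ta - u} sv * ph x - indicator {ta - v<..ta - u} sv * ph' sv \<partial>?M)"
   using g_diff[of u v] uv' m i1 int[of "{ta - v<..ta - u}"] by simp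
   have "abs((P v - P u) * ph x - (g v - g u)) <= (\<integral>sv. abs(indicator {ta - v<..ta - u} sv * ph x - indicator {ta - v<..ta - u} sv * ph' sv) \<partial>?M)"
   unfolding cell_eq by (rule integral_abs_bound)
   also have "... <= (\<integral>sv. indicator {ta - v<..ta - u} sv * (e / K) \<partial>?M)"
   proof (rule integral_mono)
   show "integrable ?M (%sv. abs(indicator {ta - v<..ta - u} sv * ph x - indicator {ta - v<..ta - u} sv * ph' sv))"
   by (intro integrable_abs Bochner_Integration.integrable_diff i1 int) simp
   show "integrable ?M (%sv. indicator {ta - v<..ta - u} sv * (e / K))"
   by (intro integrable_mult_left integrable_real_indicator) (auto simp: emeasure_eq_measure)
   fix sv
   show "abs(indicator {ta - v<..ta - u} sv * ph x - indicator {ta - v<..ta - u} sv * ph' sv) <= indicator {ta - v<..ta - u} sv * (e / K)"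
   proof (cases "sv : {ta - v<..ta - u}")
   case True
   then have s: "ta - sv : J" "ta - sv : {a..b}" "sv : {ta - b..ta - a}" using uv uv' by auto
   then have "dist (ta - sv) x < dl" using ball by (auto simp: dist_commute)
   from dl(2)[OF _ s(2) this] have "abs(ph (ta - sv) - ph x) < e / K" using xin sub by (auto simp: dist_real_def)
   then show ?thesis using True s(3) by (simp add: ph'_def)
   qed simp
   qed
   also have "... = e / K * (P v - P u)" using m by simp
   finally show ?thesis by (simp add: si)
  qed
  have "abs((\<Sum>(x, J)\<in>d. (P (Sup J) - P (Inf J)) * ph x) - g b) =
   abs(\<Sum>(x, J)\<in>d. (P (Sup J) - P (Inf J)) * ph x - (g (Sup J) - g (Inf J)))"
   using tele_g ga by (simp add: split_beta sum_subtractf)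
  also have "... <= (\<Sum>(x, J)\<in>d. abs((P (Sup J) - P (Inf J)) * ph x - (g (Sup J) - g (Inf J))))"
   unfolding split_beta by (rule sum_abs)
  also have "... <= (\<Sum>(x, J)\<in>d. e / K * (P (Sup J) - P (Inf J)))"
   using cell by (intro sum_mono) auto
  also have "... = e / K * (P b - P a)" using tele_P by (simp add: split_beta sum_distrib_left[symmetric] del: times_divide_eq_left)
  also have "... < e" using e K by (simp add: K_def field_simps)
  finally show ?thesis .
 qed
 then show "\<exists>dl>0. ALL d. d tagged_division_of {a..b} & (%x. ball x dl) fine d -->
   abs((\<Sum>(x, J)\<in>d. (P (Sup J) - P (Inf J)) * ph x) - (\<integral>sv. indicator {ta - b<..ta - a} sv * ph (ta - sv) \<partial>?M)) < e"
  using dl(1) gb by auto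
qed
end

text \<open>
  Jordan decomposition. The total variation is only needed up to the superadditivity
  \<open>V x + \<bar>ee y - ee x\<bar> \<le> V y\<close>; passing to left limits restores left continuity.
\<close>

lemma monotone_left_limit:
 fixes V :: "real => real"
 assumes mono: "!!x y. a <= x ==> x <= y ==> y <= b ==> V x <= V y" and x: "a < x" "x <= b"
 shows "(V ---> Sup (V ` {a..<x})) (at_left x)"
proof (rule order_tendstoI)
 have bdd: "bdd_above (V ` {a..<x})" using mono[of _ x] x by (intro bdd_aboveI[of _ "V x"]) auto
 have ne: "V ` {a..<x} ~= {}" using x by auto
 fix c assume c: "c < Sup (V ` {a..<x})"
 then obtain s where s: "s : {a..<x}" "c < V s" using less_cSupD[OF ne c] by auto
 show "eventually (%t. c < V t) (at_left x)"
  unfolding eventually_at_left_field using s mono[of s] x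
  by (intro exI[of _ s]) (auto intro: less_le_trans)
next
 have bdd: "bdd_above (V ` {a..<x})" using mono[of _ x] x by (intro bdd_aboveI[of _ "V x"]) auto
 fix c assume c: "Sup (V ` {a..<x}) < c"
 show "eventually (%t. V t < c) (at_left x)"
  unfolding eventually_at_left_field
 proof (intro exI[of _ a] conjI allI impI)
  fix t assume "a < t" "t < x"
  then have "V t <= Sup (V ` {a..<x})" by (intro cSup_upper bdd) auto
  then show "V t < c" using c by simp
 qed (use x in simp)
qed

lemma Jordan_decomposition:
 fixes ee :: "real => real"
 assumes ab: "a < b" and left: "!!x. a < x ==> x <= b ==> continuous (at_left x) ee"
  and BV: "!!d. d division_of {a..b} ==> (\<Sum>J\<in>d. abs(ee (Sup J) - ee (Inf J))) <= B"
 obtains P Q where "left_monotone a b P" "left_monotone a b Q" "!!t. t : {a..b} ==> ee t = P t - Q t"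
proof -
 define s where "s d = (\<Sum>J\<in>d. abs(ee (Sup J) - ee (Inf J)))" for d
 define D where "D x = {d. d division_of {a..x}}" for x
 define V where "V x = Sup (s ` D x)" for x
 have ext: "s d + abs(ee y - ee x) = s (insert {x..y} d) & insert {x..y} d : D y"
  if d: "d : D x" and xy: "a <= x" "x < y" for d x y
 proof -
  have dd: "d division_of {a..x}" using d by (simp add: D_def)
  have nin: "{x..y} ~: d"
  proof
   assume "{x..y} : d"
   then have "{x..y} \<subseteq> {a..x}" by (rule division_ofD(2)[OF dd])
   then show False using xy by auto
  qed
  have "{{x..y}} division_of {x..y}" using division_of_self[of x y] xy by (simp add: cbox_interval)
  from division_disjoint_union[OF dd this]
  have "d \<union> {{x..y}} division_of {a..x} \<union> {x..y}" by (auto simp: interior_atLeastAtMost_real)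
  moreover have "{a..x} \<union> {x..y} = {a..y}" using xy by auto
  ultimately have "insert {x..y} d : D y" by (simp add: D_def)
  moreover have "s (insert {x..y} d) = abs(ee y - ee x) + s d"
   using nin division_ofD(1)[OF dd] xy by (simp add: s_def)
  ultimately show ?thesis by simp
 qed
 have ne: "D x ~= {}" if "a <= x" for x
  using division_of_self[of a x] that by (auto simp: D_def cbox_interval)
 have bd: "s d <= B" if "d : D x" "a <= x" "x <= b" for d x
 proof (cases "x = b")
  case True
  then show ?thesis using BV that by (simp add: D_def s_def)
 next
  case False
  then have "s d + abs(ee b - ee x) <= B" using ext[of d x b] that BV by (auto simp: D_def s_def)
  then show ?thesis by linarith
 qed
 have bdd: "bdd_above (s ` D x)" if "a <= x" "x <= b" for x
  using bd that by (intro bdd_aboveI[of _ B]) auto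
 have super: "V x + abs(ee y - ee x) <= V y" if xy: "a <= x" "x <= y" "y <= b" for x y
 proof (cases "x = y")
  case False
  have "V x <= V y - abs(ee y - ee x)"
   unfolding V_def
  proof (rule cSup_least)
   show "s ` D x ~= {}" using ne xy by auto
   fix z assume "z : s ` D x"
   then obtain d where d: "d : D x" "z = s d" by blast
   have "s (insert {x..y} d) <= Sup (s ` D y)"
   using ext[OF d(1)] xy False by (intro cSup_upper bdd) auto
   then show "z <= Sup (s ` D y) - abs(ee y - ee x)" using ext[OF d(1), of y] d xy False by auto
  qed
  then show ?thesis by simp
 qed simp
 have Vmono: "V x <= V y" if "a <= x" "x <= y" "y <= b" for x y using super[OF that] by linarith
 define P where "P x = (if x <= a then V a else Sup (V ` {a..<x}))" for x
 have lim: "(V ---> P x) (at_left x)" if "a < x" "x <= b" for x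
  using monotone_left_limit[OF Vmono that] that by (simp add: P_def)
 have nb: "at_left x ~= bot" for x :: real by simp
 have Ple: "P x <= V x" if "a < x" "x <= b" for x
 proof (rule tendsto_upperbound[OF lim[OF that] _ nb])
  show "\<forall>\<^sub>F t in at_left x. V t <= V x"
   unfolding eventually_at_left_field using Vmono that by (intro exI[of _ a]) auto
 qed
 have Pge: "V t <= P x" if "a <= t" "t < x" "x <= b" for t x
 proof (rule tendsto_lowerbound[OF lim _ nb])
  show "\<forall>\<^sub>F s in at_left x. V t <= V s"
   unfolding eventually_at_left_field using Vmono that by (intro exI[of _ t]) auto
 qed (use that in auto)
 have Pa: "P a = V a" by (simp add: P_def)
 have incr: "abs(ee y - ee x) <= P y - P x" if xy: "a <= x" "x < y" "y <= b" for x y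
 proof -
  have lee: "(ee ---> ee t) (at_left t)" if "a < t" "t <= b" for t using left[OF that] by (simp add: continuous_within)
  have 1: "abs(ee y - ee t) <= P y - V t" if t: "a <= t" "t < y" for t
  proof (rule tendsto_le[OF nb])
   show "((%s. V s - V t) ---> P y - V t) (at_left y)" using t xy by (intro tendsto_intros lim) auto
   show "((%s. abs(ee s - ee t)) ---> abs(ee y - ee t)) (at_left y)" using t xy by (intro tendsto_intros lee) auto
   show "\<forall>\<^sub>F s in at_left y. abs(ee s - ee t) <= V s - V t"
   unfolding eventually_at_left_field
   proof (intro exI[of _ t] conjI allI impI)
   fix s assume "t < s" "s < y"
   then show "abs(ee s - ee t) <= V s - V t" using super[of t s] t xy by auto
   qed (use t in simp)
  qed
  show ?thesis
  proof (cases "x = a")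
   case True
   then show ?thesis using 1[of x] xy Pa by simp
  next
   case False
   show ?thesis
   proof (rule tendsto_le[OF nb])
   show "((%t. P y - V t) ---> P y - P x) (at_left x)" using False xy by (intro tendsto_intros lim) auto
   show "((%t. abs(ee y - ee t)) ---> abs(ee y - ee x)) (at_left x)" using False xy by (intro tendsto_intros lee) auto
   show "\<forall>\<^sub>F t in at_left x. abs(ee y - ee t) <= P y - V t"
   unfolding eventually_at_left_field
   proof (intro exI[of _ a] conjI allI impI)
   fix t assume "a < t" "t < x"
   then show "abs(ee y - ee t) <= P y - V t" using 1[of t] xy by auto
   qed (use xy False in simp)
   qed
  qed
 qed
 have Pmono: "P x <= P y" if "a <= x" "x <= y" "y <= b" for x y
  using incr[of x y] that by (cases "x = y") auto
 have Pleft: "continuous (at_left x) P" if x: "a < x" "x <= b" for x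
  unfolding continuous_within
 proof (rule order_tendstoI)
  fix c assume "c < P x"
  from order_tendstoD(1)[OF lim[OF x] this] obtain d where d: "d < x" "!!t. d < t ==> t < x ==> c < V t"
   unfolding eventually_at_left_field by blast
  define s where "s = (max a d + x) / 2"
  have s: "a < s" "d < s" "s < x" using x d(1) by (auto simp: s_def)
  have "c < P t" if "s < t" "t < x" for t
   using d(2)[OF s(2,3)] Pge[of s t] s x that by linarith
  then show "\<forall>\<^sub>F t in at_left x. c < P t" unfolding eventually_at_left_field using s(3) by blast
 next
  fix c assume "P x < c"
  then have "P t < c" if "a < t" "t < x" for t using Pmono[of t x] that x by linarith
  then show "\<forall>\<^sub>F t in at_left x. P t < c" unfolding eventually_at_left_field using x(1) by blast
 qed
 show thesis
 proof (rule that[of P "%t. P t - ee t"])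
  show "left_monotone a b P" by unfold_locales (use ab Pmono Pleft in auto)
  show "left_monotone a b (%t. P t - ee t)"
  proof
   show "P x - ee x <= P y - ee y" if "a <= x" "x <= y" "y <= b" for x y
   proof (cases "x = y")
   case False
   then show ?thesis using incr[of x y] that by linarith
   qed simp
   show "continuous (at_left x) (%t. P t - ee t)" if "a < x" "x <= b" for x
   using Pleft[OF that] left[OF that] by (rule continuous_diff)
  qed (rule ab)
 qed simp
qed

text \<open>The vector-valued integral is determined by the scalar integrals of its entries.\<close>

lemma has_RS_integral_componentwise:
 fixes ee :: "real => real^'n^'n"
 assumes comp: "!!i j. has_RS a b (%t. ee t $ i $ j) (%t. ph t $ j) (I i j)"
 shows "has_RS_integral a b ee ph (\<chi> i. SUM j:UNIV. I i j)"
 unfolding has_RS_integral_def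
proof (intro allI impI)
 fix e :: real assume e: "0 < e"
 define c where "c = e / (real CARD('n) * real CARD('n) + 1)"
 have c: "0 < c" using e by (simp add: c_def add_nonneg_pos)
 define good where "good i j dl <=> 0 < dl & (ALL d. d tagged_division_of {a..b} & (%x. ball x dl) fine d -->
   abs((\<Sum>(x, J)\<in>d. (ee (Sup J) $ i $ j - ee (Inf J) $ i $ j) * ph x $ j) - I i j) < c)" for i j dl
 have "EX dl. good i j dl" for i j using comp c unfolding has_RS_def good_def by blast
 then obtain dl where "!!i j. good i j (dl i j)" by metis
 then have dl: "!!i j. 0 < dl i j" "!!i j d. d tagged_division_of {a..b} ==> (%x. ball x (dl i j)) fine d ==>
   abs((\<Sum>(x, J)\<in>d. (ee (Sup J) $ i $ j - ee (Inf J) $ i $ j) * ph x $ j) - I i j) < c"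
  unfolding good_def by blast+
 define dl0 where "dl0 = Min (range (%(i, j). dl i j))"
 have dl0: "0 < dl0" "!!i j. dl0 <= dl i j"
 proof -
  show "0 < dl0" unfolding dl0_def using dl(1) by (subst Min_gr_iff) auto
  show "dl0 <= dl i j" for i j unfolding dl0_def by (rule Min_le) (auto intro: range_eqI[of _ _ "(i, j)"])
 qed
 have "norm ((\<Sum>(x, J)\<in>d. (ee (Sup J) - ee (Inf J)) *v ph x) - (\<chi> i. SUM j:UNIV. I i j)) < e"
  if d: "d tagged_division_of {a..b}" "(%x. ball x dl0) fine d" for d
 proof -
  have f: "(%x. ball x (dl i j)) fine d" for i j
   by (rule fine_ball_mono[OF d(2) dl0(2)])
  let ?S = "%i j. (\<Sum>(x, J)\<in>d. (ee (Sup J) $ i $ j - ee (Inf J) $ i $ j) * ph x $ j)"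
  have comp: "((\<Sum>(x, J)\<in>d. (ee (Sup J) - ee (Inf J)) *v ph x) - (\<chi> i. SUM j:UNIV. I i j)) $ i = (SUM j:UNIV. ?S i j - I i j)" for i
  proof -
   have "(\<Sum>(x, J)\<in>d. (ee (Sup J) - ee (Inf J)) *v ph x) $ i = (\<Sum>z\<in>d. SUM j:UNIV. (ee (Sup (snd z)) $ i $ j - ee (Inf (snd z)) $ i $ j) * ph (fst z) $ j)"
   by (simp add: split_beta matrix_vector_mult_def)
   also have "... = (SUM j:UNIV. ?S i j)" unfolding split_beta by (rule sum.swap)
   finally show ?thesis by (simp add: sum_subtractf)
  qed
  have "norm ((\<Sum>(x, J)\<in>d. (ee (Sup J) - ee (Inf J)) *v ph x) - (\<chi> i. SUM j:UNIV. I i j)) <=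
   (SUM i:UNIV. abs(SUM j:UNIV. ?S i j - I i j))"
   unfolding comp[symmetric] by (rule norm_le_l1_cart)
  also have "... <= (\<Sum>i\<in>(UNIV::'n set). \<Sum>j\<in>(UNIV::'n set). c)"
  proof (rule sum_mono)
   fix i :: 'n
   have "abs(SUM j:UNIV. ?S i j - I i j) <= (SUM j:UNIV. abs(?S i j - I i j))" by (rule sum_abs)
   also have "... <= (\<Sum>j\<in>(UNIV::'n set). c)" using dl(2)[OF d(1) f] by (intro sum_mono less_imp_le)
   finally show "abs(SUM j:UNIV. ?S i j - I i j) <= (\<Sum>j\<in>(UNIV::'n set). c)" .
  qed
  also have "... = real CARD('n) * real CARD('n) * c" by simp
  also have "... < (real CARD('n) * real CARD('n) + 1) * c" using c by (simp add: distrib_right)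
  also have "... = e" unfolding c_def by (simp add: add_nonneg_eq_0_iff)
  finally show ?thesis .
 qed
 then show "\<exists>dl>0. ALL d. d tagged_division_of {a..b} & (%x. ball x dl) fine d -->
   norm ((\<Sum>(x, J)\<in>d. (ee (Sup J) - ee (Inf J)) *v ph x) - (\<chi> i. SUM j:UNIV. I i j)) < e"
  using dl0(1) by blast
qed

lemma has_RS_integral_unique:
 assumes "has_RS_integral a b ee ph I" "has_RS_integral a b ee ph J"
 shows "I = J"
proof (rule ccontr)
 assume "I ~= J"
 define e where "e = norm (I - J) / 2"
 have e: "0 < e" using \<open>I ~= J\<close> by (simp add: e_def)
 let ?S = "%d. (\<Sum>(x, K)\<in>d. (ee (Sup K) - ee (Inf K)) *v ph x)"
 obtain dl1 where dl1: "0 < dl1" "!!d. d tagged_division_of {a..b} ==> (%x. ball x dl1) fine d ==> norm (?S d - I) < e"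
  using assms(1) e unfolding has_RS_integral_def by meson
 obtain dl2 where dl2: "0 < dl2" "!!d. d tagged_division_of {a..b} ==> (%x. ball x dl2) fine d ==> norm (?S d - J) < e"
  using assms(2) e unfolding has_RS_integral_def by meson
 have "gauge (%x::real. ball x (min dl1 dl2))" using dl1 dl2 by (intro gauge_ball) simp
 from fine_division_exists_real[OF this, of a b] obtain d where d: "d tagged_division_of {a..b}" "(%x. ball x (min dl1 dl2)) fine d"
  by blast
 have f: "(%x. ball x dl1) fine d" "(%x. ball x dl2) fine d" using fine_ball_mono[OF d(2)] by simp_all
 have "norm (I - J) <= norm (?S d - I) + norm (?S d - J)"
  using norm_triangle_ineq4[of "?S d - J" "?S d - I"] by simp
 also have "... < e + e" by (intro add_strict_mono dl1(2)[OF d(1) f(1)] dl2(2)[OF d(1) f(2)])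
 finally show False by (simp add: e_def)
qed

lemma RS_integral_componentwise:
 fixes ee :: "real => real^'n^'n"
 assumes "!!i j. has_RS a b (%t. ee t $ i $ j) (%t. ph t $ j) (I i j)"
 shows "RS_integral a b ee ph $ i = (SUM j:UNIV. I i j)"
proof -
 have "RS_integral a b ee ph = (\<chi> i. SUM j:UNIV. I i j)"
  unfolding RS_integral_def
  by (rule the_equality) (use has_RS_integral_componentwise[OF assms] has_RS_integral_unique in blast)+
 then show ?thesis by simp
qed

section \<open>Positivity forces monotone entries\<close>

text \<open>Smooth approximations of the indicator of \<open>[x, y)\<close>, converging also at the end points.\<close>

definition logistic :: "real => real" where
 "logistic z = 1 / (1 + exp (- z))"

definition ramp :: "nat => real => real => real" where
 "ramp k x t = logistic (real k * real k * (t - x) + real k)"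

lemma logistic_bounds: "0 <= logistic z" "logistic z <= 1"
 by (simp_all add: logistic_def add_pos_nonneg divide_le_eq add_nonneg_nonneg)
lemma logistic_mono: "z <= z' ==> logistic z <= logistic z'"
 unfolding logistic_def by (intro frac_le) (simp_all add: add_pos_pos)

lemma ramp_tendsto: "(%k. ramp k x t) ----> indicator {x..} t"
proof (cases "x <= t")
 case True
 have "(%k. logistic (real k)) ----> 1" unfolding logistic_def by real_asymp
 then have "(%k. ramp k x t) ----> 1"
 proof (rule tendsto_sandwich[OF _ _ _ tendsto_const[of 1], rotated 2])
  show "\<forall>\<^sub>F k in sequentially. logistic (real k) <= ramp k x t"
   unfolding ramp_def using True by (intro always_eventually allI logistic_mono) simp
  show "\<forall>\<^sub>F k in sequentially. ramp k x t <= 1" by (simp add: ramp_def logistic_bounds)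
 qed
 then show ?thesis using True by simp
next
 case False
 define c where "c = x - t"
 have c: "0 < c" using False by (simp add: c_def)
 have "(%k. logistic (real k - real k * real k * c)) ----> 0" unfolding logistic_def using c by real_asymp
 moreover have "real k * real k * (t - x) + real k = real k - real k * real k * c" for k
  by (simp add: c_def algebra_simps)
 ultimately show ?thesis using False by (simp add: ramp_def)
qed

lemma ramp_deriv:
 "((%t. ramp k x t) has_real_derivative real k * real k * exp (- (real k * real k * (t - x) + real k)) / (1 + exp (- (real k * real k * (t - x) + real k)))\<^sup>2) (at t)"
proof -
 have pos: "1 + exp z ~= 0" for z :: real using exp_gt_zero[of z] by linarith
 show ?thesis unfolding ramp_def logistic_def
  by (rule derivative_eq_intros refl pos | simp add: power2_eq_square)+
qed

lemma smooth_in_W1p: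
 fixes ph :: "real => real" and j :: "'n::finite"
 assumes ab: "a < b" and p: "1 <= p" and d: "!!t. (ph has_real_derivative ph' t) (at t)" and c: "continuous_on UNIV ph'"
 shows "(%t. \<chi> i. if i = j then ph t else 0) : W1p p a b"
proof -
 have c0: "continuous_on UNIV ph" by (intro continuous_at_imp_continuous_on ballI DERIV_isCont[OF d])
 have fin: "powint p {a<..<b} q < infinity" if q: "continuous_on UNIV q" for q
 proof -
  obtain B where B: "!!t. t : {a..b} ==> abs(q t) <= B"
   using continuous_on_Icc_bounded[OF continuous_on_subset[OF q subset_UNIV]] by blast
  have "powint p {a<..<b} q <= powint p {a<..<b} (%_. B)"
   by (rule powint_mono) (use p B in \<open>auto intro!: AE_I2 order_trans[OF _ abs_ge_self]\<close>)
  then show ?thesis using powint_const_finite by (rule le_less_trans)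
 qed
 let ?F = "%q (i::'n) t. if i = j then q t else (0::real)"
 have m: "?F q i : Borel" if "continuous_on UNIV q" for q i
  using borel_measurable_continuous_onI[OF that] by (cases "i = j") auto
 have f: "powint p {a<..<b} (?F q i) < infinity" if "continuous_on UNIV q" for q i
  using fin[OF that] by (cases "i = j") (auto simp: powint_def)
 show ?thesis
 proof (rule W1pI[OF ab p vec_lambda_in_Lp[OF p m[OF c0] f[OF c0]] rep_vec_lambda[OF m[OF c0]] vec_lambda_in_Lp[OF p m[OF c] f[OF c]] rep_vec_lambda[OF m[OF c]]])
  fix i
  have "ph x = ph a + ivl a x ph'" if "x : {a<..<b}" for x
   using that d by (subst ivl_FTC[of _ _ ph]) (auto intro: continuous_on_subset[OF c])
  then show "AE x\<in>{a<..<b} in lborel. (if i = j then ph x else 0) = (if i = j then ph a else 0) + ivl a x (%t. if i = j then ph' t else 0)"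
   by (intro AE_I2) (auto simp: ivl_def)
 qed
qed

lemma positive_delay_op_mono:
 fixes ee :: "real => real^'n^'n"
 assumes p: "1 <= p" and r: "0 < r" and BV: "bounded_variation_on (-r) 0 ee"
  and left: "!!te. te : {-r<..0} ==> continuous (at_left te) ee" and pos: "positive_delay_op p r ee"
 shows "left_monotone (-r) 0 (%t. ee t $ i $ j)"
proof
 show r': "- r < 0" using r by simp
 have left': "continuous (at_left x) (%t. ee t $ i $ j)" if "- r < x" "x <= 0" for x i j
  using left[of x] that by (auto intro!: tendsto_vec_nth simp: continuous_within)
 then show "continuous (at_left x) (%t. ee t $ i $ j)" if "- r < x" "x <= 0" for x using that by blast
 obtain B where B: "!!d. d division_of {-r..0} ==> (\<Sum>J\<in>d. norm (ee (Sup J) - ee (Inf J))) <= B"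
  using BV unfolding bounded_variation_on_def by blast
 have B': "(\<Sum>J\<in>d. abs(ee (Sup J) $ i $ j - ee (Inf J) $ i $ j)) <= B" if "d division_of {-r..0}" for d i j
 proof -
  have "abs(ee (Sup J) $ i $ j - ee (Inf J) $ i $ j) <= norm (ee (Sup J) - ee (Inf J))" for J
   using component_le_norm_cart[of "(ee (Sup J) - ee (Inf J)) $ i" j] Finite_Cartesian_Product.norm_nth_le[of "ee (Sup J) - ee (Inf J)" i] by simp
  then have "(\<Sum>J\<in>d. abs(ee (Sup J) $ i $ j - ee (Inf J) $ i $ j)) <= (\<Sum>J\<in>d. norm (ee (Sup J) - ee (Inf J)))"
   by (intro sum_mono)
  then show ?thesis using B[OF that] by linarith
 qed
 have "EX P Q. left_monotone (-r) 0 P & left_monotone (-r) 0 Q & (\<forall>t\<in>{-r..0}. ee t $ i $ j = P t - Q t)" for i j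
  by (rule Jordan_decomposition[OF r' left' B']) blast+
 then obtain P Q where P: "!!i j. left_monotone (-r) 0 (P i j)" and Q: "!!i j. left_monotone (-r) 0 (Q i j)"
  and eq: "!!i j t. t : {-r..0} ==> ee t $ i $ j = P i j t - Q i j t" by metis
 define I :: "(real => real) => (real => real) => real" where "I R ph = (\<integral>sv. indicator {0 - 0<..0 - - r} sv * ph (0 - sv) \<partial>delay_measure (-r) 0 0 R)" for R ph
 have RS: "has_RS (-r) 0 (%t. ee t $ i $ j) ph (I (P i j) ph - I (Q i j) ph)" if "continuous_on {-r..0} ph" for i j ph
 proof -
  have "has_RS (-r) 0 (%t. P i j t - Q i j t) ph (I (P i j) ph - I (Q i j) ph)"
   unfolding I_def by (intro has_RS_diff left_monotone.has_RS_delay_measure P Q that)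
  moreover have "(\<Sum>(x, J)\<in>d. (ee (Sup J) $ i $ j - ee (Inf J) $ i $ j) * ph x)
   = (\<Sum>(x, J)\<in>d. (P i j (Sup J) - Q i j (Sup J) - (P i j (Inf J) - Q i j (Inf J))) * ph x)"
   if d: "d tagged_division_of {-r..0}" for d
  proof (rule sum.cong[OF refl], clarify)
   fix x J assume xJ: "(x, J) : d"
   obtain u v where uv: "J = {u..v}" using tagged_division_ofD(4)[OF d xJ] by auto
   have "x : J" "J \<subseteq> {-r..0}" using tagged_division_ofD(2,3)[OF d xJ] by auto
   then have "u <= v" "u : {-r..0}" "v : {-r..0}" using uv by auto
   then show "(ee (Sup J) $ i $ j - ee (Inf J) $ i $ j) * ph x = (P i j (Sup J) - Q i j (Sup J) - (P i j (Inf J) - Q i j (Inf J))) * ph x"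
   using uv by (simp add: eq)
  qed
  ultimately show ?thesis unfolding has_RS_def by simp
 qed
 fix x y assume xy: "- r <= x" "x <= y" "y <= 0"
 define ph where "ph k t = ramp k x t - ramp k y t" for k t
 define ph' where "ph' k t = real k * real k * exp (- (real k * real k * (t - x) + real k)) / (1 + exp (- (real k * real k * (t - x) + real k)))\<^sup>2
   - real k * real k * exp (- (real k * real k * (t - y) + real k)) / (1 + exp (- (real k * real k * (t - y) + real k)))\<^sup>2" for k t
 have d: "(ph k has_real_derivative ph' k t) (at t)" for k t
  unfolding ph_def[abs_def] ph'_def by (intro DERIV_diff ramp_deriv)
 have pos1: "1 + exp z ~= 0" for z :: real using exp_gt_zero[of z] by linarith
 have c: "continuous_on UNIV (ph' k)" for k unfolding ph'_def by (intro continuous_intros) (use pos1 in auto)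
 have cph: "continuous_on S (ph k)" for k S by (intro continuous_at_imp_continuous_on ballI DERIV_isCont[OF d])
 have nonneg: "0 <= ph k t" for k t
  unfolding ph_def ramp_def using xy by (simp add: logistic_mono mult_left_mono)
 have "0 <= I (P i j) (ph k) - I (Q i j) (ph k)" for k
 proof -
  define f where "f = (%t. \<chi> l. if l = j then ph k t else 0)"
  have cF: "continuous_on {-r..0} (%t. if l = j then ph k t else 0)" for l by (cases "l = j") (simp_all add: cph)
  have fF: "AE x\<in>{-r<..<0} in lborel. f x $ l = (if l = j then ph k x else 0)" for l by (simp add: f_def)
  have W: "f : W1p p (-r) 0" unfolding f_def by (rule smooth_in_W1p[OF r' p d c])
  have "ae_nonneg (-r) 0 f" by (simp add: ae_nonneg_def f_def less_eq_vec_def nonneg)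
  then have "0 <= delay_op r ee f" using pos W unfolding positive_delay_op_def by blast
  then have "0 <= RS_integral (-r) 0 ee (cont_rep (-r) 0 f) $ i" by (simp add: delay_op_def less_eq_vec_def)
  also have "... = (SUM l:UNIV. I (P i l) (%t. cont_rep (-r) 0 f t $ l) - I (Q i l) (%t. cont_rep (-r) 0 f t $ l))"
  proof (rule RS_integral_componentwise, rule RS)
   fix i l
   show "continuous_on {-r..0} (%t. cont_rep (-r) 0 f t $ l)"
   proof -
   have "continuous_on {-r..0} (cont_rep (-r) 0 f)"
   by (rule cont_rep_eq(1)[OF r' fF cF])
   then show ?thesis by (intro continuous_intros)
   qed
  qed
  also have "... = (SUM l:UNIV. if l = j then I (P i j) (ph k) - I (Q i j) (ph k) else 0)"
  proof (rule sum.cong[OF refl])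
   fix l
   have cr: "cont_rep (-r) 0 f t $ l = (if l = j then ph k t else 0)" if "t : {-r..0}" for t
   by (rule cont_rep_eq(2)[OF r' fF cF that])
   have "I R (%t. cont_rep (-r) 0 f t $ l) = I R (%t. if l = j then ph k t else 0)" for R
   unfolding I_def
   proof (rule integral_cong_all[OF refl])
   fix sv :: real
   show "indicator {0 - 0<..0 - - r} sv * cont_rep (-r) 0 f (0 - sv) $ l
   = indicator {0 - 0<..0 - - r} sv * (if l = j then ph k (0 - sv) else 0)"
   proof (cases "sv : {0 - 0<..0 - - r}")
   case True
   then have "0 - sv : {-r..0}" by simp
   from cr[OF this] show ?thesis by simp
   next
   case False
   then have "indicator {0 - 0<..0 - - r} sv = (0::real)" by (rule indicator_simps(2))
   then show ?thesis by simp
   qed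
   qed
   then show "I (P i l) (%t. cont_rep (-r) 0 f t $ l) - I (Q i l) (%t. cont_rep (-r) 0 f t $ l)
   = (if l = j then I (P i j) (ph k) - I (Q i j) (ph k) else 0)"
   by (auto simp: I_def)
  qed
  finally show ?thesis by simp
 qed
 moreover have lim: "(%k. I R (ph k)) ----> R y - R x" if R: "left_monotone (-r) 0 R" for R
 proof -
  interpret left_monotone "-r" 0 R by (rule R)
  interpret finite_measure "delay_measure (-r) 0 0 R" by (rule finite_delay_measure)
  have [measurable]: "ph k : Borel" for k by (rule borel_measurable_continuous_onI[OF cph])
  have "(%k. I R (ph k)) ----> (\<integral>sv. indicator {0<..r} sv * (indicator {x..} (-sv) - indicator {y..} (-sv)) \<partial>delay_measure (-r) 0 0 R)"
   unfolding I_def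
  proof (rule integral_dominated_convergence[where w="%_. 1"])
   show "AE sv in delay_measure (-r) 0 0 R. (%k. indicator {0 - 0<..0 - - r} sv * ph k (0 - sv)) ---->
   indicator {0<..r} sv * (indicator {x..} (-sv) - indicator {y..} (-sv))"
   unfolding ph_def by (intro AE_I2) (auto intro!: tendsto_intros ramp_tendsto simp del: indicator_simps)
   show "AE sv in delay_measure (-r) 0 0 R. norm (indicator {0 - 0<..0 - - r} sv * ph k (0 - sv)) <= 1" for k
   proof (rule AE_I2)
   fix sv
   have "ph k (0 - sv) <= 1"
   using logistic_bounds(2)[of "real k * real k * (0 - sv - x) + real k"] logistic_bounds(1)[of "real k * real k * (0 - sv - y) + real k"]
   unfolding ph_def ramp_def by linarith
   then show "norm (indicator {0 - 0<..0 - - r} sv * ph k (0 - sv)) <= 1"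
   using nonneg[of k "0 - sv"] by (auto split: split_indicator)
   qed
  qed auto
  also have "(\<integral>sv. indicator {0<..r} sv * (indicator {x..} (-sv) - indicator {y..} (-sv)) \<partial>delay_measure (-r) 0 0 R)
   = (\<integral>sv. (indicator {-y<..-x} sv :: real) \<partial>delay_measure (-r) 0 0 R)"
  proof (rule integral_cong_AE)
   show "AE sv in delay_measure (-r) 0 0 R. indicator {0<..r} sv * (indicator {x..} (-sv) - indicator {y..} (-sv)) = (indicator {-y<..-x} sv :: real)"
   using AE_delay_measure[of 0] by eventually_elim (use xy in \<open>auto split: split_indicator\<close>)
  qed measurable
  also have "... = R y - R x" using xy by (simp add: measure_delay_measure clip_def)
  finally show ?thesis .
 qed
 ultimately have "0 <= (P i j y - P i j x) - (Q i j y - Q i j x)"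
  by (intro LIMSEQ_le_const[OF tendsto_diff[OF lim[OF P] lim[OF Q]]]) auto
 then show "ee x $ i $ j <= ee y $ i $ j" using xy by (simp add: eq)
qed

section \<open>The delay equation\<close>

lemma powint_integral_le:
 assumes p: "1 <= p" and c: "c <= d" and [measurable]: "f : Borel"
 shows "ennreal (abs(ivl c d f) powr p) <= ennreal ((d - c) powr (p - 1)) * powint p {c<..<d} f"
proof -
 define M where "M = density lborel (%t. ennreal (indicator {c<..<d} t))"
 have [measurable_cong, simp]: "sets M = sets borel" by (simp add: M_def)
 have "emeasure M (space M) = (\<integral>\<^sup>+t. indicator {c<..<d} t \<partial>lborel)"
  unfolding M_def by (subst emeasure_density) (simp_all add: ennreal_indicator)
 then have mass: "emeasure M (space M) = ennreal (d - c)" using c by simp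
 interpret finite_measure M by (rule finite_measureI) (simp add: mass)
 have m: "measure M (space M) = d - c" using mass c by (simp add: measure_def)
 have 1: "(\<integral>t. f t \<partial>M) = ivl c d f"
 proof -
  have "(\<integral>t. f t \<partial>M) = (\<integral>t. indicator {c<..<d} t * f t \<partial>lborel)"
   unfolding M_def by (subst integral_density) auto
  also have "... = ivl c d f"
  proof -
   have "AE t in lborel. indicator {c<..<d} t * f t = indicator {c..d} t * f t"
   using AE_neq[of c] AE_neq[of d] by eventually_elim (auto split: split_indicator)
   then show ?thesis unfolding ivl_def by (intro integral_cong_AE) simp_all
  qed
  finally show ?thesis .
 qed
 have 2: "(\<integral>\<^sup>+t. ennreal (abs(f t) powr p) \<partial>M) = powint p {c<..<d} f"
  unfolding M_def powint_def by (subst nn_integral_density) (auto intro!: nn_integral_cong split: split_indicator)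
 show ?thesis using Jensen_powr[OF p, of f] by (simp add: 1 2 m)
qed

lemma powint_AE_subseq:
 fixes f :: "nat => real => real"
 assumes p: "1 <= p" and [measurable]: "!!n. f n : Borel" "A : sets borel"
  and lim: "(%n. powint p A (f n)) ----> 0"
 shows "EX r. strict_mono r & (AE x in lborel. x : A --> (%n. f (r n) x) ----> 0)"
proof -
 have "eventually (%n. powint p A (f n) < 1) sequentially" using order_tendstoD(2)[OF lim, of 1] by simp
 then obtain n0 where n0: "!!n. n >= n0 ==> powint p A (f n) < 1" by (auto simp: eventually_sequentially)
 define u where "u n x = indicator A x * abs(f (n + n0) x) powr p" for n x
 have [measurable]: "u n : borel_measurable lborel" for n unfolding u_def[abs_def] by measurable
 have un: "(\<integral>\<^sup>+x. ennreal (norm (u n x)) \<partial>lborel) = powint p A (f (n + n0))" for n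
  unfolding powint_def u_def by (intro nn_integral_cong) (auto split: split_indicator)
 have ui: "integrable lborel (u n)" for n
  by (rule integrableI_bounded) (use un n0[of "n + n0"] in \<open>auto intro: less_trans[of _ 1]\<close>)
 have "(\<integral>x. norm (u n x) \<partial>lborel) = enn2real (powint p A (f (n + n0)))" for n
  using un[of n] by (subst integral_eq_nn_integral) auto
 moreover have "(%n. enn2real (powint p A (f (n + n0)))) ----> 0"
  by (rule tendsto_enn2real) (use LIMSEQ_ignore_initial_segment[OF lim] in simp_all)
 ultimately have "(%n. \<integral>x. norm (u n x) \<partial>lborel) ----> 0" by simp
 from tendsto_L1_AE_subseq[OF ui this]
 obtain r where r: "strict_mono r" "AE x in lborel. (%n. u (r n) x) ----> 0" by blast
 have "AE x in lborel. x : A --> (%n. f (r n + n0) x) ----> 0"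
  using r(2)
 proof eventually_elim
  case (elim x)
  show ?case
  proof
   assume x: "x : A"
   then have "(%n. abs(f (r n + n0) x) powr p) ----> 0" using elim by (simp add: u_def)
   then have "(%n. (abs(f (r n + n0) x) powr p) powr (1 / p)) ----> 0 powr (1 / p)"
   using p by (intro tendsto_powr2 tendsto_const) auto
   moreover have "(abs(f (r n + n0) x) powr p) powr (1 / p) = abs(f (r n + n0) x)" for n
   using p by (simp add: powr_powr)
   ultimately have "(%n. abs(f (r n + n0) x)) ----> 0" using p by simp
   then show "(%n. f (r n + n0) x) ----> 0" by (rule tendsto_rabs_zero_cancel)
  qed
 qed
 moreover have "strict_mono (%n. r n + n0)" using r(1) by (simp add: strict_mono_def)
 ultimately show ?thesis by blast
qed

locale delay_equation =
 fixes p dl :: real and R :: "'n::finite => real" and nv :: "'n => 'n => real measure"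
 assumes p: "1 <= p" and dl: "0 < dl" and dlR: "dl <= R j"
  and sets_nv: "sets (nv i j) = sets borel" and finite_nv: "finite_measure (nv i j)"
  and supp_nv: "AE sv in nv i j. sv : {dl..R j}"
begin
declare sets_nv[measurable_cong, simp]

lemma space_nv[simp]: "space (nv i j) = UNIV"
 using sets_eq_imp_space_eq[OF sets_nv[of i j]] by simp

lemma R_pos: "0 < R j" using dl dlR[of j] by linarith

definition mass :: "'n => 'n => real" where
 "mass i j = measure (nv i j) UNIV"

lemma mass_nonneg: "0 <= mass i j" by (simp add: mass_def)

lemma emeasure_nv: "emeasure (nv i j) UNIV = ennreal (mass i j)"
 unfolding mass_def by (rule finite_measure.emeasure_eq_measure[OF finite_nv])

definition K :: "('n => real => real) => 'n => real => real" where
 "K b i t = (SUM j:UNIV. \<integral>sv. b j (t - sv) \<partial>nv i j)"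

definition en :: "('n => real => real) => ennreal" where
 "en b = (SUM j:UNIV. powint p {- R j<..<0} (b j))"

definition sol :: "('n => real => real) => bool" where
 "sol b <=> (ALL j. b j : Borel) & en b < infinity & (ALL i. AE t in lborel. 0 < t --> b i t = K b i t)"

lemma sol_meas: "sol b ==> b j : Borel"
 and sol_en: "sol b ==> en b < infinity"
 and sol_eq: "sol b ==> AE t in lborel. 0 < t --> b i t = K b i t"
 by (simp_all add: sol_def)
lemma powint_le_en: "powint p {- R j<..<0} (b j) <= en b"
 unfolding en_def by (rule member_le_sum) auto

lemma en_finite_iff: "en b < infinity <=> (ALL j. powint p {- R j<..<0} (b j) < infinity)"
 by (simp add: en_def less_top[symmetric])
lemma en_cong_AE: "(!!j. AE s\<in>{- R j<..<0} in lborel. b j s = c j s) ==> en b = en c"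
 unfolding en_def by (intro sum.cong refl powint_cong_AE)

lemma en_add:
 assumes "!!j. b j : Borel" "!!j. c j : Borel"
 shows "en (%j s. b j s + c j s) <= ennreal (2 powr (p - 1)) * (en b + en c)"
proof -
 have "en (%j s. b j s + c j s) <= (SUM j:UNIV. ennreal (2 powr (p - 1)) * (powint p {- R j<..<0} (b j) + powint p {- R j<..<0} (c j)))"
  unfolding en_def using assms by (intro sum_mono powint_add p) auto
 also have "... = ennreal (2 powr (p - 1)) * (en b + en c)"
  by (simp add: en_def sum_distrib_left[symmetric] sum.distrib)
 finally show ?thesis .
qed

lemma en_cmult:
 assumes "!!j. b j : Borel"
 shows "en (%j s. x * b j s) = ennreal (abs(x) powr p) * en b"
 unfolding en_def using assms by (simp add: powint_cmult sum_distrib_left)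

lemma en_diff:
 assumes "!!j. b j : Borel" "!!j. c j : Borel"
 shows "en (%j s. b j s - c j s) <= ennreal (2 powr (p - 1)) * (en b + en c)"
proof -
 have "en (%j s. - c j s) = en c" by (simp add: en_def powint_minus)
 then show ?thesis using en_add[of b "%j s. - c j s"] assms by simp
qed

lemma en_tendsto_0:
 assumes "!!j. ((%h. powint p {- R j<..<0} (f h j)) ---> 0) F"
 shows "((%h. en (f h)) ---> 0) F"
proof -
 have "((%h. SUM j:UNIV. powint p {- R j<..<0} (f h j)) ---> (\<Sum>j\<in>(UNIV::'n set). 0)) F"
  by (intro tendsto_sum assms)
 then show ?thesis by (simp add: en_def)
qed

lemma sigma_finite_nv: "sigma_finite_measure (nv i j)"
 using finite_nv by (rule finite_measure.axioms(1))

lemma pair_nv: "pair_sigma_finite lborel (nv i j)"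
 using sigma_finite_nv by (simp add: pair_sigma_finite_def lborel.sigma_finite_measure_axioms)

lemma integral_nv_measurable:
 fixes g :: "real => real"
 assumes [measurable]: "g : Borel"
 shows "(%t. \<integral>sv. g (t - sv) \<partial>nv i j) : Borel"
proof -
 interpret sigma_finite_measure "nv i j" by (rule sigma_finite_nv)
 show ?thesis by measurable
qed

lemma K_measurable:
 assumes "!!j. b j : Borel"
 shows "K b i : Borel"
 unfolding K_def[abs_def] by (intro borel_measurable_sum integral_nv_measurable assms)

text \<open>The weighted form of Jensen's inequality that couples the components.\<close>

lemma K_powr_le:
 assumes b[measurable]: "!!j. b j : Borel" and w: "!!j. 0 < w j" and ka: "0 < ka"
  and H: "(SUM j:UNIV. mass i j * w j) <= ka * w i"
 shows "ennreal (abs(K b i t) powr p) <= ennreal ((ka * w i) powr (p - 1)) *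
  (SUM j:UNIV. ennreal (w j powr (1 - p)) * (\<integral>\<^sup>+sv. ennreal (abs(b j (t - sv)) powr p) \<partial>nv i j))"
proof -
 define x where "x j = (\<integral>sv. b j (t - sv) \<partial>nv i j)" for j
 define te where "te j = mass i j * w j" for j
 define y where "y j = (if mass i j = 0 then 0 else abs(x j) / te j)" for j
 have J: "ennreal (abs(x j) powr p) <= ennreal (mass i j powr (p - 1)) * (\<integral>\<^sup>+sv. ennreal (abs(b j (t - sv)) powr p) \<partial>nv i j)" for j
  using finite_measure.Jensen_powr[OF finite_nv p, of "%sv. b j (t - sv)" i j] by (simp add: x_def mass_def)
 have x0: "x j = 0" if "mass i j = 0" for j
 proof -
  have "emeasure (nv i j) UNIV = 0" using that by (simp add: emeasure_nv)
  then have "AE sv in nv i j. b j (t - sv) = 0" by (intro AE_I[where N=UNIV]) auto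
  then show ?thesis unfolding x_def by (rule integral_eq_zero_AE)
 qed
 have te: "0 <= te j" for j by (simp add: te_def mass_nonneg less_imp_le w)
 have tey: "te j * y j = abs(x j)" for j using x0[of j] w[of j] by (simp add: y_def te_def)
 have y: "0 <= y j" for j using te by (simp add: y_def)
 have est: "ennreal (te j * y j powr p) <= ennreal (w j powr (1 - p)) * (\<integral>\<^sup>+sv. ennreal (abs(b j (t - sv)) powr p) \<partial>nv i j)" for j
 proof (cases "mass i j = 0")
  case False
  then have m: "0 < mass i j" using mass_nonneg[of i j] by simp
  then have t0: "0 < te j" using w[of j] by (simp add: te_def)
  have "te j * y j powr p = te j powr (1 - p) * abs(x j) powr p"
   using False t0 by (simp add: y_def powr_divide powr_diff)
  also have "te j powr (1 - p) = w j powr (1 - p) * mass i j powr (1 - p)" by (simp add: te_def powr_mult)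
  finally have "ennreal (te j * y j powr p) = ennreal (w j powr (1 - p)) * (ennreal (mass i j powr (1 - p)) * ennreal (abs(x j) powr p))"
   by (simp add: ennreal_mult[symmetric] mult.assoc)
  also have "... <= ennreal (w j powr (1 - p)) * (ennreal (mass i j powr (1 - p)) *
   (ennreal (mass i j powr (p - 1)) * (\<integral>\<^sup>+sv. ennreal (abs(b j (t - sv)) powr p) \<partial>nv i j)))"
   by (intro mult_left_mono J) auto
  also have "... = ennreal (w j powr (1 - p)) * (\<integral>\<^sup>+sv. ennreal (abs(b j (t - sv)) powr p) \<partial>nv i j)"
  proof -
   have "ennreal (mass i j powr (1 - p)) * ennreal (mass i j powr (p - 1)) = 1"
   using m by (simp add: ennreal_mult[symmetric] powr_add[symmetric])
   then show ?thesis by (simp add: mult.assoc[symmetric])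
  qed
  finally show ?thesis .
 qed (simp add: y_def)
 have "abs(K b i t) <= (SUM j:UNIV. te j * y j)" unfolding K_def tey x_def by (rule sum_abs)
 then have "abs(K b i t) powr p <= (SUM j:UNIV. te j * y j) powr p" using p by (intro powr_mono2) auto
 also have "... <= (SUM j:UNIV. te j) powr (p - 1) * (SUM j:UNIV. te j * y j powr p)"
  by (rule weighted_sum_powr_le[OF p te y])
 also have "... <= (ka * w i) powr (p - 1) * (SUM j:UNIV. te j * y j powr p)"
  using H te p by (intro mult_right_mono powr_mono2 sum_nonneg) (auto simp: te_def[abs_def] intro: sum_nonneg)
 finally have "ennreal (abs(K b i t) powr p) <= ennreal ((ka * w i) powr (p - 1) * (SUM j:UNIV. te j * y j powr p))"
  by (rule ennreal_leI)
 also have "... = ennreal ((ka * w i) powr (p - 1)) * (SUM j:UNIV. ennreal (te j * y j powr p))"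
  using te by (subst ennreal_mult) (auto intro!: sum_nonneg simp: sum_ennreal)
 also have "... <= ennreal ((ka * w i) powr (p - 1)) *
   (SUM j:UNIV. ennreal (w j powr (1 - p)) * (\<integral>\<^sup>+sv. ennreal (abs(b j (t - sv)) powr p) \<partial>nv i j))"
  by (intro mult_left_mono sum_mono est) auto
 finally show ?thesis .
qed

definition wint :: "real => real set => (real => real) => ennreal" where
 "wint al A f = (\<integral>\<^sup>+s. ennreal (exp (al * s)) * ennreal (abs(f s) powr p) * indicator A s \<partial>lborel)"

lemma wint_mono_set: "A \<subseteq> B ==> wint al A f <= wint al B f"
 unfolding wint_def by (intro nn_integral_mono) (auto split: split_indicator)

lemma wint_powint_le:
 assumes "!!s. s : A ==> exp (al * s) <= c" "0 <= c" "f : Borel" "A : sets borel"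
 shows "wint al A f <= ennreal c * powint p A f"
 unfolding wint_def powint_def using assms
 by (subst nn_integral_cmult[symmetric]) (auto intro!: nn_integral_mono mult_right_mono ennreal_leI split: split_indicator)
lemma powint_wint_le:
 assumes "!!s. s : A ==> 1 <= c * exp (al * s)" "0 <= c" and [measurable]: "f : Borel" "A : sets borel"
 shows "powint p A f <= ennreal c * wint al A f"
 unfolding wint_def powint_def
proof (subst nn_integral_cmult[symmetric])
 show "(\<integral>\<^sup>+x\<in>A. ennreal (abs(f x) powr p) \<partial>lborel) <=
  (\<integral>\<^sup>+s. ennreal c * (ennreal (exp (al * s)) * ennreal (abs(f s) powr p) * indicator A s) \<partial>lborel)"
 proof (rule nn_integral_mono)
  fix s
  show "ennreal (abs(f s) powr p) * indicator A s <= ennreal c * (ennreal (exp (al * s)) * ennreal (abs(f s) powr p) * indicator A s)"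
  proof (cases "s : A")
   case True
   have "1 * abs(f s) powr p <= (c * exp (al * s)) * abs(f s) powr p" using assms(1)[OF True] by (intro mult_right_mono) auto
   then have "ennreal (abs(f s) powr p) <= ennreal (c * (exp (al * s) * abs(f s) powr p))" by (intro ennreal_leI) (simp add: mult.assoc)
   then show ?thesis using True assms(2) by (simp add: ennreal_mult)
  qed simp
 qed
qed measurable

lemma convolution_estimate:
 assumes [measurable]: "b : Borel" and c: "!!sv. sv : {dl..R j} ==> exp (al * sv) <= c" and c0: "0 <= c"
 shows "(\<integral>\<^sup>+t. ennreal (exp (al * t)) * (\<integral>\<^sup>+sv. ennreal (abs(b (t - sv)) powr p) \<partial>nv i j) * indicator {0<..<T} t \<partial>lborel)
  <= ennreal (c * mass i j) * wint al {- R j<..<T - dl} b"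
proof -
 interpret pair_sigma_finite lborel "nv i j" by (rule pair_nv)
 have "(\<integral>\<^sup>+t. ennreal (exp (al * t)) * (\<integral>\<^sup>+sv. ennreal (abs(b (t - sv)) powr p) \<partial>nv i j) * indicator {0<..<T} t \<partial>lborel)
   = (\<integral>\<^sup>+t. \<integral>\<^sup>+sv. ennreal (exp (al * t)) * ennreal (abs(b (t - sv)) powr p) * indicator {0<..<T} t \<partial>nv i j \<partial>lborel)"
  by (intro nn_integral_cong) (simp add: nn_integral_cmult nn_integral_multc)
 also have "... = (\<integral>\<^sup>+sv. \<integral>\<^sup>+t. ennreal (exp (al * t)) * ennreal (abs(b (t - sv)) powr p) * indicator {0<..<T} t \<partial>lborel \<partial>nv i j)"
  by (rule Fubini'[symmetric]) measurable
 also have "... <= (\<integral>\<^sup>+sv. ennreal c * wint al {- R j<..<T - dl} b \<partial>nv i j)"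
 proof (rule nn_integral_mono_AE)
  show "AE sv in nv i j. (\<integral>\<^sup>+t. ennreal (exp (al * t)) * ennreal (abs(b (t - sv)) powr p) * indicator {0<..<T} t \<partial>lborel)
   <= ennreal c * wint al {- R j<..<T - dl} b"
   using supp_nv[where i=i and j=j]
  proof eventually_elim
   case (elim sv)
   have "(\<integral>\<^sup>+t. ennreal (exp (al * t)) * ennreal (abs(b (t - sv)) powr p) * indicator {0<..<T} t \<partial>lborel)
   = (\<integral>\<^sup>+t. (%s. ennreal (exp (al * (s + sv))) * ennreal (abs(b s) powr p) * indicator {0<..<T} (s + sv)) (t + - sv) \<partial>lborel)"
   by simp
   also have "... = (\<integral>\<^sup>+s. ennreal (exp (al * (s + sv))) * ennreal (abs(b s) powr p) * indicator {0<..<T} (s + sv) \<partial>lborel)"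
   by (rule nn_integral_shift) measurable
   also have "... <= (\<integral>\<^sup>+s. ennreal c * (ennreal (exp (al * s)) * ennreal (abs(b s) powr p) * indicator {- R j<..<T - dl} s) \<partial>lborel)"
   proof (rule nn_integral_mono)
   fix s
   show "ennreal (exp (al * (s + sv))) * ennreal (abs(b s) powr p) * indicator {0<..<T} (s + sv)
   <= ennreal c * (ennreal (exp (al * s)) * ennreal (abs(b s) powr p) * indicator {- R j<..<T - dl} s)"
   proof (cases "s + sv : {0<..<T}")
   case True
   then have s: "s : {- R j<..<T - dl}" using elim by auto
   have "exp (al * (s + sv)) = exp (al * sv) * exp (al * s)" by (simp add: distrib_left exp_add)
   also have "... <= c * exp (al * s)" using c[OF elim] by (intro mult_right_mono) auto
   finally have "exp (al * (s + sv)) * abs(b s) powr p <= (c * exp (al * s)) * abs(b s) powr p" by (intro mult_right_mono) auto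
   then have "ennreal (exp (al * (s + sv)) * abs(b s) powr p) <= ennreal (c * (exp (al * s) * abs(b s) powr p))"
   by (intro ennreal_leI) (simp add: mult.assoc)
   then show ?thesis using True s c0 by (simp add: ennreal_mult)
   qed simp
   qed
   also have "... = ennreal c * wint al {- R j<..<T - dl} b"
   unfolding wint_def by (rule nn_integral_cmult) measurable
   finally show ?case .
  qed
 qed
 also have "... = ennreal (c * mass i j) * wint al {- R j<..<T - dl} b"
  using c0 by (simp add: emeasure_nv ennreal_mult mass_nonneg mult_ac)
 finally show ?thesis .
qed

text \<open>
  The energy estimate. The weights \<open>w\<close> and \<open>q\<close> are test vectors for the coupling matrix and its transpose; together they
  interpolate between \<open>L\<^sup>\<infinity>\<close> and \<open>L\<^sup>1\<close>. What enters at time \<open>t\<close> left the boundary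
  before \<open>t - dl\<close>, which makes the inequality for the energies an iteration.
\<close>

lemma energy_estimate:
 assumes b: "sol b" and w: "!!j. 0 < w j" and q: "!!j. 0 < q j" and ka: "0 < ka"
  and c: "!!sv j. sv : {dl..R j} ==> exp (al * sv) <= c" and c0: "0 <= c"
  and te: "0 <= te" "te < 1"
  and H1: "!!i. (SUM j:UNIV. mass i j * w j) <= ka * w i"
  and H2: "!!j. ka powr (p - 1) * c * (SUM i:UNIV. q i * mass i j) <= te * q j"
  and T: "0 <= T"
 defines "B \<equiv> %T. (SUM j:UNIV. ennreal (q j * w j powr (1 - p)) * wint al {- R j<..<T} (b j))"
 shows "B T <= ennreal (1 / (1 - te)) * B 0"
proof -
 have [measurable]: "b j : Borel" for j by (rule sol_meas[OF b])
 have mono: "B s <= B t" if "s <= t" for s t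
  unfolding B_def using that by (intro sum_mono mult_left_mono wint_mono_set) auto
 have new: "(SUM i:UNIV. ennreal (q i * w i powr (1 - p)) * wint al {0<..<T} (b i)) <= ennreal te * B (T - dl)" for T
 proof -
  let ?X = "%j. wint al {- R j<..<T - dl} (b j)"
  have one: "wint al {0<..<T} (b i) <= ennreal ((ka * w i) powr (p - 1)) * (SUM j:UNIV. ennreal (w j powr (1 - p)) * (ennreal (c * mass i j) * ?X j))" for i
  proof -
   have "wint al {0<..<T} (b i) <= (\<integral>\<^sup>+t. ennreal ((ka * w i) powr (p - 1)) * (SUM j:UNIV. ennreal (w j powr (1 - p)) *
   (ennreal (exp (al * t)) * (\<integral>\<^sup>+sv. ennreal (abs(b j (t - sv)) powr p) \<partial>nv i j) * indicator {0<..<T} t)) \<partial>lborel)"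
   unfolding wint_def
   proof (rule nn_integral_mono_AE)
   show "AE t in lborel. ennreal (exp (al * t)) * ennreal (abs(b i t) powr p) * indicator {0<..<T} t <=
   ennreal ((ka * w i) powr (p - 1)) * (SUM j:UNIV. ennreal (w j powr (1 - p)) *
   (ennreal (exp (al * t)) * (\<integral>\<^sup>+sv. ennreal (abs(b j (t - sv)) powr p) \<partial>nv i j) * indicator {0<..<T} t))"
   using sol_eq[OF b, of i]
   proof eventually_elim
   case (elim t)
   show ?case
   proof (cases "t : {0<..<T}")
   case True
   then have "ennreal (abs(b i t) powr p) = ennreal (abs(K b i t) powr p)" using elim by simp
   also have "... <= ennreal ((ka * w i) powr (p - 1)) *
   (SUM j:UNIV. ennreal (w j powr (1 - p)) * (\<integral>\<^sup>+sv. ennreal (abs(b j (t - sv)) powr p) \<partial>nv i j))"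
   by (rule K_powr_le[OF _ w ka H1]) measurable
   finally have "ennreal (exp (al * t)) * ennreal (abs(b i t) powr p) <= ennreal (exp (al * t)) * (ennreal ((ka * w i) powr (p - 1)) *
   (SUM j:UNIV. ennreal (w j powr (1 - p)) * (\<integral>\<^sup>+sv. ennreal (abs(b j (t - sv)) powr p) \<partial>nv i j)))"
   by (intro mult_left_mono) auto
   then show ?thesis using True by (simp add: sum_distrib_left mult_ac)
   qed simp
   qed
   qed
   also have "... = ennreal ((ka * w i) powr (p - 1)) * (SUM j:UNIV. ennreal (w j powr (1 - p)) *
   (\<integral>\<^sup>+t. ennreal (exp (al * t)) * (\<integral>\<^sup>+sv. ennreal (abs(b j (t - sv)) powr p) \<partial>nv i j) * indicator {0<..<T} t \<partial>lborel))"
   proof -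
   have [measurable]: "(%t. \<integral>\<^sup>+sv. ennreal (abs(b j (t - sv)) powr p) \<partial>nv i j) : Borel" for j
   proof -
   interpret sigma_finite_measure "nv i j" by (rule sigma_finite_nv)
   show ?thesis by (rule borel_measurable_nn_integral) measurable
   qed
   show ?thesis by (simp add: nn_integral_cmult nn_integral_sum)
   qed
   also have "... <= ennreal ((ka * w i) powr (p - 1)) * (SUM j:UNIV. ennreal (w j powr (1 - p)) * (ennreal (c * mass i j) * ?X j))"
   using c0 c by (intro mult_left_mono sum_mono convolution_estimate) auto
   finally show ?thesis .
  qed
  have "(SUM i:UNIV. ennreal (q i * w i powr (1 - p)) * wint al {0<..<T} (b i)) <=
   (SUM i:UNIV. ennreal (q i * w i powr (1 - p)) * (ennreal ((ka * w i) powr (p - 1)) * (SUM j:UNIV. ennreal (w j powr (1 - p)) * (ennreal (c * mass i j) * ?X j))))"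
   by (intro sum_mono mult_left_mono one) auto
  also have "... = (SUM i:UNIV. SUM j:UNIV. ennreal (w j powr (1 - p) * (ka powr (p - 1) * c * (q i * mass i j))) * ?X j)"
  proof (rule sum.cong[OF refl])
   fix i
   have "w i powr (1 - p) * (ka * w i) powr (p - 1) = ka powr (p - 1)"
   using w[of i] by (simp add: powr_mult powr_add[symmetric] mult.left_commute)
   then have e: "q i * w i powr (1 - p) * (ka * w i) powr (p - 1) = q i * ka powr (p - 1)" by (simp add: mult.assoc)
   have "ennreal (q i * w i powr (1 - p)) * (ennreal ((ka * w i) powr (p - 1)) * (SUM j:UNIV. ennreal (w j powr (1 - p)) * (ennreal (c * mass i j) * ?X j)))
   = ennreal (q i * ka powr (p - 1)) * (SUM j:UNIV. ennreal (w j powr (1 - p)) * (ennreal (c * mass i j) * ?X j))"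
   using q[of i] by (simp add: mult.assoc[symmetric] ennreal_mult[symmetric] e)
   also have "... = (SUM j:UNIV. ennreal (w j powr (1 - p) * (ka powr (p - 1) * c * (q i * mass i j))) * ?X j)"
   unfolding sum_distrib_left
   proof (rule sum.cong[OF refl])
   fix j
   have "q i * ka powr (p - 1) * (w j powr (1 - p) * (c * mass i j)) = w j powr (1 - p) * (ka powr (p - 1) * c * (q i * mass i j))"
   by (simp add: mult_ac)
   then show "ennreal (q i * ka powr (p - 1)) * (ennreal (w j powr (1 - p)) * (ennreal (c * mass i j) * ?X j))
   = ennreal (w j powr (1 - p) * (ka powr (p - 1) * c * (q i * mass i j))) * ?X j"
   using less_imp_le[OF q[of i]] c0 mass_nonneg[of i j]
   by (simp only: mult.assoc[symmetric] ennreal_mult[symmetric] mult_nonneg_nonneg powr_ge_zero)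
   qed
   finally show "ennreal (q i * w i powr (1 - p)) * (ennreal ((ka * w i) powr (p - 1)) * (SUM j:UNIV. ennreal (w j powr (1 - p)) * (ennreal (c * mass i j) * ?X j)))
   = (SUM j:UNIV. ennreal (w j powr (1 - p) * (ka powr (p - 1) * c * (q i * mass i j))) * ?X j)" .
  qed
  also have "... = (SUM j:UNIV. SUM i:UNIV. ennreal (w j powr (1 - p) * (ka powr (p - 1) * c * (q i * mass i j))) * ?X j)"
   by (rule sum.swap)
  also have "... = (SUM j:UNIV. ennreal (w j powr (1 - p) * (ka powr (p - 1) * c * (SUM i:UNIV. q i * mass i j))) * ?X j)"
   using less_imp_le[OF q] c0 mass_nonneg
   by (simp add: sum_distrib_right[symmetric] sum_distrib_left[symmetric])
  also have "... <= (SUM j:UNIV. ennreal (te * (q j * w j powr (1 - p))) * ?X j)"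
  proof (intro sum_mono mult_right_mono ennreal_leI)
   fix j
   have "w j powr (1 - p) * (ka powr (p - 1) * c * (SUM i:UNIV. q i * mass i j)) <= w j powr (1 - p) * (te * q j)"
   by (intro mult_left_mono H2) auto
   then show "w j powr (1 - p) * (ka powr (p - 1) * c * (SUM i:UNIV. q i * mass i j)) <= te * (q j * w j powr (1 - p))"
   by (simp add: mult_ac)
  qed auto
  also have "... = ennreal te * B (T - dl)"
   unfolding B_def sum_distrib_left using te less_imp_le[OF q] by (intro sum.cong refl) (simp add: ennreal_mult mult.assoc)
  finally show ?thesis .
 qed
 have split: "B T <= B 0 + ennreal te * B (T - dl)" for T
 proof -
  have "wint al {- R j<..<T} (b j) <= wint al {- R j<..<0} (b j) + wint al {0<..<T} (b j)" for j
  proof -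
   have "wint al {- R j<..<T} (b j) <= (\<integral>\<^sup>+s. ennreal (exp (al * s)) * ennreal (abs(b j s) powr p) * indicator {- R j<..<0} s
   + ennreal (exp (al * s)) * ennreal (abs(b j s) powr p) * indicator {0<..<T} s \<partial>lborel)"
   unfolding wint_def
   proof (rule nn_integral_mono_AE)
   show "AE s in lborel. ennreal (exp (al * s)) * ennreal (abs(b j s) powr p) * indicator {- R j<..<T} s <=
   ennreal (exp (al * s)) * ennreal (abs(b j s) powr p) * indicator {- R j<..<0} s
   + ennreal (exp (al * s)) * ennreal (abs(b j s) powr p) * indicator {0<..<T} s"
   using AE_neq[of 0] by eventually_elim (auto split: split_indicator)
   qed
   also have "... = wint al {- R j<..<0} (b j) + wint al {0<..<T} (b j)"
   unfolding wint_def by (rule nn_integral_add) measurable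
   finally show ?thesis .
  qed
  then have "B T <= (SUM j:UNIV. ennreal (q j * w j powr (1 - p)) * (wint al {- R j<..<0} (b j) + wint al {0<..<T} (b j)))"
   unfolding B_def by (intro sum_mono mult_left_mono) auto
  also have "... = B 0 + (SUM i:UNIV. ennreal (q i * w i powr (1 - p)) * wint al {0<..<T} (b i))"
   by (simp add: B_def distrib_left sum.distrib)
  also have "... <= B 0 + ennreal te * B (T - dl)" by (intro add_left_mono new)
  finally show ?thesis .
 qed
 have C: "1 <= 1 / (1 - te)" "1 + te * (1 / (1 - te)) = 1 / (1 - te)" using te by (auto simp: field_simps)
 have iter: "B (real k * dl) <= ennreal (1 / (1 - te)) * B 0" for k
 proof (induction k)
  case 0
  have "1 * B 0 <= ennreal (1 / (1 - te)) * B 0" using C(1) by (intro mult_right_mono) auto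
  then show ?case by simp
 next
  case (Suc k)
  have "B (real (Suc k) * dl) <= B 0 + ennreal te * B (real k * dl)"
   using split[of "real (Suc k) * dl"] by (simp add: algebra_simps)
  also have "... <= B 0 + ennreal te * (ennreal (1 / (1 - te)) * B 0)"
   by (intro add_left_mono mult_left_mono Suc) auto
  also have "... = ennreal (1 + te * (1 / (1 - te))) * B 0"
   using te by (simp add: ennreal_mult distrib_right mult.assoc del: times_divide_eq_right)
  also have "... = ennreal (1 / (1 - te)) * B 0" unfolding C(2) ..
  finally show ?case .
 qed
 obtain k :: nat where "T <= real k * dl" using reals_Archimedean3[OF dl] less_imp_le by blast
 then show ?thesis using mono[of T "real k * dl"] iter[of k] by (meson order_trans)
qed
end

context delay_equation begin

lemma R_le_sum: "R j <= sum R UNIV"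
 by (rule member_le_sum) (auto intro: less_imp_le R_pos)

text \<open>
  Translated states inherit the growth or decay rate of the energy, because on a history interval of bounded length
  the exponential weight is comparable to a constant.
\<close>

lemma state_bound_weighted:
 assumes w: "!!j. 0 < w j" and q: "!!j. 0 < q j" and ka: "0 < ka"
  and c: "!!sv j. sv : {dl..R j} ==> exp (al * sv) <= c" and c0: "0 <= c" and te: "0 <= te" "te < 1"
  and H1: "!!i. (SUM j:UNIV. mass i j * w j) <= ka * w i"
  and H2: "!!j. ka powr (p - 1) * c * (SUM i:UNIV. q i * mass i j) <= te * q j"
 shows "\<exists>C\<ge>0. ALL b t. sol b --> 0 <= t --> en (%j s. b j (t + s)) <= ennreal (C * exp (- al * t)) * en b"
proof -
 define m where "m j = q j * w j powr (1 - p)" for j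
 have m: "0 < m j" for j using q[of j] w[of j] by (simp add: m_def)
 define e where "e = exp (abs(al) * sum R UNIV)"
 have e: "0 < e" by (simp add: e_def)
 define C where "C = (SUM j:UNIV. 1 / m j) * e * (1 / (1 - te)) * ((SUM j:UNIV. m j) * e)"
 have m1: "0 <= (SUM j:UNIV. 1 / m j)" "0 <= (SUM j:UNIV. m j)" by (intro sum_nonneg, simp add: less_imp_le m)+
 have C: "0 <= C" unfolding C_def using m1 e te by (intro mult_nonneg_nonneg) auto
 have bound: "en (%j s. b j (t + s)) <= ennreal (C * exp (- al * t)) * en b" if b: "sol b" and t: "0 <= t" for b t
 proof -
  have [measurable]: "b j : Borel" for j by (rule sol_meas[OF b])
  define B where "B T = (SUM j:UNIV. ennreal (m j) * wint al {- R j<..<T} (b j))" for T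
  define x where "x = e * exp (- al * t)"
  have x: "0 <= x" using e by (simp add: x_def)
  have one: "powint p {- R j<..<0} (%s. b j (t + s)) <= ennreal (1 / m j * x) * B t" for j
  proof -
   have "powint p {- R j<..<0} (%s. b j (t + s)) = powint p {- R j + t<..<0 + t} (b j)"
   using powint_shift[of "b j" p "- R j" 0 t] by (simp add: add.commute)
   also have "... <= ennreal x * wint al {- R j + t<..<0 + t} (b j)"
   proof (rule powint_wint_le)
   fix s assume s: "s : {- R j + t<..<0 + t}"
   have "- (al * (s - t)) <= abs(al) * abs(s - t)" by (metis abs_ge_minus_self abs_mult)
   also have "... <= abs(al) * sum R UNIV" using s R_le_sum[of j] by (intro mult_left_mono) auto
   finally have "0 <= abs(al) * sum R UNIV + - al * t + al * s" by (simp add: algebra_simps)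
   then show "1 <= x * exp (al * s)" by (simp add: x_def e_def exp_add[symmetric])
   qed (use x in auto)
   also have "... <= ennreal x * wint al {- R j<..<t} (b j)"
   using t by (intro mult_left_mono wint_mono_set) auto
   also have "... = ennreal (1 / m j * x) * (ennreal (m j) * wint al {- R j<..<t} (b j))"
   using m[of j] x by (simp add: mult.assoc[symmetric] ennreal_mult[symmetric])
   also have "... <= ennreal (1 / m j * x) * B t"
   unfolding B_def by (intro mult_left_mono member_le_sum) auto
   finally show ?thesis .
  qed
  have "en (%j s. b j (t + s)) <= (SUM j:UNIV. ennreal (1 / m j * x) * B t)"
   unfolding en_def by (intro sum_mono one)
  also have "... = ennreal ((SUM j:UNIV. 1 / m j) * x) * B t"
   using x less_imp_le[OF m] by (simp add: sum_distrib_right[symmetric] sum_nonneg) (simp add: sum_distrib_right)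
  also have "... <= ennreal ((SUM j:UNIV. 1 / m j) * x) * (ennreal (1 / (1 - te)) * B 0)"
  proof (rule mult_left_mono)
   show "B t <= ennreal (1 / (1 - te)) * B 0"
   unfolding B_def m_def by (rule energy_estimate[OF b w q ka _ c0 te H1 H2 t]) (rule c)
  qed simp
  also have "... <= ennreal ((SUM j:UNIV. 1 / m j) * x) * (ennreal (1 / (1 - te)) * (ennreal ((SUM j:UNIV. m j) * e) * en b))"
  proof (intro mult_left_mono)
   have "B 0 <= (SUM j:UNIV. ennreal (m j) * (ennreal e * en b))"
   unfolding B_def
   proof (intro sum_mono mult_left_mono)
   fix j
   have "wint al {- R j<..<0} (b j) <= ennreal e * powint p {- R j<..<0} (b j)"
   proof (rule wint_powint_le)
   fix s assume s: "s : {- R j<..<0}"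
   have "al * s <= abs(al) * abs(s)" by (metis abs_ge_self abs_mult)
   also have "... <= abs(al) * sum R UNIV" using s R_le_sum[of j] by (intro mult_left_mono) auto
   finally show "exp (al * s) <= e" by (simp add: e_def)
   qed (use e in auto)
   also have "... <= ennreal e * en b" by (intro mult_left_mono powint_le_en) auto
   finally show "wint al {- R j<..<0} (b j) <= ennreal e * en b" .
   qed auto
   also have "... = ennreal ((SUM j:UNIV. m j) * e) * en b"
   using m1 e less_imp_le[OF m] by (simp add: sum_distrib_right[symmetric] ennreal_mult mult.assoc)
   finally show "B 0 <= ennreal ((SUM j:UNIV. m j) * e) * en b" .
  qed auto
  also have "... = ennreal (((SUM j:UNIV. 1 / m j) * x) * ((1 / (1 - te)) * ((SUM j:UNIV. m j) * e))) * en b"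
  proof -
   have gen: "ennreal X * (ennreal Y * (ennreal Z * E)) = ennreal (X * (Y * Z)) * E" if "0 <= X" "0 <= Y" "0 <= Z" for X Y Z E
   using that by (simp add: ennreal_mult mult.assoc)
   have "0 <= (SUM j:UNIV. 1 / m j) * x" "0 <= 1 / (1 - te)" "0 <= (SUM j:UNIV. m j) * e"
   using m1 x e te by (auto intro!: mult_nonneg_nonneg)
   then show ?thesis by (rule gen)
  qed
  also have "((SUM j:UNIV. 1 / m j) * x) * ((1 / (1 - te)) * ((SUM j:UNIV. m j) * e)) = C * exp (- al * t)"
   by (simp add: C_def x_def)
  finally show ?thesis .
 qed
 show ?thesis using C bound by blast
qed

lemma state_bound:
 "\<exists>C\<ge>0. EX a. ALL b t. sol b --> 0 <= t --> en (%j s. b j (t + s)) <= ennreal (C * exp (a * t)) * en b"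
proof -
 define ka where "ka = 1 + (SUM i:UNIV. SUM j:UNIV. mass i j)"
 have ka1: "1 <= ka" by (simp add: ka_def sum_nonneg mass_nonneg)
 define al where "al = - ln (2 * ka powr p) / dl"
 have kap: "1 <= ka powr p" using ka1 p by (intro ge_one_powr_ge_zero) auto
 have al: "al <= 0" using kap dl by (simp add: al_def divide_nonneg_pos)
 have e: "exp (al * dl) = 1 / (2 * ka powr p)"
  using dl kap ka1 by (simp add: al_def exp_minus field_simps)
 have "\<exists>C\<ge>0. ALL b t. sol b --> 0 <= t --> en (%j s. b j (t + s)) <= ennreal (C * exp (- al * t)) * en b"
 proof (rule state_bound_weighted[where w="%_. 1" and q="%_. 1" and ka=ka and c="exp (al * dl)" and te="1 / 2"])
  show "exp (al * sv) <= exp (al * dl)" if "sv : {dl..R j}" for sv j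
   using that al by (simp add: mult_left_mono_neg)
  have row: "(SUM j:UNIV. mass i j) <= (SUM i:UNIV. SUM j:UNIV. mass i j)" for i
   by (rule member_le_sum[where f="%i. SUM j:UNIV. mass i j"]) (auto simp: sum_nonneg mass_nonneg)
  show "(SUM j:UNIV. mass i j * 1) <= ka * 1" for i using row[of i] by (simp add: ka_def)
  have col: "(SUM i:UNIV. mass i j) <= ka" for j
  proof -
   have "(SUM i:UNIV. mass i j) <= (SUM i:UNIV. SUM j:UNIV. mass i j)"
   by (intro sum_mono member_le_sum) (auto simp: mass_nonneg)
   then show ?thesis by (simp add: ka_def)
  qed
  show "ka powr (p - 1) * exp (al * dl) * (SUM i:UNIV. 1 * mass i j) <= 1 / 2 * 1" for j
  proof -
   have "ka powr (p - 1) * exp (al * dl) * (SUM i:UNIV. 1 * mass i j) <= ka powr (p - 1) * exp (al * dl) * ka"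
   using col[of j] by (intro mult_left_mono) auto
   also have "... = (ka powr (p - 1) * ka powr 1) * exp (al * dl)" using ka1 by simp
   also have "... = 1 / 2" unfolding powr_add[symmetric] e using kap ka1 by simp
   finally show ?thesis by simp
  qed
 qed (use ka1 in auto)
 then show ?thesis by blast
qed

lemma state_decay:
 assumes w: "!!j. 0 < w j" and q: "!!j. 0 < q j" and rh: "0 < rh" "rh < 1"
  and H1: "!!i. (SUM j:UNIV. mass i j * w j) <= rh * w i" and H2: "!!j. (SUM i:UNIV. q i * mass i j) <= rh * q j"
 shows "\<exists>C\<ge>0. \<exists>al>0. ALL b t. sol b --> 0 <= t --> en (%j s. b j (t + s)) <= ennreal (C * exp (- al * t)) * en b"
proof -
 have Rs: "0 < sum R UNIV" using R_pos R_le_sum by (metis less_le_trans)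
 define al where "al = - ln rh / 2 / sum R UNIV"
 have al: "0 < al" using rh Rs by (simp add: al_def zero_less_divide_iff divide_less_0_iff)
 have "\<exists>C\<ge>0. ALL b t. sol b --> 0 <= t --> en (%j s. b j (t + s)) <= ennreal (C * exp (- al * t)) * en b"
 proof (rule state_bound_weighted[OF w q rh(1) _ _ _ _ H1, where c="exp (al * sum R UNIV)" and te="exp (ln rh / 2)"])
  show "exp (al * sv) <= exp (al * sum R UNIV)" if "sv : {dl..R j}" for sv j
   using that al R_le_sum[of j] by simp
  show "exp (ln rh / 2) < 1" using rh by simp
  show "rh powr (p - 1) * exp (al * sum R UNIV) * (SUM i:UNIV. q i * mass i j) <= exp (ln rh / 2) * q j" for j
  proof -
   have "rh powr (p - 1) <= 1" using rh p by (intro powr_le1) auto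
   then have "rh powr (p - 1) * exp (al * sum R UNIV) <= 1 * exp (al * sum R UNIV)" by (intro mult_right_mono) auto
   then have "rh powr (p - 1) * exp (al * sum R UNIV) * (SUM i:UNIV. q i * mass i j) <= exp (al * sum R UNIV) * (rh * q j)"
   using H2[of j] less_imp_le[OF q] by (intro mult_mono) (auto intro!: sum_nonneg mult_nonneg_nonneg mass_nonneg)
   also have "... = exp (- ln rh / 2) * exp (ln rh) * q j" using Rs rh by (simp add: al_def)
   also have "... = exp (ln rh / 2) * q j" unfolding exp_add[symmetric] by simp
   finally show ?thesis .
  qed
 qed auto
 then show ?thesis using al by blast
qed

lemma powint_Un_le:
 assumes [measurable]: "f : Borel" "A : sets borel" "B : sets borel"
 shows "powint p (A \<union> B) f <= powint p A f + powint p B f"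
proof -
 have "powint p (A \<union> B) f <= (\<integral>\<^sup>+x. ennreal (abs(f x) powr p) * indicator A x + ennreal (abs(f x) powr p) * indicator B x \<partial>lborel)"
  unfolding powint_def by (intro nn_integral_mono) (auto split: split_indicator)
 also have "... = powint p A f + powint p B f" unfolding powint_def by (rule nn_integral_add) measurable
 finally show ?thesis .
qed

lemma sol_powint_finite:
 assumes b: "sol b"
 shows "powint p {- R j<..<T} (b j) < infinity"
proof -
 have [measurable]: "b j : Borel" for j by (rule sol_meas[OF b])
 obtain C a where C: "!!t. 0 <= t ==> en (%j s. b j (t + s)) <= ennreal (C * exp (a * t)) * en b"
  using state_bound b by blast
 have fin: "powint p {t - R j<..<t} (b j) < infinity" if "0 <= t" for t
 proof -
  have "powint p {t - R j<..<t} (b j) = powint p {- R j<..<0} (%s. b j (t + s))"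
   using powint_shift[of "b j" p "- R j" 0 t] by (simp add: add.commute)
  also have "... <= en (%j s. b j (t + s))" by (rule powint_le_en)
  also have "... < infinity" using C[OF that] sol_en[OF b] by (auto simp: ennreal_mult_less_top intro: le_less_trans)
  finally show ?thesis .
 qed
 have "powint p {- R j<..<real k * (dl / 2)} (b j) < infinity" for k
 proof (induction k)
  case 0
  then show ?case using fin[of 0] by simp
 next
  case (Suc k)
  let ?t = "real (Suc k) * (dl / 2)"
  have "?t - R j < real k * (dl / 2)" using dl dlR[of j] by (simp add: algebra_simps)
  then have "{- R j<..<?t} \<subseteq> {- R j<..<real k * (dl / 2)} \<union> {?t - R j<..<?t}" by auto
  then have "powint p {- R j<..<?t} (b j) <= powint p ({- R j<..<real k * (dl / 2)} \<union> {?t - R j<..<?t}) (b j)"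
   by (rule powint_mono_set)
  also have "... <= powint p {- R j<..<real k * (dl / 2)} (b j) + powint p {?t - R j<..<?t} (b j)"
   by (rule powint_Un_le) measurable
  also have "... < infinity" using Suc fin[of ?t] dl by simp
  finally show ?case .
 qed
 moreover obtain k :: nat where "T <= real k * (dl / 2)" using reals_Archimedean3[of "dl / 2"] dl less_imp_le by (metis half_gt_zero)
 then have "powint p {- R j<..<T} (b j) <= powint p {- R j<..<real k * (dl / 2)} (b j)" by (intro powint_mono_set) auto
 ultimately show ?thesis by (rule le_less_trans[rotated])
qed

lemma sol_set_integrable:
 assumes b: "sol b" and ab: "- R j <= a"
 shows "L1_on {a..d} (b j)"
proof -
 have "L1_on {- R j<..<d} (b j)"
  by (rule powint_integrable(1)[OF p sol_meas[OF b] sol_powint_finite[OF b]])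
 then have "L1_on {- R j..d} (b j)"
  by (simp add: set_integrable_cong_Ioo sol_meas[OF b])
 then show ?thesis by (rule set_integrable_subinterval) (use ab in auto)
qed

lemma AE_convolution:
 assumes Q: "AE s in lborel. Q s"
 shows "AE t in lborel. AE sv in nv i j. Q (t - sv)"
proof -
 interpret pair_sigma_finite lborel "nv i j" by (rule pair_nv)
 obtain N where N: "N : null_sets lborel" "{x. ~ Q x} \<subseteq> N"
  using Q by (auto elim!: AE_E simp: null_sets_def)
 then have [measurable]: "N : sets borel" by (auto simp: null_sets_def)
 have "AE t in lborel. t - sv ~: N" for sv
  using AE_shift[OF AE_not_in[OF N(1)], of "- sv"] by simp
 then have "AE sv in nv i j. AE t in lborel. t - sv ~: N" by simp
 then have "AE t in lborel. AE sv in nv i j. t - sv ~: N"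
  by (subst AE_commute) measurable
 then show ?thesis using N(2) by (auto elim!: eventually_mono)
qed

text \<open>In \<open>K b i t\<close> with \<open>0 < t < T + dl\<close> only the values of \<open>b\<close> on \<open>(- R j, T)\<close> enter.\<close>

lemma AE_history:
 assumes "AE s\<in>{- R j<..<T} in lborel. Q s"
 shows "AE t\<in>{0<..<T + dl} in lborel. (AE sv in nv i j. Q (t - sv))"
 using AE_convolution[OF assms, of i j]
proof eventually_elim
 case (elim t)
 show ?case
 proof
  assume "t : {0<..<T + dl}"
  then show "AE sv in nv i j. Q (t - sv)"
   using elim supp_nv[where i=i and j=j] by (auto elim!: eventually_elim2)
 qed
qed

lemma AE_integrable_delay:
 assumes [measurable]: "f : Borel" and fin: "!!T. powint p {- R j<..<T} f < infinity"
 shows "AE t in lborel. 0 < t --> integrable (nv i j) (%sv. f (t - sv))"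
proof -
 let ?I = "%t. \<integral>\<^sup>+sv. ennreal (abs(f (t - sv)) powr p) \<partial>nv i j"
 interpret nv: finite_measure "nv i j" by (rule finite_nv)
 have [measurable]: "?I : Borel" by measurable
 have "AE t in lborel. ?I t * indicator {0<..<real n} t ~= infinity" for n
 proof (rule nn_integral_PInf_AE)
  have "(\<integral>\<^sup>+t. ?I t * indicator {0<..<real n} t \<partial>lborel) <= ennreal (1 * mass i j) * wint 0 {- R j<..<real n - dl} f"
   using convolution_estimate[of f j 0 1 i "real n"] by simp
  also have "wint 0 {- R j<..<real n - dl} f = powint p {- R j<..<real n - dl} f" by (simp add: wint_def powint_def)
  also have "ennreal (1 * mass i j) * powint p {- R j<..<real n - dl} f < infinity"
   using fin[of "real n - dl"] by (simp add: ennreal_mult_less_top)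
  finally show "(\<integral>\<^sup>+t. ?I t * indicator {0<..<real n} t \<partial>lborel) ~= infinity" by simp
 qed measurable
 then have "AE t in lborel. ALL n. ?I t * indicator {0<..<real n} t ~= infinity" by (simp add: AE_all_countable)
 then show ?thesis
 proof eventually_elim
  case (elim t)
  show ?case
  proof
   assume t: "0 < t"
   obtain n where "t < real n" using reals_Archimedean2 by blast
   then have "?I t < infinity" using elim t by (auto dest!: spec[of _ n] simp: less_top)
   then show "integrable (nv i j) (%sv. f (t - sv))" by (intro nv.integrable_if_powr_integrable(2)[OF p]) auto
  qed
 qed
qed

lemma sol_integrable_delay:
 assumes "sol b"
 shows "AE t in lborel. 0 < t --> (ALL j. integrable (nv i j) (%sv. b j (t - sv)))"
proof -
 have "AE t in lborel. \<forall>j\<in>UNIV. 0 < t --> integrable (nv i j) (%sv. b j (t - sv))"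
  using AE_integrable_delay[OF sol_meas[OF assms] sol_powint_finite[OF assms]]
  by (intro AE_finite_allI) auto
 then show ?thesis by (auto elim!: eventually_mono)
qed

lemma sol_lin:
 assumes b: "sol b" and c: "sol c"
 shows "sol (%j s. x * b j s + y * c j s)"
 unfolding sol_def
proof (intro conjI allI)
 have m[measurable]: "b j : Borel" "c j : Borel" for j using sol_meas b c by auto
 show "(%s. x * b j s + y * c j s) : Borel" for j by measurable
 have "en (%j s. x * b j s + y * c j s) <= ennreal (2 powr (p - 1)) * (ennreal (abs(x) powr p) * en b + ennreal (abs(y) powr p) * en c)"
  using en_add[of "%j s. x * b j s" "%j s. y * c j s"] by (simp add: en_cmult m)
 also have "... < infinity" using sol_en[OF b] sol_en[OF c] by (simp add: ennreal_mult_less_top)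
 finally show "en (%j s. x * b j s + y * c j s) < infinity" .
 show "AE t in lborel. 0 < t --> x * b i t + y * c i t = K (%j s. x * b j s + y * c j s) i t" for i
  using sol_eq[OF b, of i] sol_eq[OF c, of i] sol_integrable_delay[OF b, of i] sol_integrable_delay[OF c, of i]
  by eventually_elim (auto simp: K_def sum_distrib_left sum.distrib[symmetric])
qed

lemma sol_diff: "sol b ==> sol c ==> sol (%j s. b j s - c j s)"
 using sol_lin[of b c 1 "- 1"] by simp

lemma sol_shift:
 assumes b: "sol b" and t: "0 <= t"
 shows "sol (%j s. b j (t + s))"
 unfolding sol_def
proof (intro conjI allI)
 have [measurable]: "b j : Borel" for j by (rule sol_meas[OF b])
 show "(%s. b j (t + s)) : Borel" for j by measurable
 obtain C a where C: "!!t. 0 <= t ==> en (%j s. b j (t + s)) <= ennreal (C * exp (a * t)) * en b"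
  using state_bound b by blast
 show "en (%j s. b j (t + s)) < infinity"
  using C[OF t] sol_en[OF b] by (auto simp: ennreal_mult_less_top intro: le_less_trans)
 show "AE s in lborel. 0 < s --> b i (t + s) = K (%j s. b j (t + s)) i s" for i
  using AE_shift[OF sol_eq[OF b, of i], of t]
  by eventually_elim (use t in \<open>auto simp: K_def add.commute add_diff_eq\<close>)
qed

lemma sol_unique:
 assumes b: "sol b" and c: "sol c" and eq: "en (%j s. b j s - c j s) = 0" and t: "0 <= t"
 shows "en (%j s. b j (t + s) - c j (t + s)) = 0"
proof -
 obtain C a where "en (%j s. b j (t + s) - c j (t + s)) <= ennreal (C * exp (a * t)) * en (%j s. b j s - c j s)"
  using state_bound sol_diff[OF b c] t by blast
 then show ?thesis using eq by simp
qed

text \<open>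
  Existence by steps: since all delays are at least \<open>dl\<close>, the iterates of \<open>K\<close> are stationary on \<open>t < k * dl\<close> after
  \<open>k\<close> steps.
\<close>

lemma sol_exists:
 assumes g[measurable]: "!!j. g j : Borel" and fin: "en g < infinity"
 shows "EX b. sol b & (ALL j s. s < 0 --> b j s = g j s) & (ALL i t. 0 <= t --> b i t = K b i t)"
proof -
 define it where "it = rec_nat (%j t. if t < 0 then g j t else 0) (%_ b i t. if t < 0 then g i t else K b i t)"
 have it_Suc: "it (Suc k) = (%i t. if t < 0 then g i t else K (it k) i t)" for k unfolding it_def by simp
 have it_neg: "it k j t = g j t" if "t < 0" for k j t using that by (cases k) (simp_all add: it_def)
 have [measurable]: "it k j : Borel" for k j
 proof (induction k arbitrary: j)
  case 0
  show ?case by (simp add: it_def)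
 next
  case (Suc k)
  have [measurable]: "K (it k) j : Borel" by (rule K_measurable[OF Suc])
  show ?case unfolding it_Suc by measurable
 qed
 have K_eq: "K c i t = K c' i t"
  if "!!j s. s < T ==> c j s = c' j s" "t < T + dl" "!!j. c j : Borel" "!!j. c' j : Borel" for c c' i t T
  unfolding K_def
 proof (rule sum.cong[OF refl], rule integral_cong_AE)
  fix j
  have [measurable]: "c j : Borel" "c' j : Borel" using that(3,4) by auto
  show "(%sv. c j (t - sv)) : borel_measurable (nv i j)" "(%sv. c' j (t - sv)) : borel_measurable (nv i j)" by measurable
  show "AE sv in nv i j. c j (t - sv) = c' j (t - sv)"
   using supp_nv[where i=i and j=j] by eventually_elim (use that(1,2) in auto)
 qed
 have step: "it (Suc k) j t = it k j t" if "t < real k * dl" for k j t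
  using that
 proof (induction k arbitrary: j t)
  case 0
  then show ?case by (simp add: it_neg)
 next
  case (Suc k)
  have "K (it (Suc k)) j t = K (it k) j t"
   by (rule K_eq[of "real k * dl"]) (use Suc in \<open>auto simp: algebra_simps\<close>)
  then show ?case by (simp add: it_Suc)
 qed
 have stat: "it (k + d) j t = it k j t" if "t < real k * dl" for k d j t
 proof (induction d)
  case (Suc d)
  have "real k * dl <= real (k + d) * dl" using dl by (intro mult_right_mono) auto
  then show ?case using step[of t "k + d" j] that Suc by simp
 qed simp
 have ex: "EX k. t < real k * dl" for t using reals_Archimedean3[OF dl] by blast
 define b where "b j t = it (LEAST k. t < real k * dl) j t" for j t
 have b_eq: "b j t = it k j t" if "t < real k * dl" for j t k
 proof -
  let ?l = "LEAST k. t < real k * dl"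
  have "t < real ?l * dl" by (rule LeastI_ex[OF ex])
  moreover have "?l <= k" by (rule Least_le[of "%k. t < real k * dl", OF that])
  ultimately show ?thesis using stat[of t ?l "k - ?l" j] by (simp add: b_def)
 qed
 have [measurable]: "b j : Borel" for j
 proof (rule borel_measurable_LIMSEQ_real)
  fix t
  obtain k where k: "t < real k * dl" using ex by blast
  have "eventually (%n. it n j t = b j t) sequentially"
  proof (rule eventually_sequentiallyI)
   fix n assume "k <= n"
   then show "it n j t = b j t" using stat[OF k, of "n - k" j] b_eq[OF k, of j] by simp
  qed
  then show "(%n. it n j t) ----> b j t" by (rule tendsto_eventually)
 qed measurable
 have neg: "b j s = g j s" if "s < 0" for j s by (simp add: b_def it_neg[OF that])
 have pos: "b i t = K b i t" if t: "0 <= t" for i t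
 proof -
  obtain k where k: "t < real k * dl" using ex by blast
  have "b i t = it (Suc k) i t" using b_eq[OF k] step[OF k] by simp
  also have "... = K (it k) i t" using t by (simp add: it_Suc)
  also have "... = K b i t"
   by (rule K_eq[of "real k * dl"]) (use k dl in \<open>auto simp: b_eq\<close>)
  finally show ?thesis .
 qed
 have "en b = en g" unfolding en_def by (intro sum.cong refl powint_cong_AE AE_I2) (simp add: neg)
 then have "sol b" using fin pos by (simp add: sol_def)
 then show ?thesis using neg pos by blast
qed

lemma supersolution_nonneg:
 assumes m[measurable]: "!!j. b j : Borel"
  and hist: "!!j. AE s\<in>{- R j<..<0} in lborel. 0 <= b j s"
  and super: "!!i. AE t in lborel. 0 < t --> K b i t <= b i t"
 shows "AE s in lborel. - R j < s --> 0 <= b j s"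
proof -
 have *: "AE s\<in>{- R j<..<real k * dl} in lborel. 0 <= b j s" for k j
 proof (induction k arbitrary: j)
  case (Suc k)
  have "AE t in lborel. \<forall>l\<in>UNIV. t : {0<..<real k * dl + dl} --> (AE sv in nv j l. 0 <= b l (t - sv))"
   by (intro AE_finite_allI AE_history Suc) auto
  with super[of j] hist[of j] AE_neq[of 0] show ?case
  proof eventually_elim
   case (elim t)
   show ?case
   proof
   assume t: "t : {- R j<..<real (Suc k) * dl}"
   show "0 <= b j t"
   proof (cases "t < 0")
   case False
   then have t': "0 < t" "t : {0<..<real k * dl + dl}" using t elim by (auto simp: algebra_simps)
   then have "0 <= K b j t" unfolding K_def using elim by (intro sum_nonneg integral_nonneg_AE) auto
   then show ?thesis using elim t' by simp
   qed (use elim t in auto)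
   qed
  qed
 qed (use hist in simp)
 then have "AE s in lborel. ALL k. s : {- R j<..<real k * dl} --> 0 <= b j s" unfolding AE_all_countable by blast
 then show ?thesis
 proof eventually_elim
  case (elim s)
  obtain k where "s < real k * dl" using reals_Archimedean3[OF dl] by blast
  then show ?case using elim by auto
 qed
qed

text \<open>If the coupling does not contract in the direction \<open>w\<close>, the solution that starts from the constant \<open>w\<close> stays above it.\<close>

lemma sol_nondecaying:
 assumes w: "!!j. 0 <= w j" and H: "!!i. w i <= (SUM j:UNIV. mass i j * w j)"
 shows "EX b. sol b & (\<forall>t\<ge>0. ennreal (SUM j:UNIV. R j * w j powr p) <= en (%j s. b j (t + s)))"
proof -
 have "en (%j s. w j) < infinity" unfolding en_finite_iff by (intro allI powint_const_finite)
 then obtain b where b: "sol b" and neg: "!!j s. s < 0 ==> b j s = w j"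
  using sol_exists[of "%j s. w j"] by auto
 have [measurable]: "b j : Borel" for j by (rule sol_meas[OF b])
 have super: "AE t in lborel. 0 < t --> K (%j s. b j s - w j) i t <= b i t - w i" for i
  using sol_eq[OF b, of i] sol_integrable_delay[OF b, of i]
 proof eventually_elim
  case (elim t)
  show ?case
  proof
   assume t: "0 < t"
   have "(\<integral>sv. b j (t - sv) - w j \<partial>nv i j) = (\<integral>sv. b j (t - sv) \<partial>nv i j) - mass i j * w j" for j
   proof -
   interpret finite_measure "nv i j" by (rule finite_nv)
   show ?thesis using elim t by (subst Bochner_Integration.integral_diff) (auto simp: mass_def)
   qed
   then have "K (%j s. b j s - w j) i t = K b i t - (SUM j:UNIV. mass i j * w j)" by (simp add: K_def sum_subtractf)
   then show "K (%j s. b j s - w j) i t <= b i t - w i" using elim t H[of i] by simp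
  qed
 qed
 have nn: "AE s in lborel. - R j < s --> 0 <= b j s - w j" for j
  by (rule supersolution_nonneg[OF _ _ super]) (auto simp: neg)
 have "ennreal (SUM j:UNIV. R j * w j powr p) <= en (%j s. b j (t + s))" if t: "0 <= t" for t
 proof -
  have "(SUM j:UNIV. ennreal (R j * w j powr p)) <= (SUM j:UNIV. powint p {- R j<..<0} (%s. b j (t + s)))"
  proof (rule sum_mono)
   fix j
   have "ennreal (R j * w j powr p) = powint p {- R j<..<0} (%s. w j)"
   using R_pos[of j] w[of j] by (simp add: powint_def nn_integral_cmult_indicator ennreal_mult mult.commute)
   also have "... <= powint p {- R j<..<0} (%s. b j (t + s))"
   proof (rule powint_mono)
   show "AE s\<in>{- R j<..<0} in lborel. abs(w j) <= abs(b j (t + s))"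
   using AE_shift[OF nn[of j], of t] by eventually_elim (use t w[of j] in \<open>auto simp: add.commute\<close>)
   qed (use p in simp)
   finally show "ennreal (R j * w j powr p) <= powint p {- R j<..<0} (%s. b j (t + s))" .
  qed
  then show ?thesis by (simp add: en_def sum_nonneg less_imp_le[OF R_pos])
 qed
 then show ?thesis using b by blast
qed

lemma translation_continuous_en:
 assumes b: "sol b" and t: "0 <= t"
 shows "((%s. en (%j x. b j (s + x) - b j (t + x))) ---> 0) (at t within {0..})"
proof (rule en_tendsto_0)
 fix j
 have [measurable]: "b j : Borel" by (rule sol_meas[OF b])
 define f where "f x = (if x : {- R j<..<t + 1} then b j x else 0)" for x
 have [measurable]: "f : Borel" unfolding f_def[abs_def] by measurable
 have pf: "powint p {- R j<..<t + 1} f < infinity"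
  using sol_powint_finite[OF b, of j "t + 1"] powint_cong_AE[of "{- R j<..<t + 1}" f "b j" p] by (simp add: f_def)
 have "((%h. powint p UNIV (%x. f (x + h) - f x)) ---> 0) (at 0 within UNIV)"
  by (rule translation_continuous_Lp_at[OF p _ _ pf]) (auto simp: f_def)
 moreover have "filterlim (%s. s - t) (at 0) (at t within {0..})"
  unfolding filterlim_at by (auto intro!: tendsto_eq_intros simp: eventually_at_filter)
 ultimately have lim: "((%s. powint p UNIV (%x. f (x + (s - t)) - f x)) ---> 0) (at t within {0..})"
  by (rule filterlim_compose)
 have ev: "eventually (%s. 0 <= s & s < t + 1) (at t within {0..})"
  unfolding eventually_at by (intro exI[of _ 1]) (auto simp: dist_real_def)
 show "((%s. powint p {- R j<..<0} (%x. b j (s + x) - b j (t + x))) ---> 0) (at t within {0..})"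
 proof (rule tendsto_sandwich[OF _ _ tendsto_const lim])
  show "\<forall>\<^sub>F s in at t within {0..}. powint p {- R j<..<0} (%x. b j (s + x) - b j (t + x)) <= powint p UNIV (%x. f (x + (s - t)) - f x)"
   using ev
  proof eventually_elim
   case (elim s)
   have "powint p {- R j<..<0} (%x. b j (s + x) - b j (t + x)) = powint p {- R j<..<0} (%x. f ((x + t) + (s - t)) - f (x + t))"
   by (intro powint_cong_AE AE_I2) (use elim t in \<open>auto simp: f_def add.commute\<close>)
   also have "... = powint p {- R j + t<..<0 + t} (%x. f (x + (s - t)) - f x)"
   by (rule powint_shift[of "%x. f (x + (s - t)) - f x"]) measurable
   also have "... <= powint p UNIV (%x. f (x + (s - t)) - f x)" by (rule powint_mono_set) simp
   finally show ?case .
  qed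
 qed simp
qed
end

lemma steklov_eq_ivl:
 assumes [measurable]: "f : Borel"
 shows "steklov h f s = (1 / h) * ivl s (s + h) f"
proof -
 have "AE u in lborel. indicator {0<..<h} u * f (s + u) = indicator {0..h} u * f (u + s)"
  using AE_neq[of 0] AE_neq[of h]
  by eventually_elim (auto simp: add.commute split: split_indicator)
 then have "(\<integral>u. indicator {0<..<h} u * f (s + u) \<partial>lborel) = ivl 0 h (%u. f (u + s))"
  unfolding ivl_def by (intro integral_cong_AE) simp_all
 then show ?thesis by (simp add: steklov_def ivl_shift add.commute)
qed

lemma steklov_measurable:
 assumes [measurable]: "f : Borel"
 shows "steklov h f : Borel"
 unfolding steklov_def[abs_def] by measurable

lemma ivl_measurable:
 assumes [measurable]: "f : Borel"
 shows "(%s. ivl s c f) : Borel" "(%s. ivl c s f) : Borel"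
proof -
 have "(%s. ivl s c f) = (%s. \<integral>t. (if s <= t & t <= c then f t else 0) \<partial>lborel)"
  "(%s. ivl c s f) = (%s. \<integral>t. (if c <= t & t <= s then f t else 0) \<partial>lborel)"
  unfolding ivl_def by (intro ext integral_cong_all; auto split: split_indicator)+
 then show "(%s. ivl s c f) : Borel" "(%s. ivl c s f) : Borel" by simp_all
qed

lemma abs_powr_tendsto_0_cancel:
 fixes x :: "'a => real"
 assumes p: "1 <= p" and lim: "((%n. abs(x n) powr p) ---> 0) F"
 shows "(x ---> 0) F"
proof -
 have "((%n. (abs(x n) powr p) powr (1 / p)) ---> 0 powr (1 / p)) F"
  using p by (intro tendsto_powr2 lim tendsto_const) auto
 moreover have "(abs(x n) powr p) powr (1 / p) = abs(x n)" for n using p by (simp add: powr_powr)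
 ultimately have "((%n. abs(x n)) ---> 0) F" using p by simp
 then show ?thesis by (rule tendsto_rabs_zero_cancel)
qed

definition prim :: "(real => real) => real => real" where
 "prim f x = (if x < 0 then - ivl x 0 f else ivl 0 x f)"

lemma prim_measurable: "f : Borel ==> prim f : Borel"
 using ivl_measurable[of f 0] unfolding prim_def[abs_def] by simp

lemma prim_nonpos: "x <= 0 ==> prim f x = - ivl x 0 f"
 by (cases "x = 0") (simp_all add: prim_def ivl_refl)
lemma prim_diff:
 assumes "a <= b" "L1_on {min a 0..max b 0} f"
 shows "prim f b - prim f a = ivl a b f"
proof -
 consider "b <= 0" | "a < 0" "0 < b" | "0 <= a" by linarith
 then show ?thesis
 proof cases
  case 1
  then show ?thesis using assms ivl_combine[of a 0 f b] by (simp add: prim_nonpos min_def max_def split: if_splits)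
 next
  case 2
  then show ?thesis using assms ivl_combine[of a b f 0] by (simp add: prim_def min_def max_def)
 next
  case 3
  then have "min a 0 = 0" "max b 0 = b" using assms(1) by auto
  then show ?thesis using 3 assms ivl_combine[of 0 b f a] by (simp add: prim_def)
 qed
qed

context delay_equation begin

lemma conv_ivl:
 assumes W: "sol W" and t: "0 <= t"
 shows "integrable (nv i j) (%sv. ivl (- sv) (t - sv) (W j))"
  and "ivl 0 t (%s. \<integral>sv. W j (s - sv) \<partial>nv i j) = (\<integral>sv. ivl (- sv) (t - sv) (W j) \<partial>nv i j)"
  and "L1_on {0..t} (%s. \<integral>sv. W j (s - sv) \<partial>nv i j)"
proof -
 interpret pair_sigma_finite lborel "nv i j" by (rule pair_nv)
 have [measurable]: "W j : Borel" by (rule sol_meas[OF W])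
 define f where "f s sv = indicator {0..t} s * W j (s - sv)" for s sv
 have f[measurable]: "case_prod f : borel_measurable (lborel \<Otimes>\<^sub>M nv i j)" unfolding f_def split_beta' by measurable
 define c where "c = (\<integral>\<^sup>+s. ennreal (abs(indicator {- R j..t} s * W j s)) \<partial>lborel)"
 have c: "c < infinity"
  using sol_set_integrable[OF W, of j "- R j" t] unfolding c_def set_integrable_real integrable_iff_bounded by simp
 have "(\<integral>\<^sup>+x. ennreal (norm (case_prod f x)) \<partial>(lborel \<Otimes>\<^sub>M nv i j)) = (\<integral>\<^sup>+sv. \<integral>\<^sup>+s. ennreal (abs(f s sv)) \<partial>lborel \<partial>nv i j)"
  by (subst nn_integral_snd[symmetric]) (simp_all add: split_beta')
 also have "... <= (\<integral>\<^sup>+sv. c \<partial>nv i j)"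
 proof (rule nn_integral_mono_AE)
  show "AE sv in nv i j. (\<integral>\<^sup>+s. ennreal (abs(f s sv)) \<partial>lborel) <= c"
   using supp_nv[where i=i and j=j]
  proof eventually_elim
   case (elim sv)
   have "(\<integral>\<^sup>+s. ennreal (abs(f s sv)) \<partial>lborel) = (\<integral>\<^sup>+s. (%u. ennreal (abs(indicator {0..t} (u + sv) * W j u))) (s + - sv) \<partial>lborel)"
   by (simp add: f_def)
   also have "... = (\<integral>\<^sup>+u. ennreal (abs(indicator {0..t} (u + sv) * W j u)) \<partial>lborel)" by (rule nn_integral_shift) measurable
   also have "... <= c" unfolding c_def using elim dl by (intro nn_integral_mono) (auto split: split_indicator)
   finally show ?case .
  qed
 qed
 also have "... < infinity" using c by (simp add: emeasure_nv ennreal_mult_less_top)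
 finally have int: "integrable (lborel \<Otimes>\<^sub>M nv i j) (case_prod f)" by (intro integrableI_bounded f)
 have 1: "(\<integral>s. f s sv \<partial>lborel) = ivl (- sv) (t - sv) (W j)" for sv
  using ivl_shift[of 0 t "W j" "- sv"] by (simp add: f_def ivl_def)
 have 2: "(\<integral>sv. f s sv \<partial>nv i j) = indicator {0..t} s * (\<integral>sv. W j (s - sv) \<partial>nv i j)" for s
  by (simp add: f_def)
 show "integrable (nv i j) (%sv. ivl (- sv) (t - sv) (W j))" using integrable_snd[OF int] by (simp add: 1)
 show "ivl 0 t (%s. \<integral>sv. W j (s - sv) \<partial>nv i j) = (\<integral>sv. ivl (- sv) (t - sv) (W j) \<partial>nv i j)"
  using Fubini_integral[OF int] unfolding 1 2 by (simp add: ivl_def)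
 show "L1_on {0..t} (%s. \<integral>sv. W j (s - sv) \<partial>nv i j)"
  using integrable_fst[OF int] unfolding 2 by (simp add: set_integrable_real)
qed

lemma sol_ivl:
 assumes W: "sol W" and t: "0 <= t"
 shows "ivl 0 t (W i) = (SUM j:UNIV. \<integral>sv. ivl (- sv) (t - sv) (W j) \<partial>nv i j)"
proof -
 have "ivl 0 t (W i) = ivl 0 t (K W i)"
 proof (rule ivl_cong_AE)
  show "AE s\<in>{0<..<t} in lborel. W i s = K W i s" using sol_eq[OF W, of i] by eventually_elim auto
 qed (auto intro: K_measurable sol_meas[OF W])
 also have "... = (SUM j:UNIV. ivl 0 t (%s. \<integral>sv. W j (s - sv) \<partial>nv i j))"
  unfolding ivl_def K_def sum_distrib_left using conv_ivl(3)[OF W t, of i]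
  by (intro Bochner_Integration.integral_sum) (simp add: set_integrable_real)
 finally show ?thesis by (simp add: conv_ivl(2)[OF W t])
qed

text \<open>The values \<open>be\<close> at time zero for which \<open>be + prim W\<close> satisfies the boundary condition at time zero.\<close>

definition compat :: "('n => real) => ('n => real => real) => bool" where
 "compat be om <=> (ALL i. be i = (SUM j:UNIV. \<integral>sv. be j - ivl (- sv) 0 (om j) \<partial>nv i j))"

definition in_domain :: "('n => real => real) => ('n => real => real) => bool" where
 "in_domain b om <=> (EX be. (ALL j. AE s\<in>{- R j<..<0} in lborel. b j s = be j - ivl s 0 (om j)) & compat be om)"

lemma history_integrable:
 assumes "!!j. om j : Borel" "en om < infinity"
 shows "L1_on {- R j..0} (om j)"
proof -
 have "powint p {- R j<..<0} (om j) < infinity" using assms(2) unfolding en_finite_iff by blast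
 from powint_integrable(1)[OF p assms(1) this] show ?thesis by (simp add: set_integrable_cong_Ioo assms(1))
qed

lemma history_ivl_bound:
 assumes f: "L1_on {- R j..0} f" and s: "- R j <= s" "s <= 0"
 shows "abs(ivl s 0 f) <= ivl (- R j) 0 (%t. abs(f t))"
proof -
 have "L1_on {- R j..0} (%t. abs(f t))" using set_integrable_abs[OF f] by simp
 from ivl_combine[OF this s] ivl_abs_le[of s 0 f]
 have "abs(ivl s 0 f) + ivl (- R j) s (%t. abs(f t)) <= ivl (- R j) 0 (%t. abs(f t))" by simp
 moreover have "0 <= ivl (- R j) s (%t. abs(f t))" unfolding ivl_def by (intro integral_nonneg_AE AE_I2) auto
 ultimately show ?thesis by linarith
qed

lemma history_primitive_integrable:
 assumes m: "f : Borel" and f: "L1_on {- R j..0} f"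
 shows "integrable (nv i j) (%sv. c - ivl (- sv) 0 f)"
proof -
 interpret finite_measure "nv i j" by (rule finite_nv)
 have [measurable]: "(%s. ivl s 0 f) : Borel" by (rule ivl_measurable(1)[OF m])
 have "integrable (nv i j) (%sv. ivl (- sv) 0 f)"
 proof (rule integrable_const_bound[where B="ivl (- R j) 0 (%t. abs(f t))"])
  show "AE sv in nv i j. norm (ivl (- sv) 0 f) <= ivl (- R j) 0 (%t. abs(f t))"
   using supp_nv[where i=i and j=j] by eventually_elim (use history_ivl_bound[OF f] dl in auto)
 qed measurable
 then show ?thesis by simp
qed

text \<open>Primitives of solutions are solutions, by Fubini's theorem.\<close>

lemma sol_primitive:
 assumes W: "sol W" and c: "compat be W"
 shows "sol (%j s. be j + prim (W j) s)"
 unfolding sol_def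
proof (intro conjI allI)
 have m[measurable]: "W j : Borel" for j by (rule sol_meas[OF W])
 have om: "L1_on {- R j..0} (W j)" for j by (rule history_integrable[OF m sol_en[OF W]])
 show pm[measurable]: "(%s. be j + prim (W j) s) : Borel" for j using prim_measurable[OF m] by simp
 show "en (%j s. be j + prim (W j) s) < infinity"
  unfolding en_finite_iff
 proof
  fix j
  have "powint p {- R j<..<0} (%s. be j + prim (W j) s) <= powint p {- R j<..<0} (%s. abs(be j) + ivl (- R j) 0 (%t. abs(W j t)))"
  proof (rule powint_mono)
   show "AE s\<in>{- R j<..<0} in lborel. abs(be j + prim (W j) s) <= abs(abs(be j) + ivl (- R j) 0 (%t. abs(W j t)))"
   proof (intro AE_I2 impI)
   fix s assume "s : {- R j<..<0}"
   then show "abs(be j + prim (W j) s) <= abs(abs(be j) + ivl (- R j) 0 (%t. abs(W j t)))"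
   using history_ivl_bound[OF om[of j], of s] by (simp add: prim_nonpos)
   qed
  qed (use p in simp)
  also have "... < infinity" by (rule powint_const_finite)
  finally show "powint p {- R j<..<0} (%s. be j + prim (W j) s) < infinity" .
 qed
 show "AE t in lborel. 0 < t --> be i + prim (W i) t = K (%j s. be j + prim (W j) s) i t" for i
 proof (intro AE_I2 impI)
  fix t :: real assume t: "0 < t"
  have "be i + prim (W i) t = (SUM j:UNIV. \<integral>sv. be j - ivl (- sv) 0 (W j) \<partial>nv i j) + (SUM j:UNIV. \<integral>sv. ivl (- sv) (t - sv) (W j) \<partial>nv i j)"
  proof (rule arg_cong2[where f="(+)"])
   show "be i = (SUM j:UNIV. \<integral>sv. be j - ivl (- sv) 0 (W j) \<partial>nv i j)" using c unfolding compat_def by blast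
   show "prim (W i) t = (SUM j:UNIV. \<integral>sv. ivl (- sv) (t - sv) (W j) \<partial>nv i j)"
   using t sol_ivl[OF W, of t i] by (simp add: prim_def)
  qed
  also have "... = (SUM j:UNIV. \<integral>sv. (be j - ivl (- sv) 0 (W j)) + ivl (- sv) (t - sv) (W j) \<partial>nv i j)"
   unfolding sum.distrib[symmetric] using t
   by (intro sum.cong refl Bochner_Integration.integral_add[symmetric] history_primitive_integrable m om conv_ivl(1)[OF W]) simp
  also have "... = K (%j s. be j + prim (W j) s) i t"
   unfolding K_def
  proof (rule sum.cong[OF refl], rule integral_cong_AE)
   fix j
   have [measurable]: "(%sv. be j - ivl (- sv) 0 (W j)) : borel_measurable (nv i j)" "(%sv. ivl (- sv) (t - sv) (W j)) : borel_measurable (nv i j)"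
   using history_primitive_integrable[OF m om] conv_ivl(1)[OF W, of t i j] t by auto
   show "(%sv. be j - ivl (- sv) 0 (W j) + ivl (- sv) (t - sv) (W j)) : borel_measurable (nv i j)" by measurable
   show "(%sv. be j + prim (W j) (t - sv)) : borel_measurable (nv i j)" using pm by measurable
   show "AE sv in nv i j. be j - ivl (- sv) 0 (W j) + ivl (- sv) (t - sv) (W j) = be j + prim (W j) (t - sv)"
   using supp_nv[where i=i and j=j]
   proof eventually_elim
   case (elim sv)
   then have "prim (W j) (t - sv) - prim (W j) (- sv) = ivl (- sv) (t - sv) (W j)"
   using t dl by (intro prim_diff sol_set_integrable[OF W]) auto
   then show ?case using elim dl by (simp add: prim_nonpos)
   qed
  qed
  finally show "be i + prim (W i) t = K (%j s. be j + prim (W j) s) i t" .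
 qed
qed

lemma steklov_en:
 assumes b: "sol b"
 shows "((%h. en (%j s. steklov h (b j) s - b j s)) ---> 0) (at_right 0)"
proof (rule en_tendsto_0)
 fix j
 have [measurable]: "b j : Borel" by (rule sol_meas[OF b])
 define f where "f x = (if x : {- R j<..<1} then b j x else 0)" for x
 have [measurable]: "f : Borel" unfolding f_def[abs_def] by measurable
 have pf: "powint p {- R j<..<1} f < infinity"
  using sol_powint_finite[OF b, of j 1] powint_cong_AE[of "{- R j<..<1}" f "b j" p] by (simp add: f_def)
 have lim: "((%h. powint p UNIV (%s. steklov h f s - f s)) ---> 0) (at_right 0)"
  by (rule steklov_tendsto_Lp[OF p _ _ pf]) (auto simp: f_def)
 show "((%h. powint p {- R j<..<0} (%s. steklov h (b j) s - b j s)) ---> 0) (at_right 0)"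
 proof (rule tendsto_sandwich[OF _ _ tendsto_const lim])
  have "eventually (%h. h : {0<..<1}) (at_right (0::real))" by (rule eventually_at_right_real) simp
  then show "\<forall>\<^sub>F h in at_right 0. powint p {- R j<..<0} (%s. steklov h (b j) s - b j s) <= powint p UNIV (%s. steklov h f s - f s)"
  proof eventually_elim
   case (elim h)
   have "powint p {- R j<..<0} (%s. steklov h (b j) s - b j s) = powint p {- R j<..<0} (%s. steklov h f s - f s)"
   proof (intro powint_cong_AE AE_I2 impI)
   fix s assume s: "s : {- R j<..<0}"
   then have "ivl s (s + h) (b j) = ivl s (s + h) f" using elim by (intro ivl_cong) (auto simp: f_def)
   then show "steklov h (b j) s - b j s = steklov h f s - f s" using s by (simp add: steklov_eq_ivl f_def)
   qed
   also have "... <= powint p UNIV (%s. steklov h f s - f s)" by (rule powint_mono_set) simp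
   finally show ?case .
  qed
 qed simp
qed

text \<open>The difference quotient integrates to a difference of Steklov means.\<close>

lemma ivl_difference_quotient:
 assumes b: "sol b" and h: "0 < h" and s: "- R j <= s" "s <= 0"
 shows "ivl s 0 (%x. (b j (h + x) - b j x) / h) = steklov h (b j) 0 - steklov h (b j) s"
proof -
 have [measurable]: "b j : Borel" by (rule sol_meas[OF b])
 have i: "L1_on {s..d} (b j)" for d by (rule sol_set_integrable[OF b s(1)])
 have 1: "L1_on {s..0} (%x. b j (x + h))"
  using sol_set_integrable[OF b, of j "s + h" "0 + h"] s h by (intro set_integrable_shift) auto
 have "ivl s 0 (%x. (b j (h + x) - b j x) / h) = ivl s 0 (%x. (1 / h) * (b j (x + h) - b j x))"
  by (intro ivl_cong) (simp add: add.commute)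
 also have "... = (1 / h) * (ivl s 0 (%x. b j (x + h)) - ivl s 0 (b j))"
  by (simp only: ivl_cmult ivl_diff[OF 1 i])
 also have "ivl s 0 (%x. b j (x + h)) = ivl (s + h) h (b j)" by (simp add: ivl_shift)
 also have "ivl (s + h) h (b j) - ivl s 0 (b j) = ivl 0 h (b j) - ivl s (s + h) (b j)"
  using ivl_combine[OF i, of "s + h" h] ivl_combine[OF i, of 0 h] s h by simp
 finally show ?thesis by (simp add: steklov_eq_ivl right_diff_distrib add.commute)
qed

lemma generator_if:
 assumes b: "sol b" and m: "!!j. om j : Borel" and fin: "en om < infinity" and dom: "in_domain b om"
 shows "((%h. en (%j s. (b j (h + s) - b j s) / h - om j s)) ---> 0) (at_right 0)"
proof -
 obtain be where be: "!!j. AE s\<in>{- R j<..<0} in lborel. b j s = be j - ivl s 0 (om j)" and c: "compat be om"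
  using dom unfolding in_domain_def by blast
 obtain W where W: "sol W" and neg: "!!j s. s < 0 ==> W j s = om j s" using sol_exists[OF m fin] by blast
 have Wm: "W j : Borel" for j by (rule sol_meas[OF W])
 have eq: "ivl s 0 (W j) = ivl s 0 (om j)" for s j
  by (intro ivl_cong_AE AE_I2 Wm m) (auto simp: neg)
 have "compat be W" unfolding compat_def eq by (rule c[unfolded compat_def])
 from sol_primitive[OF W this] have B: "sol (%j s. be j + prim (W j) s)" .
 have "en (%j s. b j s - (be j + prim (W j) s)) = en (%j s. 0 * b j s)"
 proof (rule en_cong_AE)
  fix j
  show "AE s\<in>{- R j<..<0} in lborel. b j s - (be j + prim (W j) s) = 0 * b j s"
   using be[of j] by eventually_elim (auto simp: prim_nonpos eq)
 qed
 also have "... = 0" using sol_meas[OF b] p by (subst en_cmult) auto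
 finally have e0: "en (%j s. b j s - (be j + prim (W j) s)) = 0" .
 have agree: "AE s\<in>{- R j<..<0} in lborel. b j (h + s) = be j + prim (W j) (h + s)" if h: "0 <= h" for h j
 proof -
  have "powint p {- R j<..<0} (%s. b j (h + s) - (be j + prim (W j) (h + s))) = 0"
   using sol_unique[OF b B e0 h] powint_le_en[of j "%j s. b j (h + s) - (be j + prim (W j) (h + s))"] by simp
  moreover have "(%s. b j (h + s) - (be j + prim (W j) (h + s))) : Borel"
   by (rule sol_meas[OF sol_shift[OF sol_diff[OF b B] h]])
  ultimately show ?thesis by (subst (asm) powint_eq_0_iff) (auto elim!: eventually_mono)
 qed
 have "en (%j s. (b j (h + s) - b j s) / h - om j s) = en (%j s. steklov h (W j) s - W j s)" if h: "0 < h" for h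
 proof (rule en_cong_AE)
  fix j
  show "AE s\<in>{- R j<..<0} in lborel. (b j (h + s) - b j s) / h - om j s = steklov h (W j) s - W j s"
   using agree[OF order_refl, of j] agree[OF less_imp_le[OF h], of j]
  proof eventually_elim
   case (elim s)
   show ?case
   proof
   assume s: "s : {- R j<..<0}"
   have "prim (W j) (s + h) - prim (W j) s = ivl s (s + h) (W j)"
   using s h R_pos[of j] by (intro prim_diff sol_set_integrable[OF W]) auto
   then show "(b j (h + s) - b j s) / h - om j s = steklov h (W j) s - W j s"
   using elim s by (simp add: steklov_eq_ivl[OF Wm] neg add.commute)
   qed
  qed
 qed
 then have "eventually (%h. en (%j s. steklov h (W j) s - W j s) = en (%j s. (b j (h + s) - b j s) / h - om j s)) (at_right 0)"
  by (auto simp: eventually_at_filter)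
 from Lim_transform_eventually[OF steklov_en[OF W] this] show ?thesis .
qed

lemma generator_only_if:
 assumes b: "sol b" and m[measurable]: "!!j. om j : Borel" and fin: "en om < infinity"
  and lim: "((%h. en (%j s. (b j (h + s) - b j s) / h - om j s)) ---> 0) (at_right 0)"
 shows "in_domain b om"
proof -
 have bm[measurable]: "b j : Borel" for j by (rule sol_meas[OF b])
 have om: "L1_on {- R j..0} (om j)" for j by (rule history_integrable[OF m fin])
 define h where "h n = inverse (real (Suc n))" for n
 have h0: "0 < h n" for n by (simp add: h_def)
 have h_lim: "h ----> 0" unfolding h_def by (rule LIMSEQ_inverse_real_of_nat)
 then have h: "filterlim h (at_right 0) sequentially" unfolding filterlim_at by (auto simp: h0 less_imp_neq[OF h0, symmetric])
 have quot: "(%n. ivl s 0 (%x. (b j (h n + x) - b j x) / h n)) ----> ivl s 0 (om j)" if s: "s : {- R j<..<0}" for s j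
 proof -
  define d where "d n = ivl s 0 (%x. (b j (h n + x) - b j x) / h n - om j x)" for n
  have d_eq: "d n = ivl s 0 (%x. (b j (h n + x) - b j x) / h n) - ivl s 0 (om j)" for n
   unfolding d_def
  proof (rule ivl_diff)
   have "L1_on {s..0} (%x. b j (x + h n))"
   using sol_set_integrable[OF b, of j "s + h n" "0 + h n"] s h0[of n] by (intro set_integrable_shift) auto
   moreover have "L1_on {s..0} (b j)" using s by (intro sol_set_integrable[OF b]) auto
   ultimately show "L1_on {s..0} (%x. (b j (h n + x) - b j x) / h n)"
   by (intro set_integrable_divide set_integral_diff(1)) (simp_all add: add.commute)
   show "L1_on {s..0} (om j)" by (rule set_integrable_subinterval[OF om[of j]]) (use s in auto)
  qed
  have "(%n. ennreal (abs(d n) powr p)) ----> 0"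
  proof (rule tendsto_sandwich[OF _ _ tendsto_const])
   let ?e = "%n. en (%j s. (b j (h n + s) - b j s) / h n - om j s)"
   show "\<forall>\<^sub>F n in sequentially. ennreal (abs(d n) powr p) <= ennreal ((0 - s) powr (p - 1)) * ?e n"
   proof (intro always_eventually allI)
   fix n
   have "ennreal (abs(d n) powr p) <= ennreal ((0 - s) powr (p - 1)) * powint p {s<..<0} (%x. (b j (h n + x) - b j x) / h n - om j x)"
   unfolding d_def using s by (intro powint_integral_le p) auto
   also have "... <= ennreal ((0 - s) powr (p - 1)) * ?e n"
   proof (rule mult_left_mono)
   have "powint p {s<..<0} (%x. (b j (h n + x) - b j x) / h n - om j x) <= powint p {- R j<..<0} (%x. (b j (h n + x) - b j x) / h n - om j x)"
   by (rule powint_mono_set) (use s in auto)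
   also have "... <= ?e n" using powint_le_en[of j "%j x. (b j (h n + x) - b j x) / h n - om j x"] .
   finally show "powint p {s<..<0} (%x. (b j (h n + x) - b j x) / h n - om j x) <= ?e n" .
   qed simp
   finally show "ennreal (abs(d n) powr p) <= ennreal ((0 - s) powr (p - 1)) * ?e n" .
   qed
   have "(%n. ennreal ((0 - s) powr (p - 1)) * ?e n) ----> ennreal ((0 - s) powr (p - 1)) * 0"
   by (intro ennreal_tendsto_cmult filterlim_compose[OF lim h]) simp
   then show "(%n. ennreal ((0 - s) powr (p - 1)) * ?e n) ----> 0" by simp
  qed simp
  then have "(%n. abs(d n) powr p) ----> 0" by (simp add: tendsto_ennreal_iff[of _ _ 0, simplified] flip: ennreal_0)
  then have "d ----> 0" by (rule abs_powr_tendsto_0_cancel[OF p])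
  then show ?thesis unfolding d_eq by (simp add: LIM_zero_iff)
 qed
 define good where "good j be r <=> strict_mono (r :: nat => nat) & (%n. steklov (h (r n)) (b j) 0) ----> be &
   (AE s\<in>{- R j<..<0} in lborel. b j s = be - ivl s 0 (om j))" for j be r
 have "EX be r. good j be r" for j
 proof -
  have "(%n. powint p {- R j<..<0} (%s. steklov (h n) (b j) s - b j s)) ----> 0"
  proof (rule tendsto_sandwich[OF _ _ tendsto_const filterlim_compose[OF steklov_en[OF b] h]])
   show "\<forall>\<^sub>F n in sequentially. powint p {- R j<..<0} (%s. steklov (h n) (b j) s - b j s) <= en (%j s. steklov (h n) (b j) s - b j s)"
   using powint_le_en[of j] by (intro always_eventually allI)
  qed simp
  then obtain r where r: "strict_mono r"
   and AE: "AE s\<in>{- R j<..<0} in lborel. (%n. steklov (h (r n)) (b j) s - b j s) ----> 0"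
   using powint_AE_subseq[OF p, of "%n s. steklov (h n) (b j) s - b j s" "{- R j<..<0}"] steklov_measurable[OF bm] by auto
  have conv: "(%n. steklov (h (r n)) (b j) 0) ----> b j s + ivl s 0 (om j)"
   if s: "s : {- R j<..<0}" "(%n. steklov (h (r n)) (b j) s - b j s) ----> 0" for s
  proof -
   have "(%n. (steklov (h (r n)) (b j) s - b j s) + b j s + ivl s 0 (%x. (b j (h (r n) + x) - b j x) / h (r n))) ----> 0 + b j s + ivl s 0 (om j)"
   using LIMSEQ_subseq_LIMSEQ[OF quot[OF s(1)] r] by (intro tendsto_add s(2) tendsto_const) (simp add: o_def)
   moreover have "ivl s 0 (%x. (b j (h (r n) + x) - b j x) / h (r n)) = steklov (h (r n)) (b j) 0 - steklov (h (r n)) (b j) s" for n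
   using s by (intro ivl_difference_quotient b h0) auto
   ultimately show ?thesis by simp
  qed
  have "EX s. s : {- R j<..<0} & (%n. steklov (h (r n)) (b j) s - b j s) ----> 0"
  proof (rule ccontr)
   assume "~ ?thesis"
   with AE have "AE s in lborel. s ~: {- R j<..<0}" by (auto elim!: eventually_mono)
   then have "{- R j<..<0} : null_sets lborel" by (subst AE_iff_null_sets) auto
   then show False using R_pos[of j] by (simp add: null_sets_def)
  qed
  then obtain s where s: "s : {- R j<..<0}" "(%n. steklov (h (r n)) (b j) s - b j s) ----> 0" by blast
  have "AE x\<in>{- R j<..<0} in lborel. b j x = (b j s + ivl s 0 (om j)) - ivl x 0 (om j)"
   using AE
  proof eventually_elim
   case (elim x)
   show ?case
   proof
   assume x: "x : {- R j<..<0}"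
   from LIMSEQ_unique[OF conv[OF x] conv[OF s]] elim x
   show "b j x = (b j s + ivl s 0 (om j)) - ivl x 0 (om j)" by auto
   qed
  qed
  then show ?thesis using r conv[OF s] unfolding good_def by blast
 qed
 then obtain be r where "!!j. good j (be j) (r j)" by metis
 then have r: "!!j. strict_mono (r j :: nat => nat)" and be: "!!j. (%n. steklov (h (r j n)) (b j) 0) ----> be j"
  and hist: "!!j. AE s\<in>{- R j<..<0} in lborel. b j s = be j - ivl s 0 (om j)"
  unfolding good_def by blast+
 define G where "G i t = (SUM j:UNIV. \<integral>sv. be j - ivl (t - sv) 0 (om j) \<partial>nv i j)" for i t
 have im: "(%s. be j - ivl s 0 (om j)) : Borel" for j using ivl_measurable(1)[OF m] by simp
 have imt: "(%sv. be j - ivl (t - sv) 0 (om j)) : borel_measurable (nv i j)" for i j t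
  by (rule measurable_compose[OF _ im]) measurable
 have Gm: "G i : Borel" for i
  unfolding G_def[abs_def] using integral_nv_measurable[OF im] by (intro borel_measurable_sum)
 have bG: "AE t\<in>{0<..<dl} in lborel. b i t = G i t" for i
 proof -
  have "AE t in lborel. \<forall>j\<in>UNIV. t : {0<..<0 + dl} --> (AE sv in nv i j. b j (t - sv) = be j - ivl (t - sv) 0 (om j))"
   by (intro AE_finite_allI AE_history hist) auto
  with sol_eq[OF b, of i] show ?thesis
  proof eventually_elim
   case (elim t)
   show ?case
   proof
   assume t: "t : {0<..<dl}"
   have "K b i t = G i t"
   unfolding K_def G_def
   proof (rule sum.cong[OF refl], rule integral_cong_AE)
   fix j
   show "AE sv in nv i j. b j (t - sv) = be j - ivl (t - sv) 0 (om j)" using elim t by simp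
   show "(%sv. b j (t - sv)) : borel_measurable (nv i j)" by (rule measurable_compose[OF _ bm]) measurable
   show "(%sv. be j - ivl (t - sv) 0 (om j)) : borel_measurable (nv i j)" by (rule imt)
   qed
   then show "b i t = G i t" using elim t by simp
   qed
  qed
 qed
 have Gc: "continuous_on {0..dl} (G i)" for i
  unfolding G_def
 proof (rule continuous_on_sum)
  fix j
  let ?B = "%s. be j - ivl s 0 (om j)"
  have Bc: "continuous_on {- R j..0} ?B"
  proof -
   have "continuous_on {- R j..0} (%s. be j - (ivl (- R j) 0 (om j) - ivl (- R j) s (om j)))"
   by (intro continuous_intros continuous_on_ivl om)
   then show ?thesis
   proof (rule continuous_on_eq)
   fix s assume "s : {- R j..0}"
   then show "be j - (ivl (- R j) 0 (om j) - ivl (- R j) s (om j)) = ?B s" using ivl_combine[OF om[of j], of s] by simp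
   qed
  qed
  interpret finite_measure "nv i j" by (rule finite_nv)
  show "continuous_on {0..dl} (%t. \<integral>sv. be j - ivl (t - sv) 0 (om j) \<partial>nv i j)"
   unfolding continuous_on_sequentially
  proof (intro allI ballI impI, elim conjE)
   fix x :: "nat => real" and a assume a: "a : {0..dl}" and x: "ALL n. x n : {0..dl}" and xa: "x ----> a"
   show "((%t. \<integral>sv. be j - ivl (t - sv) 0 (om j) \<partial>nv i j) \<circ> x) ----> (\<integral>sv. be j - ivl (a - sv) 0 (om j) \<partial>nv i j)"
   unfolding o_def
   proof (rule integral_dominated_convergence[where w="%_. abs(be j) + ivl (- R j) 0 (%t. abs(om j t))"])
   show "(%sv. be j - ivl (a - sv) 0 (om j)) : borel_measurable (nv i j)"
   "(%sv. be j - ivl (x n - sv) 0 (om j)) : borel_measurable (nv i j)" for n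
   by (rule imt)+
   show "AE sv in nv i j. (%n. be j - ivl (x n - sv) 0 (om j)) ----> be j - ivl (a - sv) 0 (om j)"
   using supp_nv[where i=i and j=j]
   proof eventually_elim
   case (elim sv)
   have "(%n. x n - sv) ----> a - sv" by (intro tendsto_intros xa)
   moreover have "a - sv : {- R j..0}" using a elim by auto
   moreover have "x n - sv : {- R j..0}" for n using spec[OF x, of n] elim by auto
   ultimately show ?case using Bc unfolding continuous_on_sequentially by (auto simp: o_def)
   qed
   show "AE sv in nv i j. norm (be j - ivl (x n - sv) 0 (om j)) <= abs(be j) + ivl (- R j) 0 (%t. abs(om j t))" for n
   using supp_nv[where i=i and j=j]
   proof eventually_elim
   case (elim sv)
   then have "abs(ivl (x n - sv) 0 (om j)) <= ivl (- R j) 0 (%t. abs(om j t))"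
   using spec[OF x, of n] by (intro history_ivl_bound om) auto
   then show ?case by simp
   qed
   qed simp
  qed
 qed
 have beG: "be i = G i 0" for i
 proof (rule LIMSEQ_unique[OF be])
  have hr: "(%n. h (r i n)) ----> 0" using LIMSEQ_subseq_LIMSEQ[OF h_lim r[of i]] by (simp add: o_def)
  then have small: "eventually (%n. h (r i n) < dl) sequentially" by (rule order_tendstoD(2)) (rule dl)
  have Gi: "L1_on {0..dl} (G i)" by (rule borel_integrable_atLeastAtMost'[OF Gc])
  have "((%x. integral {0..x} (G i)) has_real_derivative G i 0) (at 0 within {0..dl})"
   using dl by (intro integral_has_real_derivative Gc) auto
  then have "((%x. integral {0..x} (G i) / x) ---> G i 0) (at 0 within {0..dl})"
   by (simp add: has_field_derivative_iff)
  moreover have "filterlim (%n. h (r i n)) (at 0 within {0..dl}) sequentially"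
   unfolding filterlim_at
  proof (intro conjI hr eventually_mono[OF small])
   fix n assume "h (r i n) < dl"
   then show "h (r i n) : {0..dl}" "h (r i n) ~= 0" using h0[of "r i n"] by auto
  qed
  ultimately have "(%n. integral {0..h (r i n)} (G i) / h (r i n)) ----> G i 0" by (rule filterlim_compose)
  moreover have "eventually (%n. integral {0..h (r i n)} (G i) / h (r i n) = steklov (h (r i n)) (b i) 0) sequentially"
   using small
  proof eventually_elim
   case (elim n)
   have "integral {0..h (r i n)} (G i) = ivl 0 (h (r i n)) (G i)"
   using elim by (intro ivl_HK(1)[symmetric] set_integrable_subinterval[OF Gi]) auto
   also have "... = ivl 0 (h (r i n)) (b i)"
   proof (rule ivl_cong_AE)
   show "AE t\<in>{0<..<h (r i n)} in lborel. G i t = b i t" using bG[of i] by eventually_elim (use elim in auto)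
   qed (rule Gm bm)+
   finally show ?case by (simp add: steklov_eq_ivl)
  qed
  ultimately show "(%n. steklov (h (r i n)) (b i) 0) ----> G i 0" by (rule Lim_transform_eventually)
 qed
 moreover have "G i 0 = (SUM j:UNIV. \<integral>sv. be j - ivl (- sv) 0 (om j) \<partial>nv i j)" for i by (simp add: G_def)
 ultimately have "compat be om" unfolding compat_def by (intro allI) (rule trans)
 then show ?thesis using hist unfolding in_domain_def by blast
qed

text \<open>Steklov means of a solution are solutions whose states lie in the domain of the generator.\<close>

lemma domain_dense:
 assumes b: "sol b" and e: "0 < e"
 shows "EX c om. sol c & (ALL j. om j : Borel) & en om < infinity & in_domain c om & en (%j s. b j s - c j s) < e"
proof -
 have "eventually (%h. en (%j s. steklov h (b j) s - b j s) < e) (at_right 0)"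
  by (rule order_tendstoD(2)[OF steklov_en[OF b] e])
 then have "eventually (%h. en (%j s. steklov h (b j) s - b j s) < e & 0 < h) (at_right 0)"
  by (rule eventually_conj) (simp add: eventually_at_filter)
 then obtain h where h: "0 < h" "en (%j s. steklov h (b j) s - b j s) < e"
  using eventually_happens'[OF trivial_limit_at_right_real] by blast
 define W where "W j s = (b j (h + s) - b j s) / h" for j s
 have "sol (%j s. (1 / h) * b j (h + s) + (- 1 / h) * b j s)"
  by (rule sol_lin[OF sol_shift[OF b] b]) (use h in simp)
 then have W: "sol W" by (simp add: W_def[abs_def] diff_divide_distrib)
 define be where "be j = steklov h (b j) 0" for j
 have st: "be j - ivl s 0 (W j) = steklov h (b j) s" if "- R j <= s" "s <= 0" for j s
  unfolding be_def W_def using ivl_difference_quotient[OF b h(1) that] by simp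
 have "compat be W"
  unfolding compat_def
 proof
  fix i
  have "be i = (1 / h) * (SUM j:UNIV. \<integral>sv. ivl (- sv) (h - sv) (b j) \<partial>nv i j)"
   using sol_ivl[OF b, of h i] h by (simp add: be_def steklov_eq_ivl sol_meas[OF b])
  also have "... = (SUM j:UNIV. \<integral>sv. be j - ivl (- sv) 0 (W j) \<partial>nv i j)"
   unfolding sum_distrib_left
  proof (rule sum.cong[OF refl])
   fix j
   have "(\<integral>sv. (1 / h) * ivl (- sv) (h - sv) (b j) \<partial>nv i j) = (\<integral>sv. be j - ivl (- sv) 0 (W j) \<partial>nv i j)"
   proof (rule integral_cong_AE)
   show "(%sv. (1 / h) * ivl (- sv) (h - sv) (b j)) : borel_measurable (nv i j)"
   using conv_ivl(1)[OF b, of h i j] h by (intro borel_measurable_times) auto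
   show "(%sv. be j - ivl (- sv) 0 (W j)) : borel_measurable (nv i j)"
   by (rule borel_measurable_integrable[OF history_primitive_integrable[OF sol_meas[OF W] history_integrable[OF sol_meas[OF W] sol_en[OF W]]]])
   show "AE sv in nv i j. (1 / h) * ivl (- sv) (h - sv) (b j) = be j - ivl (- sv) 0 (W j)"
   using supp_nv[where i=i and j=j]
   by eventually_elim (use dl in \<open>auto simp: st steklov_eq_ivl[OF sol_meas[OF b]]\<close>)
   qed
   then show "(1 / h) * (\<integral>sv. ivl (- sv) (h - sv) (b j) \<partial>nv i j) = (\<integral>sv. be j - ivl (- sv) 0 (W j) \<partial>nv i j)" by simp
  qed
  finally show "be i = (SUM j:UNIV. \<integral>sv. be j - ivl (- sv) 0 (W j) \<partial>nv i j)" .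
 qed
 moreover from sol_primitive[OF W this] have c: "sol (%j s. be j + prim (W j) s)" .
 moreover have "in_domain (%j s. be j + prim (W j) s) W"
  unfolding in_domain_def using \<open>compat be W\<close> by (intro exI[of _ be]) (auto simp: prim_nonpos)
 moreover have "en (%j s. b j s - (be j + prim (W j) s)) = en (%j s. steklov h (b j) s - b j s)"
 proof -
  have "en (%j s. b j s - (be j + prim (W j) s)) = en (%j s. - (steklov h (b j) s - b j s))"
   by (rule en_cong_AE) (auto simp: prim_nonpos st)
  then show ?thesis by (simp add: en_def powint_def abs_minus_commute)
 qed
 ultimately show ?thesis using h sol_meas[OF W] sol_en[OF W]
  by (intro exI[of _ "%j s. be j + prim (W j) s"] exI[of _ W] conjI allI) simp_all
qed
end

section \<open>The semigroup of a delay equation\<close>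

text \<open>
  Translation along solutions, transported to a seminormed space whose elements are described by histories through
  a linear map \<open>P\<close>, with \<open>N (P b)\<close> comparable to the \<open>L\<^sup>p\<close> norm of the history \<open>b\<close>.
\<close>

locale transported_delay = delay_equation p dl R nv + complete_seminormed_space E N
 for p dl :: real and R :: "'n::finite => real" and nv :: "'n => 'n => real measure"
  and E :: "'a::real_vector set" and N :: "'a => real" +
 fixes P :: "('n => real => real) => 'a" and A B :: real
 assumes P_add: "P (%j s. b j s + c j s) = P b + P c"
  and P_scaleR: "P (%j s. x * b j s) = x *\<^sub>R P b"
  and P_in: "(!!j. b j : Borel) ==> en b < infinity ==> P b : E"
  and P_onto: "u : E ==> EX b. (ALL j. b j : Borel) & en b < infinity & N (u - P b) = 0"
  and A: "0 <= A" and B: "0 <= B"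
  and N_le: "(!!j. b j : Borel) ==> en b < infinity ==> ennreal (N (P b) powr p) <= ennreal B * en b"
  and en_le: "(!!j. b j : Borel) ==> en b < infinity ==> en b <= ennreal A * ennreal (N (P b) powr p)"
begin
definition history :: "('n => real => real) => bool" where
 "history b <=> (ALL j. b j : Borel) & en b < infinity"

lemma history_meas: "history b ==> b j : Borel"
 and history_en: "history b ==> en b < infinity"
 and history_in: "history b ==> P b : E"
 and history_N_le: "history b ==> ennreal (N (P b) powr p) <= ennreal B * en b"
 and history_en_le: "history b ==> en b <= ennreal A * ennreal (N (P b) powr p)"
 using P_in[of b] N_le[of b] en_le[of b] by (auto simp: history_def)

lemma sol_history: "sol b ==> history b"
 by (simp add: sol_def history_def)
lemma P_diff: "P (%j s. b j s - c j s) = P b - P c"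
 using P_add[of b "%j s. - 1 * c j s"] P_scaleR[of "- 1" c] by simp

lemma history_diff:
 assumes b: "history b" and c: "history c"
 shows "history (%j s. b j s - c j s)"
proof -
 have m[measurable]: "b j : Borel" "c j : Borel" for j using history_meas b c by auto
 have "en (%j s. b j s - c j s) < infinity"
  using history_en[OF b] history_en[OF c] by (intro le_less_trans[OF en_diff] m) (simp add: ennreal_mult_less_top)
 then show ?thesis by (simp add: history_def)
qed

lemma history_cmult:
 assumes b: "history b"
 shows "history (%j s. x * b j s)"
proof -
 have [measurable]: "b j : Borel" for j by (rule history_meas[OF b])
 show ?thesis using history_en[OF b] by (simp add: history_def en_cmult ennreal_mult_less_top)
qed

lemma N_lim:
 assumes h: "eventually (%h. history (f h)) F"
 shows "((%h. N (P (f h))) ---> 0) F <=> ((%h. en (f h)) ---> 0) F"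
proof
 assume lim: "((%h. N (P (f h))) ---> 0) F"
 have "((%h. N (P (f h)) powr p) ---> 0 powr p) F"
  by (intro tendsto_powr2 lim tendsto_const eventually_mono[OF h]) (use p N_nonneg history_in in auto)
 then have "((%h. ennreal (N (P (f h)) powr p)) ---> ennreal (0 powr p)) F" by (rule tendsto_ennrealI)
 then have "((%h. ennreal A * ennreal (N (P (f h)) powr p)) ---> ennreal A * ennreal (0 powr p)) F"
  by (intro ennreal_tendsto_cmult) simp
 then have lim': "((%h. ennreal A * ennreal (N (P (f h)) powr p)) ---> 0) F" using p by simp
 show "((%h. en (f h)) ---> 0) F"
  by (rule tendsto_sandwich[OF _ eventually_mono[OF h history_en_le] tendsto_const lim']) simp
next
 assume "((%h. en (f h)) ---> 0) F"
 then have "((%h. ennreal B * en (f h)) ---> ennreal B * 0) F" by (intro ennreal_tendsto_cmult) simp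
 then have lim': "((%h. ennreal B * en (f h)) ---> 0) F" by simp
 have "((%h. ennreal (N (P (f h)) powr p)) ---> ennreal 0) F"
  unfolding ennreal_0 by (rule tendsto_sandwich[OF _ eventually_mono[OF h history_N_le] tendsto_const lim']) simp
 then have "((%h. N (P (f h)) powr p) ---> 0) F" by (subst (asm) tendsto_ennreal_iff) auto
 moreover have "eventually (%h. N (P (f h)) powr p = abs(N (P (f h))) powr p) F"
  using h by eventually_elim (simp add: N_nonneg history_in)
 ultimately have "((%h. abs(N (P (f h))) powr p) ---> 0) F" by (rule Lim_transform_eventually)
 then show "((%h. N (P (f h))) ---> 0) F" by (rule abs_powr_tendsto_0_cancel[OF p])
qed

lemma N_eq_0_iff: "history b ==> N (P b) = 0 <=> en b = 0"
 using N_lim[of "%_::nat. b" sequentially] by (simp add: tendsto_const_iff)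

definition lift :: "'a => 'n => real => real" where
 "lift u = (SOME b. sol b & N (u - P b) = 0)"

lemma lift:
 assumes u: "u : E"
 shows "sol (lift u)" "N (u - P (lift u)) = 0"
proof -
 obtain g where g: "ALL j. g j : Borel" "en g < infinity" "N (u - P g) = 0" using P_onto[OF u] by blast
 obtain b where b: "sol b" and neg: "!!j s. s < 0 ==> b j s = g j s" using sol_exists[of g] g by blast
 have hg: "history g" using g by (simp add: history_def)
 have "en (%j s. g j s - b j s) = en (%j s. 0)" by (intro en_cong_AE AE_I2) (simp add: neg)
 then have "en (%j s. g j s - b j s) = 0" by (simp add: en_def powint_def)
 then have "N (P g - P b) = 0" using N_eq_0_iff[OF history_diff[OF hg sol_history[OF b]]] by (simp add: P_diff)
 then have "N (u - P b) <= 0" using N_triangle[OF u history_in[OF hg] history_in[OF sol_history[OF b]]] g by simp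
 then have "N (u - P b) = 0" using N_nonneg[OF E_diff[OF u history_in[OF sol_history[OF b]]]] by simp
 then have "EX b. sol b & N (u - P b) = 0" using b by blast
 from someI_ex[OF this] show "sol (lift u)" "N (u - P (lift u)) = 0" unfolding lift_def by auto
qed

lemma lift_agrees:
 assumes u: "u : E" and b: "history b" "N (u - P b) = 0"
 shows "en (%j s. lift u j s - b j s) = 0"
proof -
 have l: "history (lift u)" by (rule sol_history[OF lift(1)[OF u]])
 have "N (P (lift u) - P b) <= N (P (lift u) - u) + N (u - P b)" by (rule N_triangle[OF history_in[OF l] u history_in[OF b(1)]])
 also have "... = 0" using lift(2)[OF u] N_minus_commute[OF u history_in[OF l]] b(2) by simp
 finally have "N (P (lift u) - P b) = 0" using N_nonneg[OF E_diff[OF history_in[OF l] history_in[OF b(1)]]] by simp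
 then show ?thesis using N_eq_0_iff[OF history_diff[OF l b(1)]] by (simp add: P_diff)
qed

lemma lift_agrees_AE:
 assumes u: "u : E" and b: "history b" "N (u - P b) = 0"
 shows "AE s\<in>{- R j<..<0} in lborel. lift u j s = b j s"
proof -
 have "powint p {- R j<..<0} (%s. lift u j s - b j s) = 0"
  using lift_agrees[OF assms] powint_le_en[of j "%j s. lift u j s - b j s"] by simp
 then show ?thesis
  using sol_meas[OF lift(1)[OF u]] history_meas[OF b(1)] by (subst (asm) powint_eq_0_iff) (auto elim!: eventually_mono)
qed

definition T :: "real => 'a => 'a" where
 "T t u = P (%j s. lift u j (t + s))"

lemma shift_history: "sol b ==> 0 <= t ==> history (%j s. b j (t + s))"
 by (intro sol_history sol_shift)
lemma lift_shift_history: "u : E ==> 0 <= t ==> history (%j s. lift u j (t + s))"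
 by (intro shift_history lift)
lemma T_in_E: "u : E ==> 0 <= t ==> T t u : E"
 unfolding T_def by (rule history_in[OF lift_shift_history])

lemma T_eq:
 assumes u: "u : E" and b: "sol b" "N (u - P b) = 0" and t: "0 <= t"
 shows "N (T t u - P (%j s. b j (t + s))) = 0"
proof -
 have "en (%j s. lift u j (t + s) - b j (t + s)) = 0"
  by (rule sol_unique[OF lift(1)[OF u] b(1) lift_agrees[OF u sol_history[OF b(1)] b(2)] t])
 then have "N (P (%j s. lift u j (t + s) - b j (t + s))) = 0"
  by (subst N_eq_0_iff) (intro history_diff lift_shift_history shift_history u t b)
 then show ?thesis by (simp add: T_def P_diff)
qed

lemma T_norm_le:
 assumes u: "u : E" and t: "0 <= t" and c: "0 <= c"
  and en: "en (%j s. lift u j (t + s)) <= ennreal c * en (lift u)"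
 shows "N (T t u) <= (B * A * c) powr (1 / p) * N u"
proof -
 have l: "history (lift u)" by (rule sol_history[OF lift(1)[OF u]])
 have Nu: "N (P (lift u)) = N u" using N_cong[OF u history_in[OF l] lift(2)[OF u]] by simp
 have "ennreal (N (T t u) powr p) <= ennreal B * en (%j s. lift u j (t + s))"
  unfolding T_def by (rule history_N_le[OF lift_shift_history[OF u t]])
 also have "... <= ennreal B * (ennreal c * (ennreal A * ennreal (N u powr p)))"
  using history_en_le[OF l] by (intro mult_left_mono order_trans[OF en]) (simp_all add: Nu)
 also have "... = ennreal (B * A * c * N u powr p)"
  using A B c by (simp add: ennreal_mult[symmetric] mult_ac)
 finally have "N (T t u) powr p <= B * A * c * N u powr p" using A B c by (simp add: ennreal_le_iff)
 then have "(N (T t u) powr p) powr (1 / p) <= (B * A * c * N u powr p) powr (1 / p)" using p by (intro powr_mono2) auto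
 then show ?thesis using p N_nonneg[OF u] N_nonneg[OF T_in_E[OF u t]] A B c by (simp add: powr_powr powr_mult)
qed

lemma T_continuous:
 assumes u: "u : E" and t: "0 <= t"
 shows "((%s. N (T s u - T t u)) ---> 0) (at t within {0..})"
proof -
 have "eventually (%s. 0 <= s) (at t within {0..})" by (simp add: eventually_at_filter)
 then have "eventually (%s. history (%j x. lift u j (s + x) - lift u j (t + x))) (at t within {0..})"
  by eventually_elim (intro history_diff lift_shift_history u t)
 from N_lim[OF this] translation_continuous_en[OF lift(1)[OF u] t] show ?thesis
  by (simp add: P_diff T_def)
qed

lemma T_C0_semigroup: "C0_semigroup E N T"
 unfolding C0_semigroup_def
proof (intro conjI allI impI ballI)
 fix t :: real and u assume t: "0 <= t" and u: "u : E"
 show "T t u : E" by (rule T_in_E[OF u t])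
 have l: "sol (lift u)" by (rule lift[OF u])
 have lE: "P (lift u) : E" by (rule history_in[OF sol_history[OF l]])
 show "N (T t (u + w) - (T t u + T t w)) = 0" if w: "w : E" for w
 proof -
  have lw: "sol (lift w)" by (rule lift[OF w])
  have wE: "P (lift w) : E" by (rule history_in[OF sol_history[OF lw]])
  have "sol (%j s. lift u j s + lift w j s)" using sol_lin[OF l lw, of 1 1] by simp
  moreover have "N ((u + w) - P (%j s. lift u j s + lift w j s)) = 0"
  proof -
   have "N ((u - P (lift u)) + (w - P (lift w))) <= 0"
   using N_add[OF E_diff[OF u lE] E_diff[OF w wE]] lift(2)[OF u] lift(2)[OF w] by simp
   then show ?thesis
   using N_nonneg[OF E_add[OF E_diff[OF u lE] E_diff[OF w wE]]] by (simp add: P_add algebra_simps)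
  qed
  ultimately have "N (T t (u + w) - P (%j s. lift u j (t + s) + lift w j (t + s))) = 0"
   by (rule T_eq[OF E_add[OF u w] _ _ t])
  then show ?thesis by (simp add: P_add T_def)
 qed
 show "N (T t (c *\<^sub>R u) - c *\<^sub>R T t u) = 0" for c
 proof -
  have "sol (%j s. c * lift u j s)" using sol_lin[OF l l, of c 0] by simp
  moreover have "N (c *\<^sub>R u - P (%j s. c * lift u j s)) = 0"
   using N_scaleR[OF E_diff[OF u lE], of c] lift(2)[OF u] by (simp add: P_scaleR scaleR_diff_right)
  ultimately have "N (T t (c *\<^sub>R u) - P (%j s. c * lift u j (t + s))) = 0"
   by (rule T_eq[OF E_scaleR[OF u] _ _ t])
  then show ?thesis by (simp add: P_scaleR T_def)
 qed
 show "N (T (s + t) u - T s (T t u)) = 0" if s: "0 <= s" for s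
 proof -
  have "N (T s (T t u) - P (%j x. lift u j (t + (s + x)))) = 0"
   by (rule T_eq[OF T_in_E[OF u t] sol_shift[OF l t] _ s]) (simp add: T_def N_0)
  then have "N (T s (T t u) - T (s + t) u) = 0" by (simp add: T_def add_ac)
  then show ?thesis using N_minus_commute[OF T_in_E[OF T_in_E[OF u t] s] T_in_E[OF u, of "s + t"]] s t by simp
 qed
next
 fix t :: real assume t: "0 <= t"
 obtain C a where C: "0 <= C" "!!b. sol b ==> en (%j s. b j (t + s)) <= ennreal (C * exp (a * t)) * en b"
  using state_bound t by blast
 show "EX C. \<forall>u\<in>E. N (T t u) <= C * N u"
  using T_norm_le[OF _ t _ C(2)[OF lift(1)]] C(1) by (intro exI ballI) auto
next
 fix u assume u: "u : E"
 have T0: "N (T 0 u - u) = 0"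
  using lift(2)[OF u] N_minus_commute[OF u history_in[OF sol_history[OF lift(1)[OF u]]]] by (simp add: T_def)
 then show "N (T 0 u - u) = 0" .
 have "((%t. N (T t u - T 0 u)) ---> 0) (at_right 0)"
  by (rule tendsto_mono[OF at_le T_continuous[OF u order_refl]]) auto
 moreover have "eventually (%t. N (T t u - T 0 u) = N (T t u - u)) (at_right 0)"
  unfolding eventually_at_filter
  by (intro always_eventually allI impI N_cong_diff T_in_E u T0) (auto simp: N_0)
 ultimately show "((%t. N (T t u - u)) ---> 0) (at_right 0)" by (rule Lim_transform_eventually)
qed

lemma in_domain_cong:
 assumes "!!j. AE s\<in>{- R j<..<0} in lborel. b j s = c j s" and "in_domain b om"
 shows "in_domain c om"
proof -
 obtain be where be: "!!j. AE s\<in>{- R j<..<0} in lborel. b j s = be j - ivl s 0 (om j)" "compat be om"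
  using assms(2) unfolding in_domain_def by blast
 have "AE s\<in>{- R j<..<0} in lborel. c j s = be j - ivl s 0 (om j)" for j
  using be(1)[of j] assms(1)[of j] by eventually_elim auto
 then show ?thesis unfolding in_domain_def using be(2) by blast
qed

lemma T_generator:
 assumes u: "u : E" and w: "w : E" and b: "history b" "N (u - P b) = 0" and om: "history om" "N (w - P om) = 0"
 shows "((%h. N ((1 / h) *\<^sub>R (T h u - u) - w)) ---> 0) (at_right 0) <=> in_domain b om"
proof -
 define l where "l = lift u"
 have l: "sol l" "history l" "P l : E" "N (u - P l) = 0"
  unfolding l_def using lift[OF u] sol_history history_in by auto
 have lb: "AE s\<in>{- R j<..<0} in lborel. l j s = b j s" for j
  unfolding l_def by (rule lift_agrees_AE[OF u b])
 have dom: "in_domain l om <=> in_domain b om"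
 proof
  show "in_domain b om" if "in_domain l om" using lb that by (rule in_domain_cong)
  have "AE s\<in>{- R j<..<0} in lborel. b j s = l j s" for j using lb[of j] by eventually_elim auto
  then show "in_domain l om" if "in_domain b om" using that by (rule in_domain_cong)
 qed
 have pos: "eventually (%h. 0 < h) (at_right (0::real))" by (simp add: eventually_at_filter)
 let ?q = "%h j s. (l j (h + s) - l j s) / h - om j s"
 have hist: "history (?q h)" if "0 < h" for h
 proof -
  have "history (%j s. (1 / h) * (l j (h + s) - l j s) - om j s)"
   using that by (intro history_diff history_cmult shift_history l om) simp
  then show ?thesis by simp
 qed
 have quot: "N ((1 / h) *\<^sub>R (T h u - u) - w) = N (P (?q h))" if h: "0 < h" for h
 proof -
  have "P (?q h) = (1 / h) *\<^sub>R (T h u - P l) - P om"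
   using P_diff[of "%j s. (1 / h) * (l j (h + s) - l j s)" om] P_scaleR[of "1 / h" "%j s. l j (h + s) - l j s"]
   P_diff[of "%j s. l j (h + s)" l] by (simp add: T_def l_def)
  moreover have "N ((1 / h) *\<^sub>R (T h u - u) - w) = N ((1 / h) *\<^sub>R (T h u - P l) - P om)"
  proof (rule N_cong_diff)
   have Th: "T h u : E" using h by (intro T_in_E u) simp
   then show "(1 / h) *\<^sub>R (T h u - u) : E" "(1 / h) *\<^sub>R (T h u - P l) : E" by (auto intro!: E_scaleR E_diff u l(3))
   show "w : E" "P om : E" "N (w - P om) = 0" using w om history_in by auto
   have "(1 / h) *\<^sub>R (T h u - u) - (1 / h) *\<^sub>R (T h u - P l) = (- 1 / h) *\<^sub>R (u - P l)"
   by (simp add: algebra_simps)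
   then show "N ((1 / h) *\<^sub>R (T h u - u) - (1 / h) *\<^sub>R (T h u - P l)) = 0"
   by (simp only: N_scaleR[OF E_diff[OF u l(3)]] l(4) mult_zero_right)
  qed
  ultimately show ?thesis by simp
 qed
 have "((%h. N ((1 / h) *\<^sub>R (T h u - u) - w)) ---> 0) (at_right 0) <=> ((%h. N (P (?q h))) ---> 0) (at_right 0)"
  by (intro tendsto_cong eventually_mono[OF pos] quot)
 also have "... <=> ((%h. en (?q h)) ---> 0) (at_right 0)" by (intro N_lim eventually_mono[OF pos] hist)
 also have "... <=> in_domain l om"
  using generator_if[OF l(1) history_meas[OF om(1)] history_en[OF om(1)]]
   generator_only_if[OF l(1) history_meas[OF om(1)] history_en[OF om(1)]] by blast
 finally show ?thesis using dom by simp
qed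

lemma T_unique:
 assumes gT: "is_generator E N T D G" and S: "C0_semigroup E N S" and gS: "is_generator E N S D G"
  and G: "!!u. u : D ==> u : E ==> G u : E" and u: "u : E" and t: "0 <= t"
 shows "N (T t u - S t u) = 0"
proof (rule generator_determines_semigroup[OF T_C0_semigroup S gT gS _ u t])
 fix u and ep :: real assume u: "u : E" and ep: "0 < ep"
 define e where "e = ((ep / 2) powr p) / (B + 1)"
 have e: "0 < e" using ep B by (simp add: e_def)
 obtain c om where c: "sol c" and om: "ALL j. om j : Borel" "en om < infinity" and dom: "in_domain c om"
  and small: "en (%j s. lift u j s - c j s) < ennreal e"
  using domain_dense[OF lift(1)[OF u], of "ennreal e"] e by auto
 have hc: "history c" and hom: "history om" using sol_history[OF c] om by (simp_all add: history_def)
 have cE: "P c : E" and wE: "P om : E" using history_in hc hom by auto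
 have "((%h. N ((1 / h) *\<^sub>R (T h (P c) - P c) - P om)) ---> 0) (at_right 0)"
  by (subst T_generator[OF cE wE hc _ hom]) (simp_all add: N_0 dom)
 then have cD: "P c : D" using gT cE wE unfolding is_generator_def by blast
 have l: "history (lift u)" "P (lift u) : E" using history_in sol_history[OF lift(1)[OF u]] by auto
 have "ennreal (N (P (%j s. lift u j s - c j s)) powr p) <= ennreal B * ennreal e"
  using history_N_le[OF history_diff[OF l(1) hc]] small by (meson less_imp_le mult_left_mono order_trans zero_le)
 then have "N (P (lift u) - P c) powr p <= B * e" using B e by (simp add: P_diff ennreal_mult[symmetric])
 also have "... <= (ep / 2) powr p" using B unfolding e_def by (simp add: field_simps)
 finally have "(N (P (lift u) - P c) powr p) powr (1 / p) <= ((ep / 2) powr p) powr (1 / p)" by (rule powr_mono2[rotated 2]) (use p in simp_all)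
 moreover have "(x powr p) powr (1 / p) = x" if "0 <= x" for x using p that by (simp add: powr_powr)
 ultimately have "N (P (lift u) - P c) <= ep / 2"
  using ep N_nonneg[OF E_diff[OF l(2) cE]] by (simp only: half_gt_zero less_imp_le)
 then have "N (u - P c) < ep" using N_triangle[OF u l(2) cE] lift(2)[OF u] ep by simp
 then show "\<exists>w\<in>D \<inter> E. G w : E & N (u - w) < ep" using cD cE G by blast
qed

lemma T_nonneg:
 assumes u: "u : E" and b: "history b" "N (u - P b) = 0" and t: "0 <= t"
  and nn: "!!j. AE s\<in>{- R j<..<0} in lborel. 0 <= b j s"
 shows "EX c. history c & T t u = P c & (ALL j. AE s\<in>{- R j<..<0} in lborel. 0 <= c j s)"
proof -
 have l: "sol (lift u)" by (rule lift(1)[OF u])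
 have pos: "AE s in lborel. - R j < s --> 0 <= lift u j s" for j
 proof (rule supersolution_nonneg[OF sol_meas[OF l]])
  show "AE s\<in>{- R j<..<0} in lborel. 0 <= lift u j s" for j
   using nn[of j] lift_agrees_AE[OF u b, of j] by eventually_elim auto
  show "AE t in lborel. 0 < t --> K (lift u) i t <= lift u i t" for i
   using sol_eq[OF l, of i] by eventually_elim auto
 qed
 have "AE s\<in>{- R j<..<0} in lborel. 0 <= lift u j (t + s)" for j
  using AE_shift[OF pos[of j], of t] by eventually_elim (use t in \<open>auto simp: add.commute\<close>)
 then show ?thesis using lift_shift_history[OF u t] by (intro exI[of _ "%j s. lift u j (t + s)"]) (simp add: T_def)
qed

lemma T_stable:
 assumes w: "!!j. 0 < w j" and q: "!!j. 0 < q j" and rh: "0 < rh" "rh < 1"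
  and H: "!!i. (SUM j:UNIV. mass i j * w j) <= rh * w i" "!!j. (SUM i:UNIV. q i * mass i j) <= rh * q j"
 shows "uniformly_exp_stable E N T"
proof -
 obtain C al where C: "0 <= C" and al: "0 < al"
  and dec: "!!b t. sol b ==> 0 <= t ==> en (%j s. b j (t + s)) <= ennreal (C * exp (- al * t)) * en b"
  using state_decay[OF w q rh H] by blast
 have "N (T t u) <= ((B * A * C) powr (1 / p) + 1) * exp (- (al / p) * t) * N u" if t: "0 <= t" and u: "u : E" for t u
 proof -
  have "N (T t u) <= (B * A * (C * exp (- al * t))) powr (1 / p) * N u"
   using C by (intro T_norm_le u t dec lift) simp
  also have "(B * A * (C * exp (- al * t))) powr (1 / p) = (B * A * C) powr (1 / p) * exp (- (al / p) * t)"
   using A B C by (simp add: powr_mult mult.assoc[symmetric] exp_powr_real)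
  also have "... * N u <= ((B * A * C) powr (1 / p) + 1) * exp (- (al / p) * t) * N u"
   using N_nonneg[OF u] by (intro mult_right_mono) auto
  finally show ?thesis .
 qed
 then show ?thesis unfolding uniformly_exp_stable_def
  using al p by (intro exI[of _ "(B * A * C) powr (1 / p) + 1"] conjI exI[of _ "al / p"]) (auto simp: add_nonneg_pos)
qed

lemma T_unstable:
 assumes w: "!!j. 0 <= w j" and w0: "w k ~= 0" and H: "!!i. w i <= (SUM j:UNIV. mass i j * w j)"
 shows "~ uniformly_exp_stable E N T"
proof
 assume "uniformly_exp_stable E N T"
 then obtain M al where al: "0 < al" and M: "!!t u. 0 <= t ==> u : E ==> N (T t u) <= M * exp (- al * t) * N u"
  unfolding uniformly_exp_stable_def by blast
 obtain b where b: "sol b" and low: "!!t. 0 <= t ==> ennreal (SUM j:UNIV. R j * w j powr p) <= en (%j s. b j (t + s))"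
  using sol_nondecaying[of w] w H by blast
 define u where "u = P b"
 have u: "u : E" unfolding u_def by (rule history_in[OF sol_history[OF b]])
 have eq: "N (P (%j s. b j (t + s))) = N (T t u)" if t: "0 <= t" for t
  using N_cong[OF T_in_E[OF u t] history_in[OF shift_history[OF b t]] T_eq[OF u b _ t]] by (simp add: u_def N_0)
 have "((%t. M * exp (- al * t) * N u) ---> M * 0 * N u) at_top"
 proof (intro tendsto_intros)
  have "filterlim (%t. al * t) at_top at_top" by (rule filterlim_tendsto_pos_mult_at_top[OF tendsto_const al filterlim_ident])
  then have "filterlim (%t. - al * t) at_bot at_top" by (simp add: filterlim_uminus_at_bot)
  then show "((%t. exp (- al * t)) ---> 0) at_top" by (rule filterlim_compose[OF exp_at_bot])
 qed
 then have lim0: "((%t. M * exp (- al * t) * N u) ---> 0) at_top" by simp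
 have ev: "eventually (%t::real. 0 <= t) at_top" by (rule eventually_ge_at_top)
 have "((%t. N (P (%j s. b j (t + s)))) ---> 0) at_top"
  by (rule tendsto_sandwich[OF _ _ tendsto_const lim0]; rule eventually_mono[OF ev])
   (use M[OF _ u] in \<open>simp_all add: eq u N_nonneg T_in_E\<close>)
 then have "((%t. en (%j s. b j (t + s))) ---> 0) at_top"
  by (subst (asm) N_lim) (auto intro: eventually_mono[OF ev] shift_history[OF b])
 then have "ennreal (SUM j:UNIV. R j * w j powr p) <= 0"
  by (rule tendsto_lowerbound) (auto intro: eventually_mono[OF ev] low)
 then have "(SUM j:UNIV. R j * w j powr p) = 0"
  using less_imp_le[OF R_pos] by (intro antisym sum_nonneg) (auto simp: ennreal_eq_0_iff)
 moreover have "0 < R k * w k powr p" using R_pos[of k] w[of k] w0 by simp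
 moreover have "R k * w k powr p <= (SUM j:UNIV. R j * w j powr p)"
  using less_imp_le[OF R_pos] by (intro member_le_sum) auto
 ultimately show False by linarith
qed
end

section \<open>Straightening the characteristics\<close>

lemma AE_reflect:
 assumes "AE x in lborel. Q (x::real)"
 shows "AE x in lborel. Q (- x)"
proof -
 obtain S where S: "S : null_sets lborel" "{x. ~ Q x} \<subseteq> S"
  using assms by (auto elim!: AE_E simp: null_sets_def)
 have "AE x in lborel. 0 + (- 1) * x ~: S"
  using AE_not_in[OF S(1)] S(1) by (intro AE_borel_affine) (auto simp: null_sets_def)
 then show ?thesis by eventually_elim (use S(2) in auto)
qed

lemma ivl_reflect: "ivl a b (%s. f (- s)) = ivl (- b) (- a) f"
proof -
 have "ivl a b (%s. f (- s)) = (\<integral>s. (%t. indicator {- b..- a} t * f t) (0 + (- 1) * s) \<partial>lborel)"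
  unfolding ivl_def by (intro integral_cong_all) (auto split: split_indicator)
 also have "... = ivl (- b) (- a) f"
  using lborel_integral_real_affine[of "- 1" "%t. indicator {- b..- a} t * f t" 0] by (simp add: ivl_def)
 finally show ?thesis .
qed

lemma powint_mult_bounded_le:
 assumes p: "0 <= p" and c: "!!x. x : S ==> abs(c x) <= C" and C: "0 <= C"
  and [measurable]: "f : Borel" "S : sets borel"
 shows "powint p S (%x. c x * f x) <= ennreal (C powr p) * powint p S f"
proof -
 have "powint p S (%x. c x * f x) <= powint p S (%x. C * f x)"
 proof (rule powint_mono[OF p], intro AE_I2 impI)
  fix x assume "x : S"
  then have "abs(c x) * abs(f x) <= C * abs(f x)" using c by (intro mult_right_mono) auto
  then show "abs(c x * f x) <= abs(C * f x)" using C by (simp add: abs_mult)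
 qed
 also have "... = ennreal (C powr p) * powint p S f" using C by (simp add: powint_cmult)
 finally show ?thesis .
qed

locale time_change =
 fixes a :: "real => real" and m M :: real
 assumes a[measurable]: "a : Borel" and m: "0 < m" and a_bounds: "m <= a x" "a x <= M"
begin
lemma M: "0 < M" using m a_bounds[of 0] by linarith

lemma a_pos: "0 < a x" using m a_bounds(1)[of x] by linarith

lemma a_integrable: "L1_on {c..d} a"
 unfolding set_integrable_real
proof (rule Bochner_Integration.integrable_bound)
 show "integrable lborel (%t. indicator {c..d} t * M)"
  using set_integrable_const_Icc[of c d M] by (simp add: set_integrable_real)
 show "AE x in lborel. norm (indicator {c..d} x * a x) <= norm (indicator {c..d} x * M)"
  using a_bounds(2) a_pos M by (intro AE_I2) (auto simp: less_imp_le split: split_indicator)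
qed measurable

text \<open>The travel time from \<open>0\<close> to \<open>x\<close> along a characteristic of speed \<open>1 / a\<close>, and its inverse.\<close>

definition tt :: "real => real" where "tt = prim a"
definition pos :: "real => real" where "pos = inv tt"

lemma tt_diff: "x <= y ==> tt y - tt x = ivl x y a"
 unfolding tt_def by (rule prim_diff[OF _ a_integrable])

lemma tt_0: "tt 0 = 0" by (simp add: tt_def prim_nonpos ivl_refl)

lemma tt_bounds: "x <= y ==> m * (y - x) <= tt y - tt x" "x <= y ==> tt y - tt x <= M * (y - x)"
 using ivl_mono[OF set_integrable_const_Icc[of x y m] a_integrable] ivl_mono[OF a_integrable set_integrable_const_Icc[of x y M]]
 by (simp_all add: tt_diff ivl_const a_bounds)
lemma tt_less_iff: "tt x < tt y <=> x < y"
proof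
 have *: "tt x < tt y" if "x < y" for x y
  using tt_bounds(1)[of x y] mult_pos_pos[OF m, of "y - x"] that by simp
 show "tt x < tt y" if "x < y" using * that .
 show "x < y" if "tt x < tt y" using *[of y x] that by (cases x y rule: linorder_cases) auto
qed

lemma tt_continuous: "continuous_on S tt"
proof -
 have "M-lipschitz_on S tt"
 proof (rule lipschitz_onI)
  fix x y
  show "dist (tt x) (tt y) <= M * dist x y"
   using tt_bounds(2)[of x y] tt_bounds(2)[of y x] tt_less_iff[of x y] tt_less_iff[of y x]
   by (cases x y rule: linorder_cases) (auto simp: dist_real_def abs_if)
 qed (use M in simp)
 then show ?thesis by (rule lipschitz_on_continuous_on)
qed

lemma tt_surj: "EX x. tt x = s"
proof -
 have "s <= tt (abs(s) / m)" "tt (- (abs(s) / m)) <= s"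
  using tt_bounds(1)[of 0 "abs(s) / m"] tt_bounds(1)[of "- (abs(s) / m)" 0] m by (simp_all add: tt_0)
 then show ?thesis using IVT'[of tt "- (abs(s) / m)" s "abs(s) / m"] m tt_continuous by auto
qed

lemma tt_pos: "tt (pos s) = s" unfolding pos_def by (rule f_inv_into_f) (use tt_surj[of s] in auto)

lemma pos_tt: "pos (tt x) = x"
 using tt_pos[of "tt x"] tt_less_iff[of x "pos (tt x)"] tt_less_iff[of "pos (tt x)" x] by (cases x "pos (tt x)" rule: linorder_cases) auto

lemma pos_less_iff: "pos s < pos t <=> s < t" using tt_less_iff[of "pos s" "pos t"] by (simp add: tt_pos)

lemma tt_measurable[measurable]: "tt : Borel" unfolding tt_def by (rule prim_measurable) measurable

lemma pos_measurable[measurable]: "pos : Borel"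
 by (rule borel_measurable_mono, rule monoI) (meson linorder_not_less pos_less_iff)
lemma lborel_eq: "lborel = distr (density lborel (%x. ennreal (a x))) borel tt"
proof (rule lborel_eqI)
 fix l u :: real assume "!!b. b : Basis ==> l \<bullet> b <= u \<bullet> b"
 then have lu: "l <= u" by simp
 have "tt -` {l<..<u} = {pos l<..<pos u}"
  using pos_less_iff[of l] pos_less_iff[of _ u] by (auto simp: pos_tt) (metis pos_less_iff pos_tt)+
 then have "emeasure (distr (density lborel (%x. ennreal (a x))) borel tt) (box l u)
   = (\<integral>\<^sup>+x. ennreal (a x) * indicator {pos l<..<pos u} x \<partial>lborel)"
  by (simp add: emeasure_distr emeasure_density)
 also have "... = (\<integral>\<^sup>+x. ennreal (indicator {pos l..pos u} x * a x) \<partial>lborel)"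
 proof (rule nn_integral_cong_AE)
  show "AE x in lborel. ennreal (a x) * indicator {pos l<..<pos u} x = ennreal (indicator {pos l..pos u} x * a x)"
   using AE_neq[of "pos l"] AE_neq[of "pos u"] by eventually_elim (auto split: split_indicator)
 qed
 also have "... = ennreal (ivl (pos l) (pos u) a)"
  unfolding ivl_def using a_integrable[of "pos l" "pos u"] less_imp_le[OF a_pos]
  by (intro nn_integral_eq_integral) (auto simp: set_integrable_real)
 also have "ivl (pos l) (pos u) a = u - l"
  using tt_diff[of "pos l" "pos u"] lu pos_less_iff[of u l] by (simp add: tt_pos)
 finally show "emeasure (distr (density lborel (%x. ennreal (a x))) borel tt) (box l u) = ennreal (\<Prod>b\<in>Basis. (u - l) \<bullet> b)"
  by simp
qed simp

lemma nn_integral_tt: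
 assumes [measurable]: "f : Borel"
 shows "(\<integral>\<^sup>+s. f s \<partial>lborel) = (\<integral>\<^sup>+x. ennreal (a x) * f (tt x) \<partial>lborel)"
 by (subst lborel_eq) (simp add: nn_integral_distr nn_integral_density)
lemma ivl_tt:
 assumes [measurable]: "f : Borel"
 shows "ivl (tt x) (tt y) f = ivl x y (%z. a z * f (tt z))"
proof -
 have "ivl (tt x) (tt y) f = (\<integral>z. a z * (indicator {tt x..tt y} (tt z) * f (tt z)) \<partial>lborel)"
  unfolding ivl_def by (subst lborel_eq) (simp add: integral_distr integral_density less_imp_le[OF a_pos])
 also have "... = ivl x y (%z. a z * f (tt z))"
  unfolding ivl_def using tt_less_iff
  by (intro integral_cong_all) (auto simp: linorder_not_less[symmetric] split: split_indicator)
 finally show ?thesis .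
qed

lemma AE_tt:
 assumes "AE s in lborel. Q s"
 shows "AE x in lborel. Q (tt x)"
proof -
 obtain S where S: "S : null_sets lborel" "{x. ~ Q x} \<subseteq> S"
  using assms by (auto elim!: AE_E simp: null_sets_def)
 then have [measurable]: "S : sets borel" by (auto simp: null_sets_def)
 have "AE s in distr (density lborel (%x. ennreal (a x))) borel tt. s ~: S"
  using AE_not_in[OF S(1)] unfolding lborel_eq[symmetric] .
 then have "AE x in lborel. 0 < ennreal (a x) --> tt x ~: S" by (simp add: AE_distr_iff AE_density)
 then show ?thesis by eventually_elim (use S(2) a_pos in auto)
qed

lemma AE_pos:
 assumes "AE x in lborel. Q x"
 shows "AE s in lborel. Q (pos s)"
proof -
 obtain S where S: "S : null_sets lborel" "{x. ~ Q x} \<subseteq> S"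
  using assms by (auto elim!: AE_E simp: null_sets_def)
 then have [measurable]: "S : sets borel" by (auto simp: null_sets_def)
 have "AE x in lborel. 0 < ennreal (a x) --> x ~: S" using AE_not_in[OF S(1)] by eventually_elim simp
 then have "AE s in distr (density lborel (%x. ennreal (a x))) borel tt. pos s ~: S"
  by (simp add: AE_distr_iff AE_density pos_tt)
 then have "AE s in lborel. pos s ~: S" unfolding lborel_eq[symmetric] .
 then show ?thesis by eventually_elim (use S(2) in auto)
qed

lemma powint_tt:
 assumes [measurable]: "b : Borel"
 shows "powint p {- tt l<..<0} b <= ennreal M * powint p {0<..<l} (%x. b (- tt x))"
  and "ennreal m * powint p {0<..<l} (%x. b (- tt x)) <= powint p {- tt l<..<0} b"
proof -
 have "powint p {- tt l<..<0} b = (\<integral>\<^sup>+s. ennreal (abs(b (- s)) powr p) * indicator {0<..<tt l} s \<partial>lborel)"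
  unfolding powint_def
  by (subst nn_integral_real_affine[of _ "- 1" 0]) (auto intro!: nn_integral_cong split: split_indicator)
 also have "... = (\<integral>\<^sup>+x. ennreal (a x) * (ennreal (abs(b (- tt x)) powr p) * indicator {0<..<tt l} (tt x)) \<partial>lborel)"
  by (rule nn_integral_tt) measurable
 also have "... = (\<integral>\<^sup>+x. ennreal (a x) * (ennreal (abs(b (- tt x)) powr p) * indicator {0<..<l} x) \<partial>lborel)"
  using tt_less_iff[of 0] tt_less_iff[of _ l] by (intro nn_integral_cong) (auto simp: tt_0 split: split_indicator)
 finally have eq: "powint p {- tt l<..<0} b = ..." .
 have c: "ennreal c * powint p {0<..<l} (%x. b (- tt x)) = (\<integral>\<^sup>+x. ennreal c * (ennreal (abs(b (- tt x)) powr p) * indicator {0<..<l} x) \<partial>lborel)" for c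
  unfolding powint_def by (rule nn_integral_cmult[symmetric]) measurable
 show "powint p {- tt l<..<0} b <= ennreal M * powint p {0<..<l} (%x. b (- tt x))"
  unfolding eq c by (intro nn_integral_mono mult_right_mono ennreal_leI a_bounds) simp
 show "ennreal m * powint p {0<..<l} (%x. b (- tt x)) <= powint p {- tt l<..<0} b"
  unfolding eq c by (intro nn_integral_mono mult_right_mono ennreal_leI a_bounds) simp
qed
end

locale characteristic = time_change +
 fixes ka :: "real => real" and l :: real
 assumes ka[measurable]: "ka : Borel" and ka_bound: "abs(ka x) <= M" and l: "0 < l"
begin
text \<open>The amplification along the characteristic, normalized at the outflow end \<open>l\<close>.\<close>

definition amp :: "real => real" where "amp x = exp (ivl 0 x ka - ivl 0 l ka)"

lemma amp_pos: "0 < amp x" by (simp add: amp_def)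

lemma amp_l: "amp l = 1" by (simp add: amp_def)

lemma amp_measurable[measurable]: "amp : Borel"
proof -
 have [measurable]: "(%x. ivl 0 x ka) : Borel" by (rule ivl_measurable(2)[OF ka])
 show ?thesis unfolding amp_def[abs_def] by measurable
qed

lemma ka_integrable: "L1_on {c..d} ka"
 unfolding set_integrable_real
proof (rule Bochner_Integration.integrable_bound)
 show "integrable lborel (%t. indicator {c..d} t * M)"
  using set_integrable_const_Icc[of c d M] by (simp add: set_integrable_real)
 show "AE x in lborel. norm (indicator {c..d} x * ka x) <= norm (indicator {c..d} x * M)"
  using ka_bound M by (intro AE_I2) (auto split: split_indicator)
qed measurable

definition amp_bound :: real where "amp_bound = exp (2 * (M * l))"

lemma amp_bounds: "x : {0..l} ==> amp x <= amp_bound" "x : {0..l} ==> 1 / amp x <= amp_bound"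
proof -
 have *: "abs(ivl 0 x ka) <= M * l" if "x : {0..l}" for x
 proof -
  have "abs(ivl 0 x ka) <= ivl 0 x (%t. abs(ka t))" by (rule ivl_abs_le)
  also have "... <= ivl 0 x (%t. M)"
   using set_integrable_abs[OF ka_integrable[of 0 x]] ka_bound by (intro ivl_mono set_integrable_const_Icc) auto
  also have "... <= M * l" using that M by (simp add: ivl_const)
  finally show ?thesis .
 qed
 assume x: "x : {0..l}"
 have "abs(ivl 0 x ka) <= M * l" "abs(ivl 0 l ka) <= M * l" using * x l by auto
 then show "amp x <= amp_bound" "1 / amp x <= amp_bound"
  unfolding amp_def amp_bound_def by (auto simp: exp_minus[symmetric] inverse_eq_divide[symmetric])
qed

lemma amp_primitive:
 assumes x: "x : {0..l}"
 shows "amp x = amp 0 + ivl 0 x (%y. ka y * amp y)" "1 / amp x = 1 / amp 0 + ivl 0 x (%y. - ka y * (1 / amp y))"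
proof -
 have 1: "exp (ivl 0 x ka) = 1 + ivl 0 x (%y. ka y * exp (ivl 0 y ka))"
  using x by (intro ivl_exp_rule ka_integrable) simp
 have "amp x = exp (- ivl 0 l ka) * exp (ivl 0 x ka)" by (simp add: amp_def exp_add[symmetric])
 also have "... = exp (- ivl 0 l ka) + ivl 0 x (%y. exp (- ivl 0 l ka) * (ka y * exp (ivl 0 y ka)))"
  by (subst 1) (simp add: ivl_cmult distrib_left)
 also have "(%y. exp (- ivl 0 l ka) * (ka y * exp (ivl 0 y ka))) = (%y. ka y * amp y)"
  by (simp add: amp_def exp_diff exp_minus field_simps)
 finally show "amp x = amp 0 + ivl 0 x (%y. ka y * amp y)" by (simp add: amp_def ivl_refl)
 have neg: "ivl 0 y (%t. - ka t) = - ivl 0 y ka" for y using ivl_cmult[of 0 y "- 1" ka] by simp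
 have 2: "exp (- ivl 0 x ka) = 1 + ivl 0 x (%y. - ka y * exp (- ivl 0 y ka))"
  using ivl_exp_rule[of 0 x "%t. - ka t"] x ka_integrable[of 0 x] unfolding neg by (simp add: set_integrable_real)
 have inv: "1 / amp y = exp (ivl 0 l ka) * exp (- ivl 0 y ka)" for y
  by (simp add: amp_def exp_add[symmetric] exp_minus[symmetric] inverse_eq_divide[symmetric])
 have "1 / amp x = exp (ivl 0 l ka) + ivl 0 x (%y. exp (ivl 0 l ka) * (- ka y * exp (- ivl 0 y ka)))"
  unfolding inv by (subst 2) (simp only: ivl_cmult distrib_left mult_1_right)
 also have "(%y. exp (ivl 0 l ka) * (- ka y * exp (- ivl 0 y ka))) = (%y. - ka y * (1 / amp y))"
  unfolding inv by (simp add: mult_ac)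
 finally show "1 / amp x = 1 / amp 0 + ivl 0 x (%y. - ka y * (1 / amp y))" using inv[of 0] by (simp add: ivl_refl)
qed

lemma amp_continuous: "continuous_on {0..l} amp" "continuous_on {0..l} (%x. 1 / amp x)"
proof -
 show "continuous_on {0..l} amp"
  unfolding amp_def[abs_def] by (intro continuous_intros continuous_on_ivl ka_integrable)
 then show "continuous_on {0..l} (%x. 1 / amp x)"
  by (intro continuous_intros) (auto simp: less_imp_neq[OF amp_pos, symmetric])
qed

lemma transport_finite:
 assumes p: "1 <= p" and b[measurable]: "b : Borel" and fin: "powint p {- tt l<..<0} b < infinity"
 shows "powint p {0<..<l} (%x. b (- tt x)) < infinity"
proof -
 have "ennreal m * powint p {0<..<l} (%x. b (- tt x)) < infinity" by (rule le_less_trans[OF powint_tt(2)[OF b] fin])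
 then show ?thesis using m by (auto simp: ennreal_mult_less_top)
qed

context
 fixes p :: real and b om :: "real => real" and be :: real
 assumes p: "1 <= p" and b[measurable]: "b : Borel" and om[measurable]: "om : Borel"
  and b_fin: "powint p {- tt l<..<0} b < infinity" and om_fin: "powint p {- tt l<..<0} om < infinity"
begin
definition F where "F x = amp x * b (- tt x)"
definition G where "G x = amp x * om (- tt x)"
definition H where "H x = ka x * F x - a x * G x"
definition Q where "Q x = be - ivl (- tt x) 0 om"

lemma F_measurable[measurable]: "F : Borel"
 and G_measurable[measurable]: "G : Borel"
 and H_measurable[measurable]: "H : Borel"
 unfolding F_def[abs_def] G_def[abs_def] H_def[abs_def] by measurable

lemma Q_measurable[measurable]: "Q : Borel"
proof -
 have [measurable]: "(%s. ivl s 0 om) : Borel" by (rule ivl_measurable(1)[OF om])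
 show ?thesis unfolding Q_def[abs_def] by measurable
qed

lemma F_finite: "powint p {0<..<l} F < infinity" and G_finite: "powint p {0<..<l} G < infinity"
proof -
 have "powint p {0<..<l} (%x. amp x * f (- tt x)) < infinity"
  if [measurable]: "f : Borel" and "powint p {- tt l<..<0} f < infinity" for f
 proof -
  have "powint p {0<..<l} (%x. amp x * f (- tt x)) <= ennreal (amp_bound powr p) * powint p {0<..<l} (%x. f (- tt x))"
   using p amp_bounds(1) less_imp_le[OF amp_pos] by (intro powint_mult_bounded_le) (auto simp: amp_bound_def)
  then show ?thesis using transport_finite[OF p that] by (auto simp: ennreal_mult_less_top intro: le_less_trans)
 qed
 then show "powint p {0<..<l} F < infinity" "powint p {0<..<l} G < infinity"
  unfolding F_def[abs_def] G_def[abs_def] using b_fin om_fin by simp_all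
qed

lemma H_finite: "powint p {0<..<l} H < infinity"
proof -
 have "powint p {0<..<l} (%x. ka x * F x) < infinity"
  using powint_mult_bounded_le[of p "{0<..<l}" ka M F] p ka_bound M F_finite
  by (auto simp: ennreal_mult_less_top intro: le_less_trans)
 moreover have "powint p {0<..<l} (%x. a x * G x) < infinity"
  using powint_mult_bounded_le[of p "{0<..<l}" a M G] p a_bounds(2) a_pos M G_finite
  by (auto simp: ennreal_mult_less_top less_imp_le intro: le_less_trans)
 ultimately show ?thesis
  unfolding H_def[abs_def] using powint_diff[OF p, of "%x. ka x * F x" "%x. a x * G x" "{0<..<l}"]
  by (auto simp: ennreal_mult_less_top intro: le_less_trans)
qed

lemma H_integrable: "L1_on {0..l} H"
 using powint_integrable(1)[OF p H_measurable H_finite] by (simp add: set_integrable_cong_Ioo)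

lemma q_integrable: "L1_on {0..l} (%y. - (a y * om (- tt y)))"
proof -
 have "powint p {0<..<l} (%x. a x * om (- tt x)) <= ennreal (M powr p) * powint p {0<..<l} (%x. om (- tt x))"
  using p a_bounds(2) a_pos M by (intro powint_mult_bounded_le) (auto simp: less_imp_le)
 then have "powint p {0<..<l} (%x. a x * om (- tt x)) < infinity"
  using transport_finite[OF p om om_fin] by (auto simp: ennreal_mult_less_top intro: le_less_trans)
 then have "L1_on {0..l} (%x. a x * om (- tt x))"
  using powint_integrable(1)[OF p, of "%x. a x * om (- tt x)" 0 l] by (simp add: set_integrable_cong_Ioo)
 then show ?thesis by (simp add: set_integrable_real)
qed

lemma Q_0: "Q 0 = be" by (simp add: Q_def tt_0 ivl_refl)

lemma Q_primitive: "Q x = Q 0 + ivl 0 x (%y. - (a y * om (- tt y)))"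
proof -
 have "ivl (- tt x) 0 om = ivl (tt 0) (tt x) (%s. om (- s))" by (simp add: ivl_reflect tt_0)
 also have "... = ivl 0 x (%y. a y * om (- tt y))" by (rule ivl_tt) measurable
 finally show ?thesis
  using ivl_cmult[of 0 x "- 1" "%y. a y * om (- tt y)"] unfolding Q_0 by (simp add: Q_def)
qed

lemma amp_Q:
 assumes x: "x : {0..l}"
 shows "amp x * Q x = amp 0 * be + ivl 0 x (%y. ka y * (amp y * Q y) - a y * G y)"
proof -
 have "amp x * Q x - amp 0 * Q 0 = ivl 0 x (%y. (ka y * amp y) * Q y + amp y * - (a y * om (- tt y)))"
 proof (rule ivl_product_rule(2))
  show "L1_on {0..x} (%y. ka y * amp y)"
   by (rule set_integrable_mult_continuous[OF ka_integrable continuous_on_subset[OF amp_continuous(1)]]) (use x in auto)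
  show "L1_on {0..x} (%y. - (a y * om (- tt y)))"
   by (rule set_integrable_subinterval[OF q_integrable]) (use x in auto)
  show "amp y = amp 0 + ivl 0 y (%y. ka y * amp y)" if "y : {0..x}" for y using that x by (intro amp_primitive) auto
  show "Q y = Q 0 + ivl 0 y (%y. - (a y * om (- tt y)))" for y by (rule Q_primitive)
 qed (use x in simp)
 also have "... = ivl 0 x (%y. ka y * (amp y * Q y) - a y * G y)" by (intro ivl_cong) (simp add: G_def algebra_simps)
 finally show ?thesis by (simp add: Q_0)
qed

lemma transport_value:
 assumes F: "AE x\<in>{0<..<l} in lborel. F x = amp 0 * be + ivl 0 x H" and x: "x : {0..l}"
 shows "amp 0 * be + ivl 0 x H = amp x * Q x"
proof -
 define f where "f x = amp 0 * be + ivl 0 x H" for x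
 have [measurable]: "f : Borel" unfolding f_def[abs_def] using ivl_measurable(2)[OF H_measurable] by simp
 have "(1 / amp x) * f x - (1 / amp 0) * f 0 = ivl 0 x (%y. (- ka y * (1 / amp y)) * f y + (1 / amp y) * H y)"
 proof (rule ivl_product_rule(2))
  have "L1_on {0..x} (%y. - 1 * (ka y * (1 / amp y)))"
   by (intro set_integrable_mult_right set_integrable_mult_continuous[OF ka_integrable continuous_on_subset[OF amp_continuous(2)]])
   (use x in auto)
  then show "L1_on {0..x} (%y. - ka y * (1 / amp y))" by simp
  show "L1_on {0..x} H" by (rule set_integrable_subinterval[OF H_integrable]) (use x in auto)
  show "1 / amp y = 1 / amp 0 + ivl 0 y (%y. - ka y * (1 / amp y))" if "y : {0..x}" for y
   using that x by (intro amp_primitive) auto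
  show "f y = f 0 + ivl 0 y H" for y by (simp add: f_def ivl_refl)
 qed (use x in simp)
 also have "... = ivl 0 x (%y. - (a y * om (- tt y)))"
 proof (rule ivl_cong_AE)
  show "AE y\<in>{0<..<x} in lborel. (- ka y * (1 / amp y)) * f y + (1 / amp y) * H y = - (a y * om (- tt y))"
   using F
  proof eventually_elim
   case (elim y)
   show ?case
   proof
   assume "y : {0<..<x}"
   then have "f y = F y" using elim x by (simp add: f_def)
   then have "(- ka y * (1 / amp y)) * f y + (1 / amp y) * H y = - (a y * (G y / amp y))"
   by (simp add: H_def diff_divide_distrib right_diff_distrib)
   also have "G y / amp y = om (- tt y)" using amp_pos[of y] by (simp add: G_def)
   finally show "(- ka y * (1 / amp y)) * f y + (1 / amp y) * H y = - (a y * om (- tt y))" .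
   qed
  qed
 qed measurable
 also have "... = Q x - Q 0" using Q_primitive[of x] by linarith
 finally have "f x / amp x = Q x" using amp_pos[of 0] by (simp add: Q_0 f_def ivl_refl)
 then show ?thesis using amp_pos[of x] by (simp add: f_def field_simps)
qed

text \<open>
  Along the characteristics the operator \<open>- v \<partial>\<^sub>x + k\<close> becomes the derivative with respect to travel time.
\<close>

lemma transport_iff:
 "(AE s\<in>{- tt l<..<0} in lborel. b s = be - ivl s 0 om) <=>
  (AE x\<in>{0<..<l} in lborel. F x = amp 0 * be + ivl 0 x H)"
proof
 assume "AE s\<in>{- tt l<..<0} in lborel. b s = be - ivl s 0 om"
 from AE_tt[OF AE_reflect[OF this]] have FQ: "AE x\<in>{0<..<l} in lborel. F x = amp x * Q x"
  by eventually_elim (use tt_less_iff[of 0] tt_less_iff[of _ l] in \<open>auto simp: F_def Q_def tt_0\<close>)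
 then show "AE x\<in>{0<..<l} in lborel. F x = amp 0 * be + ivl 0 x H"
 proof eventually_elim
  case (elim x)
  show ?case
  proof
   assume x: "x : {0<..<l}"
   have "ivl 0 x (%y. ka y * (amp y * Q y) - a y * G y) = ivl 0 x H"
   proof (rule ivl_cong_AE)
   show "AE y\<in>{0<..<x} in lborel. ka y * (amp y * Q y) - a y * G y = H y"
   using FQ by eventually_elim (use x in \<open>auto simp: H_def\<close>)
   qed measurable
   then show "F x = amp 0 * be + ivl 0 x H" using elim x amp_Q[of x] by simp
  qed
 qed
next
 assume F: "AE x\<in>{0<..<l} in lborel. F x = amp 0 * be + ivl 0 x H"
 have "AE x\<in>{0<..<l} in lborel. b (- tt x) = Q x"
  using F
 proof eventually_elim
  case (elim x)
  show ?case using elim transport_value[OF F, of x] amp_pos[of x] by (auto simp: F_def)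
 qed
 from AE_reflect[OF AE_pos[OF this]]
 show "AE s\<in>{- tt l<..<0} in lborel. b s = be - ivl s 0 om"
 proof eventually_elim
  case (elim s)
  show ?case
  proof
   assume s: "s : {- tt l<..<0}"
   then have "pos (- s) : {0<..<l}" using tt_less_iff[of 0 "pos (- s)"] tt_less_iff[of "pos (- s)" l] by (simp add: tt_0 tt_pos)
   then show "b s = be - ivl s 0 om" using elim by (simp add: Q_def tt_pos)
  qed
 qed
qed
end

end

section \<open>The state space\<close>

lemma Lp_add: "1 <= p ==> f : Lp p a b ==> g : Lp p a b ==> f + g : Lp p a b"
 and Lp_norm_add: "1 <= p ==> f : Lp p a b ==> g : Lp p a b ==> Lp_norm p a b (f + g) <= Lp_norm p a b f + Lp_norm p a b g"
 and Lp_diff: "1 <= p ==> f : Lp p a b ==> g : Lp p a b ==> f - g : Lp p a b"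
 and Lp_scaleR: "f : Lp p a b ==> c *\<^sub>R f : Lp p a b"
 and Lp_norm_scaleR: "1 <= p ==> Lp_norm p a b (c *\<^sub>R f) = abs(c) * Lp_norm p a b f"
 unfolding Lp_eq_Lspace Lp_norm_eq_Lnorm plus_fun_def fun_diff_def scaleR_fun_def
 using Minkowski Lspace_diff Lspace_scaleR Lnorm_scaleR by blast+

lemma Lp_norm_triangle:
 "1 <= p ==> f : Lp p a b ==> g : Lp p a b ==> h : Lp p a b ==> Lp_norm p a b (f - h) <= Lp_norm p a b (f - g) + Lp_norm p a b (g - h)"
 using Lp_norm_add[of p "f - g" a b "g - h"] by (simp add: Lp_diff)

lemma Lp_norm_diff_eq_0_iff:
 fixes f g :: "real => real^'n"
 assumes p: "1 <= p" and f: "f : Lp p a b" and g: "g : Lp p a b" and G: "rep a b g G"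
 shows "Lp_norm p a b (f - g) = 0 <=> rep a b f G"
proof
 obtain F where F: "rep a b f F" using Lp_rep[OF p f] by blast
 have d: "rep a b (f - g) (%i x. F i x - G i x)" by (rule rep_diff[OF F G])
 assume 0: "Lp_norm p a b (f - g) = 0"
 have "AE x\<in>{a<..<b} in lborel. f x $ i = G i x" for i
 proof -
  have "powint p {a<..<b} (%x. F i x - G i x) = 0"
   using Lp_norm_bounds(1)[OF p Lp_diff[OF p f g] d, of i] p by (simp add: 0)
  then have "AE x\<in>{a<..<b} in lborel. F i x - G i x = 0"
   by (subst (asm) powint_eq_0_iff) (auto intro!: borel_measurable_diff rep_meas[OF F] rep_meas[OF G])
  then show ?thesis using rep_AE[OF F, of i] by eventually_elim auto
 qed
 then show "rep a b f G" using rep_meas[OF G] by (simp add: rep_def)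
next
 assume f': "rep a b f G"
 have "ennreal (Lp_norm p a b (f - g) powr p) <= 0"
  using Lp_norm_bounds(2)[OF p Lp_diff[OF p f g] rep_diff[OF f' G]] by (simp add: powint_def)
 then show "Lp_norm p a b (f - g) = 0" using p Lp_norm_nonneg[of p a b "f - g"] by (simp add: ennreal_eq_0_iff)
qed

lemma XY_norm_diff_eq_0_iff:
 assumes p: "1 <= p" and u: "u : XY p l r" and w: "w : XY p l r"
  and F: "rep 0 l (fst w) F" and Ph: "rep (-r) 0 (snd w) Ph"
 shows "XY_norm p l r (u - w) = 0 <=> rep 0 l (fst u) F & rep (-r) 0 (snd u) Ph"
proof -
 have L: "fst u : Lp p 0 l" "snd u : Lp p (-r) 0" "fst w : Lp p 0 l" "snd w : Lp p (-r) 0" using u w by (auto simp: XY_def)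
 have "XY_norm p l r (u - w) = 0 <=> Lp_norm p 0 l (fst u - fst w) = 0 & Lp_norm p (-r) 0 (snd u - snd w) = 0"
  using Lp_norm_nonneg[of p 0 l "fst u - fst w"] Lp_norm_nonneg[of p "- r" 0 "snd u - snd w"]
  by (auto simp: XY_norm_def split_beta add_nonneg_eq_0_iff)
 then show ?thesis by (simp add: Lp_norm_diff_eq_0_iff[OF p L(1,3) F] Lp_norm_diff_eq_0_iff[OF p L(2,4) Ph])
qed

lemma XY_complete:
 assumes p: "1 <= p"
 shows "complete_seminormed_space (XY p l r :: 'n::finite state set) (XY_norm p l r)"
proof
 show "subspace (XY p l r :: 'n state set)"
 proof (rule subspaceI)
  show "0 : (XY p l r :: 'n state set)"
   using Lspace_zero by (auto simp: XY_def Lp_eq_Lspace zero_prod_def zero_fun_def)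
 qed (use p in \<open>auto simp: XY_def Lp_add Lp_scaleR\<close>)
next
 fix u :: "'n state"
 show "0 <= XY_norm p l r u" by (simp add: XY_norm_def split_beta Lp_norm_nonneg)
 show "XY_norm p l r (c *\<^sub>R u) = abs(c) * XY_norm p l r u" for c
  by (simp add: XY_norm_def split_beta Lp_norm_scaleR[OF p] distrib_left)
next
 fix u w :: "'n state" assume "u : XY p l r" "w : XY p l r"
 then show "XY_norm p l r (u + w) <= XY_norm p l r u + XY_norm p l r w"
  using Lp_norm_add[OF p, of "fst u" 0 l "fst w"] Lp_norm_add[OF p, of "snd u" "- r" 0 "snd w"]
  by (auto simp: XY_def XY_norm_def split_beta)
next
 fix u :: "nat => 'n state" assume u: "!!n. u n : XY p l r" and le: "!!n. XY_norm p l r (u n) <= (1/3) ^ n"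
 have s: "(\<Sum>k<n. (g k :: real => real^'n)) = (%x. \<Sum>k<n. g k x)" for g and n :: nat
  by (induction n) (simp_all add: zero_fun_def plus_fun_def)
 have comp: "\<exists>w\<in>Lp p a b. (%n. Lp_norm p a b (w - (\<Sum>k<n. g k))) ----> 0"
  if "!!n. g n : Lp p a b" "!!n. Lp_norm p a b (g n) <= (1/3) ^ n" for g :: "nat => real => real^'n" and a b
  using Lspace_complete[OF p, of g "lebesgue_on {a<..<b}"] that
  by (simp add: s fun_diff_def Lp_eq_Lspace Lp_norm_eq_Lnorm)
 have "fst (u n) : Lp p 0 l" "snd (u n) : Lp p (-r) 0" for n using u[of n] by (auto simp: XY_def)
 moreover have "Lp_norm p 0 l (fst (u n)) <= (1/3) ^ n" "Lp_norm p (-r) 0 (snd (u n)) <= (1/3) ^ n" for n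
  using le[of n] Lp_norm_nonneg[of p 0 l "fst (u n)"] Lp_norm_nonneg[of p "- r" 0 "snd (u n)"]
  by (simp_all add: XY_norm_def split_beta)
 ultimately obtain w1 w2 where "w1 : Lp p 0 l" "w2 : Lp p (-r) 0"
  and lim: "(%n. Lp_norm p 0 l (w1 - (\<Sum>k<n. fst (u k)))) ----> 0" "(%n. Lp_norm p (-r) 0 (w2 - (\<Sum>k<n. snd (u k)))) ----> 0"
  using comp[of "%n. fst (u n)" 0 l] comp[of "%n. snd (u n)" "- r" 0] by blast
 then show "\<exists>w\<in>XY p l r. (%n. XY_norm p l r (w - (\<Sum>k<n. u k))) ----> 0"
  using tendsto_add[OF lim] by (intro bexI[of _ "(w1, w2)"]) (simp_all add: XY_def XY_norm_def split_beta fst_sum snd_sum)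
qed

lemma has_RS_cmult:
 assumes "has_RS a b P ph I"
 shows "has_RS a b (%t. c * P t) ph (c * I)"
 unfolding has_RS_def
proof (intro allI impI)
 fix e :: real assume e: "0 < e"
 then have "0 < e / (abs(c) + 1)" by simp
 then obtain dl where dl: "0 < dl" "!!d. d tagged_division_of {a..b} & (%x. ball x dl) fine d ==>
   abs((\<Sum>(x, J)\<in>d. (P (Sup J) - P (Inf J)) * ph x) - I) < e / (abs(c) + 1)"
  using assms unfolding has_RS_def by meson
 have "abs((\<Sum>(x, J)\<in>d. (c * P (Sup J) - c * P (Inf J)) * ph x) - c * I) < e"
  if d: "d tagged_division_of {a..b} & (%x. ball x dl) fine d" for d
 proof -
  let ?S = "\<Sum>(x, J)\<in>d. (P (Sup J) - P (Inf J)) * ph x"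
  have "(\<Sum>(x, J)\<in>d. (c * P (Sup J) - c * P (Inf J)) * ph x) = c * ?S"
   unfolding sum_distrib_left by (intro sum.cong refl) (simp add: split_beta algebra_simps)
  then have eq: "abs((\<Sum>(x, J)\<in>d. (c * P (Sup J) - c * P (Inf J)) * ph x) - c * I) = abs(c) * abs(?S - I)"
   by (simp add: abs_mult[symmetric] right_diff_distrib)
  have "abs(c) * abs(?S - I) <= abs(c) * (e / (abs(c) + 1))" using dl(2)[OF d] by (intro mult_left_mono) auto
  also have "... < e" using e by (simp add: field_simps)
  finally show ?thesis by (simp only: eq)
 qed
 then show "\<exists>dl>0. ALL d. d tagged_division_of {a..b} & (%x. ball x dl) fine d -->
   abs((\<Sum>(x, J)\<in>d. (c * P (Sup J) - c * P (Inf J)) * ph x) - c * I) < e" using dl(1) by blast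
qed

lemma left_monotone_cmult: "0 <= c ==> left_monotone a b P ==> left_monotone a b (%t. c * P t)"
 unfolding left_monotone_def by (auto intro: mult_left_mono continuous_intros)

section \<open>The hyperbolic system as a delay equation\<close>

locale hyperbolic_system =
 fixes p l r :: real and v k :: "real => real^'n::finite" and ee :: "real => real^'n^'n"
  and a ka :: "'n => real => real" and m M :: real
 assumes p: "1 <= p" and r: "0 < r" and char: "!!i. characteristic (a i) m M (ka i) l"
  and v_meas: "!!i. (%x. v x $ i) : borel_measurable (lebesgue_on {0<..<l})"
  and k_meas: "!!i. (%x. k x $ i) : borel_measurable (lebesgue_on {0<..<l})"
  and v_AE: "!!i. AE x\<in>{0<..<l} in lborel. v x $ i = 1 / a i x"
  and k_AE: "!!i. AE x\<in>{0<..<l} in lborel. k x $ i = ka i x / a i x"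
  and mono: "!!i j. left_monotone (-r) 0 (%t. ee t $ i $ j)"
begin
abbreviation "tt i \<equiv> time_change.tt (a i)"
abbreviation "amp i \<equiv> characteristic.amp (ka i) l"

lemma l: "0 < l" and m: "0 < m" and M: "0 < M"
proof -
 interpret c: characteristic "a i" m M "ka i" l for i by (rule char)
 show "0 < l" "0 < m" "0 < M" by (rule c.l c.m c.M)+
qed

lemma tt_pos: "0 < tt i l"
proof -
 interpret c: characteristic "a i" m M "ka i" l by (rule char)
 show ?thesis using c.tt_less_iff[of 0 l] l by (simp add: c.tt_0)
qed

lemma amp_pos: "0 < amp i x"
proof -
 interpret c: characteristic "a i" m M "ka i" l by (rule char)
 show ?thesis by (rule c.amp_pos)
qed

definition R :: "'n => real" where "R i = tt i l + r"
definition dl :: real where "dl = Min (range (%i. tt i l))"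
definition nv :: "'n => 'n => real measure" where
 "nv i j = delay_measure (-r) 0 (tt j l) (%t. (1 / amp i 0) * ee t $ i $ j)"

lemma scaled_mono: "left_monotone (-r) 0 (%t. (1 / amp i 0) * ee t $ i $ j)"
 using less_imp_le[OF amp_pos] by (intro left_monotone_cmult mono) simp

lemma dl_le: "dl <= tt i l" unfolding dl_def by (rule Min_le) auto

lemma nv_facts: "sets (nv i j) = sets borel" "finite_measure (nv i j)" "AE sv in nv i j. sv : {dl..R j}"
proof -
 interpret c: left_monotone "-r" 0 "%t. (1 / amp i 0) * ee t $ i $ j" by (rule scaled_mono)
 show "sets (nv i j) = sets borel" "finite_measure (nv i j)" unfolding nv_def by (rule c.sets_delay_measure c.finite_delay_measure)+
 show "AE sv in nv i j. sv : {dl..R j}"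
  using c.AE_delay_measure[of "tt j l"] unfolding nv_def by eventually_elim (use dl_le[of j] in \<open>auto simp: R_def\<close>)
qed

lemma dl_pos: "0 < dl" unfolding dl_def by (simp add: tt_pos)

lemma dl_le_R: "dl <= R j" using dl_le[of j] r by (simp add: R_def)

sublocale delay_equation p dl R nv
 by (rule delay_equation.intro) (rule p dl_pos dl_le_R nv_facts)+

text \<open>The state at time zero that corresponds to a history of the outflow values.\<close>

definition state :: "('n => real => real) => 'n state" where
 "state b = ((%x. \<chi> i. amp i x * b i (- tt i x)), (%te. \<chi> i. b i (te - tt i l)))"

definition D :: real where
 "D = exp (2 * (M * l)) powr p * (1 / m) + M * exp (2 * (M * l)) powr p + 1"

lemma D: "1 <= D" using m M by (simp add: D_def)

lemma component_bounds:
 assumes b[measurable]: "f : Borel"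
 shows "(%x. amp i x * f (- tt i x)) : Borel"
  and "powint p {0<..<l} (%x. amp i x * f (- tt i x)) <= ennreal D * powint p {- tt i l<..<0} f"
  and "powint p {- tt i l<..<0} f <= ennreal D * powint p {0<..<l} (%x. amp i x * f (- tt i x))"
  and "powint p {-r<..<0} (%te. f (te - tt i l)) = powint p {- R i<..<- tt i l} f"
proof -
 interpret c: characteristic "a i" m M "ka i" l by (rule char)
 let ?e = "c.amp_bound"
 have e: "0 <= ?e" by (simp add: c.amp_bound_def)
 show me[measurable]: "(%x. amp i x * f (- tt i x)) : Borel" by measurable
 have "powint p {0<..<l} (%x. amp i x * f (- tt i x)) <= ennreal (?e powr p) * powint p {0<..<l} (%x. f (- tt i x))"
  using p e c.amp_bounds(1) less_imp_le[OF c.amp_pos] by (intro powint_mult_bounded_le) auto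
 also have "... = ennreal (?e powr p * (1 / m)) * (ennreal m * powint p {0<..<l} (%x. f (- tt i x)))"
  using m by (simp add: mult.assoc[symmetric] ennreal_mult[symmetric])
 also have "... <= ennreal D * powint p {- tt i l<..<0} f"
  using m M by (intro mult_mono c.powint_tt(2) ennreal_leI) (auto simp: D_def c.amp_bound_def)
 finally show "powint p {0<..<l} (%x. amp i x * f (- tt i x)) <= ennreal D * powint p {- tt i l<..<0} f" .
 have "powint p {- tt i l<..<0} f <= ennreal M * powint p {0<..<l} (%x. f (- tt i x))" by (rule c.powint_tt(1)[OF b])
 also have "(%x. f (- tt i x)) = (%x. (1 / amp i x) * (amp i x * f (- tt i x)))"
  using less_imp_neq[OF c.amp_pos, symmetric] by auto
 also have "powint p {0<..<l} ... <= ennreal (?e powr p) * powint p {0<..<l} (%x. amp i x * f (- tt i x))"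
  using p e c.amp_bounds(2) less_imp_le[OF c.amp_pos] by (intro powint_mult_bounded_le) auto
 also have "ennreal M * ... = ennreal (M * ?e powr p) * powint p {0<..<l} (%x. amp i x * f (- tt i x))"
  using M by (simp add: ennreal_mult mult.assoc)
 also have "... <= ennreal D * powint p {0<..<l} (%x. amp i x * f (- tt i x))"
  using m M by (intro mult_right_mono ennreal_leI) (auto simp: D_def c.amp_bound_def)
 finally show "powint p {- tt i l<..<0} f <= ennreal D * powint p {0<..<l} (%x. amp i x * f (- tt i x))"
  by (simp add: mult_left_mono)
 show "powint p {-r<..<0} (%te. f (te - tt i l)) = powint p {- R i<..<- tt i l} f"
  using powint_shift[OF b, of p "- r" 0 "- tt i l"] by (simp add: R_def algebra_simps)
qed

lemma powint_split: "f : Borel ==> powint p {- R i<..<0} f <= powint p {- R i<..<- tt i l} f + powint p {- tt i l<..<0} f"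
proof -
 assume [measurable]: "f : Borel"
 have "powint p {- R i<..<0} f <= (\<integral>\<^sup>+x. ennreal (abs(f x) powr p) * indicator {- R i<..<- tt i l} x + ennreal (abs(f x) powr p) * indicator {- tt i l<..<0} x \<partial>lborel)"
  unfolding powint_def
 proof (rule nn_integral_mono_AE)
  show "AE x in lborel. ennreal (abs(f x) powr p) * indicator {- R i<..<0} x <=
   ennreal (abs(f x) powr p) * indicator {- R i<..<- tt i l} x + ennreal (abs(f x) powr p) * indicator {- tt i l<..<0} x"
   using AE_neq[of "- tt i l"] by eventually_elim (auto split: split_indicator)
 qed
 then show ?thesis unfolding powint_def by (subst (asm) nn_integral_add) auto
qed

lemma powint_parts_le: "powint p {- R i<..<- tt i l} f <= powint p {- R i<..<0} f" "powint p {- tt i l<..<0} f <= powint p {- R i<..<0} f"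
 using tt_pos[of i] r by (intro powint_mono_set; auto simp: R_def)+

context
 fixes b :: "'n => real => real"
 assumes b[measurable]: "!!j. b j : Borel"
begin
lemma state_rep: "rep 0 l (fst (state b)) (%i x. amp i x * b i (- tt i x))" "rep (-r) 0 (snd (state b)) (%i te. b i (te - tt i l))"
 unfolding state_def fst_conv snd_conv using component_bounds(1)[OF b] by (intro rep_vec_lambda; simp)+

context
 assumes fin: "en b < infinity"
begin
lemma component_finite: "powint p {0<..<l} (%x. amp i x * b i (- tt i x)) < infinity" "powint p {-r<..<0} (%te. b i (te - tt i l)) < infinity"
 "powint p {- tt i l<..<0} (b i) < infinity"
proof -
 have fi: "powint p {- R i<..<0} (b i) < infinity" using fin unfolding en_finite_iff by blast
 show 1: "powint p {- tt i l<..<0} (b i) < infinity" by (rule le_less_trans[OF powint_parts_le(2) fi])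
 then show "powint p {0<..<l} (%x. amp i x * b i (- tt i x)) < infinity"
  by (intro le_less_trans[OF component_bounds(2)[OF b]]) (simp add: ennreal_mult_less_top)
 show "powint p {-r<..<0} (%te. b i (te - tt i l)) < infinity"
  unfolding component_bounds(4)[OF b] by (rule le_less_trans[OF powint_parts_le(1) fi])
qed

lemma state_in: "state b : XY p l r"
 unfolding state_def XY_def using component_bounds(1)[OF b] component_finite by (auto intro!: vec_lambda_in_Lp[OF p])

lemma state_Lp: "fst (state b) : Lp p 0 l" "snd (state b) : Lp p (-r) 0"
 using state_in by (auto simp: XY_def)

lemma state_norm_le:
 "ennreal (XY_norm p l r (state b) powr p) <= ennreal (2 powr (p - 1) * (real CARD('n) powr (p - 1) * (D + 1))) * en b"
proof -
 let ?f = "Lp_norm p 0 l (fst (state b))" and ?g = "Lp_norm p (-r) 0 (snd (state b))" and ?C = "real CARD('n) powr (p - 1)"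
 have f: "ennreal (?f powr p) <= ennreal ?C * (ennreal D * en b)"
 proof (rule order_trans[OF Lp_norm_bounds(2)[OF p state_Lp(1) state_rep(1)]], rule mult_left_mono)
  show "(SUM i:UNIV. powint p {0<..<l} (%x. amp i x * b i (- tt i x))) <= ennreal D * en b"
   unfolding en_def sum_distrib_left
   by (intro sum_mono order_trans[OF component_bounds(2)[OF b]] mult_left_mono powint_parts_le) simp
 qed simp
 have g: "ennreal (?g powr p) <= ennreal ?C * en b"
 proof (rule order_trans[OF Lp_norm_bounds(2)[OF p state_Lp(2) state_rep(2)]], rule mult_left_mono)
  show "(SUM i:UNIV. powint p {-r<..<0} (%te. b i (te - tt i l))) <= en b"
   unfolding en_def component_bounds(4)[OF b] by (intro sum_mono powint_parts_le)
 qed simp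
 have "ennreal (XY_norm p l r (state b) powr p) <= ennreal (2 powr (p - 1) * (?f powr p + ?g powr p))"
  using abs_powr_add_le[OF p, of ?f ?g] by (intro ennreal_leI) (simp add: XY_norm_def split_beta Lp_norm_nonneg)
 also have "... = ennreal (2 powr (p - 1)) * (ennreal (?f powr p) + ennreal (?g powr p))" by (simp add: ennreal_mult)
 also have "... <= ennreal (2 powr (p - 1)) * (ennreal ?C * (ennreal D * en b) + ennreal ?C * en b)"
  by (intro mult_left_mono add_mono f g) simp
 also have "... = ennreal (2 powr (p - 1) * (?C * (D + 1))) * en b"
  using D by (simp add: ennreal_mult distrib_left distrib_right mult.assoc)
 finally show ?thesis .
qed

lemma state_norm_ge: "en b <= ennreal ((D + 1) * real CARD('n)) * ennreal (XY_norm p l r (state b) powr p)"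
proof -
 let ?N = "ennreal (XY_norm p l r (state b) powr p)"
 have "en b <= (\<Sum>i\<in>(UNIV::'n set). ?N + ennreal D * ?N)"
  unfolding en_def
 proof (rule sum_mono)
  fix i :: 'n
  have "powint p {0<..<l} (%x. amp i x * b i (- tt i x)) <= ?N"
   by (rule order_trans[OF Lp_norm_bounds(1)[OF p state_Lp(1) state_rep(1)]])
   (use p in \<open>auto intro!: ennreal_leI powr_mono2 simp: XY_norm_def split_beta Lp_norm_nonneg\<close>)
  moreover have "powint p {-r<..<0} (%te. b i (te - tt i l)) <= ?N"
   by (rule order_trans[OF Lp_norm_bounds(1)[OF p state_Lp(2) state_rep(2)]])
   (use p in \<open>auto intro!: ennreal_leI powr_mono2 simp: XY_norm_def split_beta Lp_norm_nonneg\<close>)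
  ultimately have "powint p {- R i<..<- tt i l} (b i) + powint p {- tt i l<..<0} (b i) <= ?N + ennreal D * ?N"
   unfolding component_bounds(4)[OF b]
   by (intro add_mono order_trans[OF component_bounds(3)[OF b]] mult_left_mono) simp_all
  then show "powint p {- R i<..<0} (b i) <= ?N + ennreal D * ?N" by (rule order_trans[OF powint_split[OF b]])
 qed
 also have "... = ennreal ((D + 1) * real CARD('n)) * ?N"
  using D by (simp add: ennreal_mult distrib_right distrib_left ennreal_of_nat_eq_real_of_nat mult_ac)
 finally show ?thesis .
qed

lemma state_eq_iff:
 assumes u: "u : XY p l r"
 shows "XY_norm p l r (u - state b) = 0 <=>
  rep 0 l (fst u) (%i x. amp i x * b i (- tt i x)) & rep (-r) 0 (snd u) (%i te. b i (te - tt i l))"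
 by (rule XY_norm_diff_eq_0_iff[OF p u state_in state_rep])
end

end

lemma state_onto:
 assumes u: "u : XY p l r"
 shows "EX b. (ALL j. b j : Borel) & en b < infinity & XY_norm p l r (u - state b) = 0"
proof -
 have uL: "fst u : Lp p 0 l" "snd u : Lp p (-r) 0" using u by (auto simp: XY_def)
 obtain F where F: "rep 0 l (fst u) F" "!!i. powint p {0<..<l} (F i) < infinity" using Lp_rep[OF p uL(1)] by blast
 obtain Ph where Ph: "rep (-r) 0 (snd u) Ph" "!!i. powint p {-r<..<0} (Ph i) < infinity" using Lp_rep[OF p uL(2)] by blast
 have [measurable]: "F i : Borel" "Ph i : Borel" for i
  by (rule rep_meas[OF F(1)] rep_meas[OF Ph(1)])+
 define b where "b i s = (if s < - tt i l then Ph i (s + tt i l) else F i (time_change.pos (a i) (- s)) / amp i (time_change.pos (a i) (- s)))" for i s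
 have bm[measurable]: "b i : Borel" for i
 proof -
  interpret c: characteristic "a i" m M "ka i" l by (rule char)
  show ?thesis unfolding b_def[abs_def] by measurable
 qed
 have eqF: "amp i x * b i (- tt i x) = F i x" if "x : {0<..<l}" for i x
 proof -
  interpret c: characteristic "a i" m M "ka i" l by (rule char)
  have "~ - tt i x < - tt i l" using c.tt_less_iff[of l x] that by simp
  then show ?thesis using less_imp_neq[OF amp_pos[of i x], symmetric] by (simp add: b_def c.pos_tt)
 qed
 have eqPh: "b i (te - tt i l) = Ph i te" if "te : {-r<..<0}" for i te using that by (simp add: b_def)
 have pF: "powint p {0<..<l} (%x. amp i x * b i (- tt i x)) = powint p {0<..<l} (F i)" for i
  by (intro powint_cong_AE AE_I2 impI eqF)
 have pPh: "powint p {-r<..<0} (%te. b i (te - tt i l)) = powint p {-r<..<0} (Ph i)" for i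
  by (intro powint_cong_AE AE_I2 impI eqPh)
 have fin: "en b < infinity"
  unfolding en_finite_iff
 proof
  fix i
  have "powint p {- R i<..<0} (b i) <= powint p {- R i<..<- tt i l} (b i) + powint p {- tt i l<..<0} (b i)"
   by (rule powint_split[OF bm])
  also have "... <= powint p {-r<..<0} (Ph i) + ennreal D * powint p {0<..<l} (F i)"
   using component_bounds(3,4)[OF bm[of i], of i] unfolding pF pPh by (intro add_mono) simp_all
  also have "... < infinity" using F(2)[of i] Ph(2)[of i] by (simp add: ennreal_mult_less_top)
  finally show "powint p {- R i<..<0} (b i) < infinity" .
 qed
 have "AE x\<in>{0<..<l} in lborel. fst u x $ i = amp i x * b i (- tt i x)" for i
  using rep_AE[OF F(1), of i] by eventually_elim (simp add: eqF)
 moreover have "AE x\<in>{-r<..<0} in lborel. snd u x $ i = b i (x - tt i l)" for i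
  using rep_AE[OF Ph(1), of i] by eventually_elim (simp add: eqPh)
 ultimately have "XY_norm p l r (u - state b) = 0"
  unfolding state_eq_iff[OF bm fin u] using component_bounds(1)[OF bm] by (simp add: rep_def)
 then show ?thesis using bm fin by blast
qed

lemma state_add: "state (%j s. b j s + c j s) = state b + state c"
 and state_scaleR: "state (%j s. x * b j s) = x *\<^sub>R state b"
 by (simp_all add: state_def plus_fun_def scaleR_fun_def vec_eq_iff fun_eq_iff algebra_simps)
end

lemma weighted_component: "A_max p l v k f x $ i = - (v x $ i * weak_deriv p 0 l f x $ i) + k x $ i * f x $ i"
 by (simp add: A_max_def diag_def matrix_vector_mult_def if_distrib[where f="%y. y * _"] sum.delta cong: if_cong)

context hyperbolic_system begin

lemma A_max_rep:
 assumes f: "f : W1p p 0 l" and F: "rep 0 l f F" and DF: "rep 0 l (weak_deriv p 0 l f) DF"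
 shows "rep 0 l (A_max p l v k f) (%i x. (ka i x * F i x - DF i x) / a i x)" "A_max p l v k f : Lp p 0 l"
proof -
 have fL: "f : Lp p 0 l" "weak_deriv p 0 l f : Lp p 0 l" using W1pD(1,2)[OF l p f] by auto
 have [measurable]: "F i : Borel" "DF i : Borel" for i by (rule rep_meas[OF F] rep_meas[OF DF])+
 have [measurable]: "a i : Borel" "ka i : Borel" for i
 proof -
  interpret c: characteristic "a i" m M "ka i" l by (rule char)
  show "a i : Borel" "ka i : Borel" by (rule c.a c.ka)+
 qed
 have "AE x\<in>{0<..<l} in lborel. A_max p l v k f x $ i = (ka i x * F i x - DF i x) / a i x" for i
  using rep_AE[OF F, of i] rep_AE[OF DF, of i] v_AE[of i] k_AE[of i]
  by eventually_elim (auto simp: weighted_component diff_divide_distrib)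
 then show rep: "rep 0 l (A_max p l v k f) (%i x. (ka i x * F i x - DF i x) / a i x)" by (simp add: rep_def)
 have fm: "f : borel_measurable (lebesgue_on {0<..<l})" "weak_deriv p 0 l f : borel_measurable (lebesgue_on {0<..<l})"
  using fL by (auto simp: Lp_def)
 have "(%x. A_max p l v k f x $ i) : borel_measurable (lebesgue_on {0<..<l})" for i
  unfolding weighted_component
  by (intro borel_measurable_add borel_measurable_uminus borel_measurable_times v_meas k_meas
   measurable_compose[OF fm(1) borel_measurable_nth] measurable_compose[OF fm(2) borel_measurable_nth])
 from borel_measurable_vec_lambda[of "%i x. A_max p l v k f x $ i", OF this]
 have "A_max p l v k f : borel_measurable (lebesgue_on {0<..<l})" by (simp add: vec_nth_inverse)
 moreover have "powint p {0<..<l} (%x. (ka i x * F i x - DF i x) / a i x) < infinity" for i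
 proof -
  interpret c: characteristic "a i" m M "ka i" l by (rule char)
  have fin: "powint p {0<..<l} (F i) < infinity" "powint p {0<..<l} (DF i) < infinity"
   using Lp_iff_rep[OF p F fm(1)] Lp_iff_rep[OF p DF fm(2)] fL by auto
  have "powint p {0<..<l} (%x. ka i x * F i x) < infinity"
   using powint_mult_bounded_le[of p "{0<..<l}" "ka i" M "F i"] p c.ka_bound M fin(1)
   by (auto simp: ennreal_mult_less_top intro: le_less_trans)
  then have d: "powint p {0<..<l} (%x. ka i x * F i x - DF i x) < infinity"
   using powint_diff[OF p, of "%x. ka i x * F i x" "DF i" "{0<..<l}"] fin(2)
   by (auto simp: ennreal_mult_less_top intro: le_less_trans)
  have "abs(1 / a i x) <= 1 / m" for x using c.a_pos[of x] c.a_bounds(1)[of x] m by (simp add: frac_le)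
  then have "powint p {0<..<l} (%x. (1 / a i x) * (ka i x * F i x - DF i x)) <= ennreal ((1 / m) powr p) * powint p {0<..<l} (%x. ka i x * F i x - DF i x)"
   using p m by (intro powint_mult_bounded_le) auto
  then show ?thesis using d by (auto simp: ennreal_mult_less_top intro: le_less_trans)
 qed
 ultimately show "A_max p l v k f : Lp p 0 l" using Lp_iff_rep[OF p rep] by blast
qed

lemma sys_op_in: "u : sys_domain p l r ee ==> sys_op p l r v k u : XY p l r"
proof -
 assume u: "u : sys_domain p l r ee"
 then have W: "fst u : W1p p 0 l" "snd u : W1p p (-r) 0" by (auto simp: sys_domain_def)
 obtain F DF where "rep 0 l (fst u) F" "rep 0 l (weak_deriv p 0 l (fst u)) DF"
  using Lp_rep[OF p W1pD(1)[OF l p W(1)]] Lp_rep[OF p W1pD(2)[OF l p W(1)]] by blast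
 from A_max_rep(2)[OF W(1) this] W1pD(2)[OF _ p W(2)] r show ?thesis by (simp add: sys_op_def XY_def split_beta)
qed

lemma RS_delay:
 assumes "continuous_on {-r..0} ph"
 shows "has_RS (-r) 0 (%t. ee t $ i $ j) ph (amp i 0 * (\<integral>sv. indicator {tt j l - 0<..tt j l - - r} sv * ph (tt j l - sv) \<partial>nv i j))"
proof -
 have "has_RS (-r) 0 (%t. amp i 0 * ((1 / amp i 0) * ee t $ i $ j)) ph
   (amp i 0 * (\<integral>sv. indicator {tt j l - 0<..tt j l - - r} sv * ph (tt j l - sv) \<partial>nv i j))"
  unfolding nv_def by (rule has_RS_cmult[OF left_monotone.has_RS_delay_measure[OF scaled_mono assms]])
 moreover have "(%t. amp i 0 * ((1 / amp i 0) * ee t $ i $ j)) = (%t. ee t $ i $ j)"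
  using less_imp_neq[OF amp_pos[of i 0], symmetric] by simp
 ultimately show ?thesis by simp
qed

lemma AE_nv: "AE sv in nv i j. sv : {tt j l - 0<..tt j l - - r}"
 unfolding nv_def by (rule left_monotone.AE_delay_measure[OF scaled_mono])

lemma char_facts:
 assumes b[measurable]: "b : Borel" and om[measurable]: "om : Borel"
  and b_fin: "powint p {- tt i l<..<0} b < infinity" and om_fin: "powint p {- tt i l<..<0} om < infinity"
 defines "H \<equiv> %x. ka i x * (amp i x * b (- tt i x)) - a i x * (amp i x * om (- tt i x))"
 shows "H : Borel" "powint p {0<..<l} H < infinity"
  "(AE s\<in>{- tt i l<..<0} in lborel. b s = be - ivl s 0 om) <=>
   (AE x\<in>{0<..<l} in lborel. amp i x * b (- tt i x) = amp i 0 * be + ivl 0 x H)"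
  "AE x\<in>{0<..<l} in lborel. amp i x * b (- tt i x) = amp i 0 * be + ivl 0 x H ==>
   amp i 0 * be + ivl 0 l H = be - ivl (- tt i l) 0 om"
proof -
 interpret c: characteristic "a i" m M "ka i" l by (rule char)
 note pre = p b om b_fin om_fin
 have H: "c.H b om = H" unfolding H_def by (rule ext) (simp add: c.H_def[OF pre] c.F_def[OF pre] c.G_def[OF pre])
 show "H : Borel" "powint p {0<..<l} H < infinity"
  using c.H_measurable[OF pre] c.H_finite[OF pre] unfolding H by auto
 show "(AE s\<in>{- tt i l<..<0} in lborel. b s = be - ivl s 0 om) <=>
   (AE x\<in>{0<..<l} in lborel. amp i x * b (- tt i x) = amp i 0 * be + ivl 0 x H)"
  using c.transport_iff[OF pre, of be] unfolding H c.F_def[OF pre] .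
 assume "AE x\<in>{0<..<l} in lborel. amp i x * b (- tt i x) = amp i 0 * be + ivl 0 x H"
 then show "amp i 0 * be + ivl 0 l H = be - ivl (- tt i l) 0 om"
  using c.transport_value[OF pre, of be l] l unfolding H c.F_def[OF pre] c.Q_def[OF pre] c.amp_l by simp
qed

lemma outflow_history:
 assumes om: "L1_on {- R i..0} om" and t: "t : {-r..0}"
 shows "be - ivl (t - tt i l) 0 om = (be - ivl (- tt i l) 0 om) - ivl t 0 (%t. om (t - tt i l))"
proof -
 have "ivl (t - tt i l) 0 om = ivl (t - tt i l) (- tt i l) om + ivl (- tt i l) 0 om"
  using t tt_pos[of i] by (intro ivl_combine set_integrable_subinterval[OF om]) (auto simp: R_def)
 then show ?thesis using ivl_shift[of t 0 om "- tt i l"] by simp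
qed

lemma history_iff:
 assumes b: "b : Borel" and omm: "om : Borel" and om: "L1_on {- R i..0} om"
 shows "(AE s\<in>{- R i<..<0} in lborel. b s = be - ivl s 0 om) <=>
  (AE s\<in>{- tt i l<..<0} in lborel. b s = be - ivl s 0 om) &
  (AE t\<in>{-r<..<0} in lborel. b (t - tt i l) = (be - ivl (- tt i l) 0 om) - ivl t 0 (%t. om (t - tt i l)))"
proof (intro iffI conjI)
 assume h: "AE s\<in>{- R i<..<0} in lborel. b s = be - ivl s 0 om"
 show "AE s\<in>{- tt i l<..<0} in lborel. b s = be - ivl s 0 om"
  using h by eventually_elim (use r in \<open>auto simp: R_def\<close>)
 show "AE t\<in>{-r<..<0} in lborel. b (t - tt i l) = (be - ivl (- tt i l) 0 om) - ivl t 0 (%t. om (t - tt i l))"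
  using AE_shift[OF h, of "- tt i l"]
 proof eventually_elim
  case (elim t)
  show ?case using elim outflow_history[OF om, of t be] tt_pos[of i] by (auto simp: R_def)
 qed
next
 assume "(AE s\<in>{- tt i l<..<0} in lborel. b s = be - ivl s 0 om) &
  (AE t\<in>{-r<..<0} in lborel. b (t - tt i l) = (be - ivl (- tt i l) 0 om) - ivl t 0 (%t. om (t - tt i l)))"
 then have 1: "AE s\<in>{- tt i l<..<0} in lborel. b s = be - ivl s 0 om"
  and 2: "AE t\<in>{-r<..<0} in lborel. b (t - tt i l) = (be - ivl (- tt i l) 0 om) - ivl t 0 (%t. om (t - tt i l))" by auto
 show "AE s\<in>{- R i<..<0} in lborel. b s = be - ivl s 0 om"
  using 1 AE_shift[OF 2, of "tt i l"] AE_neq[of "- tt i l"]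
 proof eventually_elim
  case (elim s)
  show ?case
  proof
   assume s: "s : {- R i<..<0}"
   show "b s = be - ivl s 0 om"
   proof (cases "- tt i l < s")
   case True
   then show ?thesis using elim s by simp
   next
   case False
   then have "s + tt i l : {-r<..<0}" using elim s by (auto simp: R_def)
   then show ?thesis using elim outflow_history[OF om, of "s + tt i l" be] by simp
   qed
  qed
 qed
qed

text \<open>
  The derivative on histories together with the delayed coupling is the system operator on its domain: in travel
  time coordinates the transport equation is \<open>\<partial>\<^sub>t = \<partial>\<^sub>s\<close>, and the compatibility of the boundary values
  \<open>be\<close> is the boundary condition \<open>f(0) = L(ph)\<close>.
\<close>

lemma in_domain_iff:
 assumes b[measurable]: "!!j. b j : Borel" and b_fin: "en b < infinity"
  and om[measurable]: "!!j. om j : Borel" and om_fin: "en om < infinity"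
  and u: "u : XY p l r" "XY_norm p l r (u - state b) = 0" and w: "w : XY p l r" "XY_norm p l r (w - state om) = 0"
 shows "in_domain b om <=> u : sys_domain p l r ee & XY_norm p l r (sys_op p l r v k u - w) = 0"
proof -
 have r': "- r < 0" using r by simp
 define F where "F i x = amp i x * b i (- tt i x)" for i x
 define G where "G i x = amp i x * om i (- tt i x)" for i x
 define H where "H i x = ka i x * F i x - a i x * G i x" for i x
 define Ph where "Ph i t = b i (t - tt i l)" for i t
 define Ps where "Ps i t = om i (t - tt i l)" for i t
 have repu: "rep 0 l (fst u) F" "rep (-r) 0 (snd u) Ph"
  using state_eq_iff[OF b b_fin u(1)] u(2) unfolding F_def[abs_def] Ph_def[abs_def] by auto
 have repw: "rep 0 l (fst w) G" "rep (-r) 0 (snd w) Ps"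
  using state_eq_iff[OF om om_fin w(1)] w(2) unfolding G_def[abs_def] Ps_def[abs_def] by auto
 have uL: "fst u : Lp p 0 l" "snd u : Lp p (-r) 0" using u by (auto simp: XY_def)
 have int: "L1_on {- R i..0} (om i)" for i by (rule history_integrable[OF om om_fin])
 note fact_i = char_facts[OF b om component_finite(3)[OF b b_fin] component_finite(3)[OF om om_fin]]
 have Hm: "H i : Borel" and Hf: "powint p {0<..<l} (H i) < infinity"
  and transport: "(AE s\<in>{- tt i l<..<0} in lborel. b i s = c - ivl s 0 (om i)) <=>
   (AE x\<in>{0<..<l} in lborel. F i x = amp i 0 * c + ivl 0 x (H i))"
  and endpoint: "AE x\<in>{0<..<l} in lborel. F i x = amp i 0 * c + ivl 0 x (H i) ==>
   amp i 0 * c + ivl 0 l (H i) = c - ivl (- tt i l) 0 (om i)" for i c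
  unfolding H_def[abs_def] F_def G_def by (fact fact_i)+
 have Hint: "L1_on {0..l} (H i)" for i
  using powint_integrable(1)[OF p Hm Hf] by (simp add: set_integrable_cong_Ioo Hm)
 have Psm: "Ps i : Borel" and Psf: "powint p {-r<..<0} (Ps i) < infinity" for i
  using rep_meas[OF repw(2)] component_finite(2)[OF om om_fin] by (simp_all add: Ps_def[abs_def])
 have Psint: "L1_on {-r..0} (Ps i)" for i
  using powint_integrable(1)[OF p Psm Psf] by (simp add: set_integrable_cong_Ioo Psm)
 define q where "q be i = be i - ivl (- tt i l) 0 (om i)" for be i
 define inner where "inner be <=> (ALL i. AE x\<in>{0<..<l} in lborel. F i x = amp i 0 * be i + ivl 0 x (H i))" for be
 define outer where "outer c <=> (ALL i. AE t\<in>{-r<..<0} in lborel. Ph i t = c i - ivl t 0 (Ps i))" for c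
 have hist: "(ALL i. AE s\<in>{- R i<..<0} in lborel. b i s = be i - ivl s 0 (om i)) <=> inner be & outer (q be)" for be
 proof -
  have "(AE s\<in>{- R i<..<0} in lborel. b i s = be i - ivl s 0 (om i)) <=>
   (AE x\<in>{0<..<l} in lborel. F i x = amp i 0 * be i + ivl 0 x (H i)) &
   (AE t\<in>{-r<..<0} in lborel. Ph i t = q be i - ivl t 0 (Ps i))" for i
   unfolding history_iff[OF b om int] transport by (simp add: q_def Ph_def Ps_def[abs_def])
  then show ?thesis unfolding inner_def outer_def by blast
 qed
 have inflow: "x : {0..l} ==> cont_rep 0 l (fst u) x $ i = amp i 0 * be i + ivl 0 x (H i)" if "inner be" for be x i
 proof (rule cont_rep_eq(2)[OF l, where H="%i x. amp i 0 * be i + ivl 0 x (H i)"])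
  fix i
  have "AE x\<in>{0<..<l} in lborel. F i x = amp i 0 * be i + ivl 0 x (H i)" using that unfolding inner_def by blast
  with rep_AE[OF repu(1), of i] show "AE x\<in>{0<..<l} in lborel. fst u x $ i = amp i 0 * be i + ivl 0 x (H i)"
   by eventually_elim auto
  show "continuous_on {0..l} (%x. amp i 0 * be i + ivl 0 x (H i))" by (intro continuous_intros continuous_on_ivl Hint)
 qed
 have split: "c - ivl t 0 (Ps i) = (c - ivl (-r) 0 (Ps i)) + ivl (-r) t (Ps i)" if "t : {-r..0}" for c t i
  using ivl_combine[OF Psint[of i], of t] that by simp
 have outflow_AE: "AE t\<in>{-r<..<0} in lborel. Ph i t = (c i - ivl (-r) 0 (Ps i)) + ivl (-r) t (Ps i)" if "outer c" for c i
 proof -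
  have "AE t\<in>{-r<..<0} in lborel. Ph i t = c i - ivl t 0 (Ps i)" using that unfolding outer_def by blast
  then show ?thesis
  proof eventually_elim
   case (elim t)
   show ?case using elim split[of t "c i" i] by auto
  qed
 qed
 have outflow: "t : {-r..0} ==> cont_rep (-r) 0 (snd u) t $ i = c i - ivl t 0 (Ps i)"
  and outflow_cont: "continuous_on {-r..0} (cont_rep (-r) 0 (snd u))" if "outer c" for c t i
 proof -
  let ?h = "%i t. (c i - ivl (-r) 0 (Ps i)) + ivl (-r) t (Ps i)"
  have ae: "AE t\<in>{-r<..<0} in lborel. snd u t $ i = ?h i t" for i
   using rep_AE[OF repu(2), of i] outflow_AE[OF that, of i] by eventually_elim auto
  have co: "continuous_on {-r..0} (?h i)" for i by (intro continuous_intros continuous_on_ivl Psint)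
  show "continuous_on {-r..0} (cont_rep (-r) 0 (snd u))" by (rule cont_rep_eq(1)[OF r' ae co])
  show "cont_rep (-r) 0 (snd u) t $ i = c i - ivl t 0 (Ps i)" if "t : {-r..0}"
   using cont_rep_eq(2)[OF r' ae co that] split[OF that] by simp
 qed
 have outval: "cont_rep 0 l (fst u) l $ i = q be i" if "inner be" for be i
  using inflow[OF that, of l i] l endpoint[of i "be i"] that by (simp add: inner_def q_def)
 have forward: "u : sys_domain p l r ee & XY_norm p l r (sys_op p l r v k u - w) = 0 <=> compat be om"
  if inn: "inner be" and out: "outer (q be)" for be
 proof -
  have FH: "AE x\<in>{0<..<l} in lborel. F i x = amp i 0 * be i + ivl 0 x (H i)" for i using inn unfolding inner_def by blast
  note HL = vec_lambda_in_Lp[OF p Hm Hf] rep_vec_lambda[OF Hm]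
  note PsL = vec_lambda_in_Lp[OF p Psm Psf] rep_vec_lambda[OF Psm]
  have fW: "fst u : W1p p 0 l" by (rule W1pI[OF l p uL(1) repu(1) HL FH])
  have fD: "rep 0 l (weak_deriv p 0 l (fst u)) H"
   using weak_deriv_AE[OF l p uL(1) repu(1) HL FH] Hm by (simp add: rep_def)
  have phW: "snd u : W1p p (-r) 0" by (rule W1pI[OF r' p uL(2) repu(2) PsL outflow_AE[OF out]])
  have phD: "rep (-r) 0 (weak_deriv p (-r) 0 (snd u)) Ps"
   using weak_deriv_AE[OF r' p uL(2) repu(2) PsL outflow_AE[OF out]] Psm by (simp add: rep_def)
  have "rep 0 l (A_max p l v k (fst u)) G"
  proof -
   have "(ka i x * F i x - H i x) / a i x = G i x" for i x
   proof -
   interpret c: characteristic "a i" m M "ka i" l by (rule char)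
   show ?thesis using c.a_pos[of x] by (simp add: H_def)
   qed
   then show ?thesis using A_max_rep(1)[OF fW repu(1) fD] by simp
  qed
  moreover have "(A_max p l v k (fst u), weak_deriv p (-r) 0 (snd u)) : XY p l r"
   using A_max_rep(2)[OF fW repu(1) fD] W1pD(2)[OF r' p phW] by (simp add: XY_def)
  ultimately have N0: "XY_norm p l r (sys_op p l r v k u - w) = 0"
   unfolding sys_op_def split_beta using XY_norm_diff_eq_0_iff[OF p _ w(1) repw] phD by simp
  have zero: "cont_rep (-r) 0 (snd u) 0 = cont_rep 0 l (fst u) l"
   using outflow[OF out, of 0] outval[OF inn] r by (simp add: vec_eq_iff ivl_refl)
  have L: "delay_op r ee (snd u) $ i = amp i 0 * (SUM j:UNIV. \<integral>sv. be j - ivl (- sv) 0 (om j) \<partial>nv i j)" for i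
  proof -
   have co: "continuous_on {-r..0} (%t. cont_rep (-r) 0 (snd u) t $ j)" for j
   using outflow_cont[OF out] by (intro continuous_intros)
   have "delay_op r ee (snd u) $ i = (SUM j:UNIV. amp i 0 *
   (\<integral>sv. indicator {tt j l - 0<..tt j l - - r} sv * cont_rep (-r) 0 (snd u) (tt j l - sv) $ j \<partial>nv i j))"
   unfolding delay_op_def by (rule RS_integral_componentwise) (rule RS_delay[OF co])
   also have "... = (SUM j:UNIV. amp i 0 * (\<integral>sv. be j - ivl (- sv) 0 (om j) \<partial>nv i j))"
   proof (rule sum.cong[OF refl])
   fix j
   let ?I = "indicator {tt j l - 0<..tt j l - - r} :: real => real"
   have "(\<integral>sv. ?I sv * cont_rep (-r) 0 (snd u) (tt j l - sv) $ j \<partial>nv i j) = (\<integral>sv. ?I sv * (be j - ivl (- sv) 0 (om j)) \<partial>nv i j)"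
   proof (rule integral_cong_all[OF refl])
   fix sv
   show "?I sv * cont_rep (-r) 0 (snd u) (tt j l - sv) $ j = ?I sv * (be j - ivl (- sv) 0 (om j))"
   proof (cases "sv : {tt j l - 0<..tt j l - - r}")
   case True
   then have t: "tt j l - sv : {-r..0}" by auto
   have e: "tt j l - sv - tt j l = - sv" by simp
   show ?thesis using outflow[OF out t, of j] outflow_history[OF int[of j] t, of "be j", unfolded e] by (simp add: q_def Ps_def[abs_def])
   qed simp
   qed
   also have "... = (\<integral>sv. be j - ivl (- sv) 0 (om j) \<partial>nv i j)"
   proof (rule integral_cong_AE)
   show m1: "(%sv. be j - ivl (- sv) 0 (om j)) : borel_measurable (nv i j)"
   by (rule borel_measurable_integrable[OF history_primitive_integrable[OF om int]])
   show "(%sv. ?I sv * (be j - ivl (- sv) 0 (om j))) : borel_measurable (nv i j)" by (intro borel_measurable_times m1) measurable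
   show "AE sv in nv i j. ?I sv * (be j - ivl (- sv) 0 (om j)) = be j - ivl (- sv) 0 (om j)"
   using AE_nv by eventually_elim simp
   qed
   finally show "amp i 0 * (\<integral>sv. ?I sv * cont_rep (-r) 0 (snd u) (tt j l - sv) $ j \<partial>nv i j) = amp i 0 * (\<integral>sv. be j - ivl (- sv) 0 (om j) \<partial>nv i j)"
   by (rule arg_cong)
   qed
   finally show ?thesis by (simp add: sum_distrib_left)
  qed
  have "cont_rep 0 l (fst u) 0 $ i = amp i 0 * be i" for i using inflow[OF inn, of 0 i] l by (simp add: ivl_refl)
  then have "cont_rep 0 l (fst u) 0 = delay_op r ee (snd u) <=> compat be om"
   unfolding vec_eq_iff L compat_def using less_imp_neq[OF amp_pos, symmetric] by (simp only: mult_cancel_left) blast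
  then show ?thesis using N0 zero fW phW by (simp add: sys_domain_def split_beta)
 qed
 have backward: "EX be. inner be & outer (q be)"
  if u': "u : sys_domain p l r ee" and N0: "XY_norm p l r (sys_op p l r v k u - w) = 0"
 proof -
  have W: "fst u : W1p p 0 l" "snd u : W1p p (-r) 0" and match: "cont_rep (-r) 0 (snd u) 0 = cont_rep 0 l (fst u) l"
   using u' by (auto simp: sys_domain_def)
  obtain DF where DF: "rep 0 l (weak_deriv p 0 l (fst u)) DF" using Lp_rep[OF p W1pD(2)[OF l p W(1)]] by blast
  have reps: "rep 0 l (A_max p l v k (fst u)) G" "rep (-r) 0 (weak_deriv p (-r) 0 (snd u)) Ps"
   using XY_norm_diff_eq_0_iff[OF p sys_op_in[OF u'] w(1) repw] N0 by (simp_all add: sys_op_def split_beta)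
  have DH: "AE x\<in>{0<..<l} in lborel. DF i x = H i x" for i
   using rep_AE[OF reps(1), of i] rep_AE[OF A_max_rep(1)[OF W(1) repu(1) DF], of i]
  proof eventually_elim
   case (elim x)
   interpret c: characteristic "a i" m M "ka i" l by (rule char)
   show ?case using elim c.a_pos[of x] by (auto simp: H_def field_simps)
  qed
  have ex: "EX c. AE x\<in>{0<..<l} in lborel. F i x = amp i 0 * c + ivl 0 x (H i)" for i
  proof -
   obtain c where c: "AE x\<in>{0<..<l} in lborel. F i x = c + ivl 0 x (DF i)"
   using W1pD(3)[OF l p W(1) repu(1) DF] by blast
   have "ivl 0 x (DF i) = ivl 0 x (H i)" if "x : {0<..<l}" for x
   proof (rule ivl_cong_AE[OF _ rep_meas[OF DF] Hm])
   show "AE t\<in>{0<..<x} in lborel. DF i t = H i t" using DH[of i] by eventually_elim (use that in auto)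
   qed
   then have "AE x\<in>{0<..<l} in lborel. F i x = amp i 0 * (c / amp i 0) + ivl 0 x (H i)"
   using c less_imp_neq[OF amp_pos[of i 0], symmetric] by (auto elim!: eventually_mono)
   then show ?thesis by blast
  qed
  have "EX be. inner be" unfolding inner_def by (intro choice allI ex)
  then obtain be where inn: "inner be" by blast
  have ex': "EX c. AE t\<in>{-r<..<0} in lborel. Ph i t = c - ivl t 0 (Ps i)" for i
  proof -
   obtain c where "AE t\<in>{-r<..<0} in lborel. Ph i t = c + ivl (-r) t (Ps i)"
   using W1pD(3)[OF r' p W(2) repu(2) reps(2)] by blast
   then have "AE t\<in>{-r<..<0} in lborel. Ph i t = (c + ivl (-r) 0 (Ps i)) - ivl t 0 (Ps i)"
   proof eventually_elim
   case (elim t)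
   show ?case using elim split[of t "c + ivl (-r) 0 (Ps i)" i] by auto
   qed
   then show ?thesis by blast
  qed
  have "EX c. outer c" unfolding outer_def by (intro choice allI ex')
  then obtain c where out: "outer c" by blast
  have "c = q be"
   using outflow[OF out, of 0] match outval[OF inn] r by (intro ext) (simp add: ivl_refl)
  then show ?thesis using inn out by blast
 qed
 show ?thesis
  unfolding in_domain_def hist using forward backward by blast
qed
end

context hyperbolic_system begin

sublocale tr: transported_delay p dl R nv "XY p l r" "XY_norm p l r" state
 "(D + 1) * real CARD('n)" "2 powr (p - 1) * (real CARD('n) powr (p - 1) * (D + 1))"
 by (rule transported_delay.intro[OF delay_equation_axioms XY_complete[OF p]], rule transported_delay_axioms.intro)
  (rule state_add state_scaleR state_in state_onto state_norm_le state_norm_ge mult_nonneg_nonneg powr_ge_zero of_nat_0_le_iff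
   | assumption | use D in linarith)+

lemma semigroup: "sys_semigroup p l r v k ee tr.T"
 unfolding sys_semigroup_def is_generator_def
proof (intro conjI ballI tr.T_C0_semigroup)
 fix u w :: "'n state" assume u: "u : XY p l r" and w: "w : XY p l r"
 obtain b where b: "ALL j. b j : Borel" "en b < infinity" "XY_norm p l r (u - state b) = 0" using state_onto[OF u] by blast
 obtain om where om: "ALL j. om j : Borel" "en om < infinity" "XY_norm p l r (w - state om) = 0" using state_onto[OF w] by blast
 have "tr.history b" "tr.history om" using b om by (simp_all add: tr.history_def)
 from tr.T_generator[OF u w this(1) b(3) this(2) om(3)]
 show "((%h. XY_norm p l r ((1 / h) *\<^sub>R (tr.T h u - u) - w)) ---> 0) (at_right 0) <=>
   u : sys_domain p l r ee & XY_norm p l r (sys_op p l r v k u - w) = 0"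
  using in_domain_iff[OF _ b(2) _ om(2) u b(3) w om(3)] b(1) om(1) by blast
qed

lemma semigroup_unique:
 assumes T: "sys_semigroup p l r v k ee T" and u: "u : XY p l r" and t: "0 <= t"
 shows "XY_norm p l r (tr.T t u - T t u) = 0" "T t u : XY p l r"
proof -
 show "XY_norm p l r (tr.T t u - T t u) = 0"
  using T semigroup sys_op_in unfolding sys_semigroup_def by (intro tr.T_unique[OF _ _ _ _ u t]) blast+
 show "T t u : XY p l r" using T u t unfolding sys_semigroup_def C0_semigroup_def by blast
qed

lemma stable_iff:
 assumes T: "sys_semigroup p l r v k ee T"
 shows "uniformly_exp_stable (XY p l r) (XY_norm p l r) T <=> uniformly_exp_stable (XY p l r) (XY_norm p l r) tr.T"
proof -
 have "XY_norm p l r (T t u) = XY_norm p l r (tr.T t u)" if "0 <= t" "u : XY p l r" for t u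
  using tr.N_cong[OF tr.T_in_E[OF that(2,1)] semigroup_unique(2)[OF T that(2,1)] semigroup_unique(1)[OF T that(2,1)]] by simp
 then show ?thesis unfolding uniformly_exp_stable_def by simp
qed

lemma state_nonneg_iff:
 assumes b: "tr.history b" and u: "u : XY p l r" "XY_norm p l r (u - state b) = 0"
 shows "XY_nonneg l r u <=> (ALL i. AE s\<in>{- R i<..<0} in lborel. 0 <= b i s)"
proof -
 note bm = tr.history_meas[OF b] and bf = tr.history_en[OF b]
 have repu: "rep 0 l (fst u) (%i x. amp i x * b i (- tt i x))" "rep (-r) 0 (snd u) (%i te. b i (te - tt i l))"
  using state_eq_iff[OF bm bf u(1)] u(2) by auto
 have comp: "ae_nonneg c d f <=> (ALL i. AE x\<in>{c<..<d} in lborel. 0 <= F i x)" if "rep c d f F" for c d and f :: "real => real^'n" and F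
 proof -
  have "ae_nonneg c d f <=> (AE x in lborel. \<forall>i\<in>UNIV. x : {c<..<d} --> 0 <= f x $ i)"
   unfolding ae_nonneg_def AE_lebesgue_on_Ioo less_eq_vec_def by (rule AE_cong) auto
  also have "... <=> (\<forall>i\<in>UNIV. AE x\<in>{c<..<d} in lborel. 0 <= f x $ i)" by (rule AE_finite_all) simp
  also have "... <=> (ALL i. AE x\<in>{c<..<d} in lborel. 0 <= F i x)"
  proof -
   have "(AE x\<in>{c<..<d} in lborel. 0 <= f x $ i) <=> (AE x\<in>{c<..<d} in lborel. 0 <= F i x)" for i
   using rep_AE[OF that, of i] by (rule eventually_subst[OF eventually_mono]) auto
   then show ?thesis by simp
  qed
  finally show ?thesis .
 qed
 have "(AE x\<in>{0<..<l} in lborel. 0 <= amp i x * b i (- tt i x)) & (AE t\<in>{-r<..<0} in lborel. 0 <= b i (t - tt i l))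
   <=> (AE s\<in>{- R i<..<0} in lborel. 0 <= b i s)" for i
 proof (intro iffI conjI)
  interpret c: characteristic "a i" m M "ka i" l by (rule char)
  assume h: "AE s\<in>{- R i<..<0} in lborel. 0 <= b i s"
  from c.AE_tt[OF AE_reflect[OF h]] show "AE x\<in>{0<..<l} in lborel. 0 <= amp i x * b i (- tt i x)"
  proof eventually_elim
   case (elim x)
   show ?case
   proof
   assume "x : {0<..<l}"
   then have "- tt i x : {- R i<..<0}" using c.tt_less_iff[of 0 x] c.tt_less_iff[of x l] r by (simp add: c.tt_0 R_def)
   then show "0 <= amp i x * b i (- tt i x)" using elim less_imp_le[OF amp_pos[of i x]] by simp
   qed
  qed
  show "AE t\<in>{-r<..<0} in lborel. 0 <= b i (t - tt i l)"
   using AE_shift[OF h, of "- tt i l"] by eventually_elim (use tt_pos[of i] in \<open>auto simp: R_def\<close>)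
 next
  interpret c: characteristic "a i" m M "ka i" l by (rule char)
  assume "(AE x\<in>{0<..<l} in lborel. 0 <= amp i x * b i (- tt i x)) & (AE t\<in>{-r<..<0} in lborel. 0 <= b i (t - tt i l))"
  then have h: "AE x\<in>{0<..<l} in lborel. 0 <= amp i x * b i (- tt i x)" "AE t\<in>{-r<..<0} in lborel. 0 <= b i (t - tt i l)" by auto
  from AE_reflect[OF c.AE_pos[OF h(1)]] AE_shift[OF h(2), of "tt i l"] AE_neq[of "- tt i l"]
  show "AE s\<in>{- R i<..<0} in lborel. 0 <= b i s"
  proof eventually_elim
   case (elim s)
   show ?case
   proof
   assume s: "s : {- R i<..<0}"
   show "0 <= b i s"
   proof (cases "- tt i l < s")
   case True
   then have "c.pos (- s) : {0<..<l}"
   using s c.tt_less_iff[of 0 "c.pos (- s)"] c.tt_less_iff[of "c.pos (- s)" l] by (simp add: c.tt_0 c.tt_pos)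
   then show ?thesis using elim amp_pos[of i "c.pos (- s)"] by (simp add: c.tt_pos zero_le_mult_iff)
   next
   case False
   then show ?thesis using elim s by (auto simp: R_def)
   qed
   qed
  qed
 qed
 then show ?thesis unfolding XY_nonneg_def split_beta comp[OF repu(1)] comp[OF repu(2)] by blast
qed

lemma semigroup_positive: "positive_semigroup p l r tr.T"
 unfolding positive_semigroup_def
proof (intro allI impI ballI)
 fix t :: real and u :: "'n state" assume t: "0 <= t" and u: "u : XY p l r" and nn: "XY_nonneg l r u"
 obtain b where b: "ALL j. b j : Borel" "en b < infinity" "XY_norm p l r (u - state b) = 0" using state_onto[OF u] by blast
 have hb: "tr.history b" using b by (simp add: tr.history_def)
 obtain c where c: "tr.history c" "tr.T t u = state c" "ALL j. AE s\<in>{- R j<..<0} in lborel. 0 <= c j s"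
  using tr.T_nonneg[OF u hb b(3) t] nn[unfolded state_nonneg_iff[OF hb u b(3)]] by blast
 show "XY_nonneg l r (tr.T t u)"
  using state_nonneg_iff[OF c(1) tr.T_in_E[OF u t]] c(2,3) by (simp add: tr.N_0)
qed

lemma well_posed: "well_posed p l r v k ee"
proof -
 have mild: "z t : Lp p 0 l & Lp_norm p 0 l (z t - fst (tr.T t u)) = 0"
  if u: "u : XY p l r" and z: "mild_solution p l r v k ee u z" and t: "0 <= t" for u z t
 proof -
  obtain T where T: "sys_semigroup p l r v k ee T" and zT: "z t : Lp p 0 l" "Lp_norm p 0 l (z t - fst (T t u)) = 0"
   using z t unfolding mild_solution_def by blast
  have L: "fst (T t u) : Lp p 0 l" "fst (tr.T t u) : Lp p 0 l"
   using semigroup_unique(2)[OF T u t] tr.T_in_E[OF u t] by (auto simp: XY_def)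
  have "XY_norm p l r (T t u - tr.T t u) = 0"
   using semigroup_unique[OF T u t] tr.N_minus_commute[OF tr.T_in_E[OF u t]] by simp
  then have "Lp_norm p 0 l (fst (T t u) - fst (tr.T t u)) <= 0"
   using Lp_norm_nonneg[of p "- r" 0 "snd (T t u) - snd (tr.T t u)"] by (simp add: XY_norm_def split_beta)
  then show ?thesis using Lp_norm_triangle[OF p zT(1) L] zT Lp_norm_nonneg[of p 0 l "z t - fst (tr.T t u)"] by simp
 qed
 have TL: "fst (tr.T t u) : Lp p 0 l" if "u : XY p l r" "0 <= t" for u t using tr.T_in_E[OF that] by (auto simp: XY_def)
 have sym: "Lp_norm p 0 l (f - g) = Lp_norm p 0 l (g - f)" for f g :: "real => real^'n"
  using Lp_norm_scaleR[OF p, of 0 l "- 1" "f - g"] by simp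
 have cmp: "Lp_norm p 0 l (z s - z' t) <= Lp_norm p 0 l (fst (tr.T s u) - fst (tr.T t u))"
  if u: "u : XY p l r" and z: "mild_solution p l r v k ee u z" "mild_solution p l r v k ee u z'" and st: "0 <= s" "0 <= t" for u z z' s t
  using mild[OF u z(1) st(1)] mild[OF u z(2) st(2)] TL[OF u st(1)] TL[OF u st(2)] sym[of "z' t" "fst (tr.T t u)"]
   Lp_norm_triangle[OF p, of "z s" 0 l "fst (tr.T s u)" "z' t"] Lp_norm_triangle[OF p, of "fst (tr.T s u)" 0 l "fst (tr.T t u)" "z' t"]
  by simp
 show ?thesis
  unfolding well_posed_def
 proof (intro conjI ballI allI impI)
  show "EX T. sys_semigroup p l r v k ee T & positive_semigroup p l r T" using semigroup semigroup_positive by blast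
  fix u :: "'n state" assume u: "u : XY p l r"
  have Z: "Lp_norm p 0 l (0 :: real => real^'n) = 0" using Lp_norm_scaleR[OF p, of 0 l 0 0] by simp
  show "EX z. mild_solution p l r v k ee u z"
   unfolding mild_solution_def using semigroup TL[OF u] Z by (intro exI[of _ "%t. fst (tr.T t u)"] exI[of _ tr.T]) auto
  show "Lp_norm p 0 l (z t - z' t) = 0" if "mild_solution p l r v k ee u z & mild_solution p l r v k ee u z'" "0 <= t" for z z' t
   using cmp[OF u _ _ that(2,2), of z z'] that(1) Lp_norm_nonneg[of p 0 l "z t - z' t"] by (simp add: Z)
  fix z :: "real => real => real^'n" and t :: real assume z: "mild_solution p l r v k ee u z" and t: "0 <= t"
  show "((%s. Lp_norm p 0 l (z s - z t)) ---> 0) (at t within {0..})"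
  proof (rule tendsto_sandwich[OF _ _ tendsto_const tr.T_continuous[OF u t]])
   have "eventually (%s. 0 <= s) (at t within {0..})" by (simp add: eventually_at_filter)
   then show "\<forall>\<^sub>F s in at t within {0..}. Lp_norm p 0 l (z s - z t) <= XY_norm p l r (tr.T s u - tr.T t u)"
   proof eventually_elim
   case (elim s)
   show ?case using cmp[OF u z z elim t] Lp_norm_nonneg[of p "- r" 0 "snd (tr.T s u) - snd (tr.T t u)"]
   by (simp add: XY_norm_def split_beta)
   qed
  qed (simp add: Lp_norm_nonneg)
  show "ae_nonneg 0 l (z t)" if "XY_nonneg l r u"
  proof -
   have nn: "AE x in lebesgue_on {0<..<l}. 0 <= fst (tr.T t u) x"
   using semigroup_positive that u t by (auto simp: positive_semigroup_def XY_nonneg_def split_beta ae_nonneg_def)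
   obtain G where G: "rep 0 l (fst (tr.T t u)) G" using Lp_rep[OF p TL[OF u t]] by blast
   have zG: "rep 0 l (z t) G" using Lp_norm_diff_eq_0_iff[OF p _ TL[OF u t] G] mild[OF u z t] by blast
   have "AE x in lborel. \<forall>i\<in>UNIV. x : {0<..<l} --> z t x $ i = fst (tr.T t u) x $ i"
   proof (rule AE_finite_allI)
   show "AE x\<in>{0<..<l} in lborel. z t x $ i = fst (tr.T t u) x $ i" for i
   using rep_AE[OF G, of i] rep_AE[OF zG, of i] by eventually_elim auto
   qed simp
   with nn[unfolded AE_lebesgue_on_Ioo] show ?thesis
   unfolding ae_nonneg_def AE_lebesgue_on_Ioo by eventually_elim (auto simp: less_eq_vec_def)
  qed
 qed
qed

lemma coupling_matrix: "(Xi l v k ** L_eps0 r ee) $ i $ j = mass i j"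
proof -
 interpret c: characteristic "a i" m M "ka i" l by (rule char)
 have "xi v k i l = (\<integral>s. ka i s \<partial>lebesgue_on {0<..<l})"
  unfolding xi_def
 proof (rule integral_cong_AE)
  show "(%s. k s $ i / v s $ i) : borel_measurable (lebesgue_on {0<..<l})" by (intro borel_measurable_divide k_meas v_meas)
  show "ka i : borel_measurable (lebesgue_on {0<..<l})" by (rule borel_measurable_lebesgue_on[OF c.ka])
  show "AE s in lebesgue_on {0<..<l}. k s $ i / v s $ i = ka i s"
   unfolding AE_lebesgue_on_Ioo using v_AE[of i] k_AE[of i] by eventually_elim (use c.a_pos in \<open>auto simp: less_imp_neq[symmetric]\<close>)
 qed
 also have "... = (\<integral>s. indicator {0<..<l} s * ka i s \<partial>lborel)"
  by (subst integral_restrict_space) (simp_all add: integral_completion)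
 also have "... = ivl 0 l (ka i)"
  unfolding ivl_def
 proof (rule integral_cong_AE)
  show "AE s in lborel. indicator {0<..<l} s * ka i s = indicator {0..l} s * ka i s"
   using AE_neq[of 0] AE_neq[of l] by eventually_elim (auto split: split_indicator)
 qed measurable
 finally have xi: "exp (xi v k i l) = 1 / amp i 0" by (simp add: c.amp_def ivl_refl exp_minus inverse_eq_divide)
 have I: "(\<integral>sv. indicator {tt h l - 0<..tt h l - - r} sv * y \<partial>nv i h) = mass i h * y" for h y
 proof -
  have "(\<integral>sv. indicator {tt h l - 0<..tt h l - - r} sv * y \<partial>nv i h) = (\<integral>sv. y \<partial>nv i h)"
  proof (rule integral_cong_AE)
   show "AE sv in nv i h. indicator {tt h l - 0<..tt h l - - r} sv * y = y" using AE_nv by eventually_elim simp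
  qed measurable
  then show ?thesis by (simp add: mass_def)
 qed
 have "L_eps0 r ee $ i $ j = RS_integral (-r) 0 ee (%te. axis j 1) $ i" by (simp add: L_eps0_def matrix_def)
 also have "... = (SUM h:UNIV. amp i 0 * (\<integral>sv. indicator {tt h l - 0<..tt h l - - r} sv * axis j 1 $ h \<partial>nv i h))"
  by (rule RS_integral_componentwise) (rule RS_delay[OF continuous_on_const])
 also have "... = amp i 0 * mass i j" unfolding I by (simp add: axis_def if_distrib cong: if_cong)
 finally have "L_eps0 r ee $ i $ j = amp i 0 * mass i j" .
 then show ?thesis
  using amp_pos[of i 0] by (simp add: Xi_def diag_def matrix_matrix_mult_def if_distrib[where f="%y. y * _"] xi cong: if_cong)
qed

lemma stability: "uniformly_exp_stable (XY p l r) (XY_norm p l r) tr.T <=> spectral_radius (Xi l v k ** L_eps0 r ee) < 1"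
proof
 have nn: "0 <= (Xi l v k ** L_eps0 r ee) $ i $ j" for i j unfolding coupling_matrix by (rule mass_nonneg)
 show "uniformly_exp_stable (XY p l r) (XY_norm p l r) tr.T" if small: "spectral_radius (Xi l v k ** L_eps0 r ee) < 1"
 proof (rule spectral_radius_less_one_contracts[OF nn small])
  fix w q :: "real^'n" and rh
  assume "!!i. 0 < w $ i" "!!i. 0 < q $ i" "0 < rh" "rh < 1"
   "!!i. (SUM j:UNIV. (Xi l v k ** L_eps0 r ee) $ i $ j * w $ j) <= rh * w $ i"
   "!!j. (SUM i:UNIV. q $ i * (Xi l v k ** L_eps0 r ee) $ i $ j) <= rh * q $ j"
  then show ?thesis unfolding coupling_matrix by (rule tr.T_stable)
 qed
 show "spectral_radius (Xi l v k ** L_eps0 r ee) < 1" if "uniformly_exp_stable (XY p l r) (XY_norm p l r) tr.T"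
 proof (rule ccontr)
  assume large: "~ spectral_radius (Xi l v k ** L_eps0 r ee) < 1"
  show False
  proof (rule spectral_radius_ge_one_noncontracting[OF nn large])
   fix w :: "real^'n" assume w: "!!i. 0 <= w $ i" "w ~= 0" "!!i. w $ i <= (SUM j:UNIV. (Xi l v k ** L_eps0 r ee) $ i $ j * w $ j)"
   obtain i where "w $ i ~= 0" using w(2) by (auto simp: vec_eq_iff)
   then show False using tr.T_unstable[OF w(1) _ w(3)[unfolded coupling_matrix]] that by blast
  qed
 qed
qed
end

lemma Linf_clipped_rep:
 assumes "!!i. (%x. f x $ i) : Linf 0 l"
 shows "EX F C. (ALL i. F i : Borel) & 0 <= C & (ALL i x. abs(F i x) <= C) & (ALL i. AE x\<in>{0<..<l} in lborel. f x $ i = F i x)"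
proof -
 have m: "(%x. f x $ i) : borel_measurable (lebesgue_on {0<..<l})" for i using assms[of i] by (simp add: Linf_def)
 have "f : borel_measurable (lebesgue_on {0<..<l})"
  using borel_measurable_vec_lambda[of "%i x. f x $ i", OF m] by simp
 then obtain F where F: "rep 0 l f F" using rep_exists by blast
 have "EX C. AE x\<in>{0<..<l} in lborel. abs(f x $ i) <= C" for i
  using assms[of i] unfolding Linf_def AE_lebesgue_on_Ioo by blast
 then have "EX C. ALL i. AE x\<in>{0<..<l} in lborel. abs(f x $ i) <= C i" by (intro choice allI)
 then obtain C where C: "!!i. AE x\<in>{0<..<l} in lborel. abs(f x $ i) <= C i" by blast
 define S where "S = (SUM i:UNIV. abs(C i))"
 have S: "0 <= S" "C i <= S" for i
  unfolding S_def using member_le_sum[of i UNIV "%i. abs(C i)"] by (auto intro: sum_nonneg)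
 have [measurable]: "F i : Borel" for i by (rule rep_meas[OF F])
 have "AE x\<in>{0<..<l} in lborel. f x $ i = max (- S) (min S (F i x))" for i
  using C[of i] rep_AE[OF F, of i] by eventually_elim (use S(2)[of i] in \<open>auto simp: max_def min_def abs_le_iff\<close>)
 moreover have "abs(max (- S) (min S (F i x))) <= S" for i x using S(1) by (auto simp: max_def min_def abs_if)
 ultimately show ?thesis using S(1) by (intro exI[of _ "%i x. max (- S) (min S (F i x))"] exI[of _ S]) auto
qed

theorem mainTheorem6:
  fixes p l r \<nu> :: real
    and v k :: "real \<Rightarrow> real^'n::finite"
    and \<eta> :: "real \<Rightarrow> real^'n^'n"
  assumes "0 < l" and "0 < r" and "1 \<le> p"
    and "\<And>i. (\<lambda>x. v x $ i) \<in> Linf 0 l"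
    and "\<And>i. (\<lambda>x. k x $ i) \<in> Linf 0 l"
    and "0 < \<nu>"
    and "\<And>i. AE x in lebesgue_on {0<..<l}. \<nu> \<le> v x $ i"
    and "bounded_variation_on (-r) 0 \<eta>"
    and "\<And>\<theta>. \<theta> \<in> {-r<..0} \<Longrightarrow> continuous (at_left \<theta>) \<eta>"
    and "positive_delay_op p r \<eta>"
  shows "well_posed p l r v k \<eta> \<and>
    (\<forall>T. sys_semigroup p l r v k \<eta> T \<longrightarrow>
       (uniformly_exp_stable (XY p l r) (XY_norm p l r) T \<longleftrightarrow>
        spectral_radius (Xi l v k ** L_eps0 r \<eta>) < 1))"
proof -
  obtain V C where V[measurable]: "\<And>i. V i \<in> borel_measurable borel" and C: "\<And>i x. \<bar>V i x\<bar> \<le> C"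
    and vV: "\<And>i. AE x in lborel. x \<in> {0<..<l} \<longrightarrow> v x $ i = V i x"
    using Linf_clipped_rep[of v l, OF assms(4)] by blast
  obtain K C' where K[measurable]: "\<And>i. K i \<in> borel_measurable borel" and C': "0 \<le> C'" "\<And>i x. \<bar>K i x\<bar> \<le> C'"
    and kK: "\<And>i. AE x in lborel. x \<in> {0<..<l} \<longrightarrow> k x $ i = K i x"
    using Linf_clipped_rep[of k l, OF assms(5)] by blast
  define W where "W i x = max \<nu> (V i x)" for i x
  have W: "0 < W i x" "\<nu> \<le> W i x" "W i x \<le> \<bar>C\<bar> + \<nu>" for i x
    using assms(6) C[of i x] unfolding W_def by (auto simp: max_def abs_le_iff)
  have vW: "AE x in lborel. x \<in> {0<..<l} \<longrightarrow> v x $ i = W i x" for i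
    using vV[of i] assms(7)[of i, unfolded AE_lebesgue_on_Ioo] by eventually_elim (auto simp: W_def max_def)
  have "hyperbolic_system p l r v k \<eta> (\<lambda>i x. 1 / W i x) (\<lambda>i x. K i x / W i x) (1 / (\<bar>C\<bar> + \<nu>)) ((C' + 1) / \<nu>)"
  proof (rule hyperbolic_system.intro)
    have [measurable]: "W i \<in> borel_measurable borel" for i unfolding W_def[abs_def] by measurable
    show "characteristic (\<lambda>x. 1 / W i x) (1 / (\<bar>C\<bar> + \<nu>)) ((C' + 1) / \<nu>) (\<lambda>x. K i x / W i x) l" for i
    proof
      show "0 < 1 / (\<bar>C\<bar> + \<nu>)" using assms(6) by simp
      show "1 / (\<bar>C\<bar> + \<nu>) \<le> 1 / W i x" "1 / W i x \<le> (C' + 1) / \<nu>" for x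
        using W[of i x] assms(6) C'(1) by (auto intro!: frac_le)
      show "\<bar>K i x / W i x\<bar> \<le> (C' + 1) / \<nu>" for x
        using W[of i x] assms(6) C'(1) C'(2)[of i x] by (auto simp: abs_divide intro!: frac_le)
      show "(\<lambda>x. 1 / W i x) \<in> borel_measurable borel" "(\<lambda>x. K i x / W i x) \<in> borel_measurable borel" by measurable
      show "0 < l" by (rule assms(1))
    qed
    show "(\<lambda>x. v x $ i) \<in> borel_measurable (lebesgue_on {0<..<l})" "(\<lambda>x. k x $ i) \<in> borel_measurable (lebesgue_on {0<..<l})" for i
      using assms(4,5)[of i] by (auto simp: Linf_def)
    show "AE x in lborel. x \<in> {0<..<l} \<longrightarrow> v x $ i = 1 / (1 / W i x)" for i using vW[of i] by simp
    show "AE x in lborel. x \<in> {0<..<l} \<longrightarrow> k x $ i = K i x / W i x / (1 / W i x)" for i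
      using kK[of i] by eventually_elim (use W(1) in \<open>auto simp: less_imp_neq[symmetric]\<close>)
    show "left_monotone (-r) 0 (\<lambda>t. \<eta> t $ i $ j)" for i j
      by (rule positive_delay_op_mono[OF assms(3,2,8,9,10)])
  qed (use assms in simp_all)
  then interpret hyperbolic_system p l r v k \<eta> "\<lambda>i x. 1 / W i x" "\<lambda>i x. K i x / W i x" "1 / (\<bar>C\<bar> + \<nu>)" "(C' + 1) / \<nu>" .
  show ?thesis using well_posed stable_iff stability by blast
qed

end
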